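(* Let $1<\alpha<2$, $0\le p\le 1$, and let $c\ge 0$ be a constant. For every $f\in H^{-1}(\Lambda)$ there is a unique $u\in H_{RL}^{\alpha-1,0}(\Lambda)$ such that $$c\,(u,\mathcal{I}_{p}^{2-\alpha}v)+(\mathcal{D}_{p}^{\alpha-1}u,\mathcal{D}_{p}^{\alpha-1}v)=\langle f,\mathcal{I}_{p}^{2-\alpha}v\rangle\qquad\text{for all } v\in H_{RL}^{\alpha-1,0}(\Lambda),$$ and it satisfies $\|u\|_{H_{RL}^{\alpha-1}(\Lambda)}\le C\|f\|_{H^{-1}(\Lambda)}$ with a constant $C$ independent of $f$.
   Context: $\Lambda=(-1,1)$, $(\cdot,\cdot)$ is the $L^2(\Lambda)$ inner product and $\langle\cdot,\cdot\rangle$ the duality pairing between $H^{-1}(\Lambda)$ and $H^1_0(\Lambda)$. Let $\mu,\nu$ be real numbers with $\alpha-2\le\mu,\nu\le0$, $\mu+\nu=\alpha-2$, $p\sin(\pi\mu)=(1-p)\sin(\pi\nu)$, and $C_{\alpha,p}:=(\sin\pi\mu+\sin\pi\nu)/\sin\pi\alpha$. For $\sigma>0$, ${}_{-1}I_x^{\sigma}v(x)=\frac{1}{\Gamma(\sigma)}\int_{-1}^x (x-y)^{\sigma-1}v(y)\,dy$, ${}_{x}I_1^{\sigma}v(x)=\frac{1}{\Gamma(\sigma)}\int_x^1 (y-x)^{\sigma-1}v(y)\,dy$, $\mathcal{I}_p^{\sigma}v:=C_{\alpha,p}\big(p\,{}_{-1}I_x^{\sigma}v+(1-p)\,{}_{x}I_1^{\sigma}v\big)$,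 and $\mathcal{D}_p^{\alpha-1}v:=\frac{d}{dx}\mathcal{I}_p^{2-\alpha}v$. The space $H_{RL}^{\alpha-1}(\Lambda)$ consists of $v$ with $\mathcal{I}_p^{2-\alpha}v\in L^2(\Lambda)$ and $\mathcal{D}_p^{\alpha-1}v\in L^2(\Lambda)$, with norm $\|v\|_{H_{RL}^{\alpha-1}(\Lambda)}^2=\|\mathcal{I}_p^{2-\alpha}v\|_{L^2(\Lambda)}^2+\|\mathcal{D}_p^{\alpha-1}v\|_{L^2(\Lambda)}^2$, and $H_{RL}^{\alpha-1,0}(\Lambda):=\{v\in H_{RL}^{\alpha-1}(\Lambda):\mathcal{I}_p^{2-\alpha}v(\pm1)=0\}$. *)

theory Defs
  imports "HOL-Analysis.Analysis"
begin

definition Lam :: "real set" where "Lam = {-1<..<1}"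

abbreviation LM :: "real measure" where "LM \<equiv> lebesgue_on Lam"

text \<open>Square integrable functions on Lambda (representatives of L2 elements).\<close>
definition sqint :: "(real \<Rightarrow> real) \<Rightarrow> bool" where
  "sqint f \<longleftrightarrow> f \<in> borel_measurable LM \<and> integrable LM (\<lambda>x. (f x)^2)"

definition L2ip :: "(real \<Rightarrow> real) \<Rightarrow> (real \<Rightarrow> real) \<Rightarrow> real" where
  "L2ip f g = integral\<^sup>L LM (\<lambda>x. f x * g x)"

definition test_fun :: "(real \<Rightarrow> real) \<Rightarrow> bool" where
  "test_fun \<phi> \<longleftrightarrow> (\<forall>n x. ((deriv ^^ n) \<phi>) differentiable (at x))
     \<and> (\<exists>a b. -1 < a \<and> b < 1 \<and> (\<forall>x. x \<notin> {a..b} \<longrightarrow> \<phi> x = 0))"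

definition weak_deriv :: "(real \<Rightarrow> real) \<Rightarrow> (real \<Rightarrow> real) \<Rightarrow> bool" where
  "weak_deriv w g \<longleftrightarrow> sqint g \<and>
     (\<forall>\<phi>. test_fun \<phi> \<longrightarrow> L2ip w (deriv \<phi>) = - L2ip g \<phi>)"

definition wderiv :: "(real \<Rightarrow> real) \<Rightarrow> real \<Rightarrow> real" where
  "wderiv w = (SOME g. weak_deriv w g)"

text \<open>Boundary values of an H1 function: its continuous representative on [-1,1].\<close>
definition vanishes_at_ends :: "(real \<Rightarrow> real) \<Rightarrow> bool" where
  "vanishes_at_ends w \<longleftrightarrow> (\<exists>w0. continuous_on {-1..1} w0 \<and>
       (AE x in LM. w x = w0 x) \<and> w0 (-1) = 0 \<and> w0 1 = 0)"

definition H10 :: "(real \<Rightarrow> real) \<Rightarrow> bool" where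
  "H10 w \<longleftrightarrow> sqint w \<and> (\<exists>g. weak_deriv w g) \<and> vanishes_at_ends w"

definition H1norm :: "(real \<Rightarrow> real) \<Rightarrow> real" where
  "H1norm w = sqrt (L2ip w w + L2ip (wderiv w) (wderiv w))"

definition Hm1 :: "((real \<Rightarrow> real) \<Rightarrow> real) \<Rightarrow> bool" where
  "Hm1 f \<longleftrightarrow> (\<forall>w1 w2 a b. H10 w1 \<longrightarrow> H10 w2 \<longrightarrow>
        f (\<lambda>x. a * w1 x + b * w2 x) = a * f w1 + b * f w2)
     \<and> (\<exists>K. \<forall>w. H10 w \<longrightarrow> \<bar>f w\<bar> \<le> K * H1norm w)"

definition Hm1norm :: "((real \<Rightarrow> real) \<Rightarrow> real) \<Rightarrow> real" where
  "Hm1norm f = Sup {\<bar>f w\<bar> | w. H10 w \<and> H1norm w \<le> 1}"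

definition RL_left :: "real \<Rightarrow> (real \<Rightarrow> real) \<Rightarrow> real \<Rightarrow> real" where
  "RL_left \<sigma> v x = (1 / Gamma \<sigma>) *
     integral\<^sup>L (lebesgue_on {-1..x}) (\<lambda>y. (x - y) powr (\<sigma> - 1) * v y)"

definition RL_right :: "real \<Rightarrow> (real \<Rightarrow> real) \<Rightarrow> real \<Rightarrow> real" where
  "RL_right \<sigma> v x = (1 / Gamma \<sigma>) *
     integral\<^sup>L (lebesgue_on {x..1}) (\<lambda>y. (y - x) powr (\<sigma> - 1) * v y)"

definition Calp :: "real \<Rightarrow> real \<Rightarrow> real \<Rightarrow> real" where
  "Calp \<alpha> \<mu> \<nu> = (sin (pi * \<mu>) + sin (pi * \<nu>)) / sin (pi * \<alpha>)"

definition Ip :: "real \<Rightarrow> real \<Rightarrow> real \<Rightarrow> real \<Rightarrow> real \<Rightarrow> (real \<Rightarrow> real) \<Rightarrow> real \<Rightarrow> real" where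
  "Ip \<alpha> p \<mu> \<nu> \<sigma> v x = Calp \<alpha> \<mu> \<nu> * (p * RL_left \<sigma> v x + (1 - p) * RL_right \<sigma> v x)"

definition Dp :: "real \<Rightarrow> real \<Rightarrow> real \<Rightarrow> real \<Rightarrow> (real \<Rightarrow> real) \<Rightarrow> real \<Rightarrow> real" where
  "Dp \<alpha> p \<mu> \<nu> v = wderiv (Ip \<alpha> p \<mu> \<nu> (2 - \<alpha>) v)"

text \<open>H_RL^{alpha-1}(Lambda) (ambient: v in L1(Lambda) so that the RL integrals are defined).\<close>
definition HRL :: "real \<Rightarrow> real \<Rightarrow> real \<Rightarrow> real \<Rightarrow> (real \<Rightarrow> real) \<Rightarrow> bool" where
  "HRL \<alpha> p \<mu> \<nu> v \<longleftrightarrow> integrable LM v \<and> sqint (Ip \<alpha> p \<mu> \<nu> (2 - \<alpha>) v)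
     \<and> (\<exists>g. weak_deriv (Ip \<alpha> p \<mu> \<nu> (2 - \<alpha>) v) g)"

definition HRL0 :: "real \<Rightarrow> real \<Rightarrow> real \<Rightarrow> real \<Rightarrow> (real \<Rightarrow> real) \<Rightarrow> bool" where
  "HRL0 \<alpha> p \<mu> \<nu> v \<longleftrightarrow> HRL \<alpha> p \<mu> \<nu> v \<and> vanishes_at_ends (Ip \<alpha> p \<mu> \<nu> (2 - \<alpha>) v)"

definition HRLnorm :: "real \<Rightarrow> real \<Rightarrow> real \<Rightarrow> real \<Rightarrow> (real \<Rightarrow> real) \<Rightarrow> real" where
  "HRLnorm \<alpha> p \<mu> \<nu> v = sqrt (L2ip (Ip \<alpha> p \<mu> \<nu> (2 - \<alpha>) v) (Ip \<alpha> p \<mu> \<nu> (2 - \<alpha>) v)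
        + L2ip (Dp \<alpha> p \<mu> \<nu> v) (Dp \<alpha> p \<mu> \<nu> v))"

definition weak_eq :: "real \<Rightarrow> real \<Rightarrow> real \<Rightarrow> real \<Rightarrow> real \<Rightarrow> ((real \<Rightarrow> real) \<Rightarrow> real) \<Rightarrow> (real \<Rightarrow> real) \<Rightarrow> bool" where
  "weak_eq \<alpha> p \<mu> \<nu> c f u \<longleftrightarrow> (\<forall>v. HRL0 \<alpha> p \<mu> \<nu> v \<longrightarrow>
     c * L2ip u (Ip \<alpha> p \<mu> \<nu> (2 - \<alpha>) v) + L2ip (Dp \<alpha> p \<mu> \<nu> u) (Dp \<alpha> p \<mu> \<nu> v)
       = f (Ip \<alpha> p \<mu> \<nu> (2 - \<alpha>) v))"

end

theory Submission imports Defs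
begin

text \<open>
  Put \<open>a = -\<nu>\<close>, \<open>b = -\<mu>\<close> (or the reverse, after a reflection). The condition on \<open>p\<close> makes the kernel of
  \<open>T = I_p^{2-\<alpha>}\<close> a multiple of Sonine's kernel, which factors into weighted left and right Abel integrals
  of orders \<open>a\<close> and \<open>b\<close>. Inverting the two Abel integrals gives explicit integrable solutions \<open>\<phi>_s\<close> of
  \<open>T \<phi>_s = 1_{x > s}\<close>, and superposing them with density \<open>z'\<close> gives \<open>T^{-1} z\<close> for every \<open>z\<close> in \<open>H^1_0\<close>, with
  an \<open>L^1\<close> bound by the norm of \<open>z'\<close> in \<open>L^2\<close>. The form \<open>(T^{-1} z, z)\<close> is nonnegative because it only sees the even
  part of the kernel, which is a superposition of rank-one squares, and \<open>T\<close> is injective because its transpose is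
  its reflection. Hence the weak problem is an equation for \<open>z = T u\<close> in \<open>H^1_0\<close> with a bounded coercive form, and
  the Lax--Milgram theorem applies.
\<close>

section \<open>Abel integral equations and Sonine's kernel\<close>

text \<open>A solution \<open>u\<close> is only known to be integrable, so its pairing with an image
  under T is estimated as L^1 against L^infinity, and the whole argument rests on the L^1 bound for
  the inverse of T. That bound pairs a square integrable derivative with end point singularities of
  order \<open>a\<close>, whose squares are integrable only for \<open>a < 1 / 2\<close>. Hence the
  smaller exponent has to play the part of \<open>a\<close>, and the other ordering is reached by
  reflection; the reflection is compatible with the right-hand sides because they vanish at both
  ends.

  The energy is first shown to be nonnegative for bounded derivatives, where its double integral
  converges absolutely, and then extended by truncation, using that the pairing is continuous in the
  L^2 norm of the derivatives.

  The unknown of the variational problem is the derivative of \<open>z\<close>, an element of L^2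
  with mean zero. The term with \<open>c\<close> only adds something nonnegative to the L^2 inner
  product of derivatives, so coercivity holds with constant 1 for all parameters, and the constant
  of the final estimate comes solely from comparing the H^1 norm with the norm of the
  derivative.\<close>

text \<open>The case distinction is needed since \<^term>\<open>r powr e\<close> does not vanish for negative \<^term>\<open>r\<close>.\<close>

definition pw :: "real \<Rightarrow> real \<Rightarrow> real" where
  "pw r e = (if 0 < r then r powr e else 0)"

lemma pw_measurable [measurable]:
  assumes [measurable]: "f \<in> borel_measurable M" "g \<in> borel_measurable M"
  shows "(\<lambda>x. pw (f x) (g x)) \<in> borel_measurable M"
  unfolding pw_def by measurable

lemma pw_nonneg [simp]: "0 \<le> pw r e"
  by (simp add: pw_def)

lemma pw_pos: "0 < r \<Longrightarrow> pw r e = r powr e"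
  by (simp add: pw_def)

lemma pw_neg: "r \<le> 0 \<Longrightarrow> pw r e = 0"
  by (simp add: pw_def)

lemma pw_zero_exp: "pw r 0 = indicator {0<..} r"
  by (simp add: pw_def)

lemma pw_mult: "0 < c \<Longrightarrow> pw (c * r) e = c powr e * pw r e"
  by (auto simp: pw_def powr_mult zero_less_mult_iff)

text \<open>Differentiability is required only in the open interval because the antiderivative built
  from \<open>ib\<close> later on is merely continuous at the end point \<open>s\<close>.\<close>

lemma nn_integral_FTC_Ioo:
  fixes f F :: "real \<Rightarrow> real"
  assumes "a \<le> b" "continuous_on {a..b} F"
    and deriv: "\<And>x. a < x \<Longrightarrow> x < b \<Longrightarrow> (F has_real_derivative f x) (at x)"
    and nonneg: "\<And>x. a < x \<Longrightarrow> x < b \<Longrightarrow> 0 \<le> f x"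
  shows "(\<integral>\<^sup>+x\<in>{a<..<b}. ennreal (f x) \<partial>lborel) = ennreal (F b - F a)"
proof -
  have "(f has_integral (F b - F a)) {a..b}"
    using assms by (intro fundamental_theorem_of_calculus_interior)
      (auto simp: has_real_derivative_iff_has_vector_derivative)
  then have "(f has_integral (F b - F a)) {a<..<b}"
    by (simp add: has_integral_Icc_iff_Ioo)
  then show ?thesis
    using nonneg by (intro nn_integral_has_integral_lebesgue') auto
qed

text \<open>The substitution \<open>s + d * t\<close> with \<open>d = x - s\<close> reduces the
  convolution to Euler's integral on the unit interval. For \<open>x \<le> s\<close> the supports of
  the two truncated powers do not meet.\<close>

lemma nn_integral_pw_beta:
  assumes "0 < A" "0 < B"
  shows "(\<integral>\<^sup>+t. ennreal (pw (x - t) (A - 1) * pw (t - s) (B - 1)) \<partial>lborel)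
    = ennreal (Beta A B * pw (x - s) (A + B - 1))"
proof (cases "s < x")
  case False
  then have "pw (x - t) (A - 1) * pw (t - s) (B - 1) = 0" for t
    by (auto simp: pw_def)
  then show ?thesis using False by (simp only: pw_neg) (simp add: pw_neg)
next
  case True
  define d where "d = x - s"
  have d: "0 < d" using True by (simp add: d_def)
  have hi: "((\<lambda>t. t powr (B - 1) * (1 - t) powr (A - 1)) has_integral Beta B A) {0<..<1}"
    using has_integral_Beta_real[OF assms(2,1)] by (simp add: has_integral_Icc_iff_Ioo)
  have beta: "(\<integral>\<^sup>+t. ennreal (pw t (B - 1) * pw (1 - t) (A - 1)) \<partial>lborel) = ennreal (Beta A B)"
  proof -
    have "(\<integral>\<^sup>+t\<in>{0<..<1}. ennreal (t powr (B - 1) * (1 - t) powr (A - 1)) \<partial>lborel) = ennreal (Beta B A)"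
      by (rule nn_integral_has_integral_lebesgue'[OF _ hi]) auto
    moreover have "(\<integral>\<^sup>+t\<in>{0<..<1}. ennreal (t powr (B - 1) * (1 - t) powr (A - 1)) \<partial>lborel)
       = (\<integral>\<^sup>+t. ennreal (pw t (B - 1) * pw (1 - t) (A - 1)) \<partial>lborel)"
      by (intro nn_integral_cong) (auto simp: pw_def indicator_def)
    ultimately show ?thesis by (simp add: Beta_commute)
  qed
  have "(\<integral>\<^sup>+t. ennreal (pw (x - t) (A - 1) * pw (t - s) (B - 1)) \<partial>lborel)
      = ennreal d * (\<integral>\<^sup>+t. ennreal (pw (x - (s + d * t)) (A - 1) * pw ((s + d * t) - s) (B - 1)) \<partial>lborel)"
    using d by (subst nn_integral_real_affine[where c=d and t=s]) auto
  also have "(\<lambda>t. pw (x - (s + d * t)) (A - 1) * pw ((s + d * t) - s) (B - 1))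
      = (\<lambda>t. d powr (A + B - 2) * (pw t (B - 1) * pw (1 - t) (A - 1)))"
  proof
    fix t
    have "x - (s + d * t) = d * (1 - t)" by (simp add: d_def algebra_simps)
    then have "pw (x - (s + d * t)) (A - 1) * pw ((s + d * t) - s) (B - 1)
        = (d powr (A - 1) * d powr (B - 1)) * (pw t (B - 1) * pw (1 - t) (A - 1))"
      using d by (simp add: pw_mult)
    also have "d powr (A - 1) * d powr (B - 1) = d powr (A + B - 2)"
      by (simp add: powr_add[symmetric])
    finally show "pw (x - (s + d * t)) (A - 1) * pw ((s + d * t) - s) (B - 1)
        = d powr (A + B - 2) * (pw t (B - 1) * pw (1 - t) (A - 1))" .
  qed
  also have "(\<integral>\<^sup>+t. ennreal (d powr (A + B - 2) * (pw t (B - 1) * pw (1 - t) (A - 1))) \<partial>lborel)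
      = ennreal (d powr (A + B - 2)) * ennreal (Beta A B)"
    by (subst ennreal_mult) (simp_all add: nn_integral_cmult beta)
  also have "ennreal d * (ennreal (d powr (A + B - 2)) * ennreal (Beta A B))
      = ennreal (d * d powr (A + B - 2) * Beta A B)"
    using d by (simp add: ennreal_mult'' ennreal_mult' mult.assoc)
  also have "d * d powr (A + B - 2) = d powr (A + B - 1)"
    using d by (simp add: powr_mult_base algebra_simps)
  finally show ?thesis using d by (simp add: pw_pos d_def mult.commute)
qed

text \<open>The expression \<open>t * (y - x) / (x * (y - t))\<close> is the Moebius map in
  \<open>t\<close> that fixes 0, sends \<open>x\<close> to 1 and has its pole at \<open>y\<close>;
  the last factor is its derivative. The exponent \<open>- A - B\<close> of \<open>y - t\<close> is
  the one for which the Beta density is transformed without a remaining factor depending on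
  \<open>t\<close>. After taking logarithms the identity is linear.\<close>

lemma sonine_integrand:
  fixes A B t x y :: real
  assumes "0 < t" "t < x" "x < y"
  shows "t powr (B - 1) * (x - t) powr (A - 1) * (y - t) powr (- A - B)
    = (x powr (A + B - 1) * y powr (- A) * (y - x) powr (- B)) *
      ((t * (y - x) / (x * (y - t))) powr (B - 1) * (1 - t * (y - x) / (x * (y - t))) powr (A - 1) *
       ((y - x) * y / (x * (y - t)\<^sup>2)))"
proof -
  have pos: "0 < x" "0 < y" "0 < y - x" "0 < y - t" "0 < x - t" using assms by auto
  have e1: "1 - t * (y - x) / (x * (y - t)) = y * (x - t) / (x * (y - t))"
    using pos by (simp add: field_simps)
  have e2: "(y - x) * y / (x * (y - t)\<^sup>2) = exp (ln (y - x) + ln y - ln x - 2 * ln (y - t))"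
    using pos assms by (simp add: exp_add exp_diff exp_double power2_eq_square field_simps)
  show ?thesis
    unfolding e1 e2 using pos assms
    apply (simp add: powr_def ln_mult ln_div exp_add[symmetric])
    apply (simp add: algebra_simps)
    done
qed

lemma nn_integral_sonine:
  assumes "0 < A" "0 < B" "0 < x" "x < y"
  shows "(\<integral>\<^sup>+t. ennreal (pw (x - t) (A - 1) * pw (y - t) (- A - B) * pw t (B - 1)) \<partial>lborel)
    = ennreal (Beta A B * (x powr (A + B - 1) * y powr (- A) * (y - x) powr (- B)))"
proof -
  define g where "g = (\<lambda>t. t * (y - x) / (x * (y - t)))"
  define g' where "g' = (\<lambda>t. (y - x) * y / (x * (y - t)\<^sup>2))"
  define f where "f = (\<lambda>u::real. u powr (B - 1) * (1 - u) powr (A - 1))"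
  define c where "c = x powr (A + B - 1) * y powr (- A) * (y - x) powr (- B)"
  have c: "0 \<le> c" by (simp add: c_def)
  have g0: "g 0 = 0" "g x = 1" using assms by (auto simp: g_def)
  have "(\<integral>\<^sup>+ u. ennreal (f u * indicator {g 0..g x} u) \<partial>lborel)
     = (\<integral>\<^sup>+ t. ennreal (f (g t) * g' t * indicator {0..x} t) \<partial>lborel)"
  proof (rule nn_integral_substitution)
    show "set_borel_measurable borel {g 0..g x} f"
      unfolding f_def set_borel_measurable_def by measurable
    show "(g has_real_derivative g' t) (at t)" if "t \<in> {0..x}" for t
    proof -
      have nz: "x \<noteq> 0" "y - t \<noteq> 0" using that assms by auto
      have "(g has_real_derivative ((y - x) * (x * (y - t)) - t * (y - x) * (x * (- 1))) / (x * (y - t))\<^sup>2) (at t)"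
        unfolding g_def using nz
        by (auto intro!: derivative_eq_intros simp: power2_eq_square)
      also have "((y - x) * (x * (y - t)) - t * (y - x) * (x * (- 1))) / (x * (y - t))\<^sup>2 = x * ((y - x) * y) / (x * (y - t))\<^sup>2"
        by (simp add: algebra_simps)
      also have "\<dots> = g' t"
        unfolding g'_def power2_eq_square using nz by (simp add: divide_simps)
      finally show ?thesis .
    qed
    show "continuous_on {0..x} g'"
      unfolding g'_def using assms by (auto intro!: continuous_intros)
    show "0 \<le> g' t" if "t \<in> {0..x}" for t
      unfolding g'_def using that assms by auto
  qed (use assms in auto)
  moreover have "(\<integral>\<^sup>+ u. ennreal (f u * indicator {g 0..g x} u) \<partial>lborel) = ennreal (Beta A B)"
  proof -
    have "(f has_integral Beta B A) {0..1}"
      unfolding f_def by (rule has_integral_Beta_real[OF assms(2,1)])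
    then have "(\<integral>\<^sup>+u\<in>{0..1}. ennreal (f u) \<partial>lborel) = ennreal (Beta B A)"
      by (intro nn_integral_has_integral_lebesgue') (auto simp: f_def)
    moreover have "(\<integral>\<^sup>+u\<in>{0..1}. ennreal (f u) \<partial>lborel) = (\<integral>\<^sup>+ u. ennreal (f u * indicator {g 0..g x} u) \<partial>lborel)"
      unfolding g0 by (intro nn_integral_cong) (auto simp: indicator_def)
    ultimately show ?thesis by (simp add: Beta_commute)
  qed
  ultimately have I: "(\<integral>\<^sup>+ t. ennreal (f (g t) * g' t * indicator {0..x} t) \<partial>lborel) = ennreal (Beta A B)"
    by simp
  have "(\<integral>\<^sup>+t. ennreal (pw (x - t) (A - 1) * pw (y - t) (- A - B) * pw t (B - 1)) \<partial>lborel)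
     = (\<integral>\<^sup>+t. ennreal c * ennreal (f (g t) * g' t * indicator {0..x} t) \<partial>lborel)"
  proof (intro nn_integral_cong_AE)
    have "AE t in lborel. t \<noteq> 0 \<and> t \<noteq> x"
      by (simp add: AE_lborel_singleton)
    then show "AE t in lborel. ennreal (pw (x - t) (A - 1) * pw (y - t) (- A - B) * pw t (B - 1))
        = ennreal c * ennreal (f (g t) * g' t * indicator {0..x} t)"
    proof eventually_elim
      case (elim t)
      show ?case
      proof (cases "0 < t \<and> t < x")
        case True
        then have "pw (x - t) (A - 1) * pw (y - t) (- A - B) * pw t (B - 1) = c * (f (g t) * g' t)"
          using sonine_integrand[of t x y B A] assms
          by (simp add: pw_pos c_def f_def g_def g'_def mult_ac)
        then show ?thesis using True c by (simp add: ennreal_mult'[symmetric])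
      next
        case False
        then show ?thesis using elim by (auto simp: pw_def indicator_def)
      qed
    qed
  qed
  also have "\<dots> = ennreal c * ennreal (Beta A B)"
    unfolding I[symmetric]
    by (rule nn_integral_cmult) (simp add: f_def g_def g'_def)
  finally show ?thesis
    unfolding c_def[symmetric] by (simp only: ennreal_mult'[OF c] mult.commute)
qed

section \<open>Abel integrals of nonnegative functions: semigroup law and inversion\<close>

abbreviation epw :: "real \<Rightarrow> real \<Rightarrow> ennreal" where
  "epw r e \<equiv> ennreal (pw r e)"

text \<open>Tonelli's theorem moves the inner integral onto the two kernels, whose convolution is a
  Beta integral. Since all values are extended nonnegative reals, the law holds without any
  integrability condition.\<close>

lemma abel_semigroup:
  fixes u :: "real \<Rightarrow> ennreal"
  assumes "0 < A" "0 < B" and [measurable]: "u \<in> borel_measurable borel"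
  shows "(\<integral>\<^sup>+t. epw (t - x) (A - 1) * (\<integral>\<^sup>+y. epw (y - t) (B - 1) * u y \<partial>lborel) \<partial>lborel)
    = ennreal (Beta A B) * (\<integral>\<^sup>+y. epw (y - x) (A + B - 1) * u y \<partial>lborel)"
proof -
  have "(\<integral>\<^sup>+t. epw (t - x) (A - 1) * (\<integral>\<^sup>+y. epw (y - t) (B - 1) * u y \<partial>lborel) \<partial>lborel)
      = (\<integral>\<^sup>+t. (\<integral>\<^sup>+y. epw (t - x) (A - 1) * (epw (y - t) (B - 1) * u y) \<partial>lborel) \<partial>lborel)"
    by (simp add: nn_integral_cmult)
  also have "\<dots> = (\<integral>\<^sup>+y. (\<integral>\<^sup>+t. epw (t - x) (A - 1) * (epw (y - t) (B - 1) * u y) \<partial>lborel) \<partial>lborel)"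
    by (rule lborel_pair.Fubini') simp
  also have "\<dots> = (\<integral>\<^sup>+y. ennreal (Beta A B) * (epw (y - x) (A + B - 1) * u y) \<partial>lborel)"
  proof (intro nn_integral_cong)
    fix y
    have "(\<integral>\<^sup>+t. epw (t - x) (A - 1) * (epw (y - t) (B - 1) * u y) \<partial>lborel)
      = (\<integral>\<^sup>+t. ennreal (pw (y - t) (B - 1) * pw (t - x) (A - 1)) * u y \<partial>lborel)"
      by (simp add: ennreal_mult' mult_ac)
    also have "\<dots> = ennreal (Beta B A * pw (y - x) (B + A - 1)) * u y"
      using nn_integral_pw_beta[OF assms(2,1), of y x]
      by (subst nn_integral_multc) auto
    finally show "(\<integral>\<^sup>+t. epw (t - x) (A - 1) * (epw (y - t) (B - 1) * u y) \<partial>lborel)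
       = ennreal (Beta A B) * (epw (y - x) (A + B - 1) * u y)"
      by (simp add: ennreal_mult'' Beta_commute mult_ac add.commute)
  qed
  also have "\<dots> = ennreal (Beta A B) * (\<integral>\<^sup>+y. epw (y - x) (A + B - 1) * u y \<partial>lborel)"
    by (simp add: nn_integral_cmult)
  finally show ?thesis .
qed

lemma Beta_pos: "0 < A \<Longrightarrow> 0 < B \<Longrightarrow> 0 < Beta A (B::real)"
  by (simp add: Beta_def)

text \<open>
  Abel's equation with index \<^term>\<open>b\<close> is solved by comparing primitives: both sides of the claim have
  the same integral over every half line.
\<close>

lemma abel_inversion_AE:
  fixes u w q :: "real \<Rightarrow> ennreal"
  assumes b: "0 < b" "b < 1"
    and [measurable]: "u \<in> borel_measurable borel" "w \<in> borel_measurable borel" "q \<in> borel_measurable borel"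
    and fin: "(\<integral>\<^sup>+y. epw (y - l) b * u y \<partial>lborel) < \<infinity>"
    and hyp: "\<And>y. l \<le> y \<Longrightarrow> (\<integral>\<^sup>+t. epw (t - y) 0 * u t \<partial>lborel)
        = (\<integral>\<^sup>+t. epw (t - y) (- b) * q t \<partial>lborel) + (\<integral>\<^sup>+t. epw (t - y) 0 * w t \<partial>lborel)"
  shows "AE t in lborel. l < t \<longrightarrow> (\<integral>\<^sup>+y. epw (y - t) (b - 1) * u y \<partial>lborel)
        = ennreal (Beta b (1 - b)) * q t + (\<integral>\<^sup>+y. epw (y - t) (b - 1) * w y \<partial>lborel)"
proof -
  define U where "U = (\<lambda>t. \<integral>\<^sup>+y. epw (y - t) (b - 1) * u y \<partial>lborel)"
  define W where "W = (\<lambda>t. ennreal (Beta b (1 - b)) * q t + (\<integral>\<^sup>+y. epw (y - t) (b - 1) * w y \<partial>lborel))"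
  have [measurable]: "U \<in> borel_measurable borel" "W \<in> borel_measurable borel"
    unfolding U_def W_def by measurable
  \<comment> \<open>These are the semigroup law for the pairs of orders (1, b), (b, 1) and (b, 1 -
    b). The first two together say that integration over a half line commutes with the Abel integral
    of order \<open>b\<close>.\<close>
  have key1: "(\<integral>\<^sup>+t. epw (t - x) 0 * (\<integral>\<^sup>+y. epw (y - t) (b - 1) * v y \<partial>lborel) \<partial>lborel)
     = ennreal (Beta 1 b) * (\<integral>\<^sup>+y. epw (y - x) b * v y \<partial>lborel)"
    if [measurable]: "v \<in> borel_measurable borel" for v x
    using abel_semigroup[of 1 b v x] b by simp
  have key2: "(\<integral>\<^sup>+t. epw (t - x) (b - 1) * (\<integral>\<^sup>+y. epw (y - t) 0 * v y \<partial>lborel) \<partial>lborel)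
     = ennreal (Beta 1 b) * (\<integral>\<^sup>+y. epw (y - x) b * v y \<partial>lborel)"
    if [measurable]: "v \<in> borel_measurable borel" for v x
    using abel_semigroup[of b 1 v x] b by (simp add: Beta_commute)
  have key3: "(\<integral>\<^sup>+t. epw (t - x) (b - 1) * (\<integral>\<^sup>+y. epw (y - t) (- b) * v y \<partial>lborel) \<partial>lborel)
     = ennreal (Beta b (1 - b)) * (\<integral>\<^sup>+y. epw (y - x) 0 * v y \<partial>lborel)"
    if [measurable]: "v \<in> borel_measurable borel" for v x
    using abel_semigroup[of b "1 - b" v x] b by simp
  \<comment> \<open>The Abel integral of order \<open>b\<close> is applied to \<open>hyp\<close>;
    \<open>key3\<close> turns the term with \<open>q\<close> into a plain integral. The kernel
    vanishes for \<open>t \<le> x\<close>, so \<open>hyp\<close> is only used at points to the right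
    of \<open>l\<close>.\<close>
  have eq: "(\<integral>\<^sup>+t. epw (t - x) 0 * U t \<partial>lborel) = (\<integral>\<^sup>+t. epw (t - x) 0 * W t \<partial>lborel)"
    if "l \<le> x" for x
  proof -
    have "(\<integral>\<^sup>+t. epw (t - x) 0 * U t \<partial>lborel)
        = (\<integral>\<^sup>+t. epw (t - x) (b - 1) * (\<integral>\<^sup>+y. epw (y - t) 0 * u y \<partial>lborel) \<partial>lborel)"
      unfolding U_def by (simp add: key1 key2)
    also have "\<dots> = (\<integral>\<^sup>+t. epw (t - x) (b - 1) *
       ((\<integral>\<^sup>+y. epw (y - t) (- b) * q y \<partial>lborel) + (\<integral>\<^sup>+y. epw (y - t) 0 * w y \<partial>lborel)) \<partial>lborel)"
    proof (intro nn_integral_cong)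
      fix t
      show "epw (t - x) (b - 1) * (\<integral>\<^sup>+y. epw (y - t) 0 * u y \<partial>lborel) = epw (t - x) (b - 1) *
       ((\<integral>\<^sup>+y. epw (y - t) (- b) * q y \<partial>lborel) + (\<integral>\<^sup>+y. epw (y - t) 0 * w y \<partial>lborel))"
        using hyp[of t] that by (cases "x < t") (simp_all add: pw_neg)
    qed
    also have "\<dots> = ennreal (Beta b (1 - b)) * (\<integral>\<^sup>+y. epw (y - x) 0 * q y \<partial>lborel)
        + ennreal (Beta 1 b) * (\<integral>\<^sup>+y. epw (y - x) b * w y \<partial>lborel)"
      by (simp add: distrib_left nn_integral_add key2 key3)
    also have "\<dots> = (\<integral>\<^sup>+t. epw (t - x) 0 * W t \<partial>lborel)"
      unfolding W_def
      by (simp add: distrib_left nn_integral_add key1 mult.left_commute nn_integral_cmult)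
    finally show ?thesis .
  qed
  define U' W' where "U' = (\<lambda>t. indicator {l<..} t * U t)" and "W' = (\<lambda>t. indicator {l<..} t * W t)"
  have [measurable]: "U' \<in> borel_measurable borel" "W' \<in> borel_measurable borel"
    unfolding U'_def W'_def by measurable
  have dU: "emeasure (density lborel U') {x<..} = (\<integral>\<^sup>+t. epw (t - max l x) 0 * U t \<partial>lborel)" for x
    by (subst emeasure_density) (auto intro!: nn_integral_cong simp: U'_def pw_zero_exp indicator_def)
  have dW: "emeasure (density lborel W') {x<..} = (\<integral>\<^sup>+t. epw (t - max l x) 0 * W t \<partial>lborel)" for x
    by (subst emeasure_density) (auto intro!: nn_integral_cong simp: W'_def pw_zero_exp indicator_def)
  have finU: "(\<integral>\<^sup>+t. epw (t - max l x) 0 * U t \<partial>lborel) < \<infinity>" for x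
  proof -
    have "(\<integral>\<^sup>+t. epw (t - max l x) 0 * U t \<partial>lborel) \<le> (\<integral>\<^sup>+t. epw (t - l) 0 * U t \<partial>lborel)"
      by (intro nn_integral_mono mult_right_mono ennreal_leI) (auto simp: pw_zero_exp indicator_def)
    also have "\<dots> < \<infinity>"
      unfolding U_def using fin by (simp add: key1 ennreal_mult_less_top)
    finally show ?thesis .
  qed
  \<comment> \<open>Measures that agree on all half lines, with finite values there, are equal, and
    a density is determined almost everywhere. This is where \<open>fin\<close> enters.\<close>
  have "density lborel U' = density lborel W'"
  proof (rule measure_eqI_lessThan)
    show "emeasure (density lborel U') {x<..} < \<infinity>" for x
      unfolding dU by (rule finU)
    show "emeasure (density lborel U') {x<..} = emeasure (density lborel W') {x<..}" for x
      unfolding dU dW by (rule eq) simp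
  qed simp_all
  then have "AE t in lborel. U' t = W' t"
    by (intro sigma_finite_measure.density_unique[OF sigma_finite_lborel]) simp_all
  then show ?thesis
    by eventually_elim (auto simp: U'_def W'_def U_def W_def)
qed

text \<open>The kernel of a combination of the left and the right Riemann-Liouville integral of
  order \<sigma>, up to the Gamma factor. For \<open>A = B = 1\<close> and
  \<open>r \<noteq> 0\<close> it is the Riesz kernel, a power of the absolute value of
  \<open>r\<close>.\<close>

definition rk :: "real \<Rightarrow> real \<Rightarrow> real \<Rightarrow> real \<Rightarrow> real" where
  "rk A B \<sigma> r = A * pw r (\<sigma> - 1) + B * pw (- r) (\<sigma> - 1)"

lemma rk_measurable [measurable]:
  assumes [measurable]: "f \<in> borel_measurable M"
  shows "(\<lambda>x. rk A B \<sigma> (f x)) \<in> borel_measurable M"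
  unfolding rk_def by measurable

lemma rk_nonneg: "0 \<le> A \<Longrightarrow> 0 \<le> B \<Longrightarrow> 0 \<le> rk A B \<sigma> r"
  by (simp add: rk_def)

text \<open>The integration stops at the smaller of \<open>x\<close> and \<open>y\<close>, so the
  two orderings lead to the same integral with \<open>a\<close> and \<open>b\<close> exchanged. This
  is the origin of the different Beta factors on the two sides of the kernel.\<close>

lemma sonine_kernel:
  assumes "0 < a" "0 < b" "a + b < 1" "0 < x" "0 < y" "x \<noteq> y"
  shows "(\<integral>\<^sup>+t. ennreal (pw (x - t) (a - 1) * pw (y - t) (b - 1) * pw t (- (a + b))) \<partial>lborel)
    = ennreal (x powr (- b) * y powr (- a) * rk (Beta b (1 - (a + b))) (Beta a (1 - (a + b))) (a + b) (x - y))"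
proof (cases "x < y")
  case True
  then show ?thesis
    using nn_integral_sonine[of a "1 - (a + b)" x y] assms
    by (simp add: rk_def pw_pos pw_neg mult_ac algebra_simps)
next
  case False
  then show ?thesis
    using nn_integral_sonine[of b "1 - (a + b)" y x] assms
    by (simp add: rk_def pw_pos pw_neg mult_ac algebra_simps)
qed

text \<open>Read from the inside, the right-hand side is a weight, a right Abel integral of order
  \<open>b\<close>, a second weight, a left Abel integral of order \<open>a\<close> and a third
  weight. Interchanging the integrals produces the integral of \<open>sonine_kernel\<close>, and the
  outer weights cancel its factor \<open>x powr (- b) * y powr (- a)\<close>.\<close>

lemma sonine_factorization:
  fixes w :: "real \<Rightarrow> ennreal"
  assumes ab: "0 < a" "0 < b" "a + b < 1" and x: "0 < x"
    and [measurable]: "w \<in> borel_measurable borel" and w: "\<And>y. y \<le> 0 \<Longrightarrow> w y = 0"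
  shows "(\<integral>\<^sup>+y. ennreal (rk (Beta b (1 - (a + b))) (Beta a (1 - (a + b))) (a + b) (x - y)) * w y \<partial>lborel)
   = ennreal (x powr b) * (\<integral>\<^sup>+t. epw (x - t) (a - 1) * epw t (- (a + b)) *
        (\<integral>\<^sup>+y. epw (y - t) (b - 1) * (epw y a * w y) \<partial>lborel) \<partial>lborel)"
proof -
  let ?k = "rk (Beta b (1 - (a + b))) (Beta a (1 - (a + b))) (a + b)"
  have k0: "0 \<le> ?k r" for r
    using ab by (intro rk_nonneg) (auto intro!: less_imp_le Beta_pos)
  have "(\<integral>\<^sup>+t. epw (x - t) (a - 1) * epw t (- (a + b)) *
        (\<integral>\<^sup>+y. epw (y - t) (b - 1) * (epw y a * w y) \<partial>lborel) \<partial>lborel)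
     = (\<integral>\<^sup>+t. (\<integral>\<^sup>+y. epw (x - t) (a - 1) * epw t (- (a + b)) * (epw (y - t) (b - 1) * (epw y a * w y)) \<partial>lborel) \<partial>lborel)"
    by (simp add: nn_integral_cmult)
  also have "\<dots> = (\<integral>\<^sup>+y. (\<integral>\<^sup>+t. epw (x - t) (a - 1) * epw t (- (a + b)) * (epw (y - t) (b - 1) * (epw y a * w y)) \<partial>lborel) \<partial>lborel)"
    by (rule lborel_pair.Fubini') simp
  also have "\<dots> = (\<integral>\<^sup>+y. ennreal (x powr (- b)) * (ennreal (?k (x - y)) * w y) \<partial>lborel)"
  proof (intro nn_integral_cong_AE)
    have "AE y in lborel. y \<noteq> x" by (rule AE_lborel_singleton)
    then show "AE y in lborel. (\<integral>\<^sup>+t. epw (x - t) (a - 1) * epw t (- (a + b)) * (epw (y - t) (b - 1) * (epw y a * w y)) \<partial>lborel)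
        = ennreal (x powr (- b)) * (ennreal (?k (x - y)) * w y)"
    proof eventually_elim
      case (elim y)
      show ?case
      proof (cases "0 < y")
        case True
        have "(\<integral>\<^sup>+t. epw (x - t) (a - 1) * epw t (- (a + b)) * (epw (y - t) (b - 1) * (epw y a * w y)) \<partial>lborel)
          = (\<integral>\<^sup>+t. ennreal (pw (x - t) (a - 1) * pw (y - t) (b - 1) * pw t (- (a + b))) * (epw y a * w y) \<partial>lborel)"
          by (simp add: ennreal_mult' mult_ac)
        also have "\<dots> = ennreal (x powr (- b) * y powr (- a) * ?k (x - y)) * (epw y a * w y)"
          using sonine_kernel[OF ab x True] elim by (subst nn_integral_multc) auto
        also have "\<dots> = ennreal (x powr (- b) * y powr (- a) * ?k (x - y) * pw y a) * w y"
          using k0[of "x - y"] by (simp add: ennreal_mult' mult.assoc)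
        also have "x powr (- b) * y powr (- a) * ?k (x - y) * pw y a = x powr (- b) * ?k (x - y)"
          using True by (simp add: pw_pos powr_minus field_simps)
        finally show ?thesis by (simp add: ennreal_mult' k0 mult.assoc)
      next
        case False
        then show ?thesis by (simp add: w)
      qed
    qed
  qed
  also have "\<dots> = ennreal (x powr (- b)) * (\<integral>\<^sup>+y. ennreal (?k (x - y)) * w y \<partial>lborel)"
    by (rule nn_integral_cmult) simp
  finally have "ennreal (x powr b) * (\<integral>\<^sup>+t. epw (x - t) (a - 1) * epw t (- (a + b)) *
        (\<integral>\<^sup>+y. epw (y - t) (b - 1) * (epw y a * w y) \<partial>lborel) \<partial>lborel)
      = ennreal (x powr b * x powr (- b)) * (\<integral>\<^sup>+y. ennreal (?k (x - y)) * w y \<partial>lborel)"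
    by (simp add: ennreal_mult' mult.assoc)
  also have "x powr b * x powr (- b) = 1"
    using x by (simp add: powr_minus)
  finally show ?thesis by simp
qed

text \<open>The mirror image of the right-sided inversion, with the subtracted term equal to 0; the
  left end \<open>l\<close> becomes the right end \<open>r\<close>.\<close>

lemma left_abel_inversion_AE:
  fixes h q :: "real \<Rightarrow> ennreal"
  assumes a: "0 < a" "a < 1"
    and [measurable]: "h \<in> borel_measurable borel" "q \<in> borel_measurable borel"
    and fin: "(\<integral>\<^sup>+y. epw (r - y) a * h y \<partial>lborel) < \<infinity>"
    and hyp: "\<And>x. (\<integral>\<^sup>+t. epw (x - t) 0 * h t \<partial>lborel) = (\<integral>\<^sup>+t. epw (x - t) (- a) * q t \<partial>lborel)"
  shows "AE x in lborel. x < r \<longrightarrow> (\<integral>\<^sup>+t. epw (x - t) (a - 1) * h t \<partial>lborel) = ennreal (Beta a (1 - a)) * q x"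
proof -
  have refl: "(\<integral>\<^sup>+t. epw (t - x) e * v (- t) \<partial>lborel) = (\<integral>\<^sup>+t. epw (- x - t) e * v t \<partial>lborel)"
    if [measurable]: "v \<in> borel_measurable borel" for v :: "real \<Rightarrow> ennreal" and x e
    by (subst nn_integral_real_affine[where c="-1" and t=0]) (auto simp: algebra_simps)
  have "AE t in lborel. - r < t \<longrightarrow> (\<integral>\<^sup>+y. epw (y - t) (a - 1) * h (- y) \<partial>lborel)
        = ennreal (Beta a (1 - a)) * q (- t) + (\<integral>\<^sup>+y. epw (y - t) (a - 1) * 0 \<partial>lborel)"
  proof (rule abel_inversion_AE[OF a])
    show "(\<integral>\<^sup>+y. epw (y - - r) a * h (- y) \<partial>lborel) < \<infinity>"
      using fin by (subst refl) auto
    show "(\<integral>\<^sup>+t. epw (t - y) 0 * h (- t) \<partial>lborel)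
      = (\<integral>\<^sup>+t. epw (t - y) (- a) * q (- t) \<partial>lborel) + (\<integral>\<^sup>+t. epw (t - y) 0 * 0 \<partial>lborel)" for y
      using hyp[of "- y"] by (subst (1 2) refl) auto
  qed auto
  then have "AE t in lborel. - r < 0 + (- 1) * t \<longrightarrow> (\<integral>\<^sup>+y. epw (y - (0 + (- 1) * t)) (a - 1) * h (- y) \<partial>lborel)
        = ennreal (Beta a (1 - a)) * q (- (0 + (- 1) * t)) + (\<integral>\<^sup>+y. epw (y - (0 + (- 1) * t)) (a - 1) * 0 \<partial>lborel)"
    by (rule AE_borel_affine[rotated 2]) auto
  then show ?thesis
    by eventually_elim (subst (asm) refl, auto)
qed

section \<open>Solutions for step functions\<close>

locale abel_exponents =
  fixes a b :: real
  assumes a: "0 < a" and b: "0 < b" and ab: "a + b < 1"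
begin

text \<open>
  For fixed \<open>s\<close>, the left Abel integral of order \<open>a\<close> of \<open>t^{-(a+b)} G s t\<close> is a multiple of \<open>x^{-b} 1_{x > s}\<close>.
  The function \<open>G s t = Gh (s / t)\<close> comes from differentiating the left Abel integral of order \<open>1 - a\<close> of the
  latter, which is an incomplete beta integral \<open>ib\<close>.
\<close>

definition bint :: "real \<Rightarrow> real" where
  "bint \<tau> = \<tau> powr (- b) * (1 - \<tau>) powr (- a)"

text \<open>Encoded as a nonnegative integral, and not as \<open>integral {r..1} bint\<close>, so
  that Borel measurability in \<open>r\<close> is immediate; \<open>ib_eq_integral\<close> recovers
  the incomplete Beta function on the unit interval.\<close>

definition ib :: "real \<Rightarrow> real" where
  "ib r = enn2real (\<integral>\<^sup>+\<tau>. epw (1 - \<tau>) (- a) * (epw \<tau> (- b) * epw (\<tau> - r) 0) \<partial>lborel)"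

lemma ib_measurable [measurable]: "ib \<in> borel_measurable borel"
  unfolding ib_def by measurable

lemma bint_integral: "(bint has_integral Beta (1 - b) (1 - a)) {0..1}"
  using has_integral_Beta_real[of "1 - b" "1 - a"] a b ab by (simp add: bint_def[abs_def])

lemma bint_integrable: "0 \<le> r \<Longrightarrow> r \<le> s \<Longrightarrow> s \<le> 1 \<Longrightarrow> bint integrable_on {r..s}"
  using bint_integral integrable_on_subinterval[of bint "{0..1}" r s] by auto

lemma ib_eq_integral:
  assumes "0 \<le> r" "r \<le> 1"
  shows "ib r = integral {r..1} bint"
    and "(\<integral>\<^sup>+\<tau>. epw (1 - \<tau>) (- a) * (epw \<tau> (- b) * epw (\<tau> - r) 0) \<partial>lborel) = ennreal (ib r)"
proof -
  have "(bint has_integral (integral {r..1} bint)) {r<..<1}"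
    using bint_integrable[of r 1] assms by (simp add: has_integral_Icc_iff_Ioo[symmetric] integrable_integral)
  from nn_integral_has_integral_lebesgue'[OF _ this]
  have "(\<integral>\<^sup>+\<tau>\<in>{r<..<1}. ennreal (bint \<tau>) \<partial>lborel) = ennreal (integral {r..1} bint)"
    by (simp add: bint_def)
  also have "(\<integral>\<^sup>+\<tau>\<in>{r<..<1}. ennreal (bint \<tau>) \<partial>lborel)
      = (\<integral>\<^sup>+\<tau>. epw (1 - \<tau>) (- a) * (epw \<tau> (- b) * epw (\<tau> - r) 0) \<partial>lborel)"
    using assms by (intro nn_integral_cong) (auto simp: bint_def pw_def indicator_def ennreal_mult'[symmetric] mult_ac)
  finally have *: "(\<integral>\<^sup>+\<tau>. epw (1 - \<tau>) (- a) * (epw \<tau> (- b) * epw (\<tau> - r) 0) \<partial>lborel)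
      = ennreal (integral {r..1} bint)" by simp
  have "0 \<le> integral {r..1} bint"
    using bint_integrable[of r 1] assms by (intro integral_nonneg) (auto simp: bint_def)
  then show "ib r = integral {r..1} bint" unfolding ib_def * by simp
  then show "(\<integral>\<^sup>+\<tau>. epw (1 - \<tau>) (- a) * (epw \<tau> (- b) * epw (\<tau> - r) 0) \<partial>lborel) = ennreal (ib r)"
    using * by simp
qed

lemma ib_eq: "0 \<le> r \<Longrightarrow> r \<le> 1 \<Longrightarrow> ib r = Beta (1 - b) (1 - a) - integral {0..r} bint"
  using Henstock_Kurzweil_Integration.integral_combine[of 0 r 1 bint] bint_integrable[of 0 1] bint_integral
  by (simp add: ib_eq_integral integral_unique)

lemma ib_nonneg: "0 \<le> ib r"
  by (simp add: ib_def)

lemma ib_le: "0 \<le> r \<Longrightarrow> r \<le> 1 \<Longrightarrow> ib r \<le> Beta (1 - b) (1 - a)"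
  using bint_integrable[of 0 r] by (simp add: ib_eq integral_nonneg bint_def)

lemma ib_1: "ib 1 = 0"
  by (simp add: ib_eq_integral)

lemma ib_continuous: "continuous_on {0..1} ib"
proof -
  have "continuous_on {0..1} (\<lambda>r. Beta (1 - b) (1 - a) - integral {0..r} bint)"
    by (intro continuous_intros indefinite_integral_continuous_1 bint_integrable) auto
  then show ?thesis
    by (rule continuous_on_eq) (simp add: ib_eq)
qed

lemma ib_deriv:
  assumes "0 < r" "r < 1"
  shows "(ib has_real_derivative - bint r) (at r)"
proof -
  have "((\<lambda>u. integral {0..u} bint) has_vector_derivative bint r) (at r within {0..1})"
  proof -
    have "continuous (at r within {0..1} - {}) bint"
      unfolding bint_def[abs_def] using assms by (intro continuous_intros) auto
    from integral_has_vector_derivative_continuous_at[OF bint_integrable[of 0 1] _ _ this]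
    show ?thesis using assms by simp
  qed
  moreover have "at r within {0..1} = at r"
    using assms by (intro at_within_interior) auto
  ultimately have "((\<lambda>u. integral {0..u} bint) has_real_derivative bint r) (at r)"
    by (simp add: has_real_derivative_iff_has_vector_derivative)
  then have "((\<lambda>r. Beta (1 - b) (1 - a) - integral {0..r} bint) has_real_derivative - bint r) (at r)"
    by (auto intro!: derivative_eq_intros)
  then show ?thesis
    by (rule DERIV_cong_ev[THEN iffD1, rotated -1])
      (use assms in \<open>auto simp: ib_eq intro!: eventually_mono[OF eventually_nhds_in_open[of "{0<..<1}" r]]\<close>)
qed

definition Gh :: "real \<Rightarrow> real" where
  "Gh r = (1 - (a + b)) * ib r + r powr (1 - b) * (1 - r) powr (- a)"

lemma Gh_measurable [measurable]: "Gh \<in> borel_measurable borel"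
  unfolding Gh_def by measurable

text \<open>The multiples of \<open>r powr (- b) * (1 - r) powr (- a)\<close> add up to the factor
  \<open>a\<close>, and combine with the remaining term because \<open>(1 - r) + r = 1\<close>. The
  positive sign means that \<open>G s t\<close> decreases in \<open>t\<close>, which is what allows
  \<open>dG\<close> to be a nonnegative density.\<close>

lemma Gh_deriv:
  assumes "0 < r" "r < 1"
  shows "(Gh has_real_derivative a * r powr (- b) * (1 - r) powr (- a - 1)) (at r)"
proof -
  have "(Gh has_real_derivative (1 - (a + b)) * - bint r +
      ((1 - b) * r powr (1 - b - 1) * (1 - r) powr (- a) + a * (1 - r) powr (- a - 1) * r powr (1 - b))) (at r)"
    unfolding Gh_def[abs_def] using assms
    by (auto intro!: derivative_eq_intros ib_deriv)
  also have "(1 - (a + b)) * - bint r +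
      ((1 - b) * r powr (1 - b - 1) * (1 - r) powr (- a) + a * (1 - r) powr (- a - 1) * r powr (1 - b))
     = a * r powr (- b) * (1 - r) powr (- a - 1)"
  proof -
    have 1: "(1 - r) powr (- a) = (1 - r) * (1 - r) powr (- a - 1)"
      using assms by (simp add: powr_mult_base)
    have 2: "r powr (1 - b) = r * r powr (- b)"
      using assms by (simp add: powr_mult_base)
    show ?thesis unfolding bint_def 1 2 by (simp add: algebra_simps)
  qed
  finally show ?thesis .
qed

lemma Gh_nonneg: "0 \<le> Gh r"
  using ab ib_nonneg by (auto simp: Gh_def intro!: add_nonneg_nonneg)

text \<open>The first summand bounds \<open>ib\<close>, the second bounds the factor
  \<open>r powr (1 - b)\<close> in \<open>Gh\<close>.\<close>

definition CG :: real where "CG = Beta (1 - b) (1 - a) + 1"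

lemma CG_pos: "0 < CG"
  unfolding CG_def using Beta_pos[of "1 - b" "1 - a"] a b ab by simp

lemma Gh_le:
  assumes "0 < r" "r < 1"
  shows "Gh r \<le> CG * (1 - r) powr (- a)"
proof -
  have 1: "1 \<le> (1 - r) powr (- a)"
    using assms a powr_mono'[of "-a" 0 "1 - r"] by simp
  have 2: "r powr (1 - b) \<le> 1"
    using assms a b ab powr_le1[of "1 - b" r] by simp
  have "(1 - (a + b)) * ib r \<le> 1 * Beta (1 - b) (1 - a)"
    using a b ab ib_le[of r] ib_nonneg[of r] assms by (intro mult_mono) auto
  also have "\<dots> \<le> Beta (1 - b) (1 - a) * (1 - r) powr (- a)"
    using 1 Beta_pos[of "1 - b" "1 - a"] a b ab by (simp add: mult_le_cancel_left1)
  finally have "Gh r \<le> Beta (1 - b) (1 - a) * (1 - r) powr (- a) + 1 * (1 - r) powr (- a)"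
    unfolding Gh_def using 2 by (intro add_mono mult_right_mono) auto
  then show ?thesis by (simp add: CG_def algebra_simps)
qed

definition G :: "real \<Rightarrow> real \<Rightarrow> real" where
  "G s t = (if 0 < s \<and> s < t then Gh (s / t) else 0)"

text \<open>Minus the derivative of \<open>G s t\<close> with respect to \<open>t\<close>, see
  \<open>G_deriv\<close>. Truncated powers make it jointly measurable and let it vanish for
  \<open>t \<le> s\<close>.\<close>

definition dG :: "real \<Rightarrow> real \<Rightarrow> real" where
  "dG s t = a * pw s (1 - b) * pw t (a + b - 1) * pw (t - s) (- a - 1)"

lemma G_measurable [measurable]:
  assumes [measurable]: "f \<in> borel_measurable M" "g \<in> borel_measurable M"
  shows "(\<lambda>x. G (f x) (g x)) \<in> borel_measurable M"
  unfolding G_def by measurable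

lemma dG_measurable [measurable]:
  assumes [measurable]: "f \<in> borel_measurable M" "g \<in> borel_measurable M"
  shows "(\<lambda>x. dG (f x) (g x)) \<in> borel_measurable M"
  unfolding dG_def by measurable

lemma G_nonneg: "0 \<le> G s t" by (simp add: G_def Gh_nonneg)

lemma dG_nonneg: "0 \<le> dG s t" using a by (simp add: dG_def)

lemma G_deriv:
  assumes "0 < s" "s < t"
  shows "((\<lambda>t. Gh (s / t)) has_real_derivative - dG s t) (at t)"
proof -
  have r: "0 < s / t" "s / t < 1" using assms by auto
  have "((\<lambda>t. Gh (s / t)) has_real_derivative
      (a * (s / t) powr (- b) * (1 - s / t) powr (- a - 1)) * (- s / t\<^sup>2)) (at t)"
    by (rule DERIV_chain2[where f=Gh and g="\<lambda>t. s / t", OF Gh_deriv[OF r]])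
      (use assms in \<open>auto intro!: derivative_eq_intros simp: power2_eq_square\<close>)
  also have "(a * (s / t) powr (- b) * (1 - s / t) powr (- a - 1)) * (- s / t\<^sup>2) = - dG s t"
  proof -
    have 1: "1 - s / t = (t - s) / t" using assms by (simp add: field_simps)
    have 2: "s / t\<^sup>2 = exp (ln s - 2 * ln t)"
      using assms by (simp add: exp_diff exp_double power2_eq_square)
    have "(s / t) powr (- b) * ((t - s) / t) powr (- a - 1) * (s / t\<^sup>2)
        = s powr (1 - b) * t powr (a + b - 1) * (t - s) powr (- a - 1)"
      unfolding 2 using assms
      apply (simp add: powr_def ln_div exp_add[symmetric])
      apply (simp add: algebra_simps)
      done
    from arg_cong[OF this, of "\<lambda>z. a * z"] show ?thesis
      unfolding 1 dG_def using assms by (simp add: pw_pos mult_ac)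
  qed
  finally show ?thesis .
qed

lemma nn_integral_dG:
  assumes "0 < s" "s < \<tau>" "\<tau> \<le> T"
  shows "(\<integral>\<^sup>+t\<in>{\<tau><..<T}. ennreal (dG s t) \<partial>lborel) = ennreal (G s \<tau> - G s T)"
proof -
  have "(\<integral>\<^sup>+t\<in>{\<tau><..<T}. ennreal (dG s t) \<partial>lborel) = ennreal (- Gh (s / T) - (- Gh (s / \<tau>)))"
  proof (rule nn_integral_FTC_Ioo)
    show D: "((\<lambda>t. - Gh (s / t)) has_real_derivative dG s x) (at x)" if "\<tau> < x" for x
      using DERIV_minus[OF G_deriv[of s x]] that assms by simp
    have "isCont (\<lambda>t. - Gh (s / t)) x" if "\<tau> \<le> x" for x
      using DERIV_isCont[OF DERIV_minus[OF G_deriv[of s x]]] that assms by simp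
    then show "continuous_on {\<tau>..T} (\<lambda>t. - Gh (s / t))"
      by (auto intro!: continuous_at_imp_continuous_on)
  qed (use assms in \<open>auto simp: dG_nonneg\<close>)
  then show ?thesis using assms by (simp add: G_def)
qed

lemma G_le:
  assumes "0 < s" "s < t"
  shows "G s t \<le> CG * (t powr a * (t - s) powr (- a))"
proof -
  have "1 - s / t = (t - s) / t" using assms by (simp add: field_simps)
  then have "(1 - s / t) powr (- a) = t powr a * (t - s) powr (- a)"
    using assms by (simp add: powr_divide powr_minus field_simps)
  then show ?thesis using Gh_le[of "s / t"] assms by (simp add: G_def)
qed

text \<open>The integrated form of the left Abel equation, as the inversion lemma requires it. For
  \<open>s < x\<close> both sides equal \<open>x powr (1 - (a + b)) * ib (s / x)\<close>: the left
  one by the fundamental theorem of calculus, the right one by scaling the variable with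
  \<open>x\<close>.\<close>

lemma left_primitive:
  assumes "0 < s"
  shows "(\<integral>\<^sup>+t. epw (x - t) 0 * (epw t (- (a + b)) * ennreal (G s t)) \<partial>lborel)
     = (\<integral>\<^sup>+t. epw (x - t) (- a) * (epw t (- b) * epw (t - s) 0) \<partial>lborel)"
proof (cases "s < x")
  case False
  have "epw (x - t) 0 * (epw t (- (a + b)) * ennreal (G s t)) = 0" for t
    using False by (auto simp: pw_def G_def)
  moreover have "epw (x - t) (- a) * (epw t (- b) * epw (t - s) 0) = 0" for t
    using False by (auto simp: pw_def)
  ultimately show ?thesis by (simp only:)
next
  case True
  define F where "F t = t powr (1 - (a + b)) * ib (s / t)" for t
  have "(\<integral>\<^sup>+t. epw (x - t) 0 * (epw t (- (a + b)) * ennreal (G s t)) \<partial>lborel)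
     = (\<integral>\<^sup>+t\<in>{s<..<x}. ennreal (t powr (- (a + b)) * Gh (s / t)) \<partial>lborel)"
    using assms by (intro nn_integral_cong) (auto simp: pw_def G_def indicator_def ennreal_mult')
  also have "\<dots> = ennreal (F x - F s)"
  proof (rule nn_integral_FTC_Ioo)
    show "continuous_on {s..x} F"
      unfolding F_def[abs_def] using assms
      by (intro continuous_intros continuous_on_compose2[OF ib_continuous]) auto
    fix t assume t: "s < t" "t < x"
    have D: "(F has_real_derivative ((1 - (a + b)) * t powr (1 - (a + b) - 1) * ib (s / t)
        + (- bint (s / t) * (- s / t\<^sup>2)) * t powr (1 - (a + b)))) (at t)"
      unfolding F_def[abs_def] using t assms
      by (auto intro!: derivative_eq_intros DERIV_chain2[OF ib_deriv] simp: power2_eq_square)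
    have 1: "1 - s / t = (t - s) / t" using assms t by (simp add: field_simps)
    have 2: "s / t\<^sup>2 = exp (ln s - 2 * ln t)"
      using assms t by (simp add: exp_diff exp_double power2_eq_square)
    have "(s / t) powr (- b) * ((t - s) / t) powr (- a) * (s / t\<^sup>2) * t powr (1 - (a + b))
       = t powr (- (a + b)) * ((s / t) powr (1 - b) * ((t - s) / t) powr (- a))"
      unfolding 2 using assms t
      apply (simp add: powr_def ln_div exp_add[symmetric])
      apply (simp add: algebra_simps)
      done
    then have "(1 - (a + b)) * t powr (1 - (a + b) - 1) * ib (s / t)
        + (- bint (s / t) * (- s / t\<^sup>2)) * t powr (1 - (a + b)) = t powr (- (a + b)) * Gh (s / t)"
      unfolding bint_def Gh_def 1 by (simp add: algebra_simps)
    then show "(F has_real_derivative t powr (- (a + b)) * Gh (s / t)) (at t)"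
      using D by simp
  qed (use True in \<open>auto simp: Gh_nonneg\<close>)
  \<comment> \<open>There is no contribution from the lower limit because
    \<open>ib 1 = 0\<close>.\<close>
  also have "F x - F s = x powr (1 - (a + b)) * ib (s / x)"
    using assms by (simp add: F_def ib_1)
  finally have L: "(\<integral>\<^sup>+t. epw (x - t) 0 * (epw t (- (a + b)) * ennreal (G s t)) \<partial>lborel)
     = ennreal (x powr (1 - (a + b)) * ib (s / x))" .
  have x: "0 < x" using assms True by simp
  have "(\<integral>\<^sup>+t. epw (x - t) (- a) * (epw t (- b) * epw (t - s) 0) \<partial>lborel)
      = ennreal x * (\<integral>\<^sup>+t. epw (x - x * t) (- a) * (epw (x * t) (- b) * epw (x * t - s) 0) \<partial>lborel)"
    using x by (subst nn_integral_real_affine[where c=x and t=0]) auto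
  also have "(\<lambda>t. epw (x - x * t) (- a) * (epw (x * t) (- b) * epw (x * t - s) 0))
      = (\<lambda>t. ennreal (x powr (- (a + b))) * (epw (1 - t) (- a) * (epw t (- b) * epw (t - s / x) 0)))"
  proof
    fix t
    have 1: "x - x * t = x * (1 - t)" "x * t - s = x * (t - s / x)"
      using x by (auto simp: field_simps)
    have "x powr (- (a + b)) = x powr (- a) * x powr (- b)"
      by (simp add: powr_add[symmetric])
    then show "epw (x - x * t) (- a) * (epw (x * t) (- b) * epw (x * t - s) 0)
      = ennreal (x powr (- (a + b))) * (epw (1 - t) (- a) * (epw t (- b) * epw (t - s / x) 0))"
      unfolding 1 using x by (simp only: pw_mult) (simp add: ennreal_mult' mult_ac)
  qed
  also have "(\<integral>\<^sup>+t. ennreal (x powr (- (a + b))) * (epw (1 - t) (- a) * (epw t (- b) * epw (t - s / x) 0)) \<partial>lborel)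
      = ennreal (x powr (- (a + b))) * ennreal (ib (s / x))"
    using assms True by (subst nn_integral_cmult) (auto simp: ib_eq_integral(2))
  also have "ennreal x * (ennreal (x powr (- (a + b))) * ennreal (ib (s / x)))
      = ennreal (x * x powr (- (a + b)) * ib (s / x))"
    using x by (simp add: ennreal_mult' mult.assoc)
  also have "x * x powr (- (a + b)) = x powr (1 - (a + b))"
    using x by (simp add: powr_mult_base algebra_simps)
  finally show ?thesis using L by simp
qed

lemma left_step:
  assumes s: "0 < s"
  shows "AE x in lborel. (\<integral>\<^sup>+t. epw (x - t) (a - 1) * (epw t (- (a + b)) * ennreal (G s t)) \<partial>lborel)
    = ennreal (Beta a (1 - a)) * (epw x (- b) * epw (x - s) 0)"
proof -
  \<comment> \<open>The inversion needs a finite integral and therefore a right end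
    \<open>r\<close>; the integers as right ends exhaust the line.\<close>
  have *: "AE x in lborel. x < r \<longrightarrow> (\<integral>\<^sup>+t. epw (x - t) (a - 1) * (epw t (- (a + b)) * ennreal (G s t)) \<partial>lborel)
    = ennreal (Beta a (1 - a)) * (epw x (- b) * epw (x - s) 0)" for r
  proof (rule left_abel_inversion_AE)
    show "0 < a" "a < 1" using a b ab by auto
    show "(\<integral>\<^sup>+t. epw (x - t) 0 * (epw t (- (a + b)) * ennreal (G s t)) \<partial>lborel)
     = (\<integral>\<^sup>+t. epw (x - t) (- a) * (epw t (- b) * epw (t - s) 0) \<partial>lborel)" for x
      by (rule left_primitive[OF s])
    have "(\<integral>\<^sup>+t. epw (r - t) a * (epw t (- (a + b)) * ennreal (G s t)) \<partial>lborel)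
       \<le> (\<integral>\<^sup>+t. ennreal (\<bar>r\<bar> powr a) * (epw (r - t) 0 * (epw t (- (a + b)) * ennreal (G s t))) \<partial>lborel)"
    proof (intro nn_integral_mono)
      fix t
      have "pw (r - t) a \<le> \<bar>r\<bar> powr a * pw (r - t) 0" if "0 < t"
        using that a by (auto simp: pw_def intro!: powr_mono2)
      then have "epw (r - t) a \<le> ennreal (\<bar>r\<bar> powr a) * epw (r - t) 0" if "0 < t"
        using that by (simp add: ennreal_mult'[symmetric] ennreal_leI)
      then show "epw (r - t) a * (epw t (- (a + b)) * ennreal (G s t))
        \<le> ennreal (\<bar>r\<bar> powr a) * (epw (r - t) 0 * (epw t (- (a + b)) * ennreal (G s t)))"
        by (cases "0 < t") (auto simp: mult.assoc[symmetric] pw_neg intro!: mult_right_mono)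
    qed
    also have "\<dots> = ennreal (\<bar>r\<bar> powr a) * (\<integral>\<^sup>+t. epw (r - t) 0 * (epw t (- (a + b)) * ennreal (G s t)) \<partial>lborel)"
      by (rule nn_integral_cmult) simp
    also have "\<dots> = ennreal (\<bar>r\<bar> powr a) * (\<integral>\<^sup>+t. epw (r - t) (- a) * (epw t (- b) * epw (t - s) 0) \<partial>lborel)"
      by (simp only: left_primitive[OF s])
    also have "\<dots> \<le> ennreal (\<bar>r\<bar> powr a) * (\<integral>\<^sup>+t. epw (r - t) (- a) * epw (t - 0) (- b) \<partial>lborel)"
      by (intro mult_left_mono nn_integral_mono mult_left_mono)
        (auto simp: pw_def)
    also have "\<dots> < \<infinity>"
      using nn_integral_pw_beta[of "1 - a" "1 - b" r 0] a b ab
      by (simp add: ennreal_mult_less_top ennreal_mult'[symmetric])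
    finally show "(\<integral>\<^sup>+t. epw (r - t) a * (epw t (- (a + b)) * ennreal (G s t)) \<partial>lborel) < \<infinity>" .
  qed auto
  then have "AE x in lborel. \<forall>n. x < real n \<longrightarrow> (\<integral>\<^sup>+t. epw (x - t) (a - 1) * (epw t (- (a + b)) * ennreal (G s t)) \<partial>lborel)
    = ennreal (Beta a (1 - a)) * (epw x (- b) * epw (x - s) 0)"
    unfolding AE_all_countable by (intro allI *)
  then show ?thesis
  proof eventually_elim
    case (elim x)
    obtain n where "x < real n" using reals_Archimedean2 by blast
    then show ?case using elim by blast
  qed
qed

end

text \<open>The integral is homogeneous of degree \<open>- (\<beta> + \<gamma>)\<close> in
  \<open>d\<close>. It is split at distance \<open>d\<close> from \<open>x\<close>: closer to
  \<open>x\<close> the second factor is at most \<open>d powr (- \<gamma> - 1)\<close>, farther away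
  the integrand is dominated by a power of the distance that is integrable at infinity. The two
  pieces give the two summands of the constant.\<close>

lemma nn_integral_pw_kernel_le:
  assumes "0 < d" "0 \<le> \<beta>" "\<beta> < 1" "0 \<le> \<gamma>" "0 < \<beta> + \<gamma>"
  shows "(\<integral>\<^sup>+t. epw (t - x) (- \<beta>) * epw (t - x + d) (- \<gamma> - 1) \<partial>lborel)
    \<le> ennreal ((Beta 1 (1 - \<beta>) + 1 / (\<beta> + \<gamma>)) * d powr (- (\<beta> + \<gamma>)))"
proof -
  define e where "e = \<beta> + \<gamma>"
  have e: "0 < e" using assms by (simp add: e_def)
  have "(\<integral>\<^sup>+t. epw (t - x) (- \<beta>) * epw (t - x + d) (- \<gamma> - 1) \<partial>lborel)
      = (\<integral>\<^sup>+t. epw t (- \<beta>) * epw (t + d) (- \<gamma> - 1) \<partial>lborel)"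
    by (subst nn_integral_real_affine[where c=1 and t=x]) auto
  also have "\<dots> \<le> (\<integral>\<^sup>+t. ennreal (d powr (- \<gamma> - 1)) * ennreal (pw (d - t) (1 - 1) * pw (t - 0) ((1 - \<beta>) - 1))
      + ennreal (t powr (- e - 1)) * indicator {d..} t \<partial>lborel)"
  proof (intro nn_integral_mono)
    fix t
    have 1: "pw t (- \<beta>) * pw (t + d) (- \<gamma> - 1) \<le> d powr (- \<gamma> - 1) * (pw (d - t) 0 * pw t (- \<beta>))" if "t < d"
      using that assms by (auto simp: pw_def mult.commute intro!: mult_mono powr_mono2')
    have 2: "pw t (- \<beta>) * pw (t + d) (- \<gamma> - 1) \<le> t powr (- e - 1)" if "d \<le> t"
    proof -
      have "pw t (- \<beta>) * pw (t + d) (- \<gamma> - 1) \<le> t powr (- \<beta>) * t powr (- \<gamma> - 1)"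
        using that assms by (auto simp: pw_def intro!: mult_left_mono powr_mono2')
      also have "\<dots> = t powr (- e - 1)"
        by (simp add: powr_add[symmetric] e_def algebra_simps)
      finally show ?thesis .
    qed
    show "epw t (- \<beta>) * epw (t + d) (- \<gamma> - 1)
      \<le> ennreal (d powr (- \<gamma> - 1)) * ennreal (pw (d - t) (1 - 1) * pw (t - 0) ((1 - \<beta>) - 1))
      + ennreal (t powr (- e - 1)) * indicator {d..} t"
      using 1 2 by (cases "t < d") (auto simp: ennreal_mult'[symmetric] ennreal_leI pw_neg)
  qed
  also have "\<dots> = ennreal (d powr (- \<gamma> - 1)) * ennreal (Beta 1 (1 - \<beta>) * pw (d - 0) (1 + (1 - \<beta>) - 1))
      + (\<integral>\<^sup>+t\<in>{d..}. ennreal (t powr (- e - 1)) \<partial>lborel)"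
    using assms by (subst nn_integral_add)
      (auto simp: nn_integral_cmult nn_integral_pw_beta[of 1 "1 - \<beta>" d 0, simplified])
  also have "(\<integral>\<^sup>+t\<in>{d..}. ennreal (t powr (- e - 1)) \<partial>lborel) = ennreal (0 - (- (d powr (- e)) / e))"
  proof (rule nn_integral_FTC_atLeast)
    show "((\<lambda>t. - (t powr (- e)) / e) has_real_derivative x powr (- e - 1)) (at x)" if "d \<le> x" for x
      using that assms e by (auto intro!: derivative_eq_intros)
    have "((\<lambda>t. - (t powr (- e)) / e) \<longlongrightarrow> - 0 / e) at_top"
      using e by (intro tendsto_intros tendsto_neg_powr filterlim_ident) auto
    then show "((\<lambda>t. - (t powr (- e)) / e) \<longlongrightarrow> 0) at_top" by simp
  qed auto
  also have "ennreal (d powr (- \<gamma> - 1)) * ennreal (Beta 1 (1 - \<beta>) * pw (d - 0) (1 + (1 - \<beta>) - 1)) + ennreal (0 - (- (d powr (- e)) / e))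
     = ennreal (Beta 1 (1 - \<beta>) * d powr (- e) + d powr (- e) / e)"
  proof -
    have "d powr (- \<gamma> - 1) * (Beta 1 (1 - \<beta>) * pw (d - 0) (1 + (1 - \<beta>) - 1)) = Beta 1 (1 - \<beta>) * (d powr (- \<gamma> - 1) * d powr (1 - \<beta>))"
      using assms by (simp add: pw_pos algebra_simps)
    also have "d powr (- \<gamma> - 1) * d powr (1 - \<beta>) = d powr (- e)"
      by (simp add: powr_add[symmetric] e_def algebra_simps)
    finally have "ennreal (d powr (- \<gamma> - 1) * (Beta 1 (1 - \<beta>) * pw (d - 0) (1 + (1 - \<beta>) - 1)))
       = ennreal (Beta 1 (1 - \<beta>) * d powr (- e))"
      by (rule arg_cong)
    then have "ennreal (d powr (- \<gamma> - 1)) * ennreal (Beta 1 (1 - \<beta>) * pw (d - 0) (1 + (1 - \<beta>) - 1))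
       = ennreal (Beta 1 (1 - \<beta>) * d powr (- e))"
      by (simp only: ennreal_mult'[OF powr_ge_zero])
    then show ?thesis
      using e Beta_pos[of 1 "1 - \<beta>"] assms by (simp add: ennreal_plus[symmetric] del: ennreal_plus)
  qed
  finally show ?thesis by (simp add: e_def algebra_simps)
qed

section \<open>The right Abel equation\<close>

context abel_exponents
begin

text \<open>
  Up to a constant factor, \<open>psip s - psim s\<close> is the solution on \<open>(0, 2)\<close> of the right Abel equation of order \<open>b\<close>
  with right-hand side \<open>G s\<close>. Keeping its two nonnegative parts apart makes Tonelli's theorem applicable without
  any integrability conditions.
\<close>

definition psip :: "real \<Rightarrow> real \<Rightarrow> ennreal" where
  "psip s y = indicator {s<..<2} y * (epw (2 - y) (- b) * ennreal (G s 2)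
     + (\<integral>\<^sup>+t. epw (t - y) (- b) * (indicator {..<2} t * ennreal (dG s t)) \<partial>lborel))"

definition psim :: "real \<Rightarrow> real \<Rightarrow> ennreal" where
  "psim s y = indicator {0<..<s} y *
     (\<integral>\<^sup>+t. ennreal b * epw (t - y) (- b - 1) * (indicator {s<..<2} t * ennreal (G s t)) \<partial>lborel)"

lemma indicator_pw: "indicator {s<..<t} y = epw (y - s) 0 * epw (t - y) 0"
  by (auto simp: pw_def indicator_def)

lemma psip_measurable [measurable]:
  assumes [measurable]: "f \<in> borel_measurable M" "g \<in> borel_measurable M"
  shows "(\<lambda>x. psip (f x) (g x)) \<in> borel_measurable M"
  unfolding psip_def indicator_pw by measurable

lemma psim_measurable [measurable]:
  assumes [measurable]: "f \<in> borel_measurable M" "g \<in> borel_measurable M"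
  shows "(\<lambda>x. psim (f x) (g x)) \<in> borel_measurable M"
  unfolding psim_def indicator_pw by measurable

lemma G_antimono:
  assumes "0 < s" "s < t" "t \<le> t'"
  shows "G s t' \<le> G s t"
proof -
  have "Gh (s / t') \<le> Gh (s / t)"
  proof (rule DERIV_nonpos_imp_nonincreasing[OF assms(3)])
    fix x assume "t \<le> x" "x \<le> t'"
    then show "\<exists>y. ((\<lambda>t. Gh (s / t)) has_real_derivative y) (at x) \<and> y \<le> 0"
      using G_deriv[of s x] assms dG_nonneg[of s x] by (intro exI[of _ "- dG s x"]) auto
  qed
  then show ?thesis using assms by (simp add: G_def)
qed

text \<open>Formally \<open>psip s\<close> is minus the derivative of the right-hand side after an
  integration by parts that moves the derivative onto \<open>G s\<close>: the boundary term at 2 is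
  the first summand of \<open>psip\<close>, and \<open>dG\<close> gives the second. The proof goes
  backwards, from the representation of \<open>G s t\<close> as \<open>G s 2\<close> plus an
  integral of \<open>dG s\<close>, together with the commutation of the Abel integrals of orders 1
  and \<open>1 - b\<close>.\<close>

lemma right_primitive_above:
  assumes s: "0 < s" "s < 2" and y: "s \<le> y"
  shows "(\<integral>\<^sup>+t. epw (t - y) 0 * psip s t \<partial>lborel)
    = (\<integral>\<^sup>+t. epw (t - y) (- b) * (indicator {..<2} t * ennreal (G s t)) \<partial>lborel)"
proof -
  define u where "u = (\<lambda>t. indicator {..<2} t * ennreal (dG s t))"
  have [measurable]: "u \<in> borel_measurable borel" unfolding u_def by measurable
  have 1: "epw (t - y) 0 * psip s t = epw (t - y) 0 * (epw (2 - t) (- b) * ennreal (G s 2))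
      + epw (t - y) 0 * (\<integral>\<^sup>+\<tau>. epw (\<tau> - t) (- b) * u \<tau> \<partial>lborel)" for t
  proof (cases "y < t \<and> t < 2")
    case True
    then show ?thesis using y by (simp add: psip_def u_def distrib_left)
  next
    case False
    moreover have "(\<integral>\<^sup>+\<tau>. epw (\<tau> - t) (- b) * u \<tau> \<partial>lborel) = 0" if "2 \<le> t"
    proof -
      have "epw (\<tau> - t) (- b) * u \<tau> = 0" for \<tau> using that by (auto simp: u_def pw_def indicator_def)
      then show ?thesis by (simp only:) simp
    qed
    ultimately show ?thesis by (auto simp: psip_def pw_def)
  qed
  have 2: "epw (t - y) (- b) * (indicator {..<2} t * ennreal (G s t))
      = epw (t - y) (- b) * (epw (2 - t) 0 * ennreal (G s 2))
       + epw (t - y) (- b) * (\<integral>\<^sup>+\<tau>. epw (\<tau> - t) 0 * u \<tau> \<partial>lborel)" for t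
  proof (cases "y < t \<and> t < 2")
    case True
    have "(\<integral>\<^sup>+\<tau>. epw (\<tau> - t) 0 * u \<tau> \<partial>lborel) = (\<integral>\<^sup>+\<tau>\<in>{t<..<2}. ennreal (dG s \<tau>) \<partial>lborel)"
      by (intro nn_integral_cong) (auto simp: u_def pw_zero_exp indicator_def)
    also have "\<dots> = ennreal (G s t - G s 2)"
      using True y s by (intro nn_integral_dG) auto
    finally have "(\<integral>\<^sup>+\<tau>. epw (\<tau> - t) 0 * u \<tau> \<partial>lborel) + ennreal (G s 2) = ennreal (G s t)"
      using G_antimono[of s t 2] s y True G_nonneg[of s 2] by (simp add: ennreal_plus[symmetric] del: ennreal_plus)
    then show ?thesis using True by (simp add: pw_zero_exp distrib_left[symmetric] add.commute)
  next
    case False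
    moreover have "(\<integral>\<^sup>+\<tau>. epw (\<tau> - t) 0 * u \<tau> \<partial>lborel) = 0" if "2 \<le> t"
    proof -
      have "epw (\<tau> - t) 0 * u \<tau> = 0" for \<tau> using that by (auto simp: u_def pw_def indicator_def)
      then show ?thesis by (simp only:) simp
    qed
    ultimately show ?thesis by (auto simp: pw_def)
  qed
  have b1: "b < 1" using a ab by simp
  have "(\<integral>\<^sup>+t. epw (t - y) 0 * psip s t \<partial>lborel)
      = (\<integral>\<^sup>+t. epw (t - y) 0 * (epw (2 - t) (- b) * ennreal (G s 2)) \<partial>lborel)
       + (\<integral>\<^sup>+t. epw (t - y) 0 * (\<integral>\<^sup>+\<tau>. epw (\<tau> - t) (- b) * u \<tau> \<partial>lborel) \<partial>lborel)"
    unfolding 1 by (subst nn_integral_add) auto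
  also have "(\<integral>\<^sup>+t. epw (t - y) 0 * (\<integral>\<^sup>+\<tau>. epw (\<tau> - t) (- b) * u \<tau> \<partial>lborel) \<partial>lborel)
     = (\<integral>\<^sup>+t. epw (t - y) (- b) * (\<integral>\<^sup>+\<tau>. epw (\<tau> - t) 0 * u \<tau> \<partial>lborel) \<partial>lborel)"
    using abel_semigroup[of 1 "1 - b" u y] abel_semigroup[of "1 - b" 1 u y] b1
    by (simp add: Beta_commute)
  also have "(\<integral>\<^sup>+t. epw (t - y) 0 * (epw (2 - t) (- b) * ennreal (G s 2)) \<partial>lborel)
     = (\<integral>\<^sup>+t. ennreal (pw (2 - t) ((1 - b) - 1) * pw (t - y) (1 - 1)) * ennreal (G s 2) \<partial>lborel)"
    by (simp add: ennreal_mult' mult_ac)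
  also have "\<dots> = (\<integral>\<^sup>+t. ennreal (pw (2 - t) (1 - 1) * pw (t - y) ((1 - b) - 1)) * ennreal (G s 2) \<partial>lborel)"
    using nn_integral_pw_beta[of 1 "1 - b" 2 y] nn_integral_pw_beta[of "1 - b" 1 2 y] b1
    by (subst (1 2) nn_integral_multc) (auto simp: Beta_commute)
  also have "\<dots> = (\<integral>\<^sup>+t. epw (t - y) (- b) * (epw (2 - t) 0 * ennreal (G s 2)) \<partial>lborel)"
    by (simp add: ennreal_mult' mult_ac)
  also have "\<dots> + (\<integral>\<^sup>+t. epw (t - y) (- b) * (\<integral>\<^sup>+\<tau>. epw (\<tau> - t) 0 * u \<tau> \<partial>lborel) \<partial>lborel)
     = (\<integral>\<^sup>+t. epw (t - y) (- b) * (indicator {..<2} t * ennreal (G s t)) \<partial>lborel)"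
    unfolding 2 by (subst nn_integral_add) auto
  finally show ?thesis .
qed

text \<open>Below the step the kernel is not singular on the support of \<open>G s\<close>, so the
  differentiation falls on the kernel, and minus its derivative is negative. This is why a part
  \<open>psim\<close> has to be subtracted there; in the integrated equation it stands on the other
  side.\<close>

lemma right_primitive:
  assumes s: "0 < s" "s < 2" and y: "0 \<le> y"
  shows "(\<integral>\<^sup>+t. epw (t - y) 0 * psip s t \<partial>lborel)
    = (\<integral>\<^sup>+t. epw (t - y) (- b) * (indicator {..<2} t * ennreal (G s t)) \<partial>lborel)
     + (\<integral>\<^sup>+t. epw (t - y) 0 * psim s t \<partial>lborel)"
proof (cases "s \<le> y")
  case True
  have "epw (t - y) 0 * psim s t = 0" for t
    using True by (auto simp: psim_def pw_def indicator_def)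
  then have "(\<integral>\<^sup>+t. epw (t - y) 0 * psim s t \<partial>lborel) = 0"
    by (simp only:) simp
  then show ?thesis using right_primitive_above[OF s True] by simp
next
  case False
  then have ys: "y < s" by simp
  define q where "q = (\<lambda>t. indicator {s<..<2} t * ennreal (G s t))"
  have [measurable]: "q \<in> borel_measurable borel" unfolding q_def by measurable
  have q: "indicator {..<2} t * ennreal (G s t) = q t" for t
    by (auto simp: q_def indicator_def G_def)
  have "(\<integral>\<^sup>+t. epw (t - y) 0 * psip s t \<partial>lborel) = (\<integral>\<^sup>+t. epw (t - s) 0 * psip s t \<partial>lborel)"
    using ys by (intro nn_integral_cong) (auto simp: psip_def pw_def indicator_def)
  also have "\<dots> = (\<integral>\<^sup>+t. epw (t - s) (- b) * q t \<partial>lborel)"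
    using right_primitive_above[OF s order_refl] by (simp add: q)
  \<comment> \<open>The kernel with base point \<open>s\<close> is the kernel with base point
    \<open>y\<close> plus the integral over \<open>r\<close> from \<open>y\<close> to
    \<open>s\<close> of its derivative \<open>b * (t - r) powr (- b - 1)\<close>.\<close>
  also have "\<dots> = (\<integral>\<^sup>+t. epw (t - y) (- b) * q t + (\<integral>\<^sup>+r. epw (r - y) 0 * epw (s - r) 0 * (ennreal b * epw (t - r) (- b - 1)) \<partial>lborel) * q t \<partial>lborel)"
  proof (intro nn_integral_cong)
    fix t
    show "epw (t - s) (- b) * q t = epw (t - y) (- b) * q t + (\<integral>\<^sup>+r. epw (r - y) 0 * epw (s - r) 0 * (ennreal b * epw (t - r) (- b - 1)) \<partial>lborel) * q t"
    proof (cases "s < t")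
      case True
      have "(\<integral>\<^sup>+r. epw (r - y) 0 * epw (s - r) 0 * (ennreal b * epw (t - r) (- b - 1)) \<partial>lborel)
          = (\<integral>\<^sup>+r\<in>{y<..<s}. ennreal (b * (t - r) powr (- b - 1)) \<partial>lborel)"
        using True b by (intro nn_integral_cong) (auto simp: pw_def indicator_def ennreal_mult')
      also have "\<dots> = ennreal ((t - s) powr (- b) - (t - y) powr (- b))"
        by (rule nn_integral_FTC_Ioo)
          (use True ys b in \<open>auto intro!: continuous_intros derivative_eq_intros\<close>)
      finally have I: "(\<integral>\<^sup>+r. epw (r - y) 0 * epw (s - r) 0 * (ennreal b * epw (t - r) (- b - 1)) \<partial>lborel)
        = ennreal ((t - s) powr (- b) - (t - y) powr (- b))" .
      have "(t - y) powr (- b) \<le> (t - s) powr (- b)"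
        using True ys b by (intro powr_mono2') auto
      then have "epw (t - s) (- b) = epw (t - y) (- b) + ennreal ((t - s) powr (- b) - (t - y) powr (- b))"
        using True ys by (simp add: pw_pos ennreal_plus[symmetric] del: ennreal_plus)
      then show ?thesis unfolding I by (simp add: distrib_right)
    next
      case False
      then show ?thesis by (simp add: q_def)
    qed
  qed
  also have "\<dots> = (\<integral>\<^sup>+t. epw (t - y) (- b) * q t \<partial>lborel) +
     (\<integral>\<^sup>+t. (\<integral>\<^sup>+r. epw (r - y) 0 * epw (s - r) 0 * (ennreal b * epw (t - r) (- b - 1)) * q t \<partial>lborel) \<partial>lborel)"
    by (subst nn_integral_add) (auto simp: nn_integral_multc)
  also have "(\<integral>\<^sup>+t. (\<integral>\<^sup>+r. epw (r - y) 0 * epw (s - r) 0 * (ennreal b * epw (t - r) (- b - 1)) * q t \<partial>lborel) \<partial>lborel)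
     = (\<integral>\<^sup>+r. (\<integral>\<^sup>+t. epw (r - y) 0 * epw (s - r) 0 * (ennreal b * epw (t - r) (- b - 1)) * q t \<partial>lborel) \<partial>lborel)"
    by (rule lborel_pair.Fubini') simp
  also have "\<dots> = (\<integral>\<^sup>+r. epw (r - y) 0 * psim s r \<partial>lborel)"
  proof (intro nn_integral_cong)
    fix r
    have "(\<integral>\<^sup>+t. epw (r - y) 0 * epw (s - r) 0 * (ennreal b * epw (t - r) (- b - 1)) * q t \<partial>lborel)
       = epw (r - y) 0 * epw (s - r) 0 * (\<integral>\<^sup>+t. ennreal b * epw (t - r) (- b - 1) * q t \<partial>lborel)"
      by (subst nn_integral_cmult[symmetric]) (auto simp: mult.assoc)
    also have "\<dots> = epw (r - y) 0 * psim s r"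
      unfolding psim_def q_def using y by (auto simp: pw_zero_exp indicator_def)
    finally show "(\<integral>\<^sup>+t. epw (r - y) 0 * epw (s - r) 0 * (ennreal b * epw (t - r) (- b - 1)) * q t \<partial>lborel)
       = epw (r - y) 0 * psim s r" .
  qed
  finally show ?thesis by (simp add: q)
qed

lemma powr_le_two: "0 \<le> t \<Longrightarrow> t \<le> 2 \<Longrightarrow> t powr a \<le> 2"
  using powr_mono2[of a t 2] powr_mono[of a 1 2] a b ab by simp

lemma G_le_pw:
  assumes "0 < s" "s < t" "t \<le> 2"
  shows "G s t \<le> 2 * CG * (t - s) powr (- a)"
proof -
  have "G s t \<le> CG * (t powr a * (t - s) powr (- a))" using G_le assms by simp
  also have "\<dots> \<le> CG * (2 * (t - s) powr (- a))"
    using CG_pos powr_le_two[of t] assms by (intro mult_left_mono mult_right_mono) auto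
  finally show ?thesis by simp
qed

lemma right_step:
  assumes s: "0 < s" "s < 2"
  shows "AE t in lborel. 0 < t \<longrightarrow> (\<integral>\<^sup>+y. epw (y - t) (b - 1) * psip s y \<partial>lborel)
    = ennreal (Beta b (1 - b)) * (indicator {..<2} t * ennreal (G s t))
      + (\<integral>\<^sup>+y. epw (y - t) (b - 1) * psim s y \<partial>lborel)"
proof (rule abel_inversion_AE)
  show "0 < b" "b < 1" using a b ab by auto
  show "(\<integral>\<^sup>+y. epw (y - 0) b * psip s y \<partial>lborel) < \<infinity>"
  proof -
    \<comment> \<open>The integrated equation at the step itself expresses the total mass of
      \<open>psip s\<close>; by \<open>G_le_pw\<close> it is bounded by a Beta integral with
      exponent \<open>- (a + b)\<close>, which is above -1.\<close>
    have "(\<integral>\<^sup>+y. epw (y - s) 0 * psip s y \<partial>lborel)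
       = (\<integral>\<^sup>+t. epw (t - s) (- b) * (indicator {..<2} t * ennreal (G s t)) \<partial>lborel)"
      by (rule right_primitive_above[OF s order_refl])
    also have "\<dots> \<le> (\<integral>\<^sup>+t. ennreal (2 * CG) * ennreal (pw (2 - t) (1 - 1) * pw (t - s) ((1 - (a + b)) - 1)) \<partial>lborel)"
    proof (intro nn_integral_mono)
      fix t
      show "epw (t - s) (- b) * (indicator {..<2} t * ennreal (G s t))
        \<le> ennreal (2 * CG) * ennreal (pw (2 - t) (1 - 1) * pw (t - s) ((1 - (a + b)) - 1))"
      proof (cases "s < t \<and> t < 2")
        case True
        have "(t - s) powr (- b) * G s t \<le> (t - s) powr (- b) * (2 * CG * (t - s) powr (- a))"
          using G_le_pw[of s t] True s by (intro mult_left_mono) auto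
        also have "\<dots> = 2 * CG * ((t - s) powr (- b) * (t - s) powr (- a))" by simp
        also have "(t - s) powr (- b) * (t - s) powr (- a) = (t - s) powr (1 - (a + b) - 1)"
          by (simp add: powr_add[symmetric] algebra_simps)
        finally show ?thesis using True CG_pos
          by (simp add: pw_pos ennreal_mult'[symmetric] ennreal_leI)
      next
        case False then show ?thesis by (auto simp: pw_def indicator_def)
      qed
    qed
    also have "\<dots> < \<infinity>"
      using nn_integral_pw_beta[of 1 "1 - (a + b)" 2 s] ab
      by (subst nn_integral_cmult) (auto simp: ennreal_mult_less_top)
    finally have X: "(\<integral>\<^sup>+y. epw (y - s) 0 * psip s y \<partial>lborel) < \<infinity>" .
    have "(\<integral>\<^sup>+y. epw (y - 0) b * psip s y \<partial>lborel) \<le> (\<integral>\<^sup>+y. ennreal (2 powr b) * (epw (y - s) 0 * psip s y) \<partial>lborel)"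
    proof (intro nn_integral_mono)
      fix y
      show "epw (y - 0) b * psip s y \<le> ennreal (2 powr b) * (epw (y - s) 0 * psip s y)"
      proof (cases "s < y \<and> y < 2")
        case True
        then have "pw (y - 0) b \<le> 2 powr b" using s b by (auto simp: pw_def intro!: powr_mono2)
        then show ?thesis using True by (auto simp: pw_zero_exp intro!: mult_right_mono ennreal_leI)
      next
        case False then show ?thesis by (simp add: psip_def)
      qed
    qed
    also have "\<dots> = ennreal (2 powr b) * (\<integral>\<^sup>+y. epw (y - s) 0 * psip s y \<partial>lborel)"
      by (rule nn_integral_cmult) simp
    also have "\<dots> < \<infinity>" using X by (simp add: ennreal_mult_less_top)
    finally show ?thesis .
  qed
qed (use right_primitive[OF s] in auto)

abbreviation kern :: "real \<Rightarrow> real" where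
  "kern \<equiv> rk (Beta b (1 - (a + b))) (Beta a (1 - (a + b))) (a + b)"

text \<open>The weight \<open>epw y (- a)\<close> cancels the innermost weight of the factorization.
  The right Abel equation then applies inside, the left one outside, and \<open>x powr b\<close>
  cancels the factor \<open>epw x (- b)\<close> on the right of \<open>left_step\<close>.\<close>

lemma kern_psi:
  assumes s: "0 < s" "s < 2"
  shows "AE x in lborel. 0 < x \<and> x < 2 \<longrightarrow>
    (\<integral>\<^sup>+y. ennreal (kern (x - y)) * (epw y (- a) * psip s y) \<partial>lborel)
     = (\<integral>\<^sup>+y. ennreal (kern (x - y)) * (epw y (- a) * psim s y) \<partial>lborel)
       + ennreal (Beta a (1 - a) * Beta b (1 - b)) * indicator {s<..} x"
proof -
  have pwa: "epw y a * (epw y (- a) * v) = v" if "y \<le> 0 \<Longrightarrow> v = 0" for y v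
    using that by (cases "0 < y") (auto simp: mult.assoc[symmetric] ennreal_mult'[symmetric] pw_pos powr_minus pw_neg)
  show ?thesis
    using left_step[OF s(1)]
  proof eventually_elim
    case (elim x)
    show ?case
    proof
      assume x: "0 < x \<and> x < 2"
      have fac: "(\<integral>\<^sup>+y. ennreal (kern (x - y)) * (epw y (- a) * v y) \<partial>lborel)
        = ennreal (x powr b) * (\<integral>\<^sup>+t. epw (x - t) (a - 1) * epw t (- (a + b)) *
        (\<integral>\<^sup>+y. epw (y - t) (b - 1) * v y \<partial>lborel) \<partial>lborel)"
        if [measurable]: "v \<in> borel_measurable borel" and v: "\<And>y. y \<le> 0 \<Longrightarrow> v y = 0" for v
        using sonine_factorization[OF a b ab, of x "\<lambda>y. epw y (- a) * v y"] x v by (simp add: pwa)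
      have m0: "psim s y = 0" "psip s y = 0" if "y \<le> 0" for y
        using that s by (auto simp: psim_def psip_def)
      have "(\<integral>\<^sup>+y. ennreal (kern (x - y)) * (epw y (- a) * psip s y) \<partial>lborel)
        = ennreal (x powr b) * (\<integral>\<^sup>+t. epw (x - t) (a - 1) * epw t (- (a + b)) *
        (\<integral>\<^sup>+y. epw (y - t) (b - 1) * psip s y \<partial>lborel) \<partial>lborel)"
        by (rule fac) (auto simp: m0)
      also have "(\<integral>\<^sup>+t. epw (x - t) (a - 1) * epw t (- (a + b)) *
        (\<integral>\<^sup>+y. epw (y - t) (b - 1) * psip s y \<partial>lborel) \<partial>lborel)
         = (\<integral>\<^sup>+t. ennreal (Beta b (1 - b)) * (epw (x - t) (a - 1) * (epw t (- (a + b)) * ennreal (G s t)))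
          + epw (x - t) (a - 1) * epw t (- (a + b)) * (\<integral>\<^sup>+y. epw (y - t) (b - 1) * psim s y \<partial>lborel) \<partial>lborel)"
        using right_step[OF s]
      proof (intro nn_integral_cong_AE, eventually_elim)
        case (elim t)
        then show ?case
          using x by (cases "0 < t \<and> t < x") (auto simp: pw_neg distrib_left mult_ac)
      qed
      also have "\<dots> = ennreal (Beta b (1 - b)) * (\<integral>\<^sup>+t. (epw (x - t) (a - 1) * (epw t (- (a + b)) * ennreal (G s t))) \<partial>lborel)
         + (\<integral>\<^sup>+t. epw (x - t) (a - 1) * epw t (- (a + b)) * (\<integral>\<^sup>+y. epw (y - t) (b - 1) * psim s y \<partial>lborel) \<partial>lborel)"
        by (subst nn_integral_add) (auto simp: nn_integral_cmult)
      also have "(\<integral>\<^sup>+t. (epw (x - t) (a - 1) * (epw t (- (a + b)) * ennreal (G s t))) \<partial>lborel)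
         = ennreal (Beta a (1 - a)) * (epw x (- b) * epw (x - s) 0)" by (rule elim)
      also have "ennreal (x powr b) * (ennreal (Beta b (1 - b)) * (ennreal (Beta a (1 - a)) * (epw x (- b) * epw (x - s) 0))
         + (\<integral>\<^sup>+t. epw (x - t) (a - 1) * epw t (- (a + b)) * (\<integral>\<^sup>+y. epw (y - t) (b - 1) * psim s y \<partial>lborel) \<partial>lborel))
       = ennreal (x powr b * x powr (- b)) * (ennreal (Beta b (1 - b)) * ennreal (Beta a (1 - a))) * epw (x - s) 0
         + (\<integral>\<^sup>+y. ennreal (kern (x - y)) * (epw y (- a) * psim s y) \<partial>lborel)"
        using x by (subst fac) (auto simp: m0 distrib_left pw_pos ennreal_mult' mult_ac)
      also have "x powr b * x powr (- b) = 1" using x by (simp add: powr_minus)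
      also have "ennreal (Beta b (1 - b)) * ennreal (Beta a (1 - a)) = ennreal (Beta a (1 - a) * Beta b (1 - b))"
        using Beta_pos[of b "1 - b"] a b ab by (simp add: ennreal_mult'' mult.commute)
      finally show "(\<integral>\<^sup>+y. ennreal (kern (x - y)) * (epw y (- a) * psip s y) \<partial>lborel)
     = (\<integral>\<^sup>+y. ennreal (kern (x - y)) * (epw y (- a) * psim s y) \<partial>lborel)
       + ennreal (Beta a (1 - a) * Beta b (1 - b)) * indicator {s<..} x"
        by (simp add: add.commute pw_zero_exp indicator_def)
    qed
  qed
qed

end

section \<open>L^1 bounds for the kernel, majorants, and signed step solutions\<close>

lemma nn_integral_rk_le:
  assumes "0 \<le> A" "0 \<le> B" "0 < \<sigma>" "c < y" "y < d"
  shows "(\<integral>\<^sup>+x. indicator {c<..<d} x * ennreal (rk A B \<sigma> (x - y)) \<partial>lborel)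
      \<le> ennreal ((A + B) * (Beta 1 \<sigma> * (d - c) powr \<sigma>))"
    "(\<integral>\<^sup>+x. indicator {c<..<d} x * ennreal (rk A B \<sigma> (y - x)) \<partial>lborel)
      \<le> ennreal ((A + B) * (Beta 1 \<sigma> * (d - c) powr \<sigma>))"
proof -
  have *: "(\<integral>\<^sup>+x. indicator {c<..<d} x * ennreal (rk A B \<sigma> (x - y)) \<partial>lborel)
      \<le> ennreal ((A + B) * (Beta 1 \<sigma> * (d - c) powr \<sigma>))"
    if AB: "0 \<le> A" "0 \<le> B" for A B
  proof -
    have "(\<integral>\<^sup>+x. indicator {c<..<d} x * ennreal (rk A B \<sigma> (x - y)) \<partial>lborel)
       \<le> (\<integral>\<^sup>+x. ennreal A * ennreal (pw (d - x) (1 - 1) * pw (x - y) (\<sigma> - 1)) +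
              ennreal B * ennreal (pw (y - x) (\<sigma> - 1) * pw (x - c) (1 - 1)) \<partial>lborel)"
      using AB by (intro nn_integral_mono)
        (auto simp: rk_def pw_def indicator_def ennreal_mult'[symmetric])
    also have "\<dots> = ennreal A * ennreal (Beta 1 \<sigma> * pw (d - y) (1 + \<sigma> - 1)) + ennreal B * ennreal (Beta \<sigma> 1 * pw (y - c) (\<sigma> + 1 - 1))"
      using assms(3) nn_integral_pw_beta[of 1 \<sigma> d y] nn_integral_pw_beta[of \<sigma> 1 y c]
      by (subst nn_integral_add) (auto simp: nn_integral_cmult)
    also have "\<dots> = ennreal (A * (Beta 1 \<sigma> * pw (d - y) \<sigma>) + B * (Beta 1 \<sigma> * pw (y - c) \<sigma>))"
      using AB Beta_pos[of 1 \<sigma>] assms(3)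
      by (simp add: Beta_commute ennreal_mult'[symmetric] ennreal_plus[symmetric] del: ennreal_plus)
    also have "\<dots> \<le> ennreal (A * (Beta 1 \<sigma> * (d - c) powr \<sigma>) + B * (Beta 1 \<sigma> * (d - c) powr \<sigma>))"
      using AB Beta_pos[of 1 \<sigma>] assms(3-)
      by (intro ennreal_leI add_mono mult_left_mono) (auto simp: pw_def intro!: powr_mono2)
    finally show ?thesis by (simp add: algebra_simps)
  qed
  show "(\<integral>\<^sup>+x. indicator {c<..<d} x * ennreal (rk A B \<sigma> (x - y)) \<partial>lborel)
      \<le> ennreal ((A + B) * (Beta 1 \<sigma> * (d - c) powr \<sigma>))"
    by (rule *[OF assms(1,2)])
  have "rk A B \<sigma> (y - x) = rk B A \<sigma> (x - y)" for x by (simp add: rk_def)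
  then show "(\<integral>\<^sup>+x. indicator {c<..<d} x * ennreal (rk A B \<sigma> (y - x)) \<partial>lborel)
      \<le> ennreal ((A + B) * (Beta 1 \<sigma> * (d - c) powr \<sigma>))"
    using *[OF assms(2,1)] by (simp add: add.commute)
qed

text \<open>Young's inequality on a bounded interval: integrating over \<open>x\<close> first, each
  translate of the kernel contributes at most the mass estimated in
  \<open>nn_integral_rk_le\<close>.\<close>

lemma nn_integral_rk_L1:
  fixes v :: "real \<Rightarrow> ennreal"
  assumes AB: "0 \<le> A" "0 \<le> B" "0 < \<sigma>"
    and [measurable]: "v \<in> borel_measurable borel" and v: "\<And>y. y \<notin> {c<..<d} \<Longrightarrow> v y = 0"
  shows "(\<integral>\<^sup>+x. indicator {c<..<d} x * (\<integral>\<^sup>+y. ennreal (rk A B \<sigma> (x - y)) * v y \<partial>lborel) \<partial>lborel)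
     \<le> ennreal ((A + B) * (Beta 1 \<sigma> * (d - c) powr \<sigma>)) * (\<integral>\<^sup>+y. v y \<partial>lborel)"
proof -
  have "(\<integral>\<^sup>+x. indicator {c<..<d} x * (\<integral>\<^sup>+y. ennreal (rk A B \<sigma> (x - y)) * v y \<partial>lborel) \<partial>lborel)
     = (\<integral>\<^sup>+x. (\<integral>\<^sup>+y. indicator {c<..<d} x * (ennreal (rk A B \<sigma> (x - y)) * v y) \<partial>lborel) \<partial>lborel)"
    by (simp add: nn_integral_cmult)
  also have "\<dots> = (\<integral>\<^sup>+y. (\<integral>\<^sup>+x. indicator {c<..<d} x * (ennreal (rk A B \<sigma> (x - y)) * v y) \<partial>lborel) \<partial>lborel)"
    by (rule lborel_pair.Fubini') (simp add: abel_exponents.indicator_pw)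
  also have "\<dots> \<le> (\<integral>\<^sup>+y. ennreal ((A + B) * (Beta 1 \<sigma> * (d - c) powr \<sigma>)) * v y \<partial>lborel)"
  proof (intro nn_integral_mono)
    fix y
    have "(\<integral>\<^sup>+x. indicator {c<..<d} x * (ennreal (rk A B \<sigma> (x - y)) * v y) \<partial>lborel)
       = (\<integral>\<^sup>+x. indicator {c<..<d} x * ennreal (rk A B \<sigma> (x - y)) \<partial>lborel) * v y"
      by (subst nn_integral_multc[symmetric]) (auto simp: mult.assoc)
    also have "\<dots> \<le> ennreal ((A + B) * (Beta 1 \<sigma> * (d - c) powr \<sigma>)) * v y"
      using nn_integral_rk_le(1)[OF AB, of c y d] v[of y]
      by (cases "y \<in> {c<..<d}") (auto intro!: mult_right_mono)
    finally show "(\<integral>\<^sup>+x. indicator {c<..<d} x * (ennreal (rk A B \<sigma> (x - y)) * v y) \<partial>lborel)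
       \<le> ennreal ((A + B) * (Beta 1 \<sigma> * (d - c) powr \<sigma>)) * v y" .
  qed
  also have "\<dots> = ennreal ((A + B) * (Beta 1 \<sigma> * (d - c) powr \<sigma>)) * (\<integral>\<^sup>+y. v y \<partial>lborel)"
    by (simp add: nn_integral_cmult)
  finally show ?thesis .
qed

lemma nn_integral_rk_AE_finite:
  fixes v :: "real \<Rightarrow> ennreal"
  assumes AB: "0 \<le> A" "0 \<le> B" "0 < \<sigma>"
    and [measurable]: "v \<in> borel_measurable borel" and v: "\<And>y. y \<notin> {c<..<d} \<Longrightarrow> v y = 0"
    and fin: "(\<integral>\<^sup>+y. v y \<partial>lborel) < \<infinity>"
  shows "AE x in lborel. x \<in> {c<..<d} \<longrightarrow> (\<integral>\<^sup>+y. ennreal (rk A B \<sigma> (x - y)) * v y \<partial>lborel) < \<infinity>"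
proof -
  have "(\<integral>\<^sup>+x. indicator {c<..<d} x * (\<integral>\<^sup>+y. ennreal (rk A B \<sigma> (x - y)) * v y \<partial>lborel) \<partial>lborel) < \<infinity>"
  proof (rule order_le_less_trans)
    show "(\<integral>\<^sup>+x. indicator {c<..<d} x * (\<integral>\<^sup>+y. ennreal (rk A B \<sigma> (x - y)) * v y \<partial>lborel) \<partial>lborel)
      \<le> ennreal ((A + B) * (Beta 1 \<sigma> * (d - c) powr \<sigma>)) * (\<integral>\<^sup>+y. v y \<partial>lborel)"
      using v by (intro nn_integral_rk_L1 AB) auto
  qed (use fin in \<open>simp add: ennreal_mult_less_top\<close>)
  then have "AE x in lborel. indicator {c<..<d} x * (\<integral>\<^sup>+y. ennreal (rk A B \<sigma> (x - y)) * v y \<partial>lborel) \<noteq> \<infinity>"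
    by (intro nn_integral_PInf_AE) auto
  then show ?thesis
    by eventually_elim (auto simp: less_top)
qed

text \<open>A step solution may be singular at both end points and at the step; the last summand is
  the power \<open>- (a + b)\<close> of the distance between \<open>y\<close> and \<open>s\<close>.
  The factor \<open>(2 - s) powr (- a)\<close> records how fast the singularity at 2 is amplified
  when the step approaches that end.\<close>

definition step_maj :: "real \<Rightarrow> real \<Rightarrow> real \<Rightarrow> real \<Rightarrow> real" where
  "step_maj a b s y = indicator {0<..<2} y *
    (y powr (- a) * ((2 - y) powr (- b) * (2 - s) powr (- a) + rk 1 1 (1 - (a + b)) (y - s)))"

lemma step_maj_measurable [measurable]:
  assumes [measurable]: "f \<in> borel_measurable M" "g \<in> borel_measurable M"
  shows "(\<lambda>x. step_maj a b (f x) (g x)) \<in> borel_measurable M"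
  unfolding step_maj_def by measurable

lemma step_maj_nonneg: "0 \<le> step_maj a b s y"
  by (simp add: step_maj_def rk_nonneg)

lemma nn_integral_edge_weight:
  assumes "0 \<le> a" "a < 1" "0 \<le> b" "b < 1"
  shows "(\<integral>\<^sup>+y. ennreal (indicator {0<..<2} y * (y powr (- a) * (2 - y) powr (- b))) \<partial>lborel) < \<infinity>"
proof -
  have "(\<integral>\<^sup>+y. ennreal (indicator {0<..<2} y * (y powr (- a) * (2 - y) powr (- b))) \<partial>lborel)
    = (\<integral>\<^sup>+y. ennreal (pw (2 - y) ((1 - b) - 1) * pw (y - 0) ((1 - a) - 1)) \<partial>lborel)"
    by (intro nn_integral_cong) (auto simp: pw_def indicator_def)
  also have "\<dots> < \<infinity>" using assms by (subst nn_integral_pw_beta) auto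
  finally show ?thesis .
qed

lemma step_maj_integrable:
  assumes "0 \<le> a" "0 \<le> b" "a + b < 1" "0 < s" "s < 2"
  shows "integrable lborel (step_maj a b s)"
proof -
  let ?w = "\<lambda>b y. indicator {0<..<2} y * (y powr (- a) * (2 - y) powr (- b)) :: real"
  have w: "integrable lborel (?w b)" if "0 \<le> b" "b < 1" for b
    using nn_integral_edge_weight[of a b] assms that by (intro integrableI_nonneg) auto
  have r: "integrable lborel (\<lambda>y. indicator {0<..<2} y * rk 1 1 (1 - (a + b)) (y - s))"
  proof (rule integrableI_nonneg)
    show "(\<integral>\<^sup>+ y. ennreal (indicator {0<..<2} y * rk 1 1 (1 - (a + b)) (y - s)) \<partial>lborel) < \<infinity>"
      using order_le_less_trans[OF nn_integral_rk_le(1)[of 1 1 "1 - (a + b)" 0 s 2] ennreal_less_top] assms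
      by (simp add: ennreal_mult' ennreal_indicator)
  qed (auto simp: rk_nonneg)
  have "integrable lborel (\<lambda>y. (2 - s) powr (- a) * ?w b y +
      ((s / 2) powr (- (a + b)) * ?w 0 y + (s / 2) powr (- a) * (indicator {0<..<2} y * rk 1 1 (1 - (a + b)) (y - s))))"
    using assms by (intro Bochner_Integration.integrable_add integrable_mult_right w r) auto
  then show ?thesis
  proof (rule Bochner_Integration.integrable_bound)
    show "AE y in lborel. norm (step_maj a b s y) \<le> norm ((2 - s) powr (- a) * ?w b y +
      ((s / 2) powr (- (a + b)) * ?w 0 y + (s / 2) powr (- a) * (indicator {0<..<2} y * rk 1 1 (1 - (a + b)) (y - s))))"
    proof (intro AE_I2)
      fix y
      show "norm (step_maj a b s y) \<le> norm ((2 - s) powr (- a) * ?w b y +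
      ((s / 2) powr (- (a + b)) * ?w 0 y + (s / 2) powr (- a) * (indicator {0<..<2} y * rk 1 1 (1 - (a + b)) (y - s))))"
      proof (cases "0 < y \<and> y < 2")
        case True
        \<comment> \<open>The singularities at 0 and at \<open>s\<close> are separated at
          \<open>s / 2\<close>: to the left of it the kernel is bounded, to the right of it the
          weight is.\<close>
        have "y powr (- a) * rk 1 1 (1 - (a + b)) (y - s) \<le>
            (s / 2) powr (- (a + b)) * y powr (- a) + (s / 2) powr (- a) * rk 1 1 (1 - (a + b)) (y - s)"
        proof (cases "y < s / 2")
          case True
          then have "rk 1 1 (1 - (a + b)) (y - s) \<le> (s / 2) powr (- (a + b))"
            using assms by (auto simp: rk_def pw_def intro!: powr_mono2')
          then have "y powr (- a) * rk 1 1 (1 - (a + b)) (y - s) \<le> y powr (- a) * (s / 2) powr (- (a + b))"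
            by (intro mult_left_mono) auto
          then show ?thesis using rk_nonneg[of 1 1 "1 - (a + b)" "y - s"] by (simp add: mult.commute add_increasing2)
        next
          case False
          then have "y powr (- a) * rk 1 1 (1 - (a + b)) (y - s) \<le> (s / 2) powr (- a) * rk 1 1 (1 - (a + b)) (y - s)"
            using assms by (intro mult_right_mono powr_mono2' rk_nonneg) auto
          then show ?thesis by (simp add: add_increasing)
        qed
        then show ?thesis using True
          by (simp add: step_maj_def rk_nonneg algebra_simps abs_of_nonneg)
      qed (simp add: step_maj_def)
    qed
  qed simp
qed

text \<open>Joint measurability and a bound with one constant for all steps are included because the
  solutions are going to be integrated over \<open>s\<close>.\<close>

definition step_solution :: "real \<Rightarrow> real \<Rightarrow> real \<Rightarrow> real \<Rightarrow> (real \<Rightarrow> real \<Rightarrow> real) \<Rightarrow> bool" where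
  "step_solution a b A B \<phi> \<longleftrightarrow> case_prod \<phi> \<in> borel_measurable (borel \<Otimes>\<^sub>M borel) \<and>
    (\<exists>C. \<forall>s\<in>{0<..<2}. \<forall>y. \<bar>\<phi> s y\<bar> \<le> C * step_maj a b s y) \<and>
    (\<forall>s\<in>{0<..<2}. AE x in lborel. x \<in> {0<..<2} \<longrightarrow>
       (\<integral>y. rk A B (a + b) (x - y) * \<phi> s y \<partial>lborel) = indicator {s<..} x)"

text \<open>The equation between \<open>p\<close> and \<open>m\<close> is stated without
  subtraction, in extended nonnegative reals. The integrable majorant makes both integrals finite
  for almost every \<open>x\<close>, and only there is the difference formed.\<close>

lemma step_solutionI:
  assumes ab: "0 \<le> a" "0 \<le> b" "a + b < 1" "0 < a + b" and AB: "0 \<le> A" "0 \<le> B"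
    and [measurable]: "case_prod p \<in> borel_measurable (borel \<Otimes>\<^sub>M borel)" "case_prod m \<in> borel_measurable (borel \<Otimes>\<^sub>M borel)"
    and nonneg: "\<And>s y. 0 \<le> p s y" "\<And>s y. 0 \<le> m s y" and C: "0 \<le> C"
    and p: "\<And>s y. 0 < s \<Longrightarrow> s < 2 \<Longrightarrow> p s y \<le> C * step_maj a b s y"
    and m: "\<And>s y. 0 < s \<Longrightarrow> s < 2 \<Longrightarrow> m s y \<le> C * step_maj a b s y"
    and eq: "\<And>s. 0 < s \<Longrightarrow> s < 2 \<Longrightarrow> AE x in lborel. x \<in> {0<..<2} \<longrightarrow>
       (\<integral>\<^sup>+y. ennreal (rk A B (a + b) (x - y)) * ennreal (p s y) \<partial>lborel)
      = (\<integral>\<^sup>+y. ennreal (rk A B (a + b) (x - y)) * ennreal (m s y) \<partial>lborel) + indicator {s<..} x"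
  shows "step_solution a b A B (\<lambda>s y. p s y - m s y)"
  unfolding step_solution_def
proof (intro conjI exI[of _ C] ballI allI)
  fix s y :: real assume s: "s \<in> {0<..<2}"
  show "\<bar>p s y - m s y\<bar> \<le> C * step_maj a b s y"
    using p[of s y] m[of s y] nonneg[of s y] s by auto
next
  fix s :: real assume s: "s \<in> {0<..<2}"
  have [measurable]: "p s \<in> borel_measurable borel" "m s \<in> borel_measurable borel"
    using measurable_compose_Pair1[of s borel "case_prod p" borel borel]
      measurable_compose_Pair1[of s borel "case_prod m" borel borel] by auto
  have fin: "AE x in lborel. x \<in> {0<..<2} \<longrightarrow> (\<integral>\<^sup>+y. ennreal (rk A B (a + b) (x - y)) * ennreal (q y) \<partial>lborel) < \<infinity>"
    if [measurable]: "q \<in> borel_measurable borel" and q: "\<And>y. q y \<le> C * step_maj a b s y" "\<And>y. 0 \<le> q y" for q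
  proof (rule nn_integral_rk_AE_finite)
    show "ennreal (q y) = 0" if "y \<notin> {0<..<2}" for y
      using q[of y] that by (simp add: step_maj_def)
    have "(\<integral>\<^sup>+y. ennreal (q y) \<partial>lborel) \<le> (\<integral>\<^sup>+y. ennreal C * ennreal (step_maj a b s y) \<partial>lborel)"
      using q(1) C step_maj_nonneg by (intro nn_integral_mono) (simp add: ennreal_mult'[symmetric] ennreal_leI)
    also have "\<dots> = ennreal C * (\<integral>\<^sup>+y. ennreal (step_maj a b s y) \<partial>lborel)"
      by (rule nn_integral_cmult) simp
    also have "\<dots> < \<infinity>"
      using step_maj_integrable[OF ab(1-3), of s] s step_maj_nonneg
      by (simp add: ennreal_mult_less_top integrable_iff_bounded abs_of_nonneg)
    finally show "(\<integral>\<^sup>+y. ennreal (q y) \<partial>lborel) < \<infinity>" .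
  qed (use ab AB in auto)
  have "AE x in lborel. x \<in> {0<..<2} \<longrightarrow> (\<integral>\<^sup>+y. ennreal (rk A B (a + b) (x - y)) * ennreal (p s y) \<partial>lborel) < \<infinity>"
    by (rule fin) (use p[of s] s nonneg in auto)
  moreover have "AE x in lborel. x \<in> {0<..<2} \<longrightarrow> (\<integral>\<^sup>+y. ennreal (rk A B (a + b) (x - y)) * ennreal (m s y) \<partial>lborel) < \<infinity>"
    by (rule fin) (use m[of s] s nonneg in auto)
  moreover have "AE x in lborel. x \<in> {0<..<2} \<longrightarrow>
       (\<integral>\<^sup>+y. ennreal (rk A B (a + b) (x - y)) * ennreal (p s y) \<partial>lborel)
      = (\<integral>\<^sup>+y. ennreal (rk A B (a + b) (x - y)) * ennreal (m s y) \<partial>lborel) + indicator {s<..} x"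
    using eq[of s] s by simp
  ultimately
  show "AE x in lborel. x \<in> {0<..<2} \<longrightarrow> (\<integral>y. rk A B (a + b) (x - y) * (p s y - m s y) \<partial>lborel) = indicator {s<..} x"
  proof eventually_elim
    case (elim x)
    show ?case
    proof
      assume x: "x \<in> {0<..<2}"
      let ?k = "rk A B (a + b)"
      have k: "0 \<le> ?k r" for r using AB by (rule rk_nonneg)
      have ip: "integrable lborel (\<lambda>y. ?k (x - y) * p s y)"
        using elim x k nonneg by (intro integrableI_nonneg) (auto simp: ennreal_mult')
      have im: "integrable lborel (\<lambda>y. ?k (x - y) * m s y)"
        using elim x k nonneg by (intro integrableI_nonneg) (auto simp: ennreal_mult')
      have "ennreal (\<integral>y. ?k (x - y) * p s y \<partial>lborel) = ennreal (\<integral>y. ?k (x - y) * m s y \<partial>lborel) + ennreal (indicator {s<..} x)"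
        using elim x k nonneg ip im by (simp add: nn_integral_eq_integral[symmetric] ennreal_mult' ennreal_indicator)
      then have "(\<integral>y. ?k (x - y) * p s y \<partial>lborel) = (\<integral>y. ?k (x - y) * m s y \<partial>lborel) + indicator {s<..} x"
        using k nonneg by (simp add: ennreal_plus[symmetric] del: ennreal_plus)
      then show "(\<integral>y. ?k (x - y) * (p s y - m s y) \<partial>lborel) = indicator {s<..} x"
        using ip im by (simp add: right_diff_distrib)
    qed
  qed
qed simp

text \<open>The weight is the shape of the end point singularities of a superposition of step
  solutions with bounded density, see \<open>V_bounded\<close>. Boundedness of its image makes the
  energy of such superpositions absolutely convergent.\<close>

definition bounded_image :: "real \<Rightarrow> real \<Rightarrow> real \<Rightarrow> real \<Rightarrow> bool" where
  "bounded_image a b A B \<longleftrightarrow> (\<exists>C. \<forall>x\<in>{0<..<2}. (\<integral>\<^sup>+y. ennreal (rk A B (a + b) (x - y)) *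
      ennreal (indicator {0<..<2} y * (y powr (- a) * (2 - y) powr (- b))) \<partial>lborel) \<le> ennreal C)"

lemma rk_scale: "rk (K * A) (K * B) \<sigma> r = K * rk A B \<sigma> r"
  by (simp add: rk_def algebra_simps)

section \<open>Step solutions for two positive exponents\<close>

context abel_exponents
begin

text \<open>In the first summand of \<open>psip\<close>, the value \<open>G s 2\<close> is at most
  of the size of \<open>(2 - s) powr (- a)\<close>. In the second,
  \<open>s powr (1 - b) * t powr (a + b - 1) \<le> t powr a \<le> 2\<close> reduces
  \<open>dG s t\<close> to a power of \<open>t - s\<close>, and the kernel estimate applies with
  \<open>d = y - s\<close>.\<close>

lemma psip_le:
  assumes "0 < s" "s < y" "y < 2"
  shows "psip s y \<le> ennreal ((2 * CG + 2 * a * (Beta 1 (1 - b) + 1 / (a + b))) *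
     ((2 - y) powr (- b) * (2 - s) powr (- a) + rk 1 1 (1 - (a + b)) (y - s)))"
proof -
  have B: "0 < Beta 1 (1 - b)" using a b ab by (intro Beta_pos) auto
  have r: "rk 1 1 (1 - (a + b)) (y - s) = (y - s) powr (- (b + a))"
    using assms by (simp add: rk_def pw_def add.commute)
  have 1: "(2 - y) powr (- b) * G s 2 \<le> (2 - y) powr (- b) * (2 * CG * (2 - s) powr (- a))"
    using assms by (intro mult_left_mono G_le_pw) auto
  have "(\<integral>\<^sup>+t. epw (t - y) (- b) * (indicator {..<2} t * ennreal (dG s t)) \<partial>lborel)
     \<le> (\<integral>\<^sup>+t. ennreal (2 * a) * (epw (t - y) (- b) * epw (t - y + (y - s)) (- a - 1)) \<partial>lborel)"
  proof (intro nn_integral_mono)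
    fix t
    show "epw (t - y) (- b) * (indicator {..<2} t * ennreal (dG s t))
       \<le> ennreal (2 * a) * (epw (t - y) (- b) * epw (t - y + (y - s)) (- a - 1))"
    proof (cases "y < t \<and> t < 2")
      case True
      have "s powr (1 - b) * t powr (a + b - 1) \<le> t powr (1 - b) * t powr (a + b - 1)"
        using assms True a b ab by (intro mult_right_mono powr_mono2) auto
      also have "\<dots> = t powr a" by (simp add: powr_add[symmetric])
      also have "\<dots> \<le> 2" using powr_le_two[of t] assms True by simp
      finally have "a * (s powr (1 - b) * t powr (a + b - 1)) * (t - s) powr (- a - 1) \<le> a * 2 * (t - s) powr (- a - 1)"
        using a by (intro mult_right_mono mult_left_mono) auto
      then have "dG s t \<le> 2 * a * (t - s) powr (- a - 1)"
        using assms True by (simp add: dG_def pw_pos mult.assoc)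
      then have "(t - y) powr (- b) * dG s t \<le> (t - y) powr (- b) * (2 * a * (t - s) powr (- a - 1))"
        by (intro mult_left_mono) auto
      moreover have "epw (t - y) (- b) * (indicator {..<2} t * ennreal (dG s t)) = ennreal ((t - y) powr (- b) * dG s t)"
        using True by (simp add: pw_pos ennreal_mult')
      moreover have "ennreal (2 * a) * (epw (t - y) (- b) * epw (t - y + (y - s)) (- a - 1))
         = ennreal ((t - y) powr (- b) * (2 * a * (t - s) powr (- a - 1)))"
        using True assms a by (simp add: pw_pos ennreal_mult'[symmetric] mult_ac)
      ultimately show ?thesis by (simp only: ennreal_leI)
    qed (auto simp: pw_neg)
  qed
  also have "\<dots> = ennreal (2 * a) * (\<integral>\<^sup>+t. (epw (t - y) (- b) * epw (t - y + (y - s)) (- a - 1)) \<partial>lborel)"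
    by (rule nn_integral_cmult) simp
  also have "\<dots> \<le> ennreal (2 * a) * ennreal ((Beta 1 (1 - b) + 1 / (b + a)) * (y - s) powr (- (b + a)))"
    using assms a b ab by (intro mult_left_mono nn_integral_pw_kernel_le) auto
  finally have 2: "(\<integral>\<^sup>+t. epw (t - y) (- b) * (indicator {..<2} t * ennreal (dG s t)) \<partial>lborel)
     \<le> ennreal (2 * a * ((Beta 1 (1 - b) + 1 / (b + a)) * (y - s) powr (- (b + a))))"
    using a by (simp add: ennreal_mult'[symmetric])
  have "psip s y \<le> ennreal ((2 - y) powr (- b) * (2 * CG * (2 - s) powr (- a))
     + 2 * a * ((Beta 1 (1 - b) + 1 / (b + a)) * (y - s) powr (- (b + a))))"
    unfolding psip_def using assms 1 2 a b CG_pos B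
    by (subst ennreal_plus) (auto simp: pw_pos ennreal_mult'[symmetric] intro!: add_mono ennreal_leI)
  also have "\<dots> \<le> ennreal ((2 * CG + 2 * a * (Beta 1 (1 - b) + 1 / (a + b))) *
     ((2 - y) powr (- b) * (2 - s) powr (- a) + rk 1 1 (1 - (a + b)) (y - s)))"
  proof (rule ennreal_leI)
    have "0 \<le> 2 * a * (Beta 1 (1 - b) + 1 / (b + a)) * ((2 - y) powr (- b) * (2 - s) powr (- a)) + 2 * CG * (y - s) powr (- (b + a))"
      using a b B CG_pos by simp
    then show "(2 - y) powr (- b) * (2 * CG * (2 - s) powr (- a))
     + 2 * a * ((Beta 1 (1 - b) + 1 / (b + a)) * (y - s) powr (- (b + a))) \<le> (2 * CG + 2 * a * (Beta 1 (1 - b) + 1 / (a + b))) *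
     ((2 - y) powr (- b) * (2 - s) powr (- a) + rk 1 1 (1 - (a + b)) (y - s))"
      unfolding r by (simp add: algebra_simps)
  qed
  finally show ?thesis .
qed

text \<open>The kernel estimate is used once more, now with base point \<open>s\<close>, distance
  \<open>d = s - y\<close> and the exponents in exchanged roles.\<close>

lemma psim_le:
  assumes "0 < y" "y < s" "s < 2"
  shows "psim s y \<le> ennreal (2 * CG * b * (Beta 1 (1 - a) + 1 / (a + b)) * rk 1 1 (1 - (a + b)) (y - s))"
proof -
  have r: "rk 1 1 (1 - (a + b)) (y - s) = (s - y) powr (- (a + b))"
    using assms by (simp add: rk_def pw_def add.commute)
  have "psim s y \<le> (\<integral>\<^sup>+t. ennreal (2 * CG * b) * (epw (t - s) (- a) * epw (t - s + (s - y)) (- b - 1)) \<partial>lborel)"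
    unfolding psim_def using assms
  proof (simp, intro nn_integral_mono)
    fix t
    show "ennreal b * epw (t - y) (- b - 1) * (indicator {s<..<2} t * ennreal (G s t))
       \<le> ennreal (2 * CG * b) * (epw (t - s) (- a) * epw (t - y) (- b - 1))"
    proof (cases "s < t \<and> t < 2")
      case True
      then have "b * (t - y) powr (- b - 1) * G s t \<le> b * (t - y) powr (- b - 1) * (2 * CG * (t - s) powr (- a))"
        using assms b by (intro mult_left_mono G_le_pw) auto
      moreover have "ennreal b * epw (t - y) (- b - 1) * (indicator {s<..<2} t * ennreal (G s t))
         = ennreal (b * (t - y) powr (- b - 1) * G s t)"
        using True assms b by (simp add: pw_pos ennreal_mult')
      moreover have "ennreal (2 * CG * b) * (epw (t - s) (- a) * epw (t - y) (- b - 1))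
         = ennreal (b * (t - y) powr (- b - 1) * (2 * CG * (t - s) powr (- a)))"
        using True assms b CG_pos by (simp add: pw_pos ennreal_mult'[symmetric] mult_ac)
      ultimately show ?thesis by (simp only: ennreal_leI)
    qed auto
  qed
  also have "\<dots> = ennreal (2 * CG * b) * (\<integral>\<^sup>+t. (epw (t - s) (- a) * epw (t - s + (s - y)) (- b - 1)) \<partial>lborel)"
    by (rule nn_integral_cmult) simp
  also have "\<dots> \<le> ennreal (2 * CG * b) * ennreal ((Beta 1 (1 - a) + 1 / (a + b)) * (s - y) powr (- (a + b)))"
    using assms a b ab by (intro mult_left_mono nn_integral_pw_kernel_le) auto
  finally show ?thesis
    unfolding r using CG_pos b by (simp add: ennreal_mult'[symmetric] mult.assoc)
qed

lemma step_solution_interior: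
  assumes K: "0 < K"
  shows "\<exists>\<phi>. step_solution a b (K * Beta b (1 - (a + b))) (K * Beta a (1 - (a + b))) \<phi>"
proof -
  \<comment> \<open>The factor that the two Abel inversions leave in \<open>kern_psi\<close>,
    multiplied by \<open>K\<close>; dividing by it gives the step the height 1.\<close>
  define N where "N = K * (Beta a (1 - a) * Beta b (1 - b))"
  have N: "0 < N" using K a b ab by (auto simp: N_def intro!: mult_pos_pos Beta_pos)
  define c1 where "c1 = 2 * CG + 2 * a * (Beta 1 (1 - b) + 1 / (a + b))"
  define c2 where "c2 = 2 * CG * b * (Beta 1 (1 - a) + 1 / (a + b))"
  have c: "0 \<le> c1" "0 \<le> c2"
    using CG_pos a b ab Beta_pos[of 1 "1 - b"] Beta_pos[of 1 "1 - a"] by (auto simp: c1_def c2_def)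
  define C where "C = max c1 c2 / N"
  have C: "0 \<le> C" using N c by (simp add: C_def)
  define p where "p = (\<lambda>s y. pw y (- a) * enn2real (psip s y) / N)"
  define m where "m = (\<lambda>s y. pw y (- a) * enn2real (psim s y) / N)"
  let ?w = "\<lambda>s y. (2 - y) powr (- b) * (2 - s) powr (- a) + rk 1 1 (1 - (a + b)) (y - s)"
  have w0: "0 \<le> ?w s y" for s y by (simp add: rk_nonneg)
  have fp: "psip s y \<le> ennreal (c1 * ?w s y) \<and> psip s y < \<infinity>" if "0 < s" "s < 2" for s y
  proof (cases "s < y \<and> y < 2")
    case True
    then have "psip s y \<le> ennreal (c1 * ?w s y)"
      using psip_le[of s y] that unfolding c1_def by simp
    then show ?thesis using ennreal_less_top by (auto intro: order_le_less_trans)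
  qed (auto simp: psip_def)
  have fm: "psim s y \<le> ennreal (c2 * ?w s y) \<and> psim s y < \<infinity>" if "0 < s" "s < 2" for s y
  proof (cases "0 < y \<and> y < s")
    case True
    then have "psim s y \<le> ennreal (c2 * rk 1 1 (1 - (a + b)) (y - s))"
      using psim_le[of y s] that unfolding c2_def by simp
    also have "\<dots> \<le> ennreal (c2 * ?w s y)"
      using c by (intro ennreal_leI mult_left_mono) auto
    finally show ?thesis using ennreal_less_top by (auto intro: order_le_less_trans)
  qed (auto simp: psim_def)
  have bnd: "pw y (- a) * enn2real z / N \<le> C * step_maj a b s y"
    if z: "z \<le> ennreal (c' * ?w s y)" and c': "c' \<le> max c1 c2" "0 \<le> c'" and z0: "y \<notin> {0<..<2} \<Longrightarrow> z = 0" for z c' s y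
  proof (cases "y \<in> {0<..<2}")
    case True
    have "enn2real z \<le> c' * ?w s y"
      using z c' w0[of y s] by (intro enn2real_leI) auto
    also have "\<dots> \<le> max c1 c2 * ?w s y" using c' w0[of y s] by (intro mult_right_mono) auto
    finally have "pw y (- a) * enn2real z \<le> pw y (- a) * (max c1 c2 * ?w s y)"
      by (intro mult_left_mono) auto
    then have "pw y (- a) * enn2real z / N \<le> pw y (- a) * (max c1 c2 * ?w s y) / N"
      using N by (intro divide_right_mono) auto
    also have "\<dots> = C * step_maj a b s y"
      using True by (simp add: C_def step_maj_def pw_pos)
    finally show ?thesis .
  next
    case False
    then show ?thesis using z0 by (simp add: step_maj_def)
  qed
  have "step_solution a b (K * Beta b (1 - (a + b))) (K * Beta a (1 - (a + b))) (\<lambda>s y. p s y - m s y)"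
  proof (rule step_solutionI[OF _ _ _ _ _ _ _ _ _ _ C])
    show "p s y \<le> C * step_maj a b s y" if "0 < s" "s < 2" for s y
      unfolding p_def using fp[OF that, of y] c that by (intro bnd[of _ c1]) (auto simp: psip_def)
    show "m s y \<le> C * step_maj a b s y" if "0 < s" "s < 2" for s y
      unfolding m_def using fm[OF that, of y] c that by (intro bnd[of _ c2]) (auto simp: psim_def)
    fix s :: real assume s: "0 < s" "s < 2"
    have conv: "(\<integral>\<^sup>+y. ennreal (K * kern (x - y)) * ennreal (pw y (- a) * enn2real (z y) / N) \<partial>lborel)
       = ennreal (K / N) * (\<integral>\<^sup>+y. ennreal (kern (x - y)) * (epw y (- a) * z y) \<partial>lborel)"
      if [measurable]: "z \<in> borel_measurable borel" and z: "\<And>y. z y < \<infinity>" for x z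
    proof -
      have "ennreal (K * kern (x - y)) * ennreal (pw y (- a) * enn2real (z y) / N)
          = ennreal (K / N) * (ennreal (kern (x - y)) * (epw y (- a) * z y))" for y
      proof -
        have k: "0 \<le> kern (x - y)"
          using Beta_pos[of a "1 - (a + b)"] Beta_pos[of b "1 - (a + b)"] a b ab by (intro rk_nonneg) auto
        have "ennreal (kern (x - y)) * (epw y (- a) * z y) = ennreal (kern (x - y) * (pw y (- a) * enn2real (z y)))"
          using k z[of y] by (simp add: ennreal_mult' ennreal_enn2real)
        then have "ennreal (K / N) * (ennreal (kern (x - y)) * (epw y (- a) * z y))
           = ennreal (K / N * (kern (x - y) * (pw y (- a) * enn2real (z y))))"
          using K N by (simp add: ennreal_mult'[symmetric])
        also have "K / N * (kern (x - y) * (pw y (- a) * enn2real (z y))) = K * kern (x - y) * (pw y (- a) * enn2real (z y) / N)"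
          by simp
        also have "ennreal \<dots> = ennreal (K * kern (x - y)) * ennreal (pw y (- a) * enn2real (z y) / N)"
          using k K by (intro ennreal_mult') auto
        finally show ?thesis ..
      qed
      then have "(\<integral>\<^sup>+y. ennreal (K * kern (x - y)) * ennreal (pw y (- a) * enn2real (z y) / N) \<partial>lborel)
         = (\<integral>\<^sup>+y. ennreal (K / N) * (ennreal (kern (x - y)) * (epw y (- a) * z y)) \<partial>lborel)" by (simp only:)
      also have "\<dots> = ennreal (K / N) * (\<integral>\<^sup>+y. ennreal (kern (x - y)) * (epw y (- a) * z y) \<partial>lborel)"
        by (rule nn_integral_cmult) simp
      finally show ?thesis .
    qed
    show "AE x in lborel. x \<in> {0<..<2} \<longrightarrow>
       (\<integral>\<^sup>+y. ennreal (rk (K * Beta b (1 - (a + b))) (K * Beta a (1 - (a + b))) (a + b) (x - y)) * ennreal (p s y) \<partial>lborel)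
      = (\<integral>\<^sup>+y. ennreal (rk (K * Beta b (1 - (a + b))) (K * Beta a (1 - (a + b))) (a + b) (x - y)) * ennreal (m s y) \<partial>lborel) + indicator {s<..} x"
      using kern_psi[OF s]
    proof eventually_elim
      case (elim x)
      have pc: "(\<integral>\<^sup>+y. ennreal (K * kern (x - y)) * ennreal (p s y) \<partial>lborel)
         = ennreal (K / N) * (\<integral>\<^sup>+y. ennreal (kern (x - y)) * (epw y (- a) * psip s y) \<partial>lborel)"
        unfolding p_def using fp[OF s] by (intro conv) auto
      have mc: "(\<integral>\<^sup>+y. ennreal (K * kern (x - y)) * ennreal (m s y) \<partial>lborel)
         = ennreal (K / N) * (\<integral>\<^sup>+y. ennreal (kern (x - y)) * (epw y (- a) * psim s y) \<partial>lborel)"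
        unfolding m_def using fm[OF s] by (intro conv) auto
      have "ennreal (K / N) * ennreal (Beta a (1 - a) * Beta b (1 - b)) = ennreal (K / N * (Beta a (1 - a) * Beta b (1 - b)))"
        using K N by (intro ennreal_mult'[symmetric]) simp
      also have "K / N * (Beta a (1 - a) * Beta b (1 - b)) = 1"
        unfolding times_divide_eq_left N_def[symmetric] using N by simp
      finally show ?case
        unfolding rk_scale pc mc using elim by (auto simp: distrib_left mult.assoc[symmetric])
    qed
  qed (use a b ab K N in \<open>auto simp: p_def m_def intro!: less_imp_le[OF Beta_pos] mult_nonneg_nonneg\<close>)
  then show ?thesis by blast
qed

text \<open>By the factorization, the right Abel integral of \<open>(2 - y) powr (- b)\<close> is at
  most the constant \<open>Beta b (1 - b)\<close>. What remains is the left Abel integral of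
  \<open>t powr (- (a + b))\<close>, a multiple of \<open>x powr (- b)\<close>, which the outer
  weight cancels.\<close>

lemma bounded_image_interior:
  assumes K: "0 < K"
  shows "bounded_image a b (K * Beta b (1 - (a + b))) (K * Beta a (1 - (a + b)))"
  unfolding bounded_image_def
proof (intro exI ballI)
  fix x :: real assume x: "x \<in> {0<..<2}"
  let ?w = "\<lambda>y. ennreal (indicator {0<..<2} y * (y powr (- a) * (2 - y) powr (- b)))"
  have "(\<integral>\<^sup>+y. ennreal (kern (x - y)) * ?w y \<partial>lborel)
     = ennreal (x powr b) * (\<integral>\<^sup>+t. epw (x - t) (a - 1) * epw t (- (a + b)) *
        (\<integral>\<^sup>+y. epw (y - t) (b - 1) * (epw y a * ?w y) \<partial>lborel) \<partial>lborel)"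
    using x by (intro sonine_factorization a b ab) auto
  also have "\<dots> \<le> ennreal (x powr b) * (\<integral>\<^sup>+t. ennreal (Beta b (1 - b)) * ennreal (pw (x - t) (a - 1) * pw (t - 0) ((1 - (a + b)) - 1)) \<partial>lborel)"
  proof (intro mult_left_mono nn_integral_mono)
    fix t
    have "(\<integral>\<^sup>+y. epw (y - t) (b - 1) * (epw y a * ?w y) \<partial>lborel)
       \<le> (\<integral>\<^sup>+y. ennreal (pw (2 - y) ((1 - b) - 1) * pw (y - t) (b - 1)) \<partial>lborel)"
    proof (intro nn_integral_mono)
      fix y
      have "pw y a * (indicator {0<..<2} y * (y powr (- a) * (2 - y) powr (- b))) \<le> pw (2 - y) (- b)"
        by (auto simp: pw_def indicator_def powr_minus field_simps)
      then have "pw (y - t) (b - 1) * (pw y a * (indicator {0<..<2} y * (y powr (- a) * (2 - y) powr (- b))))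
          \<le> pw (y - t) (b - 1) * pw (2 - y) (- b)"
        by (intro mult_left_mono) auto
      then show "epw (y - t) (b - 1) * (epw y a * ?w y) \<le> ennreal (pw (2 - y) ((1 - b) - 1) * pw (y - t) (b - 1))"
        by (simp add: ennreal_mult'[symmetric] ennreal_leI mult.commute)
    qed
    also have "\<dots> = ennreal (Beta (1 - b) b * pw (2 - t) 0)"
      using nn_integral_pw_beta[of "1 - b" b 2 t] a b ab by simp
    also have "\<dots> \<le> ennreal (Beta b (1 - b))"
      using Beta_pos[of b "1 - b"] a b ab by (intro ennreal_leI) (auto simp: pw_def Beta_commute)
    finally have "epw (x - t) (a - 1) * epw t (- (a + b)) * (\<integral>\<^sup>+y. epw (y - t) (b - 1) * (epw y a * ?w y) \<partial>lborel)
       \<le> epw (x - t) (a - 1) * epw t (- (a + b)) * ennreal (Beta b (1 - b))"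
      by (intro mult_left_mono) auto
    then show "epw (x - t) (a - 1) * epw t (- (a + b)) * (\<integral>\<^sup>+y. epw (y - t) (b - 1) * (epw y a * ?w y) \<partial>lborel)
       \<le> ennreal (Beta b (1 - b)) * ennreal (pw (x - t) (a - 1) * pw (t - 0) ((1 - (a + b)) - 1))"
      by (simp add: ennreal_mult' mult_ac)
  qed auto
  also have "\<dots> = ennreal (x powr b) * (ennreal (Beta b (1 - b)) * ennreal (Beta a (1 - (a + b)) * pw (x - 0) (a + (1 - (a + b)) - 1)))"
    using nn_integral_pw_beta[of a "1 - (a + b)" x 0] a b ab by (subst nn_integral_cmult) auto
  also have "\<dots> = ennreal (x powr b * (Beta b (1 - b) * (Beta a (1 - (a + b)) * x powr (- b))))"
    using Beta_pos[of b "1 - b"] a b ab x by (simp add: ennreal_mult'[symmetric] pw_pos)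
  also have "x powr b * (Beta b (1 - b) * (Beta a (1 - (a + b)) * x powr (- b))) = Beta b (1 - b) * Beta a (1 - (a + b))"
    using x by (simp add: powr_minus field_simps)
  finally have *: "(\<integral>\<^sup>+y. ennreal (kern (x - y)) * ?w y \<partial>lborel) \<le> ennreal (Beta b (1 - b) * Beta a (1 - (a + b)))" .
  have "(\<integral>\<^sup>+y. ennreal (rk (K * Beta b (1 - (a + b))) (K * Beta a (1 - (a + b))) (a + b) (x - y)) * ?w y \<partial>lborel)
     = ennreal K * (\<integral>\<^sup>+y. ennreal (kern (x - y)) * ?w y \<partial>lborel)"
    using K by (subst nn_integral_cmult[symmetric]) (auto simp: rk_scale ennreal_mult' mult.assoc)
  also have "\<dots> \<le> ennreal K * ennreal (Beta b (1 - b) * Beta a (1 - (a + b)))"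
    using * by (intro mult_left_mono) auto
  finally show "(\<integral>\<^sup>+y. ennreal (rk (K * Beta b (1 - (a + b))) (K * Beta a (1 - (a + b))) (a + b) (x - y)) * ?w y \<partial>lborel)
    \<le> ennreal (K * (Beta b (1 - b) * Beta a (1 - (a + b))))"
    using K by (simp add: ennreal_mult')
qed

end

text \<open>For a vanishing exponent the kernel is one-sided and a single Abel equation remains. The
  truncated power of \<open>r - y\<close> with exponent \<open>- b\<close> is mapped to a multiple
  of the indicator of \<open>x < r\<close>, and the step at \<open>s\<close> is the difference of
  the cases \<open>r = 2\<close> and \<open>r = s\<close>.\<close>

lemma step_solution_end:
  assumes b: "0 < b" "b < 1" and B: "0 < B"
  shows "\<exists>\<phi>. step_solution 0 b 0 B \<phi>" "bounded_image 0 b 0 B"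
proof -
  define N where "N = B * Beta b (1 - b)"
  have N: "0 < N" using B b by (simp add: N_def Beta_pos)
  define p where "p = (\<lambda>(s::real) (y::real). pw y 0 * pw (2 - y) (- b) / N)"
  define m where "m = (\<lambda>(s::real) (y::real). pw y 0 * (pw (2 - y) 0 * pw (s - y) (- b)) / N)"
  have T: "(\<integral>\<^sup>+y. ennreal (rk 0 B (0 + b) (x - y)) * ennreal (pw y 0 * pw (r - y) (- b) / N) \<partial>lborel) = epw (r - x) 0"
    if "0 < x" for x r
  proof -
    have "(\<integral>\<^sup>+y. ennreal (rk 0 B (0 + b) (x - y)) * ennreal (pw y 0 * pw (r - y) (- b) / N) \<partial>lborel)
       = (\<integral>\<^sup>+y. ennreal (B / N) * ennreal (pw (r - y) ((1 - b) - 1) * pw (y - x) (b - 1)) \<partial>lborel)"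
      using B N that by (intro nn_integral_cong) (auto simp: rk_def pw_def ennreal_mult'[symmetric] mult_ac)
    also have "\<dots> = ennreal (B / N) * ennreal (Beta (1 - b) b * pw (r - x) ((1 - b) + b - 1))"
      using b nn_integral_pw_beta[of "1 - b" b r x] by (subst nn_integral_cmult) auto
    also have "\<dots> = ennreal ((B / N * Beta (1 - b) b) * pw (r - x) 0)"
      using B N by (simp add: ennreal_mult'[symmetric] mult.assoc)
    also have "B / N * Beta (1 - b) b = 1"
      unfolding times_divide_eq_left Beta_commute[of "1 - b" b] N_def[symmetric] using N by simp
    finally show ?thesis by simp
  qed
  have "step_solution 0 b 0 B (\<lambda>s y. p s y - m s y)"
  proof (rule step_solutionI[where C="1 / N"])
    show "p s y \<le> 1 / N * step_maj 0 b s y" if "0 < s" "s < 2" for s y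
      using N that by (auto simp: p_def step_maj_def pw_def rk_def divide_right_mono)
    show "m s y \<le> 1 / N * step_maj 0 b s y" if "0 < s" "s < 2" for s y
      using N that by (auto simp: m_def step_maj_def pw_def rk_def divide_right_mono)
    fix s :: real assume s: "0 < s" "s < 2"
    have "AE x in lborel. x \<noteq> s" by (rule AE_lborel_singleton)
    then show "AE x in lborel. x \<in> {0<..<2} \<longrightarrow>
       (\<integral>\<^sup>+y. ennreal (rk 0 B (0 + b) (x - y)) * ennreal (p s y) \<partial>lborel)
      = (\<integral>\<^sup>+y. ennreal (rk 0 B (0 + b) (x - y)) * ennreal (m s y) \<partial>lborel) + indicator {s<..} x"
    proof eventually_elim
      case (elim x)
      have "m s y = pw y 0 * pw (s - y) (- b) / N" for y
        using s by (auto simp: m_def pw_def)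
      then show ?case using T[of x s] T[of x 2] elim s by (auto simp: p_def pw_def indicator_def)
    qed
  qed (use b B N in \<open>auto simp: p_def m_def\<close>)
  then show "\<exists>\<phi>. step_solution 0 b 0 B \<phi>" by blast
  show "bounded_image 0 b 0 B"
    unfolding bounded_image_def
  proof (intro exI ballI)
    fix x :: real assume x: "x \<in> {0<..<2}"
    have "(\<integral>\<^sup>+y. ennreal (rk 0 B (0 + b) (x - y)) * ennreal (indicator {0<..<2} y * (y powr (- 0) * (2 - y) powr (- b))) \<partial>lborel)
      = (\<integral>\<^sup>+y. ennreal N * (ennreal (rk 0 B (0 + b) (x - y)) * ennreal (pw y 0 * pw (2 - y) (- b) / N)) \<partial>lborel)"
      using B N by (intro nn_integral_cong) (auto simp: pw_def indicator_def ennreal_mult'[symmetric] rk_nonneg)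
    also have "\<dots> = ennreal N * epw (2 - x) 0"
      using x by (subst nn_integral_cmult) (auto simp: T[simplified])
    finally show "(\<integral>\<^sup>+y. ennreal (rk 0 B (0 + b) (x - y)) * ennreal (indicator {0<..<2} y * (y powr (- 0) * (2 - y) powr (- b))) \<partial>lborel)
      \<le> ennreal N" using x by (simp add: pw_pos)
  qed
qed

section \<open>Superposition of step solutions\<close>

text \<open>Vanishing tails mean that the positive and the negative part of \<open>u\<close> are
  densities of the same measure, finite on half lines. They agree almost everywhere, and where they
  agree both are 0.\<close>

lemma AE_zero_if_tails_zero:
  fixes u :: "real \<Rightarrow> real"
  assumes u: "integrable lborel u" and tails: "\<And>c. (\<integral>y. indicator {c<..} y * u y \<partial>lborel) = 0"
  shows "AE y in lborel. u y = 0"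
proof -
  have [measurable]: "u \<in> borel_measurable borel" using u by auto
  have ip: "integrable lborel (\<lambda>y. max 0 (u y))" "integrable lborel (\<lambda>y. max 0 (- u y))"
    using u by (auto intro: integrable_max)
  have itail: "integrable lborel (\<lambda>y. indicator {c<..} y * f y)" if "integrable lborel f" for c and f :: "real \<Rightarrow> real"
    by (rule Bochner_Integration.integrable_bound[OF that]) (use that in \<open>auto simp: indicator_def\<close>)
  have em: "emeasure (density lborel (\<lambda>y. ennreal (f y))) {c<..} = ennreal (\<integral>y. indicator {c<..} y * f y \<partial>lborel)"
    if f: "integrable lborel f" "\<And>y. 0 \<le> f y" for c and f :: "real \<Rightarrow> real"
  proof -
    have [measurable]: "f \<in> borel_measurable borel" using f by auto
    have "emeasure (density lborel (\<lambda>y. ennreal (f y))) {c<..} = (\<integral>\<^sup>+y. ennreal (indicator {c<..} y * f y) \<partial>lborel)"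
      by (subst emeasure_density) (auto intro!: nn_integral_cong simp: indicator_def)
    also have "\<dots> = ennreal (\<integral>y. indicator {c<..} y * f y \<partial>lborel)"
      using itail[OF f(1)] f(2) by (intro nn_integral_eq_integral) auto
    finally show ?thesis .
  qed
  have eq: "(\<integral>y. indicator {c<..} y * max 0 (u y) \<partial>lborel) = (\<integral>y. indicator {c<..} y * max 0 (- u y) \<partial>lborel)" for c
  proof -
    have "(\<integral>y. indicator {c<..} y * max 0 (u y) \<partial>lborel) - (\<integral>y. indicator {c<..} y * max 0 (- u y) \<partial>lborel)
       = (\<integral>y. indicator {c<..} y * max 0 (u y) - indicator {c<..} y * max 0 (- u y) \<partial>lborel)"
      by (rule Bochner_Integration.integral_diff[symmetric]) (intro itail ip)+
    also have "\<dots> = (\<integral>y. indicator {c<..} y * u y \<partial>lborel)"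
      by (intro Bochner_Integration.integral_cong) (auto simp: indicator_def)
    finally show ?thesis using tails[of c] by simp
  qed
  have "density lborel (\<lambda>y. ennreal (max 0 (u y))) = density lborel (\<lambda>y. ennreal (max 0 (- u y)))"
    by (rule measure_eqI_lessThan) (simp_all add: em ip eq)
  then have "AE y in lborel. ennreal (max 0 (u y)) = ennreal (max 0 (- u y))"
    by (intro sigma_finite_measure.density_unique[OF sigma_finite_lborel]) simp_all
  then show ?thesis
    by eventually_elim (auto simp: max_def split: if_splits)
qed

text \<open>With \<open>l\<close> kept free this replaces the Cauchy-Schwarz inequality: after
  integration, \<open>l\<close> is chosen as the norm of one factor.\<close>

lemma am_gm_scaled:
  fixes p q l :: real
  assumes "0 < l"
  shows "p * q \<le> p\<^sup>2 / (2 * l) + l / 2 * q\<^sup>2"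
proof -
  have "0 \<le> (p - l * q)\<^sup>2 / (2 * l)" using assms by simp
  also have "\<dots> = p\<^sup>2 / (2 * l) + l / 2 * q\<^sup>2 - p * q"
    using assms by (simp add: power2_eq_square field_simps)
  finally show ?thesis by simp
qed

locale solvable_kernel =
  fixes a b A B :: real and \<phi> :: "real \<Rightarrow> real \<Rightarrow> real"
  assumes a: "0 \<le> a" "a < 1 / 2" and b: "0 \<le> b" and ab: "a + b < 1" "0 < a + b"
    and AB: "0 \<le> A" "0 \<le> B"
    and sol: "step_solution a b A B \<phi>" and bdd: "bounded_image a b A B"
begin

abbreviation J :: "real set" where "J \<equiv> {0<..<2}"

abbreviation k :: "real \<Rightarrow> real" where "k \<equiv> rk A B (a + b)"

definition w :: "real \<Rightarrow> real" where
  "w y = indicator J y * (y powr (- a) * (2 - y) powr (- b))"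

text \<open>The density \<open>g\<close> plays the part of the derivative of the right-hand side: a
  superposition of unit steps at \<open>s\<close> with density \<open>g s\<close> is
  \<open>Z g\<close>, so \<open>V g\<close> is the candidate for the preimage of
  \<open>Z g\<close>.\<close>

definition V :: "(real \<Rightarrow> real) \<Rightarrow> real \<Rightarrow> real" where
  "V g y = (\<integral>s. indicator J s * g s * \<phi> s y \<partial>lborel)"

definition Z :: "(real \<Rightarrow> real) \<Rightarrow> real \<Rightarrow> real" where
  "Z g x = (\<integral>s. indicator {0<..<x} s * g s \<partial>lborel)"

definition sq :: "(real \<Rightarrow> real) \<Rightarrow> bool" where
  "sq g \<longleftrightarrow> g \<in> borel_measurable borel \<and> integrable lborel (\<lambda>s. indicator J s * (g s)\<^sup>2)"

definition n2 :: "(real \<Rightarrow> real) \<Rightarrow> real" where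
  "n2 g = (\<integral>s. indicator J s * (g s)\<^sup>2 \<partial>lborel)"

lemma k_nonneg: "0 \<le> k r" by (rule rk_nonneg[OF AB])

lemma w_measurable [measurable]: "w \<in> borel_measurable borel"
  unfolding w_def by measurable

lemma w_nonneg: "0 \<le> w y" by (simp add: w_def)

lemma w_integrable: "integrable lborel w"
  using nn_integral_edge_weight[of a b] a b ab unfolding w_def by (intro integrableI_nonneg) auto

lemma \<phi>_pair: "case_prod \<phi> \<in> borel_measurable (borel \<Otimes>\<^sub>M borel)"
  using sol by (simp add: step_solution_def)

lemma \<phi>_measurable [measurable]:
  assumes [measurable]: "f \<in> borel_measurable M" "g \<in> borel_measurable M"
  shows "(\<lambda>x. \<phi> (f x) (g x)) \<in> borel_measurable M"
  using measurable_compose[OF _ \<phi>_pair, of "\<lambda>x. (f x, g x)" M] by simp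

lemma n2_nonneg: "0 \<le> n2 g" by (simp add: n2_def)

definition C\<phi> :: real where
  "C\<phi> = (SOME C. 0 \<le> C \<and> (\<forall>s\<in>J. \<forall>y. \<bar>\<phi> s y\<bar> \<le> C * step_maj a b s y))"

lemma C\<phi>: "0 \<le> C\<phi>" "s \<in> J \<Longrightarrow> \<bar>\<phi> s y\<bar> \<le> C\<phi> * step_maj a b s y"
proof -
  obtain C where C: "\<forall>s\<in>J. \<forall>y. \<bar>\<phi> s y\<bar> \<le> C * step_maj a b s y"
    using sol by (auto simp: step_solution_def)
  have "\<bar>\<phi> s y\<bar> \<le> max 0 C * step_maj a b s y" if "s \<in> J" for s y
  proof -
    have "C * step_maj a b s y \<le> max 0 C * step_maj a b s y"
      by (intro mult_right_mono step_maj_nonneg) simp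
    then show ?thesis using C that by (blast intro: order_trans)
  qed
  then have "0 \<le> max 0 C \<and> (\<forall>s\<in>J. \<forall>y. \<bar>\<phi> s y\<bar> \<le> max 0 C * step_maj a b s y)"
    by simp
  from someI[of "\<lambda>C. 0 \<le> C \<and> (\<forall>s\<in>J. \<forall>y. \<bar>\<phi> s y\<bar> \<le> C * step_maj a b s y)", OF this]
  show "0 \<le> C\<phi>" "s \<in> J \<Longrightarrow> \<bar>\<phi> s y\<bar> \<le> C\<phi> * step_maj a b s y"
    unfolding C\<phi>_def by auto
qed

lemma \<phi>_outside: "s \<in> J \<Longrightarrow> y \<notin> J \<Longrightarrow> \<phi> s y = 0"
  using C\<phi>(2)[of s y] by (simp add: step_maj_def)

lemma V_outside: "y \<notin> J \<Longrightarrow> V g y = 0"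
proof -
  assume "y \<notin> J"
  then have "indicator J s * g s * \<phi> s y = 0" for s
    by (cases "s \<in> J") (auto simp: \<phi>_outside)
  then show ?thesis unfolding V_def by (simp only:) simp
qed

lemma V_measurable [measurable]:
  assumes [measurable]: "g \<in> borel_measurable borel"
  shows "V g \<in> borel_measurable borel"
  unfolding V_def[abs_def] by measurable

definition W :: real where "W = (\<integral>y. w y \<partial>lborel)"
definition E2 :: real where "E2 = (\<integral>s. indicator J s * (2 - s) powr (- (2 * a)) \<partial>lborel)"
definition F2 :: real where "F2 = (\<integral>s. indicator J s * s powr (- (2 * a)) \<partial>lborel)"
definition R :: real where "R = 2 * (Beta 1 (1 - (a + b)) * 2 powr (1 - (a + b)))"

lemma E2_integrable: "integrable lborel (\<lambda>s. indicator J s * (2 - s) powr (- (2 * a)))"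
proof -
  have "(\<integral>\<^sup>+s. ennreal (indicator J s * (s powr (- 0) * (2 - s) powr (- (2 * a)))) \<partial>lborel) < \<infinity>"
    using a by (intro nn_integral_edge_weight) auto
  then have "(\<integral>\<^sup>+s. ennreal (indicator J s * (2 - s) powr (- (2 * a))) \<partial>lborel) < \<infinity>"
    by (rule order_le_less_trans[rotated]) (auto intro!: nn_integral_mono ennreal_leI simp: indicator_def)
  then show ?thesis by (intro integrableI_nonneg) auto
qed

lemma F2_integrable: "integrable lborel (\<lambda>s. indicator J s * s powr (- (2 * a)))"
proof -
  have "(\<integral>\<^sup>+s. ennreal (indicator J s * (s powr (- (2 * a)) * (2 - s) powr (- 0))) \<partial>lborel) < \<infinity>"
    using a by (intro nn_integral_edge_weight) auto
  then have "(\<integral>\<^sup>+s. ennreal (indicator J s * s powr (- (2 * a))) \<partial>lborel) < \<infinity>"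
    by (rule order_le_less_trans[rotated]) (auto intro!: nn_integral_mono ennreal_leI simp: indicator_def)
  then show ?thesis by (intro integrableI_nonneg) auto
qed

lemma consts_nonneg: "0 \<le> W" "0 \<le> E2" "0 \<le> F2" "0 \<le> R"
  using Beta_pos[of 1 "1 - (a + b)"] ab by (auto simp: W_def w_nonneg E2_def F2_def R_def)

lemma nn_W: "(\<integral>\<^sup>+y. ennreal (w y) \<partial>lborel) = ennreal W"
  unfolding W_def by (rule nn_integral_eq_integral[OF w_integrable]) (simp add: w_nonneg)

abbreviation r :: "real \<Rightarrow> real" where "r \<equiv> rk 1 1 (1 - (a + b))"

lemma r_sym: "r (x - y) = r (y - x)" by (simp add: rk_def)

lemma nn_r: "s \<in> J \<Longrightarrow> (\<integral>\<^sup>+y. indicator J y * ennreal (r (y - s)) \<partial>lborel) \<le> ennreal R"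
  using nn_integral_rk_le(1)[of 1 1 "1 - (a + b)" 0 s 2] ab by (simp add: R_def)

text \<open>In each term of the majorant the size of \<open>g s\<close> is paired with one singular
  factor: with \<open>(2 - s) powr (- a)\<close> in the first, where \<open>w y\<close> is an
  integrable weight, and with \<open>y powr (- a)\<close> in the second, where the kernel
  \<open>r\<close> is the weight and has mass at most \<open>R\<close> in either variable.\<close>

lemma nn_double:
  assumes g: "sq g" and l: "0 < l"
  shows "(\<integral>\<^sup>+s. \<integral>\<^sup>+y. ennreal (indicator J s * \<bar>g s\<bar> * step_maj a b s y) \<partial>lborel \<partial>lborel)
    \<le> ennreal ((W + R) * (n2 g / (2 * l)) + l / 2 * (W * E2 + R * F2))"
proof -
  have [measurable]: "g \<in> borel_measurable borel" using g by (simp add: sq_def)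
  define G2 where "G2 s = ennreal (indicator J s * (g s)\<^sup>2 / (2 * l))" for s
  define P where "P s = ennreal (l / 2 * (indicator J s * (2 - s) powr (- (2 * a))))" for s
  define Q where "Q y = ennreal (l / 2 * (indicator J y * y powr (- (2 * a))))" for y
  have [measurable]: "G2 \<in> borel_measurable borel" "P \<in> borel_measurable borel" "Q \<in> borel_measurable borel"
    unfolding G2_def P_def Q_def by measurable
  have iG: "(\<integral>\<^sup>+s. G2 s \<partial>lborel) = ennreal (n2 g / (2 * l))"
  proof -
    have "(\<integral>\<^sup>+s. G2 s \<partial>lborel) = ennreal (\<integral>s. indicator J s * (g s)\<^sup>2 / (2 * l) \<partial>lborel)"
      unfolding G2_def using g l by (intro nn_integral_eq_integral) (auto simp: sq_def)
    then show ?thesis by (simp add: n2_def)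
  qed
  have iP: "(\<integral>\<^sup>+s. P s \<partial>lborel) = ennreal (l / 2 * E2)"
  proof -
    have "(\<integral>\<^sup>+s. P s \<partial>lborel) = ennreal (\<integral>s. l / 2 * (indicator J s * (2 - s) powr (- (2 * a))) \<partial>lborel)"
      unfolding P_def using E2_integrable l by (intro nn_integral_eq_integral) auto
    then show ?thesis unfolding E2_def by (simp only: integral_mult_right_zero)
  qed
  have iQ: "(\<integral>\<^sup>+s. Q s \<partial>lborel) = ennreal (l / 2 * F2)"
  proof -
    have "(\<integral>\<^sup>+s. Q s \<partial>lborel) = ennreal (\<integral>s. l / 2 * (indicator J s * s powr (- (2 * a))) \<partial>lborel)"
      unfolding Q_def using F2_integrable l by (intro nn_integral_eq_integral) auto
    then show ?thesis unfolding F2_def by (simp only: integral_mult_right_zero)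
  qed
  have pt: "ennreal (indicator J s * \<bar>g s\<bar> * step_maj a b s y)
     \<le> ennreal (w y) * (G2 s + P s) + (indicator J y * ennreal (r (y - s)) * G2 s + indicator J s * (ennreal (r (s - y)) * Q y))" for s y
  proof (cases "s \<in> J \<and> y \<in> J")
    case True
    then have s: "s \<in> J" and y: "y \<in> J" by auto
    have sq: "(x powr (- a))\<^sup>2 = x powr (- (2 * a))" for x :: real
      by (simp add: power2_eq_square powr_add[symmetric])
    have "\<bar>g s\<bar> * step_maj a b s y = w y * (\<bar>g s\<bar> * (2 - s) powr (- a)) + r (y - s) * (\<bar>g s\<bar> * y powr (- a))"
      using y by (simp add: step_maj_def w_def algebra_simps)
    also have "\<dots> \<le> w y * ((g s)\<^sup>2 / (2 * l) + l / 2 * (2 - s) powr (- (2 * a)))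
        + r (y - s) * ((g s)\<^sup>2 / (2 * l) + l / 2 * y powr (- (2 * a)))"
      using am_gm_scaled[OF l, of "\<bar>g s\<bar>" "(2 - s) powr (- a)"] am_gm_scaled[OF l, of "\<bar>g s\<bar>" "y powr (- a)"]
      by (intro add_mono mult_left_mono w_nonneg rk_nonneg) (auto simp: sq)
    finally have "ennreal (indicator J s * \<bar>g s\<bar> * step_maj a b s y) \<le> ennreal \<dots>"
      using s by (intro ennreal_leI) simp
    also have "\<dots> = ennreal (w y) * (G2 s + P s) + (indicator J y * ennreal (r (y - s)) * G2 s + indicator J s * (ennreal (r (s - y)) * Q y))"
    proof -
      have e: "ennreal (W' * (G' + P') + R' * (G' + Q'))
          = ennreal W' * (ennreal G' + ennreal P') + (ennreal R' * ennreal G' + ennreal R' * ennreal Q')"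
        if "0 \<le> W'" "0 \<le> G'" "0 \<le> P'" "0 \<le> R'" "0 \<le> Q'" for W' G' P' R' Q'
        using that by (simp add: ennreal_mult' distrib_left)
      have i: "G2 s = ennreal ((g s)\<^sup>2 / (2 * l))" "P s = ennreal (l / 2 * (2 - s) powr (- (2 * a)))"
        "Q y = ennreal (l / 2 * y powr (- (2 * a)))"
        using s y by (simp_all add: G2_def P_def Q_def)
      show ?thesis
        unfolding i r_sym[of s y] using s y l by (subst e) (auto simp: w_nonneg rk_nonneg)
    qed
    finally show ?thesis .
  next
    case False
    then have "ennreal (indicator J s * \<bar>g s\<bar> * step_maj a b s y) = 0"
      by (auto simp: step_maj_def)
    then show ?thesis by (simp only: zero_le)
  qed
  have "(\<integral>\<^sup>+s. \<integral>\<^sup>+y. ennreal (indicator J s * \<bar>g s\<bar> * step_maj a b s y) \<partial>lborel \<partial>lborel)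
    \<le> (\<integral>\<^sup>+s. \<integral>\<^sup>+y. ennreal (w y) * (G2 s + P s) + (indicator J y * ennreal (r (y - s)) * G2 s + indicator J s * (ennreal (r (s - y)) * Q y)) \<partial>lborel \<partial>lborel)"
    by (intro nn_integral_mono pt)
  also have "\<dots> = (\<integral>\<^sup>+s. ennreal W * (G2 s + P s) + ((\<integral>\<^sup>+y. indicator J y * ennreal (r (y - s)) \<partial>lborel) * G2 s
       + indicator J s * (\<integral>\<^sup>+y. ennreal (r (s - y)) * Q y \<partial>lborel)) \<partial>lborel)"
    by (intro nn_integral_cong, subst nn_integral_add, simp, simp, subst nn_integral_add, simp, simp)
      (simp add: nn_integral_multc nn_integral_cmult nn_W)
  also have "\<dots> \<le> (\<integral>\<^sup>+s. ennreal W * (G2 s + P s) + (ennreal R * G2 s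
       + indicator J s * (\<integral>\<^sup>+y. ennreal (r (s - y)) * Q y \<partial>lborel)) \<partial>lborel)"
  proof (intro nn_integral_mono add_mono order_refl)
    fix s
    show "(\<integral>\<^sup>+y. indicator J y * ennreal (r (y - s)) \<partial>lborel) * G2 s \<le> ennreal R * G2 s"
      using nn_r[of s] by (cases "s \<in> J") (auto simp: G2_def intro!: mult_right_mono)
  qed
  also have "\<dots> = ennreal W * (ennreal (n2 g / (2 * l)) + ennreal (l / 2 * E2)) + (ennreal R * ennreal (n2 g / (2 * l))
      + (\<integral>\<^sup>+s. indicator J s * (\<integral>\<^sup>+y. ennreal (r (s - y)) * Q y \<partial>lborel) \<partial>lborel))"
    by (simp add: nn_integral_add nn_integral_cmult iG iP)
  also have "\<dots> \<le> ennreal W * (ennreal (n2 g / (2 * l)) + ennreal (l / 2 * E2)) + (ennreal R * ennreal (n2 g / (2 * l))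
      + ennreal R * ennreal (l / 2 * F2))"
  proof (intro add_mono order_refl)
    have "Q y = 0" if "y \<notin> J" for y using that by (simp add: Q_def)
    then show "(\<integral>\<^sup>+s. indicator J s * (\<integral>\<^sup>+y. ennreal (r (s - y)) * Q y \<partial>lborel) \<partial>lborel) \<le> ennreal R * ennreal (l / 2 * F2)"
      using nn_integral_rk_L1[of 1 1 "1 - (a + b)" Q 0 2] ab unfolding iQ R_def by simp
  qed
  also have "\<dots> = ennreal (W * (n2 g / (2 * l) + l / 2 * E2) + (R * (n2 g / (2 * l)) + R * (l / 2 * F2)))"
    using l consts_nonneg n2_nonneg[of g]
    by (simp add: ennreal_mult'[symmetric] ennreal_plus[symmetric] del: ennreal_plus)
  finally show ?thesis by (simp add: algebra_simps add_divide_distrib)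
qed

lemma nn_double_\<phi>:
  assumes g: "sq g" and l: "0 < l"
  shows "(\<integral>\<^sup>+s. \<integral>\<^sup>+y. ennreal \<bar>indicator J s * g s * \<phi> s y\<bar> \<partial>lborel \<partial>lborel)
    \<le> ennreal (C\<phi> * ((W + R) * (n2 g / (2 * l)) + l / 2 * (W * E2 + R * F2)))"
proof -
  have [measurable]: "g \<in> borel_measurable borel" using g by (simp add: sq_def)
  have "(\<integral>\<^sup>+s. \<integral>\<^sup>+y. ennreal \<bar>indicator J s * g s * \<phi> s y\<bar> \<partial>lborel \<partial>lborel)
     \<le> (\<integral>\<^sup>+s. \<integral>\<^sup>+y. ennreal C\<phi> * ennreal (indicator J s * \<bar>g s\<bar> * step_maj a b s y) \<partial>lborel \<partial>lborel)"
  proof (intro nn_integral_mono)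
    fix s y
    have "\<bar>indicator J s * g s * \<phi> s y\<bar> \<le> C\<phi> * (indicator J s * \<bar>g s\<bar> * step_maj a b s y)"
      using mult_left_mono[OF C\<phi>(2)[of s y], of "\<bar>g s\<bar>"] by (cases "s \<in> J") (auto simp: abs_mult mult_ac)
    then show "ennreal \<bar>indicator J s * g s * \<phi> s y\<bar> \<le> ennreal C\<phi> * ennreal (indicator J s * \<bar>g s\<bar> * step_maj a b s y)"
      using C\<phi>(1) by (simp add: ennreal_mult'[symmetric] ennreal_leI)
  qed
  also have "\<dots> = ennreal C\<phi> * (\<integral>\<^sup>+s. \<integral>\<^sup>+y. ennreal (indicator J s * \<bar>g s\<bar> * step_maj a b s y) \<partial>lborel \<partial>lborel)"
    by (simp add: nn_integral_cmult)
  also have "\<dots> \<le> ennreal C\<phi> * ennreal ((W + R) * (n2 g / (2 * l)) + l / 2 * (W * E2 + R * F2))"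
    by (intro mult_left_mono nn_double[OF g l]) auto
  finally show ?thesis using C\<phi>(1) by (simp add: ennreal_mult'[symmetric])
qed

lemma V_pair_integrable:
  assumes g: "sq g"
  shows "integrable (lborel \<Otimes>\<^sub>M lborel) (\<lambda>(s, y). indicator J s * g s * \<phi> s y)"
proof (rule integrableI_bounded)
  have [measurable]: "g \<in> borel_measurable borel" using g by (simp add: sq_def)
  show "(\<lambda>(s, y). indicator J s * g s * \<phi> s y) \<in> borel_measurable (lborel \<Otimes>\<^sub>M lborel)" by measurable
  have "(\<integral>\<^sup>+x. ennreal (norm (case x of (s, y) \<Rightarrow> indicator J s * g s * \<phi> s y)) \<partial>(lborel \<Otimes>\<^sub>M lborel))
     = (\<integral>\<^sup>+s. \<integral>\<^sup>+y. ennreal \<bar>indicator J s * g s * \<phi> s y\<bar> \<partial>lborel \<partial>lborel)"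
    by (subst lborel.nn_integral_fst[symmetric]) simp_all
  also have "\<dots> < \<infinity>" using nn_double_\<phi>[OF g, of 1] by (auto intro: order_le_less_trans)
  finally show "(\<integral>\<^sup>+x. ennreal (norm (case x of (s, y) \<Rightarrow> indicator J s * g s * \<phi> s y)) \<partial>(lborel \<Otimes>\<^sub>M lborel)) < \<infinity>" .
qed

lemma V_integrable: "sq g \<Longrightarrow> integrable lborel (V g)"
  using lborel_pair.integrable_snd[OF V_pair_integrable] unfolding V_def[abs_def] by simp

lemma V_AE_integrable: "sq g \<Longrightarrow> AE y in lborel. integrable lborel (\<lambda>s. indicator J s * g s * \<phi> s y)"
  using lborel_pair.AE_integrable_snd[OF V_pair_integrable] by simp

definition CV :: real where "CV = C\<phi> * ((W + R) / 2 + (W * E2 + R * F2) / 2)"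

lemma CV_nonneg: "0 \<le> CV"
  using C\<phi>(1) consts_nonneg by (simp add: CV_def)

lemma V_L1:
  assumes g: "sq g"
  shows "(\<integral>y. \<bar>V g y\<bar> \<partial>lborel) \<le> CV * sqrt (n2 g)"
proof -
  have [measurable]: "g \<in> borel_measurable borel" using g by (simp add: sq_def)
  have *: "(\<integral>y. \<bar>V g y\<bar> \<partial>lborel) \<le> C\<phi> * ((W + R) * (n2 g / (2 * l)) + l / 2 * (W * E2 + R * F2))" if l: "0 < l" for l
  proof -
    have "ennreal (\<integral>y. \<bar>V g y\<bar> \<partial>lborel) = (\<integral>\<^sup>+y. ennreal \<bar>V g y\<bar> \<partial>lborel)"
      using V_integrable[OF g] by (intro nn_integral_eq_integral[symmetric]) auto
    also have "\<dots> \<le> (\<integral>\<^sup>+y. \<integral>\<^sup>+s. ennreal \<bar>indicator J s * g s * \<phi> s y\<bar> \<partial>lborel \<partial>lborel)"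
    proof (intro nn_integral_mono_AE)
      show "AE y in lborel. ennreal \<bar>V g y\<bar> \<le> (\<integral>\<^sup>+s. ennreal \<bar>indicator J s * g s * \<phi> s y\<bar> \<partial>lborel)"
        using V_AE_integrable[OF g]
      proof eventually_elim
        case (elim y)
        show ?case unfolding V_def using integral_norm_bound_ennreal[OF elim] by simp
      qed
    qed
    also have "\<dots> = (\<integral>\<^sup>+s. \<integral>\<^sup>+y. ennreal \<bar>indicator J s * g s * \<phi> s y\<bar> \<partial>lborel \<partial>lborel)"
      by (rule lborel_pair.Fubini') simp
    also have "\<dots> \<le> ennreal (C\<phi> * ((W + R) * (n2 g / (2 * l)) + l / 2 * (W * E2 + R * F2)))"
      by (rule nn_double_\<phi>[OF g l])
    finally show ?thesis
      using C\<phi>(1) consts_nonneg l n2_nonneg[of g] by (subst (asm) ennreal_le_iff) auto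
  qed
  show ?thesis
  proof (cases "n2 g = 0")
    case True
    define c where "c = C\<phi> * (W * E2 + R * F2) / 2"
    have c: "0 \<le> c" using C\<phi>(1) consts_nonneg by (simp add: c_def)
    have "(\<integral>y. \<bar>V g y\<bar> \<partial>lborel) \<le> 0 + e" if "0 < e" for e
    proof -
      have "(\<integral>y. \<bar>V g y\<bar> \<partial>lborel) \<le> c * (e / (c + 1))"
        using *[of "e / (c + 1)"] that c True by (simp add: c_def mult_ac)
      also have "\<dots> \<le> e" using c that by (simp add: field_simps)
      finally show ?thesis by simp
    qed
    then have "(\<integral>y. \<bar>V g y\<bar> \<partial>lborel) \<le> 0" by (rule field_le_epsilon)
    then show ?thesis using True by simp
  next
    case False
    then have p: "0 < n2 g" using n2_nonneg[of g] by simp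
    \<comment> \<open>The choice \<open>l = sqrt (n2 g)\<close> makes both terms of the estimate
      proportional to the norm.\<close>
    have "n2 g / (2 * sqrt (n2 g)) = sqrt (n2 g) / 2"
      using p by (simp add: field_simps)
    from *[of "sqrt (n2 g)", unfolded this] show ?thesis
      using p by (simp add: CV_def algebra_simps add_divide_distrib)
  qed
qed

text \<open>By Fubini's theorem the image of \<open>V g\<close> is the superposition of the images
  of the step solutions. The absolute convergence required for a given \<open>x\<close> holds for
  almost every \<open>x\<close>, by the L^1 bound of the kernel applied to the majorant
  \<open>U\<close>.\<close>

lemma V_solves:
  assumes g: "sq g"
  shows "AE x in lborel. x \<in> J \<longrightarrow> integrable lborel (\<lambda>y. k (x - y) * V g y) \<and> (\<integral>y. k (x - y) * V g y \<partial>lborel) = Z g x"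
proof -
  have [measurable]: "g \<in> borel_measurable borel" using g by (simp add: sq_def)
  define U where "U y = (\<integral>\<^sup>+s. ennreal \<bar>indicator J s * g s * \<phi> s y\<bar> \<partial>lborel)" for y
  have [measurable]: "U \<in> borel_measurable borel" unfolding U_def by measurable
  have U0: "U y = 0" if "y \<notin> J" for y
  proof -
    have "ennreal \<bar>indicator J s * g s * \<phi> s y\<bar> = 0" for s
      using that by (cases "s \<in> J") (auto simp: \<phi>_outside)
    then show ?thesis unfolding U_def by (simp only:) simp
  qed
  have "(\<integral>\<^sup>+y. U y \<partial>lborel) = (\<integral>\<^sup>+s. \<integral>\<^sup>+y. ennreal \<bar>indicator J s * g s * \<phi> s y\<bar> \<partial>lborel \<partial>lborel)"
    unfolding U_def by (rule lborel_pair.Fubini') simp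
  also have "\<dots> < \<infinity>" using nn_double_\<phi>[OF g, of 1] by (auto intro: order_le_less_trans)
  finally have Ufin: "(\<integral>\<^sup>+y. U y \<partial>lborel) < \<infinity>" .
  have A1: "AE x in lborel. x \<in> J \<longrightarrow> (\<integral>\<^sup>+y. ennreal (k (x - y)) * U y \<partial>lborel) < \<infinity>"
    using U0 Ufin by (intro nn_integral_rk_AE_finite AB ab) auto
  \<comment> \<open>The step is written as \<open>pw (x - s) 0\<close> because this is measurable in
    the pair; then the exceptional set is measurable and the two almost everywhere quantifiers may
    be exchanged.\<close>
  have "AE s in lborel. AE x in lborel. s \<in> J \<longrightarrow> x \<in> J \<longrightarrow> (\<integral>y. k (x - y) * \<phi> s y \<partial>lborel) = pw (x - s) 0"
  proof (rule AE_I2)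
    fix s
    show "AE x in lborel. s \<in> J \<longrightarrow> x \<in> J \<longrightarrow> (\<integral>y. k (x - y) * \<phi> s y \<partial>lborel) = pw (x - s) 0"
    proof (cases "s \<in> J")
      case True
      then have "AE x in lborel. x \<in> J \<longrightarrow> (\<integral>y. k (x - y) * \<phi> s y \<partial>lborel) = indicator {s<..} x"
        using sol by (simp add: step_solution_def)
      then show ?thesis by eventually_elim (auto simp: pw_def indicator_def)
    next
      case False
      then show ?thesis by (intro AE_I2) blast
    qed
  qed
  then have A2: "AE x in lborel. AE s in lborel. s \<in> J \<longrightarrow> x \<in> J \<longrightarrow> (\<integral>y. k (x - y) * \<phi> s y \<partial>lborel) = pw (x - s) 0"
    by (subst (asm) lborel_pair.AE_commute) measurable
  show ?thesis using A1 A2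
  proof eventually_elim
    case (elim x)
    show ?case
    proof
      assume x: "x \<in> J"
      have int: "integrable (lborel \<Otimes>\<^sub>M lborel) (\<lambda>(s, y). k (x - y) * (indicator J s * g s * \<phi> s y))"
      proof (rule integrableI_bounded)
        have "(\<integral>\<^sup>+p. ennreal (norm (case p of (s, y) \<Rightarrow> k (x - y) * (indicator J s * g s * \<phi> s y))) \<partial>(lborel \<Otimes>\<^sub>M lborel))
          = (\<integral>\<^sup>+s. \<integral>\<^sup>+y. ennreal (k (x - y)) * ennreal \<bar>indicator J s * g s * \<phi> s y\<bar> \<partial>lborel \<partial>lborel)"
          by (subst lborel.nn_integral_fst[symmetric]) (simp_all add: abs_mult k_nonneg ennreal_mult')
        also have "\<dots> = (\<integral>\<^sup>+y. \<integral>\<^sup>+s. ennreal (k (x - y)) * ennreal \<bar>indicator J s * g s * \<phi> s y\<bar> \<partial>lborel \<partial>lborel)"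
          by (rule lborel_pair.Fubini'[symmetric]) simp
        also have "\<dots> = (\<integral>\<^sup>+y. ennreal (k (x - y)) * U y \<partial>lborel)"
          unfolding U_def by (simp add: nn_integral_cmult)
        also have "\<dots> < \<infinity>" using elim x by simp
        finally show "(\<integral>\<^sup>+p. ennreal (norm (case p of (s, y) \<Rightarrow> k (x - y) * (indicator J s * g s * \<phi> s y))) \<partial>(lborel \<Otimes>\<^sub>M lborel)) < \<infinity>" .
      qed measurable
      have eq: "(\<lambda>y. k (x - y) * V g y) = (\<lambda>y. \<integral>s. k (x - y) * (indicator J s * g s * \<phi> s y) \<partial>lborel)"
        unfolding V_def by simp
      show "integrable lborel (\<lambda>y. k (x - y) * V g y) \<and> (\<integral>y. k (x - y) * V g y \<partial>lborel) = Z g x"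
      proof
        show "integrable lborel (\<lambda>y. k (x - y) * V g y)"
          unfolding eq using lborel_pair.integrable_snd[OF int] by simp
        have "(\<integral>y. k (x - y) * V g y \<partial>lborel) = (\<integral>s. (\<integral>y. k (x - y) * (indicator J s * g s * \<phi> s y) \<partial>lborel) \<partial>lborel)"
          unfolding eq by (rule lborel_pair.Fubini_integral[OF int])
        also have "\<dots> = (\<integral>s. indicator J s * g s * (\<integral>y. k (x - y) * \<phi> s y \<partial>lborel) \<partial>lborel)"
        proof (intro Bochner_Integration.integral_cong refl)
          fix s
          show "(\<integral>y. k (x - y) * (indicator J s * g s * \<phi> s y) \<partial>lborel) = indicator J s * g s * (\<integral>y. k (x - y) * \<phi> s y \<partial>lborel)"
            by (subst integral_mult_right_zero[symmetric]) (simp only: mult_ac)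
        qed
        also have "\<dots> = Z g x"
          unfolding Z_def
        proof (rule integral_cong_AE)
          show "AE s in lborel. indicator J s * g s * (\<integral>y. k (x - y) * \<phi> s y \<partial>lborel) = indicator {0<..<x} s * g s"
            using elim(2) by eventually_elim (use x in \<open>auto simp: pw_def indicator_def\<close>)
        qed measurable
        finally show "(\<integral>y. k (x - y) * V g y \<partial>lborel) = Z g x" .
      qed
    qed
  qed
qed

section \<open>Positivity and injectivity\<close>

lemma sq_bounded:
  assumes [measurable]: "g \<in> borel_measurable borel" and g: "\<And>s. \<bar>g s\<bar> \<le> c"
  shows "sq g"
  unfolding sq_def
proof
  have "integrable lborel (\<lambda>s. c\<^sup>2 * indicator J s)"
    by (intro integrable_mult_right) simp
  then show "integrable lborel (\<lambda>s. indicator J s * (g s)\<^sup>2)"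
  proof (rule Bochner_Integration.integrable_bound)
    have "(g s)\<^sup>2 \<le> c\<^sup>2" for s using power_mono[OF g[of s], of 2] by simp
    then show "AE s in lborel. norm (indicator J s * (g s)\<^sup>2) \<le> norm (c\<^sup>2 * indicator J s)"
      by (intro AE_I2) (auto simp: indicator_def)
  qed simp
qed fact

definition CW :: real where "CW = 2 * (\<integral>s. indicator J s * (2 - s) powr (- a) \<partial>lborel) * 1 + 2 * R"

lemma E1_integrable: "integrable lborel (\<lambda>s. indicator J s * (2 - s) powr (- a))"
proof -
  have "(\<integral>\<^sup>+s. ennreal (indicator J s * (s powr (- 0) * (2 - s) powr (- a))) \<partial>lborel) < \<infinity>"
    using a by (intro nn_integral_edge_weight) auto
  then have "(\<integral>\<^sup>+s. ennreal (indicator J s * (2 - s) powr (- a)) \<partial>lborel) < \<infinity>"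
    by (rule order_le_less_trans[rotated]) (auto intro!: nn_integral_mono ennreal_leI simp: indicator_def)
  then show ?thesis by (intro integrableI_nonneg) auto
qed

lemma CW_nonneg: "0 \<le> CW"
  unfolding CW_def using consts_nonneg by (auto intro!: add_nonneg_nonneg)

text \<open>For bounded \<open>g\<close> the majorant can be integrated over \<open>s\<close> at
  fixed \<open>y\<close>. This leaves multiples of \<open>w y\<close> and of
  \<open>y powr (- a)\<close>, and the latter is at most \<open>2 * w y\<close> because
  \<open>(2 - y) powr b \<le> 2\<close>.\<close>

lemma V_bounded:
  assumes [measurable]: "g \<in> borel_measurable borel" and g: "\<And>s. \<bar>g s\<bar> \<le> c"
  shows "\<bar>V g y\<bar> \<le> c * C\<phi> * CW * w y"
proof (cases "y \<in> J")
  case False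
  then show ?thesis by (simp add: V_outside w_def)
next
  case True
  then have y: "0 < y" "y < 2" by auto
  have c: "0 \<le> c" using g[of 0] by simp
  define E1 where "E1 = (\<integral>s. indicator J s * (2 - s) powr (- a) \<partial>lborel)"
  have E1: "0 \<le> E1" by (simp add: E1_def)
  have nE1: "(\<integral>\<^sup>+s. ennreal (indicator J s * (2 - s) powr (- a)) \<partial>lborel) = ennreal E1"
    unfolding E1_def by (rule nn_integral_eq_integral[OF E1_integrable]) simp
  have one: "1 \<le> 2 * (2 - y) powr (- b)"
  proof -
    have "(2 - y) powr b \<le> 2 powr b" using y b by (intro powr_mono2) auto
    also have "\<dots> \<le> 2 powr 1" using a ab by (intro powr_mono) auto
    finally show ?thesis using y by (simp add: powr_minus field_simps)
  qed
  have "ennreal \<bar>V g y\<bar> \<le> (\<integral>\<^sup>+s. ennreal \<bar>indicator J s * g s * \<phi> s y\<bar> \<partial>lborel)"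
  proof (cases "integrable lborel (\<lambda>s. indicator J s * g s * \<phi> s y)")
    case True
    then show ?thesis unfolding V_def using integral_norm_bound_ennreal[OF True] by simp
  next
    \<comment> \<open>Where the defining integral does not exist, its value is 0 by convention, and
      the estimate is trivial.\<close>
    case False
    then have "V g y = 0" unfolding V_def by (rule not_integrable_integral_eq)
    then show ?thesis by simp
  qed
  also have "\<dots> \<le> (\<integral>\<^sup>+s. ennreal (c * C\<phi>) * (ennreal (w y) * ennreal (indicator J s * (2 - s) powr (- a))
       + ennreal (y powr (- a)) * (indicator J s * ennreal (r (y - s)))) \<partial>lborel)"
  proof (intro nn_integral_mono)
    fix s
    show "ennreal \<bar>indicator J s * g s * \<phi> s y\<bar> \<le> ennreal (c * C\<phi>) * (ennreal (w y) * ennreal (indicator J s * (2 - s) powr (- a))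
       + ennreal (y powr (- a)) * (indicator J s * ennreal (r (y - s))))"
    proof (cases "s \<in> J")
      case True
      have "\<bar>indicator J s * g s * \<phi> s y\<bar> \<le> c * (C\<phi> * step_maj a b s y)"
        using True g[of s] C\<phi>(2)[OF True, of y] c by (auto simp: abs_mult intro!: mult_mono)
      also have "\<dots> = (c * C\<phi>) * (w y * (2 - s) powr (- a) + y powr (- a) * r (y - s))"
        using y by (simp add: step_maj_def w_def algebra_simps)
      finally have "ennreal \<bar>indicator J s * g s * \<phi> s y\<bar> \<le> ennreal ((c * C\<phi>) * (w y * (2 - s) powr (- a) + y powr (- a) * r (y - s)))"
        by (rule ennreal_leI)
      also have "\<dots> = ennreal (c * C\<phi>) * (ennreal (w y) * ennreal (indicator J s * (2 - s) powr (- a))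
       + ennreal (y powr (- a)) * (indicator J s * ennreal (r (y - s))))"
        using True c C\<phi>(1) w_nonneg[of y] rk_nonneg[of 1 1 "1 - (a + b)" "y - s"]
        by (simp add: ennreal_mult' ennreal_plus)
      finally show ?thesis .
    qed simp
  qed
  also have "\<dots> = ennreal (c * C\<phi>) * (ennreal (w y) * ennreal E1
       + ennreal (y powr (- a)) * (\<integral>\<^sup>+s. indicator J s * ennreal (r (y - s)) \<partial>lborel))"
    by (simp add: nn_integral_cmult nn_integral_add nE1)
  also have "\<dots> \<le> ennreal (c * C\<phi>) * (ennreal (w y) * ennreal E1 + ennreal (y powr (- a)) * ennreal R)"
    using nn_r[OF True] by (intro mult_left_mono add_mono order_refl) (auto simp: r_sym[of y])
  also have "\<dots> = ennreal (c * C\<phi> * (w y * E1 + y powr (- a) * R))"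
    using c C\<phi>(1) w_nonneg[of y] E1 consts_nonneg by (simp add: ennreal_mult' ennreal_plus)
  finally have "\<bar>V g y\<bar> \<le> c * C\<phi> * (w y * E1 + y powr (- a) * R)"
    using c C\<phi>(1) w_nonneg[of y] E1 consts_nonneg by (subst (asm) ennreal_le_iff) auto
  also have "\<dots> \<le> c * C\<phi> * (CW * w y)"
  proof (intro mult_left_mono)
    have "y powr (- a) * R * 1 \<le> y powr (- a) * R * (2 * (2 - y) powr (- b))"
      using one consts_nonneg by (intro mult_left_mono) auto
    moreover have "0 \<le> E1 * w y" using E1 w_nonneg by simp
    ultimately show "w y * E1 + y powr (- a) * R \<le> CW * w y"
      unfolding CW_def E1_def[symmetric] using y by (simp add: w_def algebra_simps)
  qed (use c C\<phi>(1) in auto)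
  finally show ?thesis by (simp add: mult.assoc)
qed

lemma k_w_bounded: "\<exists>C\<ge>0. \<forall>x\<in>J. (\<integral>\<^sup>+y. ennreal (k (x - y)) * ennreal (w y) \<partial>lborel) \<le> ennreal C"
proof -
  obtain C where "\<forall>x\<in>J. (\<integral>\<^sup>+y. ennreal (k (x - y)) * ennreal (w y) \<partial>lborel) \<le> ennreal C"
    using bdd unfolding bounded_image_def w_def by blast
  moreover have "ennreal C \<le> ennreal (max 0 C)" by (intro ennreal_leI) simp
  ultimately show ?thesis by (intro exI[of _ "max 0 C"]) (auto intro: order_trans)
qed

text \<open>Integrating over \<open>y\<close> first leaves the image of \<open>w\<close>, which is
  bounded, and \<open>w\<close> itself is integrable.\<close>

lemma energy_pair_integrable:
  assumes [measurable]: "v \<in> borel_measurable borel" and v: "\<And>y. \<bar>v y\<bar> \<le> c * w y"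
  shows "integrable (lborel \<Otimes>\<^sub>M lborel) (\<lambda>(x, y). v x * (k (x - y) * v y))"
proof (rule integrableI_bounded)
  obtain C where C: "0 \<le> C" "\<And>x. x \<in> J \<Longrightarrow> (\<integral>\<^sup>+y. ennreal (k (x - y)) * ennreal (w y) \<partial>lborel) \<le> ennreal C"
    using k_w_bounded by blast
  have c: "0 \<le> c" using order_trans[OF abs_ge_zero v[of 1]] by (simp add: w_def)
  have "(\<integral>\<^sup>+p. ennreal (norm (case p of (x, y) \<Rightarrow> v x * (k (x - y) * v y))) \<partial>(lborel \<Otimes>\<^sub>M lborel))
     = (\<integral>\<^sup>+x. \<integral>\<^sup>+y. ennreal \<bar>v x * (k (x - y) * v y)\<bar> \<partial>lborel \<partial>lborel)"
    by (subst lborel.nn_integral_fst[symmetric]) simp_all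
  also have "\<dots> \<le> (\<integral>\<^sup>+x. \<integral>\<^sup>+y. ennreal (c\<^sup>2) * ennreal (w x) * (ennreal (k (x - y)) * ennreal (w y)) \<partial>lborel \<partial>lborel)"
  proof (intro nn_integral_mono)
    fix x y
    have "\<bar>v x * (k (x - y) * v y)\<bar> \<le> (c * w x) * (k (x - y) * (c * w y))"
      using v[of x] v[of y] k_nonneg[of "x - y"] c w_nonneg
      by (auto simp: abs_mult intro!: mult_mono mult_nonneg_nonneg)
    also have "\<dots> = c\<^sup>2 * w x * (k (x - y) * w y)" by (simp add: power2_eq_square)
    finally show "ennreal \<bar>v x * (k (x - y) * v y)\<bar> \<le> ennreal (c\<^sup>2) * ennreal (w x) * (ennreal (k (x - y)) * ennreal (w y))"
      using k_nonneg[of "x - y"] w_nonneg by (simp add: ennreal_mult'[symmetric] ennreal_leI)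
  qed
  also have "\<dots> = (\<integral>\<^sup>+x. ennreal (c\<^sup>2) * ennreal (w x) * (\<integral>\<^sup>+y. ennreal (k (x - y)) * ennreal (w y) \<partial>lborel) \<partial>lborel)"
    by (simp add: nn_integral_cmult)
  also have "\<dots> \<le> (\<integral>\<^sup>+x. ennreal (c\<^sup>2) * ennreal (w x) * ennreal C \<partial>lborel)"
  proof (intro nn_integral_mono)
    fix x
    show "ennreal (c\<^sup>2) * ennreal (w x) * (\<integral>\<^sup>+y. ennreal (k (x - y)) * ennreal (w y) \<partial>lborel) \<le> ennreal (c\<^sup>2) * ennreal (w x) * ennreal C"
      using C(2)[of x] by (cases "x \<in> J") (auto simp: w_def intro!: mult_left_mono)
  qed
  also have "\<dots> < \<infinity>"
    by (simp add: nn_integral_cmult nn_integral_multc nn_W ennreal_mult_less_top)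
  finally show "(\<integral>\<^sup>+p. ennreal (norm (case p of (x, y) \<Rightarrow> v x * (k (x - y) * v y))) \<partial>(lborel \<Otimes>\<^sub>M lborel)) < \<infinity>" .
qed measurable

lemma rk_sum_sym: "k d + k (- d) = (A + B) * rk 1 1 (a + b) d"
  by (simp add: rk_def algebra_simps)

text \<open>
  Only the even part of the kernel contributes to the energy; by the factorization with both exponents
  equal to half the order, the even part is a superposition of rank-one squares.
\<close>

lemma energy_nonneg:
  assumes [measurable]: "v \<in> borel_measurable borel" and v: "\<And>y. \<bar>v y\<bar> \<le> c * w y"
  shows "0 \<le> (\<integral>x. v x * (\<integral>y. k (x - y) * v y \<partial>lborel) \<partial>lborel)"
proof -
  let ?P = "lborel \<Otimes>\<^sub>M lborel :: (real \<times> real) measure"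
  \<comment> \<open>Equal exponents make the two Beta factors of \<open>sonine_kernel\<close> equal,
    so that the factorized kernel is even.\<close>
  define e where "e = (a + b) / 2"
  have e: "0 < e" "e + e < 1" "a + b = e + e" using ab by (auto simp: e_def)
  define \<beta> where "\<beta> = Beta e (1 - (e + e))"
  have \<beta>: "0 < \<beta>" using e by (auto simp: \<beta>_def intro!: Beta_pos)
  \<comment> \<open>The weight compensates the factor \<open>x powr (- e) * y powr (- e)\<close>
    that the factorization produces.\<close>
  define f where "f x = v x * x powr e" for x
  define H where "H p t = f (fst p) * f (snd p) * (pw (fst p - t) (e - 1) * pw (snd p - t) (e - 1) * pw t (- (e + e)))" for p t
  have v0: "v y = 0" if "y \<le> 0" for y using v[of y] that by (simp add: w_def)
  have [measurable]: "f \<in> borel_measurable borel" unfolding f_def by measurable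
  have Hm: "case_prod H \<in> borel_measurable (?P \<Otimes>\<^sub>M lborel)" unfolding H_def by measurable
  interpret PP: pair_sigma_finite ?P lborel ..
  have int1: "integrable ?P (\<lambda>(x, y). v x * (k (x - y) * v y))"
    by (rule energy_pair_integrable[OF assms])
  \<comment> \<open>The same energy with the variables exchanged; the sum of both versions contains
    the kernel only through its even part.\<close>
  have int2: "integrable ?P (\<lambda>(x, y). v y * (k (y - x) * v x))"
    using lborel_pair.integrable_product_swap[OF int1] by (simp add: case_prod_beta)
  have pt: "v x * (k (x - y) * v y) + v y * (k (y - x) * v x) = (A + B) * (v x * v y * rk 1 1 (a + b) (x - y))" for x y
  proof -
    have "v x * (k (x - y) * v y) + v y * (k (y - x) * v x) = v x * v y * (k (x - y) + k (- (x - y)))"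
      by (simp add: algebra_simps)
    then show ?thesis unfolding rk_sum_sym by (simp add: mult_ac)
  qed
  have int3: "integrable ?P (\<lambda>(x, y). (A + B) * (v x * v y * rk 1 1 (a + b) (x - y)))"
  proof -
    have "(\<lambda>p. (case p of (x, y) \<Rightarrow> v x * (k (x - y) * v y)) + (case p of (x, y) \<Rightarrow> v y * (k (y - x) * v x)))
       = (\<lambda>(x, y). (A + B) * (v x * v y * rk 1 1 (a + b) (x - y)))" by (auto simp: fun_eq_iff pt)
    then show ?thesis using Bochner_Integration.integrable_add[OF int1 int2] by simp
  qed
  have q: "(\<integral>p. (case p of (x, y) \<Rightarrow> v x * (k (x - y) * v y)) \<partial>?P) = (\<integral>x. v x * (\<integral>y. k (x - y) * v y \<partial>lborel) \<partial>lborel)"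
    using lborel_pair.integral_fst'[OF int1] by simp
  have q2: "(\<integral>p. (case p of (x, y) \<Rightarrow> v y * (k (y - x) * v x)) \<partial>?P) = (\<integral>p. (case p of (x, y) \<Rightarrow> v x * (k (x - y) * v y)) \<partial>?P)"
    using lborel_pair.integral_product_swap[of "\<lambda>(x, y). v x * (k (x - y) * v y)"] int1 by simp
  have "2 * (\<integral>x. v x * (\<integral>y. k (x - y) * v y \<partial>lborel) \<partial>lborel)
      = (\<integral>p. (case p of (x, y) \<Rightarrow> v x * (k (x - y) * v y)) + (case p of (x, y) \<Rightarrow> v y * (k (y - x) * v x)) \<partial>?P)"
    by (subst Bochner_Integration.integral_add[OF int1 int2]) (simp add: q2 q)
  also have "\<dots> = (\<integral>p. (A + B) * (case p of (x, y) \<Rightarrow> v x * v y * rk 1 1 (a + b) (x - y)) \<partial>?P)"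
  proof (intro Bochner_Integration.integral_cong refl)
    fix p :: "real \<times> real"
    show "(case p of (x, y) \<Rightarrow> v x * (k (x - y) * v y)) + (case p of (x, y) \<Rightarrow> v y * (k (y - x) * v x))
      = (A + B) * (case p of (x, y) \<Rightarrow> v x * v y * rk 1 1 (a + b) (x - y))"
      by (simp add: case_prod_beta pt)
  qed
  finally have two: "2 * (\<integral>x. v x * (\<integral>y. k (x - y) * v y \<partial>lborel) \<partial>lborel)
      = (A + B) * (\<integral>p. (case p of (x, y) \<Rightarrow> v x * v y * rk 1 1 (a + b) (x - y)) \<partial>?P)"
    by simp
  show ?thesis
  proof (cases "A + B = 0")
    case True
    then show ?thesis using two by simp
  next
    case False
    then have AB0: "0 < A + B" using AB by simp
    have int4: "integrable ?P (\<lambda>(x, y). v x * v y * rk 1 1 (a + b) (x - y))"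
    proof -
      have "integrable ?P (\<lambda>p. (1 / (A + B)) * (case p of (x, y) \<Rightarrow> (A + B) * (v x * v y * rk 1 1 (a + b) (x - y))))"
        by (intro integrable_mult_right int3)
      moreover have "(\<lambda>p. (1 / (A + B)) * (case p of (x, y) \<Rightarrow> (A + B) * (v x * v y * rk 1 1 (a + b) (x - y))))
         = (\<lambda>(x, y). v x * v y * rk 1 1 (a + b) (x - y))" using AB0 by (auto simp: fun_eq_iff)
      ultimately show ?thesis by simp
    qed
    have inner: "(\<integral>\<^sup>+t. ennreal (pw (x - t) (e - 1) * pw (y - t) (e - 1) * pw t (- (e + e))) \<partial>lborel)
        = ennreal (\<beta> * (x powr (- e) * y powr (- e) * rk 1 1 (a + b) (x - y)))" if "0 < x" "0 < y" "x \<noteq> y" for x y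
    proof -
      have rks: "rk \<beta> \<beta> (e + e) d = \<beta> * rk 1 1 (e + e) d" for d
        using rk_scale[of \<beta> 1 1 "e + e" d] by simp
      show ?thesis
        using sonine_kernel[OF e(1) e(1) e(2) that, folded \<beta>_def] unfolding rks e(3) by (simp only: mult_ac)
    qed
    have off: "AE y in lborel. fst (x, y) \<noteq> snd (x, y)" for x :: real
      using AE_lborel_singleton[of x] by eventually_elim auto
    \<comment> \<open>The factorization of the kernel is available off the diagonal, which is a null
      set of the plane.\<close>
    have neq: "AE p in ?P. fst p \<noteq> snd p"
    proof (rule lborel_pair.AE_pair_measure)
      show "{x \<in> space ?P. fst x \<noteq> snd x} \<in> sets ?P" by measurable
      show "AE x in lborel. AE y in lborel. fst (x, y) \<noteq> snd (x, y :: real)"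
        by (rule always_eventually, rule allI, rule off)
    qed
    have nnH: "(\<integral>\<^sup>+t. ennreal \<bar>H p t\<bar> \<partial>lborel) = ennreal (\<beta> * \<bar>case p of (x, y) \<Rightarrow> v x * v y * rk 1 1 (a + b) (x - y)\<bar>)"
      and intH: "integrable lborel (H p)"
      and HH: "(\<integral>t. H p t \<partial>lborel) = \<beta> * (case p of (x, y) \<Rightarrow> v x * v y * rk 1 1 (a + b) (x - y))"
      if "fst p \<noteq> snd p" for p
    proof -
      obtain x y where p: "p = (x, y)" by force
      let ?g = "\<lambda>t. pw (x - t) (e - 1) * pw (y - t) (e - 1) * pw t (- (e + e))"
      have all: "(\<integral>\<^sup>+t. ennreal \<bar>H p t\<bar> \<partial>lborel) = ennreal (\<beta> * \<bar>case p of (x, y) \<Rightarrow> v x * v y * rk 1 1 (a + b) (x - y)\<bar>)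
       \<and> integrable lborel (H p) \<and> (\<integral>t. H p t \<partial>lborel) = \<beta> * (case p of (x, y) \<Rightarrow> v x * v y * rk 1 1 (a + b) (x - y))"
      proof (cases "0 < x \<and> 0 < y")
        case True
        have ne: "x \<noteq> y" using that p by simp
        have G: "(\<integral>\<^sup>+t. ennreal (?g t) \<partial>lborel) = ennreal (\<beta> * (x powr (- e) * y powr (- e) * rk 1 1 (a + b) (x - y)))"
          using inner True ne by simp
        have gi: "integrable lborel ?g" using G by (intro integrableI_nonneg) auto
        have g0: "0 \<le> \<beta> * (x powr (- e) * y powr (- e) * rk 1 1 (a + b) (x - y))"
          using \<beta> by (intro mult_nonneg_nonneg rk_nonneg) auto
        have gI: "(\<integral>t. ?g t \<partial>lborel) = \<beta> * (x powr (- e) * y powr (- e) * rk 1 1 (a + b) (x - y))"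
          using G g0 by (subst integral_eq_nn_integral) auto
        have Hp: "H p t = f x * f y * ?g t" for t by (simp add: H_def p)
        have ff: "f x * f y * (\<beta> * (x powr (- e) * y powr (- e) * rk 1 1 (a + b) (x - y))) = \<beta> * (v x * v y * rk 1 1 (a + b) (x - y))"
          using True by (simp add: f_def powr_minus field_simps)
        have ffa: "\<bar>f x * f y\<bar> * (\<beta> * (x powr (- e) * y powr (- e) * rk 1 1 (a + b) (x - y))) = \<beta> * \<bar>v x * v y * rk 1 1 (a + b) (x - y)\<bar>"
        proof -
          have "\<bar>f x * f y\<bar> * (\<beta> * (x powr (- e) * y powr (- e) * rk 1 1 (a + b) (x - y)))
             = \<bar>f x * f y * (\<beta> * (x powr (- e) * y powr (- e) * rk 1 1 (a + b) (x - y)))\<bar>"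
            by (simp only: abs_mult[of "f x * f y"] abs_of_nonneg[OF g0])
          also have "\<dots> = \<beta> * \<bar>v x * v y * rk 1 1 (a + b) (x - y)\<bar>"
            unfolding ff using \<beta> by (simp only: abs_mult[of \<beta>] abs_of_pos)
          finally show ?thesis .
        qed
        have "(\<integral>\<^sup>+t. ennreal \<bar>H p t\<bar> \<partial>lborel) = (\<integral>\<^sup>+t. ennreal \<bar>f x * f y\<bar> * ennreal (?g t) \<partial>lborel)"
          unfolding Hp by (intro nn_integral_cong) (simp add: abs_mult ennreal_mult'[symmetric] mult.assoc)
        also have "\<dots> = ennreal \<bar>f x * f y\<bar> * ennreal (\<beta> * (x powr (- e) * y powr (- e) * rk 1 1 (a + b) (x - y)))"
          by (subst nn_integral_cmult) (simp_all add: G[simplified])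
        also have "\<dots> = ennreal (\<beta> * \<bar>case p of (x, y) \<Rightarrow> v x * v y * rk 1 1 (a + b) (x - y)\<bar>)"
          unfolding ffa[symmetric] p prod.case by (rule ennreal_mult'[symmetric]) simp
        finally have n: "(\<integral>\<^sup>+t. ennreal \<bar>H p t\<bar> \<partial>lborel) = ennreal (\<beta> * \<bar>case p of (x, y) \<Rightarrow> v x * v y * rk 1 1 (a + b) (x - y)\<bar>)" .
        have HpF: "H p = (\<lambda>t. f x * f y * ?g t)" by (rule ext) (rule Hp)
        have i: "integrable lborel (H p)" unfolding HpF by (intro integrable_mult_right gi)
        have "(\<integral>t. H p t \<partial>lborel) = \<beta> * (case p of (x, y) \<Rightarrow> v x * v y * rk 1 1 (a + b) (x - y))"
          unfolding Hp by (simp only: integral_mult_right_zero gI ff p prod.case)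
        then show ?thesis using n i by blast
      next
        case False
        then have "f x * f y = 0" "v x * v y = 0" by (auto simp: f_def v0)
        then have H0: "H p = (\<lambda>_. 0)" by (auto simp: H_def p fun_eq_iff)
        moreover have "(case p of (x, y) \<Rightarrow> v x * v y * rk 1 1 (a + b) (x - y)) = 0"
          using \<open>v x * v y = 0\<close> unfolding p prod.case by (simp only: mult_zero_left)
        ultimately show ?thesis by (simp only:) simp
      qed
      then show "(\<integral>\<^sup>+t. ennreal \<bar>H p t\<bar> \<partial>lborel) = ennreal (\<beta> * \<bar>case p of (x, y) \<Rightarrow> v x * v y * rk 1 1 (a + b) (x - y)\<bar>)"
        "integrable lborel (H p)"
        "(\<integral>t. H p t \<partial>lborel) = \<beta> * (case p of (x, y) \<Rightarrow> v x * v y * rk 1 1 (a + b) (x - y))" by auto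
    qed
    have int: "integrable (?P \<Otimes>\<^sub>M lborel) (\<lambda>(p, t). H p t)"
    proof (rule integrableI_bounded)
      have "(\<integral>\<^sup>+z. ennreal (norm (case z of (p, t) \<Rightarrow> H p t)) \<partial>(?P \<Otimes>\<^sub>M lborel)) = (\<integral>\<^sup>+p. \<integral>\<^sup>+t. ennreal \<bar>H p t\<bar> \<partial>lborel \<partial>?P)"
        using Hm by (subst lborel.nn_integral_fst[symmetric]) (simp_all add: case_prod_beta)
      also have "\<dots> = (\<integral>\<^sup>+p. ennreal (\<beta> * \<bar>case p of (x, y) \<Rightarrow> v x * v y * rk 1 1 (a + b) (x - y)\<bar>) \<partial>?P)"
      proof (rule nn_integral_cong_AE)
        show "AE p in ?P. (\<integral>\<^sup>+t. ennreal \<bar>H p t\<bar> \<partial>lborel) = ennreal (\<beta> * \<bar>case p of (x, y) \<Rightarrow> v x * v y * rk 1 1 (a + b) (x - y)\<bar>)"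
          using neq by eventually_elim (rule nnH)
      qed
      also have "\<dots> < \<infinity>"
      proof -
        have "integrable ?P (\<lambda>p. \<beta> * (case p of (x, y) \<Rightarrow> v x * v y * rk 1 1 (a + b) (x - y)))"
          by (intro integrable_mult_right int4)
        then show ?thesis using \<beta> unfolding integrable_iff_bounded by (simp add: abs_mult)
      qed
      finally show "(\<integral>\<^sup>+z. ennreal (norm (case z of (p, t) \<Rightarrow> H p t)) \<partial>(?P \<Otimes>\<^sub>M lborel)) < \<infinity>" .
    qed (use Hm in simp)
    have "0 \<le> (\<integral>t. (\<integral>p. H p t \<partial>?P) \<partial>lborel)"
    proof (rule Bochner_Integration.integral_nonneg)
      fix t
      show "0 \<le> (\<integral>p. H p t \<partial>?P)"
      \<comment> \<open>At fixed \<open>t\<close> the integrand is a product of one function of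
        \<open>x\<close> and the same function of \<open>y\<close>, so the double integral is a
        nonnegative weight times a square. For a section that is not integrable the value is 0 by
        convention, which satisfies the inequality too.\<close>
      proof (cases "integrable ?P (\<lambda>p. H p t)")
        case True
        let ?F = "\<lambda>x. f x * pw (x - t) (e - 1)"
        have "(\<integral>p. H p t \<partial>?P) = (\<integral>x. \<integral>y. H (x, y) t \<partial>lborel \<partial>lborel)"
          by (rule lborel_pair.integral_fst'[OF True, symmetric])
        also have "\<dots> = (\<integral>x. \<integral>y. (pw t (- (e + e)) * ?F x) * ?F y \<partial>lborel \<partial>lborel)"
          by (intro Bochner_Integration.integral_cong refl) (simp add: H_def mult_ac)
        also have "\<dots> = pw t (- (e + e)) * ((\<integral>x. ?F x \<partial>lborel) * (\<integral>y. ?F y \<partial>lborel))"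
          unfolding integral_mult_right_zero integral_mult_left_zero by (simp only: mult.assoc)
        also have "\<dots> \<ge> 0" by (rule mult_nonneg_nonneg[OF pw_nonneg zero_le_square])
        finally show ?thesis .
      qed (simp add: not_integrable_integral_eq)
    qed
    also have "\<dots> = (\<integral>p. (\<integral>t. H p t \<partial>lborel) \<partial>?P)"
      by (rule PP.Fubini_integral[OF int])
    also have "\<dots> = (\<integral>p. \<beta> * (case p of (x, y) \<Rightarrow> v x * v y * rk 1 1 (a + b) (x - y)) \<partial>?P)"
    proof (rule integral_cong_AE)
      show "AE p in ?P. (\<integral>t. H p t \<partial>lborel) = \<beta> * (case p of (x, y) \<Rightarrow> v x * v y * rk 1 1 (a + b) (x - y))"
        using neq by eventually_elim (rule HH)
    qed (use Hm in measurable)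
    also have "\<dots> = \<beta> * (\<integral>p. (case p of (x, y) \<Rightarrow> v x * v y * rk 1 1 (a + b) (x - y)) \<partial>?P)"
      by (rule integral_mult_right_zero)
    finally have "0 \<le> (\<integral>p. (case p of (x, y) \<Rightarrow> v x * v y * rk 1 1 (a + b) (x - y)) \<partial>?P)"
      using \<beta> by (simp add: zero_le_mult_iff)
    then have "0 \<le> 2 * (\<integral>x. v x * (\<integral>y. k (x - y) * v y \<partial>lborel) \<partial>lborel)"
      unfolding two using AB0 by simp
    then show ?thesis by simp
  qed
qed

section \<open>From bounded to square integrable densities\<close>

lemma sq_measurable: "sq g \<Longrightarrow> g \<in> borel_measurable borel"
  by (simp add: sq_def)

lemma sq_lincomb:
  assumes f: "sq f" and g: "sq g"
  shows "sq (\<lambda>s. p * f s + q * g s)"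
proof -
  have [measurable]: "f \<in> borel_measurable borel" "g \<in> borel_measurable borel"
    using f g by (auto simp: sq_def)
  have "integrable lborel (\<lambda>s. 2 * p\<^sup>2 * (indicator J s * (f s)\<^sup>2) + 2 * q\<^sup>2 * (indicator J s * (g s)\<^sup>2))"
    using f g by (intro Bochner_Integration.integrable_add integrable_mult_right) (auto simp: sq_def)
  then have "integrable lborel (\<lambda>s. indicator J s * (p * f s + q * g s)\<^sup>2)"
  proof (rule Bochner_Integration.integrable_bound)
    have "(p * f s + q * g s)\<^sup>2 \<le> 2 * p\<^sup>2 * (f s)\<^sup>2 + 2 * q\<^sup>2 * (g s)\<^sup>2" for s
      using zero_le_power2[of "p * f s - q * g s"] by (simp add: power2_eq_square algebra_simps)
    then show "AE s in lborel. norm (indicator J s * (p * f s + q * g s)\<^sup>2)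
       \<le> norm (2 * p\<^sup>2 * (indicator J s * (f s)\<^sup>2) + 2 * q\<^sup>2 * (indicator J s * (g s)\<^sup>2))"
      by (intro AE_I2) (auto simp: indicator_def)
  qed simp
  then show ?thesis by (simp add: sq_def)
qed

text \<open>The identity holds only almost everywhere, since additivity of the integral needs both
  defining integrals at \<open>y\<close> to exist.\<close>

lemma V_lincomb:
  assumes f: "sq f" and g: "sq g"
  shows "AE y in lborel. V (\<lambda>s. p * f s + q * g s) y = p * V f y + q * V g y"
  using V_AE_integrable[OF f] V_AE_integrable[OF g]
proof eventually_elim
  case (elim y)
  have "V (\<lambda>s. p * f s + q * g s) y = (\<integral>s. p * (indicator J s * f s * \<phi> s y) + q * (indicator J s * g s * \<phi> s y) \<partial>lborel)"
    unfolding V_def by (intro Bochner_Integration.integral_cong refl) (simp add: algebra_simps)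
  also have "\<dots> = p * V f y + q * V g y"
    unfolding V_def using elim by simp
  finally show ?case .
qed

lemma sq_abs_integral:
  assumes g: "sq g"
  shows "integrable lborel (\<lambda>s. indicator J s * g s)" "(\<integral>s. indicator J s * \<bar>g s\<bar> \<partial>lborel) \<le> 2 * sqrt (n2 g)"
proof -
  have [measurable]: "g \<in> borel_measurable borel" using g by (simp add: sq_def)
  have J: "integrable lborel (indicator J :: real \<Rightarrow> real)" by simp
  have Jm: "(\<integral>s. indicator J s \<partial>lborel) = (2::real)" by simp
  have bi: "integrable lborel (\<lambda>s. 1 / (2 * l) * (indicator J s * (g s)\<^sup>2) + l / 2 * indicator J s)" for l
    using g J by (intro Bochner_Integration.integrable_add integrable_mult_right) (auto simp: sq_def)
  have pt: "indicator J s * \<bar>g s\<bar> \<le> 1 / (2 * l) * (indicator J s * (g s)\<^sup>2) + l / 2 * indicator J s" if "0 < l" for l s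
    using am_gm_scaled[OF that, of "\<bar>g s\<bar>" 1] by (auto simp: indicator_def)
  have ia: "integrable lborel (\<lambda>s. indicator J s * \<bar>g s\<bar>)"
  proof (rule Bochner_Integration.integrable_bound[OF bi[of 1]])
    show "AE s in lborel. norm (indicator J s * \<bar>g s\<bar>) \<le> norm (1 / (2 * 1) * (indicator J s * (g s)\<^sup>2) + 1 / 2 * indicator J s)"
    proof (rule AE_I2)
      fix s
      have "norm (indicator J s * \<bar>g s\<bar>) = indicator J s * \<bar>g s\<bar>" by simp
      also have "\<dots> \<le> 1 / (2 * 1) * (indicator J s * (g s)\<^sup>2) + 1 / 2 * indicator J s" by (rule pt) simp
      also have "\<dots> \<le> norm \<dots>" by simp
      finally show "norm (indicator J s * \<bar>g s\<bar>) \<le> norm (1 / (2 * 1) * (indicator J s * (g s)\<^sup>2) + 1 / 2 * indicator J s)" .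
    qed
  qed simp
  show "integrable lborel (\<lambda>s. indicator J s * g s)"
    by (rule Bochner_Integration.integrable_bound[OF ia]) (auto simp: abs_mult)
  have bnd: "(\<integral>s. indicator J s * \<bar>g s\<bar> \<partial>lborel) \<le> n2 g / (2 * l) + l" if l: "0 < l" for l
  proof -
    have "(\<integral>s. indicator J s * \<bar>g s\<bar> \<partial>lborel) \<le> (\<integral>s. 1 / (2 * l) * (indicator J s * (g s)\<^sup>2) + l / 2 * indicator J s \<partial>lborel)"
      by (intro integral_mono ia bi pt l)
    also have "\<dots> = 1 / (2 * l) * n2 g + l / 2 * 2"
      unfolding n2_def using g J by (subst Bochner_Integration.integral_add) (auto simp: sq_def)
    finally show ?thesis by simp
  qed
  show "(\<integral>s. indicator J s * \<bar>g s\<bar> \<partial>lborel) \<le> 2 * sqrt (n2 g)"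
  proof (cases "n2 g = 0")
    case True
    then have "(\<integral>s. indicator J s * \<bar>g s\<bar> \<partial>lborel) \<le> 0 + l" if "0 < l" for l
      using bnd[OF that] by simp
    then have "(\<integral>s. indicator J s * \<bar>g s\<bar> \<partial>lborel) \<le> 0" by (rule field_le_epsilon)
    then show ?thesis using True by simp
  next
    case False
    then have p: "0 < n2 g" using n2_nonneg[of g] by simp
    have "n2 g / (2 * sqrt (n2 g)) = sqrt (n2 g) / 2"
      using p by (simp add: field_simps)
    \<comment> \<open>This choice of \<open>l\<close> gives the factor 3/2, which is rounded up to
      2.\<close>
    from bnd[of "sqrt (n2 g)", unfolded this] show ?thesis
      using p real_sqrt_gt_zero[OF p] by linarith
  qed
qed

lemma Z_integrable: "sq g \<Longrightarrow> x \<in> J \<Longrightarrow> integrable lborel (\<lambda>s. indicator {0<..<x} s * g s)"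
  by (rule Bochner_Integration.integrable_bound[OF sq_abs_integral(1)[of g]])
    (auto simp: sq_def indicator_def)

lemma Z_abs:
  assumes g: "sq g" and x: "x \<in> J"
  shows "\<bar>Z g x\<bar> \<le> 2 * sqrt (n2 g)"
proof -
  have ia: "integrable lborel (\<lambda>s. indicator J s * \<bar>g s\<bar>)"
    using integrable_abs[OF sq_abs_integral(1)[OF g]] by (simp add: abs_mult)
  have "\<bar>Z g x\<bar> \<le> (\<integral>s. \<bar>indicator {0<..<x} s * g s\<bar> \<partial>lborel)"
    unfolding Z_def by (rule integral_abs_bound)
  also have "\<dots> \<le> (\<integral>s. indicator J s * \<bar>g s\<bar> \<partial>lborel)"
    using x by (intro integral_mono integrable_abs Z_integrable[OF g x] ia) (auto simp: indicator_def)
  also have "\<dots> \<le> 2 * sqrt (n2 g)" by (rule sq_abs_integral(2)[OF g])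
  finally show ?thesis .
qed

lemma Z_lincomb: "sq f \<Longrightarrow> sq g \<Longrightarrow> x \<in> J \<Longrightarrow> Z (\<lambda>s. p * f s + q * g s) x = p * Z f x + q * Z g x"
  unfolding Z_def using Z_integrable[of f x] Z_integrable[of g x]
  by (simp add: distrib_left mult.left_commute[of _ p] mult.left_commute[of _ q])

lemma Z_measurable [measurable]:
  assumes [measurable]: "g \<in> borel_measurable borel"
  shows "Z g \<in> borel_measurable borel"
proof -
  have "Z g = (\<lambda>x. \<integral>s. pw (x - s) 0 * pw s 0 * g s \<partial>lborel)"
    unfolding Z_def by (auto simp: fun_eq_iff pw_def indicator_def intro!: Bochner_Integration.integral_cong)
  then show ?thesis by simp
qed

text \<open>An estimate of L^1 against L^infinity, by \<open>V_L1\<close> for the first factor and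
  \<open>Z_abs\<close> for the second. It makes the pairing continuous in both densities, which the
  truncation argument uses.\<close>

lemma VZ_integrable:
  assumes f: "sq f" and g: "sq g"
  shows "integrable lborel (\<lambda>x. V f x * Z g x)" "\<bar>\<integral>x. V f x * Z g x \<partial>lborel\<bar> \<le> 2 * CV * sqrt (n2 f) * sqrt (n2 g)"
proof -
  note [measurable] = sq_measurable[OF f] sq_measurable[OF g]
  have i1: "integrable lborel (\<lambda>x. 2 * sqrt (n2 g) * \<bar>V f x\<bar>)"
    by (intro integrable_mult_right integrable_abs V_integrable f)
  have pt: "\<bar>V f x * Z g x\<bar> \<le> 2 * sqrt (n2 g) * \<bar>V f x\<bar>" for x
  proof (cases "x \<in> J")
    case True
    then show ?thesis using mult_right_mono[OF Z_abs[OF g True], of "\<bar>V f x\<bar>"] by (simp add: abs_mult mult.commute)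
  qed (simp add: V_outside)
  show i2: "integrable lborel (\<lambda>x. V f x * Z g x)"
  proof (rule Bochner_Integration.integrable_bound[OF i1])
    show "AE x in lborel. norm (V f x * Z g x) \<le> norm (2 * sqrt (n2 g) * \<bar>V f x\<bar>)"
      using pt n2_nonneg[of g] by (intro AE_I2) (simp add: abs_mult)
  qed simp
  have "\<bar>\<integral>x. V f x * Z g x \<partial>lborel\<bar> \<le> (\<integral>x. \<bar>V f x * Z g x\<bar> \<partial>lborel)" by (rule integral_abs_bound)
  also have "\<dots> \<le> (\<integral>x. 2 * sqrt (n2 g) * \<bar>V f x\<bar> \<partial>lborel)"
    by (intro integral_mono integrable_abs i1 i2 pt)
  also have "\<dots> = 2 * sqrt (n2 g) * (\<integral>x. \<bar>V f x\<bar> \<partial>lborel)" by (rule integral_mult_right_zero)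
  also have "\<dots> \<le> 2 * sqrt (n2 g) * (CV * sqrt (n2 f))"
    using n2_nonneg[of g] by (intro mult_left_mono V_L1 f) auto
  finally show "\<bar>\<integral>x. V f x * Z g x \<partial>lborel\<bar> \<le> 2 * CV * sqrt (n2 f) * sqrt (n2 g)" by (simp add: mult_ac)
qed

lemma VZ_nonneg_bounded:
  assumes [measurable]: "g \<in> borel_measurable borel" and g: "\<And>s. \<bar>g s\<bar> \<le> c"
  shows "0 \<le> (\<integral>x. V g x * Z g x \<partial>lborel)"
proof -
  have s: "sq g" by (rule sq_bounded[OF assms])
  have "0 \<le> (\<integral>x. V g x * (\<integral>y. k (x - y) * V g y \<partial>lborel) \<partial>lborel)"
    by (rule energy_nonneg[OF _ V_bounded[OF assms]]) simp
  also have "\<dots> = (\<integral>x. V g x * Z g x \<partial>lborel)"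
  proof (rule integral_cong_AE)
    show "AE x in lborel. V g x * (\<integral>y. k (x - y) * V g y \<partial>lborel) = V g x * Z g x"
      using V_solves[OF s]
    proof eventually_elim
      case (elim x)
      then show ?case by (cases "x \<in> J") (auto simp: V_outside)
    qed
  qed measurable
  finally show ?thesis .
qed

text \<open>Bounded densities are settled by the energy. Truncating \<open>g\<close> at height
  \<open>n\<close> leaves an error \<open>d n\<close> whose norm tends to 0 by dominated
  convergence, and the pairing changes only by a multiple of that norm.\<close>

lemma VZ_nonneg:
  assumes g: "sq g"
  shows "0 \<le> (\<integral>x. V g x * Z g x \<partial>lborel)"
proof -
  note [measurable] = sq_measurable[OF g]
  define t where "t n s = max (- real n) (min (real n) (g s))" for n :: nat and s
  have [measurable]: "t n \<in> borel_measurable borel" for n unfolding t_def by measurable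
  have tb: "\<bar>t n s\<bar> \<le> real n" for n s by (auto simp: t_def)
  have ts: "sq (t n)" for n by (rule sq_bounded[OF _ tb]) simp
  define d where "d n s = 1 * g s + (- 1) * t n s" for n s
  have ds: "sq (d n)" for n unfolding d_def[abs_def] by (rule sq_lincomb[OF g ts])
  note [measurable] = sq_measurable[OF ds]
  have tle: "\<bar>t n s\<bar> \<le> \<bar>g s\<bar>" for n s by (auto simp: t_def max_def min_def)
  have dle: "\<bar>d n s\<bar> \<le> \<bar>g s\<bar>" for n s by (auto simp: d_def t_def max_def min_def)
  have n2t: "n2 (t n) \<le> n2 g" for n
    unfolding n2_def using ts[of n] g
    by (intro integral_mono) (auto simp: sq_def indicator_def abs_le_square_iff[symmetric] tle)
  have lim: "(\<lambda>n. n2 (d n)) \<longlonglongrightarrow> 0"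
  proof -
    have "(\<lambda>n. n2 (d n)) \<longlonglongrightarrow> (\<integral>s. 0 \<partial>(lborel :: real measure))"
      unfolding n2_def
    proof (rule integral_dominated_convergence)
      show "integrable lborel (\<lambda>s. indicator J s * (g s)\<^sup>2)" using g by (simp add: sq_def)
      show "AE s in lborel. norm (indicator J s * (d n s)\<^sup>2) \<le> indicator J s * (g s)\<^sup>2" for n
        using dle by (intro AE_I2) (auto simp: indicator_def abs_le_square_iff[symmetric])
      show "AE s in lborel. (\<lambda>n. indicator J s * (d n s)\<^sup>2) \<longlonglongrightarrow> 0"
      proof (rule AE_I2)
        fix s
        obtain N :: nat where N: "\<bar>g s\<bar> \<le> real N" using real_arch_simple by blast
        have "\<forall>\<^sub>F n in sequentially. indicator J s * (d n s)\<^sup>2 = 0"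
          using eventually_ge_at_top[of N]
        proof eventually_elim
          case (elim n)
          then have "\<bar>g s\<bar> \<le> real n" using N by simp
          then have "d n s = 0" by (auto simp: d_def t_def)
          then show ?case by simp
        qed
        then show "(\<lambda>n. indicator J s * (d n s)\<^sup>2) \<longlonglongrightarrow> 0" by (rule tendsto_eventually)
      qed
    qed auto
    then show ?thesis by simp
  qed
  have lower: "- (4 * CV * sqrt (n2 g) * sqrt (n2 (d n))) \<le> (\<integral>x. V g x * Z g x \<partial>lborel)" for n
  proof -
    have geq: "(\<lambda>s. 1 * t n s + 1 * d n s) = g" by (simp add: d_def)
    \<comment> \<open>The first of the three terms is nonnegative; each of the other two contains
      the truncation error as one factor.\<close>
    have "(\<integral>x. V g x * Z g x \<partial>lborel)
       = (\<integral>x. V (t n) x * Z (t n) x + (V (t n) x * Z (d n) x + V (d n) x * Z g x) \<partial>lborel)"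
    proof (rule integral_cong_AE)
      show "AE x in lborel. V g x * Z g x = V (t n) x * Z (t n) x + (V (t n) x * Z (d n) x + V (d n) x * Z g x)"
        using V_lincomb[OF ts[of n] ds[of n], of 1 1]
      proof eventually_elim
        case (elim x)
        then have Vx: "V g x = V (t n) x + V (d n) x" unfolding geq by simp
        show ?case
        proof (cases "x \<in> J")
          case True
          have "Z g x = Z (t n) x + Z (d n) x"
            using Z_lincomb[OF ts[of n] ds[of n] True, of 1 1] unfolding geq by simp
          then show ?thesis unfolding Vx by (simp add: algebra_simps)
        qed (simp add: V_outside)
      qed
    qed measurable
    also have "\<dots> = (\<integral>x. V (t n) x * Z (t n) x \<partial>lborel) + ((\<integral>x. V (t n) x * Z (d n) x \<partial>lborel) + (\<integral>x. V (d n) x * Z g x \<partial>lborel))"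
      using VZ_integrable(1) ts ds g by simp
    finally have e: "(\<integral>x. V g x * Z g x \<partial>lborel) = (\<integral>x. V (t n) x * Z (t n) x \<partial>lborel) + ((\<integral>x. V (t n) x * Z (d n) x \<partial>lborel) + (\<integral>x. V (d n) x * Z g x \<partial>lborel))" .
    have 1: "0 \<le> (\<integral>x. V (t n) x * Z (t n) x \<partial>lborel)" by (rule VZ_nonneg_bounded[OF _ tb]) simp
    have "\<bar>\<integral>x. V (t n) x * Z (d n) x \<partial>lborel\<bar> \<le> 2 * CV * sqrt (n2 (t n)) * sqrt (n2 (d n))"
      by (rule VZ_integrable(2)[OF ts ds])
    also have "\<dots> \<le> 2 * CV * sqrt (n2 g) * sqrt (n2 (d n))"
      using n2t[of n] CV_nonneg n2_nonneg by (intro mult_right_mono mult_left_mono) auto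
    finally have 2: "\<bar>\<integral>x. V (t n) x * Z (d n) x \<partial>lborel\<bar> \<le> 2 * CV * sqrt (n2 g) * sqrt (n2 (d n))" .
    have 3: "\<bar>\<integral>x. V (d n) x * Z g x \<partial>lborel\<bar> \<le> 2 * CV * sqrt (n2 g) * sqrt (n2 (d n))"
      using VZ_integrable(2)[OF ds[of n] g] by (simp add: mult_ac)
    show ?thesis unfolding e using 1 2 3 by (simp add: abs_le_iff)
  qed
  have "(\<lambda>n. - (4 * CV * sqrt (n2 g) * sqrt (n2 (d n)))) \<longlonglongrightarrow> - (4 * CV * sqrt (n2 g) * sqrt 0)"
    by (intro tendsto_intros lim)
  then have "(\<lambda>n. - (4 * CV * sqrt (n2 g) * sqrt (n2 (d n)))) \<longlonglongrightarrow> 0" by simp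
  then show ?thesis by (rule LIMSEQ_le_const2) (use lower in blast)
qed

text \<open>
  Reflecting the argument turns the kernel into its transpose, so testing \<^term>\<open>v\<close> against the reflected
  solutions \<^term>\<open>V g\<close> moves the operator onto them.
\<close>

lemma kernel_orthogonal:
  assumes v: "integrable lborel v" and v0: "\<And>y. y \<notin> J \<Longrightarrow> v y = 0"
    and Kv: "AE x in lborel. x \<in> J \<longrightarrow> (\<integral>y. k (x - y) * v y \<partial>lborel) = 0"
    and [measurable]: "g \<in> borel_measurable borel" and g: "\<And>s. \<bar>g s\<bar> \<le> c"
  shows "(\<integral>y. v y * Z g (2 - y) \<partial>lborel) = 0"
proof -
  have [measurable]: "v \<in> borel_measurable borel" using v by auto
  have s: "sq g" by (rule sq_bounded[OF assms(4) g])
  obtain C where C: "0 \<le> C" "\<And>x. x \<in> J \<Longrightarrow> (\<integral>\<^sup>+y. ennreal (k (x - y)) * ennreal (w y) \<partial>lborel) \<le> ennreal C"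
    using k_w_bounded by blast
  define M where "M = c * C\<phi> * CW"
  have M: "0 \<le> M" using g[of 0] C\<phi>(1) CW_nonneg by (auto simp: M_def)
  have refl: "(\<integral>\<^sup>+x. ennreal (k (x - y)) * f (2 - x) \<partial>lborel) = (\<integral>\<^sup>+x. ennreal (k ((2 - y) - x)) * f x \<partial>lborel)"
    if [measurable]: "f \<in> borel_measurable borel" for y and f :: "real \<Rightarrow> ennreal"
    by (subst nn_integral_real_affine[where c="-1" and t=2]) (auto simp: algebra_simps)
  \<comment> \<open>Integrated over \<open>x\<close>, the bound for the reflected solution becomes
    the image of \<open>w\<close> at the point \<open>2 - y\<close>, which is bounded for
    \<open>y\<close> in \<open>J\<close>; outside \<open>J\<close> the function \<open>v\<close>
    vanishes.\<close>
  have int: "integrable (lborel \<Otimes>\<^sub>M lborel) (\<lambda>(y, x). k (x - y) * v y * V g (2 - x))"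
  proof (rule integrableI_bounded)
    have "(\<integral>\<^sup>+p. ennreal (norm (case p of (y, x) \<Rightarrow> k (x - y) * v y * V g (2 - x))) \<partial>(lborel \<Otimes>\<^sub>M lborel))
       = (\<integral>\<^sup>+y. \<integral>\<^sup>+x. ennreal \<bar>k (x - y) * v y * V g (2 - x)\<bar> \<partial>lborel \<partial>lborel)"
      by (subst lborel.nn_integral_fst[symmetric]) simp_all
    also have "\<dots> \<le> (\<integral>\<^sup>+y. \<integral>\<^sup>+x. ennreal (M * \<bar>v y\<bar>) * (ennreal (k (x - y)) * ennreal (w (2 - x))) \<partial>lborel \<partial>lborel)"
    proof (intro nn_integral_mono)
      fix y x
      have "\<bar>k (x - y) * v y * V g (2 - x)\<bar> \<le> k (x - y) * \<bar>v y\<bar> * (M * w (2 - x))"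
        using V_bounded[OF assms(4) g, of "2 - x"] k_nonneg[of "x - y"]
        by (auto simp: abs_mult M_def intro!: mult_mono)
      also have "\<dots> = M * \<bar>v y\<bar> * (k (x - y) * w (2 - x))" by simp
      finally show "ennreal \<bar>k (x - y) * v y * V g (2 - x)\<bar> \<le> ennreal (M * \<bar>v y\<bar>) * (ennreal (k (x - y)) * ennreal (w (2 - x)))"
        using M k_nonneg[of "x - y"] by (simp add: ennreal_mult'[symmetric] ennreal_leI)
    qed
    also have "\<dots> = (\<integral>\<^sup>+y. ennreal (M * \<bar>v y\<bar>) * (\<integral>\<^sup>+x. ennreal (k ((2 - y) - x)) * ennreal (w x) \<partial>lborel) \<partial>lborel)"
      by (simp add: nn_integral_cmult refl[of "\<lambda>x. ennreal (w x)"])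
    also have "\<dots> \<le> (\<integral>\<^sup>+y. ennreal (M * \<bar>v y\<bar>) * ennreal C \<partial>lborel)"
    proof (intro nn_integral_mono)
      fix y
      show "ennreal (M * \<bar>v y\<bar>) * (\<integral>\<^sup>+x. ennreal (k ((2 - y) - x)) * ennreal (w x) \<partial>lborel) \<le> ennreal (M * \<bar>v y\<bar>) * ennreal C"
        using C(2)[of "2 - y"] v0[of y] by (cases "y \<in> J") (auto intro!: mult_left_mono)
    qed
    also have "\<dots> < \<infinity>"
    proof -
      have "integrable lborel (\<lambda>y. M * \<bar>v y\<bar>)" using v by (intro integrable_mult_right integrable_abs)
      then show ?thesis using M unfolding integrable_iff_bounded
        by (simp add: nn_integral_multc ennreal_mult_less_top abs_mult)
    qed
    finally show "(\<integral>\<^sup>+p. ennreal (norm (case p of (y, x) \<Rightarrow> k (x - y) * v y * V g (2 - x))) \<partial>(lborel \<Otimes>\<^sub>M lborel)) < \<infinity>" .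
  qed measurable
  have "(\<integral>y. v y * Z g (2 - y) \<partial>lborel) = (\<integral>y. (\<integral>x. k (x - y) * v y * V g (2 - x) \<partial>lborel) \<partial>lborel)"
  proof (rule integral_cong_AE)
    have "AE y in lborel. (2 + (- 1) * y) \<in> J \<longrightarrow> integrable lborel (\<lambda>z. k ((2 + (- 1) * y) - z) * V g z) \<and> (\<integral>z. k ((2 + (- 1) * y) - z) * V g z \<partial>lborel) = Z g (2 + (- 1) * y)"
      by (rule AE_borel_affine[OF _ _ V_solves[OF s]]) simp_all
    then show "AE y in lborel. v y * Z g (2 - y) = (\<integral>x. k (x - y) * v y * V g (2 - x) \<partial>lborel)"
    proof eventually_elim
      case (elim y)
      show ?case
      proof (cases "y \<in> J")
        case True
        have "(\<integral>x. k (x - y) * v y * V g (2 - x) \<partial>lborel) = (\<integral>x. k ((2 - y) - x) * v y * V g x \<partial>lborel)"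
          by (subst lborel_integral_real_affine[where c="-1" and t=2]) (auto simp: algebra_simps)
        also have "\<dots> = v y * (\<integral>x. k ((2 - y) - x) * V g x \<partial>lborel)"
          by (subst integral_mult_right_zero[symmetric]) (simp only: mult_ac)
        finally show ?thesis using elim True by simp
      qed (simp add: v0)
    qed
  qed measurable
  also have "\<dots> = (\<integral>x. (\<integral>y. k (x - y) * v y * V g (2 - x) \<partial>lborel) \<partial>lborel)"
    by (rule lborel_pair.Fubini_integral[OF int, symmetric])
  also have "\<dots> = (\<integral>x. 0 \<partial>(lborel :: real measure))"
  proof (rule integral_cong_AE)
    show "AE x in lborel. (\<integral>y. k (x - y) * v y * V g (2 - x) \<partial>lborel) = 0"
      using Kv
    proof eventually_elim
      case (elim x)
      have "(\<integral>y. k (x - y) * v y * V g (2 - x) \<partial>lborel) = (\<integral>y. k (x - y) * v y \<partial>lborel) * V g (2 - x)"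
        by (rule integral_mult_left_zero)
      then show ?case using elim by (cases "x \<in> J") (auto simp: V_outside)
    qed
  qed measurable
  finally show ?thesis by simp
qed

text \<open>The reflected function \<open>u\<close> is orthogonal to every \<open>Z g\<close> with
  bounded \<open>g\<close>. Steep ramps are of this form and converge boundedly to steps, so all
  tail integrals of \<open>u\<close> vanish.\<close>

lemma kernel_injective:
  assumes v: "integrable lborel v" and v0: "\<And>y. y \<notin> J \<Longrightarrow> v y = 0"
    and Kv: "AE x in lborel. x \<in> J \<longrightarrow> (\<integral>y. k (x - y) * v y \<partial>lborel) = 0"
  shows "AE y in lborel. v y = 0"
proof -
  have [measurable]: "v \<in> borel_measurable borel" using v by auto
  define u where "u y = v (2 + (- 1) * y)" for y
  have u: "integrable lborel u"
    unfolding u_def using v by (subst lborel_integrable_real_affine_iff) auto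
  have u0: "u y = 0" if "y \<notin> J" for y using that by (auto simp: u_def intro!: v0)
  have [measurable]: "u \<in> borel_measurable borel" unfolding u_def by measurable
  have orth: "(\<integral>y. u y * Z g y \<partial>lborel) = 0"
    if [measurable]: "g \<in> borel_measurable borel" and "\<And>s. \<bar>g s\<bar> \<le> c" for g c
  proof -
    have "(\<integral>y. v y * Z g (2 - y) \<partial>lborel) = (\<integral>y. u y * Z g y \<partial>lborel)"
      by (subst lborel_integral_real_affine[where c="-1" and t=2]) (auto simp: u_def)
    then show ?thesis using kernel_orthogonal[OF v v0 Kv that] by simp
  qed
  have tail0: "(\<integral>y. indicator {c<..} y * u y \<partial>lborel) = 0" if c: "0 \<le> c" "c < 2" for c
  proof -
    \<comment> \<open>The primitive \<open>Z (g n)\<close> is a ramp that rises from 0 at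
      \<open>c\<close> to 1 at \<open>c + 1 / n\<close>; for \<open>n = 0\<close> it is identically
      0.\<close>
    define g where "g n s = real n * indicator {c<..<c + 1 / real n} s" for n :: nat and s
    have gm [measurable]: "g n \<in> borel_measurable borel" for n unfolding g_def by measurable
    have gb: "\<bar>g n s\<bar> \<le> real n" for n s by (auto simp: g_def indicator_def)
    have Zle: "\<bar>Z (g n) y\<bar> \<le> 1" for n y
    proof (cases "n = 0")
      case False
      have ig: "integrable lborel (\<lambda>s. real n * indicator {c<..<c + 1 / real n} s)"
        by (intro integrable_mult_right) simp
      have "\<bar>Z (g n) y\<bar> \<le> (\<integral>s. \<bar>indicator {0<..<y} s * g n s\<bar> \<partial>lborel)"
        unfolding Z_def by (rule integral_abs_bound)
      also have "\<dots> \<le> (\<integral>s. real n * indicator {c<..<c + 1 / real n} s \<partial>lborel)"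
      proof (intro integral_mono ig)
        show "integrable lborel (\<lambda>s. \<bar>indicator {0<..<y} s * g n s\<bar>)"
          by (rule Bochner_Integration.integrable_bound[OF ig]) (auto simp: g_def indicator_def)
      qed (auto simp: g_def indicator_def)
      also have "\<dots> = 1" using False by simp
      finally show ?thesis .
    qed (simp add: Z_def g_def)
    have Zlim: "(\<lambda>n. Z (g n) y) \<longlonglongrightarrow> indicator {c<..} y" for y
    proof (cases "c < y")
      case False
      have "indicator {0<..<y} s * g n s = 0" for n s using False by (auto simp: g_def indicator_def)
      then have "Z (g n) y = 0" for n unfolding Z_def by (simp only:) simp
      then show ?thesis using False by simp
    next
      case True
      obtain N :: nat where N: "1 / (y - c) < real N" using reals_Archimedean2 by blast
      have N0: "0 < N" using N True by (cases N) (auto simp: field_simps)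
      have "\<forall>\<^sub>F n in sequentially. Z (g n) y = 1"
        using eventually_ge_at_top[of N]
      proof eventually_elim
        case (elim n)
        have n: "0 < n" using N0 elim by simp
        have "1 / (y - c) < real n" using N elim by (simp add: order_less_le_trans)
        then have "c + 1 / real n < y" using True n by (simp add: field_simps)
        then have "indicator {0<..<y} s * g n s = real n * indicator {c<..<c + 1 / real n} s" for s
          using c by (auto simp: g_def indicator_def)
        then have "Z (g n) y = (\<integral>s. real n * indicator {c<..<c + 1 / real n} s \<partial>lborel)"
          unfolding Z_def by (simp only:)
        also have "\<dots> = 1" using n by simp
        finally show ?case .
      qed
      then show ?thesis using True by (simp add: tendsto_eventually)
    qed
    have "(\<lambda>n. \<integral>y. u y * Z (g n) y \<partial>lborel) \<longlonglongrightarrow> (\<integral>y. u y * indicator {c<..} y \<partial>lborel)"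
    proof (rule integral_dominated_convergence)
      show "integrable lborel (\<lambda>y. \<bar>u y\<bar>)" using u by simp
      show "AE y in lborel. (\<lambda>n. u y * Z (g n) y) \<longlonglongrightarrow> u y * indicator {c<..} y"
        by (intro AE_I2 tendsto_intros Zlim)
      show "AE y in lborel. norm (u y * Z (g n) y) \<le> \<bar>u y\<bar>" for n
        using mult_left_mono[OF Zle[of n]] by (intro AE_I2) (fastforce simp: abs_mult)
    qed auto
    moreover have "(\<integral>y. u y * Z (g n) y \<partial>lborel) = 0" for n by (rule orth[OF gm gb])
    ultimately have "(\<integral>y. u y * indicator {c<..} y \<partial>lborel) = 0"
      by (simp add: LIMSEQ_const_iff)
    then show ?thesis by (simp add: mult.commute)
  qed
  have tails: "(\<integral>y. indicator {c<..} y * u y \<partial>lborel) = 0" for c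
  proof -
    consider "c < 0" | "0 \<le> c \<and> c < 2" | "2 \<le> c" by linarith
    then show ?thesis
    proof cases
      case 1
      then have "indicator {c<..} y * u y = indicator {0<..} y * u y" for y
        using u0[of y] by (auto simp: indicator_def)
      then show ?thesis using tail0[of 0] by (simp only: zero_less_numeral order_refl)
    next
      case 2 then show ?thesis using tail0 by simp
    next
      case 3
      then have "indicator {c<..} y * u y = 0" for y
        using u0[of y] by (auto simp: indicator_def)
      then show ?thesis by (simp only:) simp
    qed
  qed
  have "AE y in lborel. u y = 0" by (rule AE_zero_if_tails_zero[OF u tails])
  then have "AE y in lborel. u (2 + (- 1) * y) = 0"
    by (rule AE_borel_affine[rotated 2]) auto
  then show ?thesis by (simp add: u_def)
qed

end

section \<open>Kernels on the interval from -1 to 1\<close>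

definition rk_op :: "real \<Rightarrow> real \<Rightarrow> real \<Rightarrow> (real \<Rightarrow> real) \<Rightarrow> real \<Rightarrow> real" where
  "rk_op A B \<sigma> v x = (\<integral>y. rk A B \<sigma> (x - y) * v y \<partial>lborel)"

definition prim :: "(real \<Rightarrow> real) \<Rightarrow> real \<Rightarrow> real" where
  "prim g x = (\<integral>s. indicator {-1<..<x} s * g s \<partial>lborel)"

definition L2b :: "(real \<Rightarrow> real) \<Rightarrow> bool" where
  "L2b g \<longleftrightarrow> g \<in> borel_measurable borel \<and> integrable lborel (\<lambda>s. indicator Lam s * (g s)\<^sup>2)"

definition L1z :: "(real \<Rightarrow> real) \<Rightarrow> bool" where
  "L1z v \<longleftrightarrow> integrable lborel v \<and> (\<forall>y. y \<notin> Lam \<longrightarrow> v y = 0)"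

text \<open>
  The properties of the Riemann--Liouville type operator that the variational argument uses: injectivity,
  and solvability with bounds and positivity for right-hand sides that vanish at both end points.
\<close>

definition good_kernel :: "real \<Rightarrow> real \<Rightarrow> real \<Rightarrow> bool" where
  "good_kernel A B \<sigma> \<longleftrightarrow>
    (\<forall>v. L1z v \<longrightarrow> (AE x in lborel. x \<in> Lam \<longrightarrow> rk_op A B \<sigma> v x = 0) \<longrightarrow> (AE x in lborel. v x = 0)) \<and>
    (\<exists>M\<ge>0. \<forall>g. L2b g \<longrightarrow> (\<integral>s. indicator Lam s * g s \<partial>lborel) = 0 \<longrightarrow>
       (\<exists>v. L1z v \<and> (AE x in lborel. x \<in> Lam \<longrightarrow> rk_op A B \<sigma> v x = prim g x) \<and>
          (\<integral>x. \<bar>v x\<bar> \<partial>lborel) \<le> M * sqrt (\<integral>s. indicator Lam s * (g s)\<^sup>2 \<partial>lborel) \<and>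
          0 \<le> (\<integral>x. v x * prim g x \<partial>lborel)))"

text \<open>Everything is carried from (0, 2) to \<open>Lam\<close> by a translation. It is written
  in forms such as \<open>- 1 + 1 * y\<close> to have the shape of the affine substitution
  rules.\<close>

lemma (in solvable_kernel) good_kernel: "good_kernel A B (a + b)"
  unfolding good_kernel_def
proof (intro conjI allI impI)
  fix v assume v: "L1z v" and Kv: "AE x in lborel. x \<in> Lam \<longrightarrow> rk_op A B (a + b) v x = 0"
  have vi: "integrable lborel v" using v by (simp add: L1z_def)
  then have [measurable]: "v \<in> borel_measurable borel" by auto
  define u where "u y = v (- 1 + 1 * y)" for y
  have ui: "integrable lborel u"
    unfolding u_def using vi by (subst lborel_integrable_real_affine_iff) auto
  have u0: "u y = 0" if "y \<notin> J" for y
    using v that by (auto simp: u_def L1z_def Lam_def)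
  have op: "(\<integral>y. k (x - y) * u y \<partial>lborel) = rk_op A B (a + b) v (- 1 + 1 * x)" for x
    unfolding rk_op_def by (subst (2) lborel_integral_real_affine[where c=1 and t="-1"]) (auto simp: u_def)
  have "AE x in lborel. - 1 + 1 * x \<in> Lam \<longrightarrow> rk_op A B (a + b) v (- 1 + 1 * x) = 0"
    by (rule AE_borel_affine[OF _ _ Kv]) (simp_all add: rk_op_def Lam_def)
  then have "AE x in lborel. x \<in> J \<longrightarrow> (\<integral>y. k (x - y) * u y \<partial>lborel) = 0"
    unfolding op by eventually_elim (auto simp: Lam_def)
  from kernel_injective[OF ui u0 this] have "AE y in lborel. u (1 + 1 * y) = 0"
    by (intro AE_borel_affine) (auto simp: u_def)
  then show "AE x in lborel. v x = 0" by (simp add: u_def)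
next
  show "\<exists>M\<ge>0. \<forall>g. L2b g \<longrightarrow> (\<integral>s. indicator Lam s * g s \<partial>lborel) = 0 \<longrightarrow>
       (\<exists>v. L1z v \<and> (AE x in lborel. x \<in> Lam \<longrightarrow> rk_op A B (a + b) v x = prim g x) \<and>
          (\<integral>x. \<bar>v x\<bar> \<partial>lborel) \<le> M * sqrt (\<integral>s. indicator Lam s * (g s)\<^sup>2 \<partial>lborel) \<and>
          0 \<le> (\<integral>x. v x * prim g x \<partial>lborel))"
  proof (intro exI[of _ CV] conjI allI impI)
    show "0 \<le> CV" by (rule CV_nonneg)
    fix g assume g: "L2b g"
    have [measurable]: "g \<in> borel_measurable borel" using g by (simp add: L2b_def)
    define h where "h s = g (- 1 + 1 * s)" for s
    have [measurable]: "h \<in> borel_measurable borel" unfolding h_def by measurable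
    have ind: "indicator J s = (indicator Lam (- 1 + 1 * s) :: real)" for s
      by (auto simp: Lam_def indicator_def)
    have "integrable lborel (\<lambda>s. indicator Lam (- 1 + 1 * s) * (g (- 1 + 1 * s))\<^sup>2)"
      using g by (subst lborel_integrable_real_affine_iff[of 1 "\<lambda>s. indicator Lam s * (g s)\<^sup>2" "- 1"]) (auto simp: L2b_def)
    then have h: "sq h" by (simp add: sq_def h_def ind)
    have nh: "n2 h = (\<integral>s. indicator Lam s * (g s)\<^sup>2 \<partial>lborel)"
      by (subst lborel_integral_real_affine[where c=1 and t="-1"]) (auto simp: n2_def h_def ind)
    have Zh: "Z h (1 + x) = prim g x" for x
      unfolding Z_def prim_def
      by (subst (2) lborel_integral_real_affine[where c=1 and t="-1"])
        (auto simp: h_def indicator_def intro!: Bochner_Integration.integral_cong)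
    define v where "v y = V h (1 + 1 * y)" for y
    have vi: "integrable lborel v"
      unfolding v_def using V_integrable[OF h] by (subst lborel_integrable_real_affine_iff) auto
    have v0: "v y = 0" if "y \<notin> Lam" for y
      using that by (auto simp: v_def Lam_def intro!: V_outside)
    have op: "rk_op A B (a + b) v x = (\<integral>y. k (1 + 1 * x - y) * V h y \<partial>lborel)" for x
      unfolding rk_op_def by (subst (2) lborel_integral_real_affine[where c=1 and t=1]) (auto simp: v_def)
    show "\<exists>v. L1z v \<and> (AE x in lborel. x \<in> Lam \<longrightarrow> rk_op A B (a + b) v x = prim g x) \<and>
          (\<integral>x. \<bar>v x\<bar> \<partial>lborel) \<le> CV * sqrt (\<integral>s. indicator Lam s * (g s)\<^sup>2 \<partial>lborel) \<and>
          0 \<le> (\<integral>x. v x * prim g x \<partial>lborel)"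
    proof (intro exI[of _ v] conjI)
      show "L1z v" using vi v0 by (simp add: L1z_def)
      have "AE x in lborel. 1 + 1 * x \<in> J \<longrightarrow> integrable lborel (\<lambda>y. k (1 + 1 * x - y) * V h y) \<and> (\<integral>y. k (1 + 1 * x - y) * V h y \<partial>lborel) = Z h (1 + 1 * x)"
        by (rule AE_borel_affine[OF _ _ V_solves[OF h]]) simp_all
      then show "AE x in lborel. x \<in> Lam \<longrightarrow> rk_op A B (a + b) v x = prim g x"
        unfolding op by eventually_elim (auto simp: Lam_def Zh)
      have "(\<integral>x. \<bar>v x\<bar> \<partial>lborel) = (\<integral>x. \<bar>V h x\<bar> \<partial>lborel)"
        by (subst (2) lborel_integral_real_affine[where c=1 and t=1]) (auto simp: v_def)
      then show "(\<integral>x. \<bar>v x\<bar> \<partial>lborel) \<le> CV * sqrt (\<integral>s. indicator Lam s * (g s)\<^sup>2 \<partial>lborel)"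
        using V_L1[OF h] by (simp add: nh)
      have "(\<integral>x. v x * prim g x \<partial>lborel) = (\<integral>x. V h x * Z h x \<partial>lborel)"
        by (subst (2) lborel_integral_real_affine[where c=1 and t=1]) (auto simp: v_def Zh)
      then show "0 \<le> (\<integral>x. v x * prim g x \<partial>lborel)" using VZ_nonneg[OF h] by simp
    qed
  qed
qed

text \<open>The vanishing mean turns the integral of \<open>g\<close> over (-1, x) into minus the
  integral over (x, 1), which is the primitive of the reflected derivative from its own left
  end.\<close>

lemma prim_reflect:
  assumes g: "integrable lborel (\<lambda>s. indicator Lam s * g s)" and mean: "(\<integral>s. indicator Lam s * g s \<partial>lborel) = 0"
    and x: "x \<in> Lam"
  shows "prim (\<lambda>s. - g (- s)) (- x) = prim g x"
proof -
  have i: "integrable lborel (\<lambda>s. indicator {-1<..<x} s * g s)" "integrable lborel (\<lambda>s. indicator {x<..<1} s * g s)"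
  proof -
    have "integrable lborel (\<lambda>s. indicator {-1<..<x} s *\<^sub>R (indicator Lam s * g s))" "integrable lborel (\<lambda>s. indicator {x<..<1} s *\<^sub>R (indicator Lam s * g s))"
      by (intro integrable_mult_indicator g; simp)+
    moreover have "indicator {-1<..<x} s *\<^sub>R (indicator Lam s * g s) = indicator {-1<..<x} s * g s"
      "indicator {x<..<1} s *\<^sub>R (indicator Lam s * g s) = indicator {x<..<1} s * g s" for s
      using x by (auto simp: Lam_def indicator_def)
    ultimately show "integrable lborel (\<lambda>s. indicator {-1<..<x} s * g s)" "integrable lborel (\<lambda>s. indicator {x<..<1} s * g s)"
      by (simp_all only:)
  qed
  have "prim (\<lambda>s. - g (- s)) (- x) = (\<integral>s. - (indicator {x<..<1} s * g s) \<partial>lborel)"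
    unfolding prim_def
    by (subst (2) lborel_integral_real_affine[where c="-1" and t=0])
      (auto simp: indicator_def intro!: Bochner_Integration.integral_cong)
  also have "\<dots> = (\<integral>s. indicator {-1<..<x} s * g s \<partial>lborel) - ((\<integral>s. indicator {-1<..<x} s * g s \<partial>lborel) + (\<integral>s. indicator {x<..<1} s * g s \<partial>lborel))"
    by simp
  also have "(\<integral>s. indicator {-1<..<x} s * g s \<partial>lborel) + (\<integral>s. indicator {x<..<1} s * g s \<partial>lborel)
     = (\<integral>s. indicator {-1<..<x} s * g s + indicator {x<..<1} s * g s \<partial>lborel)"
    using i by simp
  also have "\<dots> = (\<integral>s. indicator Lam s * g s \<partial>lborel)"
  proof (rule integral_cong_AE)
    have "AE s in lborel. s \<noteq> x" by (rule AE_lborel_singleton)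
    then show "AE s in lborel. indicator {-1<..<x} s * g s + indicator {x<..<1} s * g s = indicator Lam s * g s"
      by eventually_elim (use x in \<open>auto simp: Lam_def indicator_def\<close>)
    show "(\<lambda>s. indicator {-1<..<x} s * g s + indicator {x<..<1} s * g s) \<in> borel_measurable lborel"
      using i by (intro borel_measurable_integrable Bochner_Integration.integrable_add)
    show "(\<lambda>s. indicator Lam s * g s) \<in> borel_measurable lborel"
      using g by (rule borel_measurable_integrable)
  qed
  finally show ?thesis using mean by (simp add: prim_def)
qed

lemma L2b_integrable:
  assumes g: "L2b g"
  shows "integrable lborel (\<lambda>s. indicator Lam s * g s)"
proof -
  have [measurable]: "g \<in> borel_measurable borel" using g by (simp add: L2b_def)
  have [measurable]: "Lam \<in> sets borel" by (simp add: Lam_def)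
  have "integrable lborel (\<lambda>s. indicator Lam s * (g s)\<^sup>2 + indicator Lam s)"
    using g by (intro Bochner_Integration.integrable_add) (auto simp: L2b_def Lam_def)
  then show ?thesis
  proof (rule Bochner_Integration.integrable_bound)
    have "\<bar>g s\<bar> \<le> (g s)\<^sup>2 + 1" for s
      using zero_le_power2[of "\<bar>g s\<bar> - 1"] zero_le_power2[of "g s"] by (simp add: power2_diff algebra_simps)
    then show "AE s in lborel. norm (indicator Lam s * g s) \<le> norm (indicator Lam s * (g s)\<^sup>2 + indicator Lam s)"
      by (intro AE_I2) (auto simp: indicator_def)
  qed simp
qed

text \<open>The reflection at 0 exchanges the two sides of the kernel. By
  \<open>prim_reflect\<close> it maps the admissible right-hand sides to admissible ones, since the
  condition that the derivative has mean zero is symmetric.\<close>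

lemma good_kernel_reflect:
  assumes good: "good_kernel A B \<sigma>"
  shows "good_kernel B A \<sigma>"
proof -
  have op: "rk_op A B \<sigma> (\<lambda>y. v (- y)) (- x) = rk_op B A \<sigma> v x" if [measurable]: "v \<in> borel_measurable borel" for v x
  proof -
    have e: "rk A B \<sigma> (- x - y) = rk B A \<sigma> (x - (0 + (- 1) * y))" for y
    proof -
      define d where "d = x - (0 + (- 1) * y)"
      have "- x - y = - d" by (simp add: d_def)
      then show ?thesis unfolding d_def[symmetric] by (simp add: rk_def)
    qed
    show ?thesis
      unfolding rk_op_def e by (subst (2) lborel_integral_real_affine[where c="-1" and t=0]) auto
  qed
  have op': "rk_op B A \<sigma> (\<lambda>y. v (- y)) x = rk_op A B \<sigma> v (- x)" if [measurable]: "v \<in> borel_measurable borel" for v x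
    using op[of "\<lambda>y. v (- y)" x] by simp
  have Lm [measurable]: "Lam \<in> sets borel" by (simp add: Lam_def)
  have L: "- x \<in> Lam \<longleftrightarrow> x \<in> Lam" for x by (auto simp: Lam_def)
  have refl: "L1z (\<lambda>y. v (- y))" if "L1z v" for v
    using that lborel_integrable_real_affine_iff[of "-1" v 0] by (auto simp: L1z_def L)
  have neg: "AE x in lborel. P (- x)" if "AE x in lborel. P x" "Measurable.pred borel P" for P :: "real \<Rightarrow> bool"
    using AE_borel_affine[of "-1" P 0] that by simp
  show ?thesis
    unfolding good_kernel_def
  proof (intro conjI allI impI)
    fix v assume v: "L1z v" and Kv: "AE x in lborel. x \<in> Lam \<longrightarrow> rk_op B A \<sigma> v x = 0"
    have [measurable]: "v \<in> borel_measurable borel" using v by (auto simp: L1z_def)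
    have "AE x in lborel. - x \<in> Lam \<longrightarrow> rk_op B A \<sigma> v (- x) = 0"
      by (rule neg[OF Kv]) (simp add: rk_op_def)
    then have "AE x in lborel. x \<in> Lam \<longrightarrow> rk_op A B \<sigma> (\<lambda>y. v (- y)) x = 0"
      using op[of v "- x" for x] by (simp add: L)
    with good refl[OF v] have "AE x in lborel. v (- x) = 0"
      unfolding good_kernel_def by blast
    then have "AE x in lborel. v (- (- x)) = 0" by (rule neg) simp
    then show "AE x in lborel. v x = 0" by simp
  next
    obtain M where M: "0 \<le> M" and sol: "\<And>g. L2b g \<Longrightarrow> (\<integral>s. indicator Lam s * g s \<partial>lborel) = 0 \<Longrightarrow>
       (\<exists>v. L1z v \<and> (AE x in lborel. x \<in> Lam \<longrightarrow> rk_op A B \<sigma> v x = prim g x) \<and>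
          (\<integral>x. \<bar>v x\<bar> \<partial>lborel) \<le> M * sqrt (\<integral>s. indicator Lam s * (g s)\<^sup>2 \<partial>lborel) \<and>
          0 \<le> (\<integral>x. v x * prim g x \<partial>lborel))"
      using good unfolding good_kernel_def by blast
    show "\<exists>M\<ge>0. \<forall>g. L2b g \<longrightarrow> (\<integral>s. indicator Lam s * g s \<partial>lborel) = 0 \<longrightarrow>
       (\<exists>v. L1z v \<and> (AE x in lborel. x \<in> Lam \<longrightarrow> rk_op B A \<sigma> v x = prim g x) \<and>
          (\<integral>x. \<bar>v x\<bar> \<partial>lborel) \<le> M * sqrt (\<integral>s. indicator Lam s * (g s)\<^sup>2 \<partial>lborel) \<and>
          0 \<le> (\<integral>x. v x * prim g x \<partial>lborel))"
    proof (intro exI[of _ M] conjI allI impI)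
      fix g assume g: "L2b g" and mean: "(\<integral>s. indicator Lam s * g s \<partial>lborel) = 0"
      have [measurable]: "g \<in> borel_measurable borel" using g by (simp add: L2b_def)
      define h where "h s = - g (- s)" for s
      have ind: "indicator Lam (- s) = (indicator Lam s :: real)" for s by (simp add: indicator_def L)
      have "integrable lborel (\<lambda>s. indicator Lam (0 + (- 1) * s) * (g (0 + (- 1) * s))\<^sup>2)"
        using g by (subst lborel_integrable_real_affine_iff[of "- 1" "\<lambda>s. indicator Lam s * (g s)\<^sup>2" 0]) (auto simp: L2b_def)
      then have h: "L2b h" by (simp add: L2b_def h_def[abs_def] ind)
      have nh: "(\<integral>s. indicator Lam s * (h s)\<^sup>2 \<partial>lborel) = (\<integral>s. indicator Lam s * (g s)\<^sup>2 \<partial>lborel)"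
        by (subst (2) lborel_integral_real_affine[where c="-1" and t=0]) (auto simp: h_def ind)
      have "(\<integral>s. indicator Lam s * g (- s) \<partial>lborel) = (\<integral>s. indicator Lam s * g s \<partial>lborel)"
        by (subst (2) lborel_integral_real_affine[where c="-1" and t=0]) (auto simp: ind)
      then have mh: "(\<integral>s. indicator Lam s * h s \<partial>lborel) = 0" using mean by (simp add: h_def)
      obtain v where v: "L1z v" "AE x in lborel. x \<in> Lam \<longrightarrow> rk_op A B \<sigma> v x = prim h x"
          "(\<integral>x. \<bar>v x\<bar> \<partial>lborel) \<le> M * sqrt (\<integral>s. indicator Lam s * (h s)\<^sup>2 \<partial>lborel)"
          "0 \<le> (\<integral>x. v x * prim h x \<partial>lborel)"
        using sol[OF h mh] by blast
      have [measurable]: "v \<in> borel_measurable borel" "h \<in> borel_measurable borel"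
        using v h by (auto simp: L1z_def L2b_def)
      have prim_ind: "prim f x = (\<integral>s. pw (s + 1) 0 * pw (x - s) 0 * f s \<partial>lborel)" for f x
        unfolding prim_def by (auto simp: pw_def indicator_def intro!: Bochner_Integration.integral_cong)
      have prefl: "prim h (- x) = prim g x" if "x \<in> Lam" for x
        using prim_reflect[OF L2b_integrable[OF g] mean that] by (simp add: h_def[abs_def])
      show "\<exists>v. L1z v \<and> (AE x in lborel. x \<in> Lam \<longrightarrow> rk_op B A \<sigma> v x = prim g x) \<and>
          (\<integral>x. \<bar>v x\<bar> \<partial>lborel) \<le> M * sqrt (\<integral>s. indicator Lam s * (g s)\<^sup>2 \<partial>lborel) \<and>
          0 \<le> (\<integral>x. v x * prim g x \<partial>lborel)"
      proof (intro exI[of _ "\<lambda>y. v (- y)"] conjI)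
        show "L1z (\<lambda>y. v (- y))" by (rule refl[OF v(1)])
        have "AE x in lborel. - x \<in> Lam \<longrightarrow> rk_op A B \<sigma> v (- x) = prim h (- x)"
          by (rule neg[OF v(2)]) (simp add: rk_op_def prim_ind)
        then show "AE x in lborel. x \<in> Lam \<longrightarrow> rk_op B A \<sigma> (\<lambda>y. v (- y)) x = prim g x"
          by eventually_elim (auto simp: op' L prefl)
        have "(\<integral>x. \<bar>v (- x)\<bar> \<partial>lborel) = (\<integral>x. \<bar>v x\<bar> \<partial>lborel)"
          by (subst (2) lborel_integral_real_affine[where c="-1" and t=0]) auto
        then show "(\<integral>x. \<bar>v (- x)\<bar> \<partial>lborel) \<le> M * sqrt (\<integral>s. indicator Lam s * (g s)\<^sup>2 \<partial>lborel)"
          using v(3) by (simp add: nh)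
        have "(\<integral>x. v (- x) * prim g x \<partial>lborel) = (\<integral>x. v (- x) * prim h (- x) \<partial>lborel)"
        proof (intro Bochner_Integration.integral_cong HOL.refl)
          fix x
          show "v (- x) * prim g x = v (- x) * prim h (- x)"
            using prefl[of x] v(1) by (cases "x \<in> Lam") (auto simp: L1z_def L)
        qed
        also have "\<dots> = (\<integral>x. v x * prim h x \<partial>lborel)"
          by (subst (2) lborel_integral_real_affine[where c="-1" and t=0]) auto
        finally show "0 \<le> (\<integral>x. v (- x) * prim g x \<partial>lborel)" using v(4) by simp
      qed
    qed (rule M)
  qed
qed

text \<open>
  With \<^term>\<open>a = - \<nu>\<close> and \<^term>\<open>b = - \<mu>\<close> the condition relating \<^term>\<open>p\<close>, \<^term>\<open>\<mu>\<close> and \<^term>\<open>\<nu>\<close> says exactly that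
  the two coefficients of the kernel are proportional to those of the factorized kernel.
\<close>

lemma good_kernel_half:
  assumes "0 < \<sigma>" "\<sigma> < 1" "0 \<le> a" "a \<le> b" "a + b = \<sigma>" "0 \<le> A" "0 \<le> B" "0 < A + B"
    and rel: "A * sin (pi * b) = B * sin (pi * a)"
  shows "good_kernel A B \<sigma>"
proof (cases "a = 0")
  case True
  \<comment> \<open>For \<open>a = 0\<close> the relation forces \<open>A = 0\<close>, so the kernel
    is one-sided.\<close>
  have "0 < sin (pi * b)" using assms True by (intro sin_gt_zero) auto
  then have A0: "A = 0" using rel True by simp
  then have B: "0 < B" using assms by simp
  obtain \<phi> where \<phi>: "step_solution 0 b 0 B \<phi>"
    using step_solution_end(1)[of b B] assms True B by auto
  interpret solvable_kernel 0 b 0 B \<phi>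
    using assms True B \<phi> step_solution_end(2)[of b B] by unfold_locales auto
  show ?thesis using good_kernel True assms A0 by simp
next
  case False
  then have a: "0 < a" and b: "0 < b" using assms by auto
  interpret abel_exponents a b using a b assms by unfold_locales auto
  have sa: "0 < sin (pi * a)" and sb: "0 < sin (pi * b)"
    using assms a b by (auto intro!: sin_gt_zero)
  have B0: "0 < B" using assms sa sb
    by (metis add.right_neutral less_eq_real_def mult_eq_0_iff mult_pos_pos order_less_irrefl)
  \<comment> \<open>This factor matches the coefficient \<open>B\<close>; that it also matches
    \<open>A\<close> is the content of the relation with the sines.\<close>
  define K where "K = B / Beta a (1 - \<sigma>)"
  have ba: "0 < Beta a (1 - \<sigma>)" using a assms by (intro Beta_pos) auto
  have K: "0 < K" using B0 ba by (simp add: K_def)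
  have KB: "K * Beta a (1 - (a + b)) = B" using ba assms by (simp add: K_def)
  \<comment> \<open>By Euler's reflection formula both sides equal
    \<open>pi * Gamma (1 - \<sigma>) / (Gamma (1 - a) * Gamma (1 - b))\<close>.\<close>
  have "Beta b (1 - \<sigma>) * sin (pi * b) = Beta a (1 - \<sigma>) * sin (pi * a)"
  proof -
    have e: "b + (1 - \<sigma>) = 1 - a" "a + (1 - \<sigma>) = 1 - b" using assms by auto
    have refl: "Gamma x * Gamma (1 - x) * sin (pi * x) = pi" if "0 < x" "x < 1" for x :: real
    proof -
      have "complex_of_real (Gamma x * Gamma (1 - x)) = complex_of_real (pi / sin (pi * x))"
        using Gamma_reflection_complex[of "complex_of_real x"]
        by (simp add: Gamma_complex_of_real[symmetric] sin_of_real[symmetric])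
      then have "Gamma x * Gamma (1 - x) = pi / sin (pi * x)" by (simp only: of_real_eq_iff)
      moreover have "0 < sin (pi * x)" using that by (intro sin_gt_zero) auto
      ultimately show ?thesis by simp
    qed
    have ra: "Gamma a * Gamma (1 - a) * sin (pi * a) = pi" and rb: "Gamma b * Gamma (1 - b) * sin (pi * b) = pi"
      using assms a b by (auto intro!: refl)
    have g: "0 < Gamma (1 - a)" "0 < Gamma (1 - b)" using assms a b by (auto intro!: Gamma_real_pos)
    have "Beta b (1 - \<sigma>) * sin (pi * b) = Gamma (1 - \<sigma>) * (Gamma b * sin (pi * b)) / Gamma (1 - a)"
      unfolding Beta_def e by simp
    also have "Gamma b * sin (pi * b) = pi / Gamma (1 - b)" using rb g by (simp add: field_simps)
    also have "Gamma (1 - \<sigma>) * (pi / Gamma (1 - b)) / Gamma (1 - a) = Gamma (1 - \<sigma>) * (pi / Gamma (1 - a)) / Gamma (1 - b)"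
      by simp
    also have "pi / Gamma (1 - a) = Gamma a * sin (pi * a)" using ra g by (simp add: field_simps)
    also have "Gamma (1 - \<sigma>) * (Gamma a * sin (pi * a)) / Gamma (1 - b) = Beta a (1 - \<sigma>) * sin (pi * a)"
      unfolding Beta_def e by simp
    finally show ?thesis .
  qed
  then have "(K * Beta b (1 - \<sigma>)) * sin (pi * b) = A * sin (pi * b)"
    using rel ba by (simp add: K_def field_simps)
  then have "K * Beta b (1 - \<sigma>) = A" using sb by (subst (asm) mult_cancel_right) auto
  then have KA: "K * Beta b (1 - (a + b)) = A" using assms by simp
  obtain \<phi> where \<phi>: "step_solution a b A B \<phi>"
    using step_solution_interior[OF K] unfolding KA KB by blast
  interpret solvable_kernel a b A B \<phi>
    using assms a b \<phi> bounded_image_interior[OF K] unfolding KA KB by unfold_locales auto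
  show ?thesis using good_kernel assms by simp
qed

text \<open>Reflecting when \<open>a > b\<close> puts the smaller exponent first; as the sum is
  below 1, that exponent is below 1/2.\<close>

lemma good_kernel:
  assumes "0 < \<sigma>" "\<sigma> < 1" "0 \<le> a" "0 \<le> b" "a + b = \<sigma>" "0 \<le> A" "0 \<le> B" "0 < A + B"
    and rel: "A * sin (pi * b) = B * sin (pi * a)"
  shows "good_kernel A B \<sigma>"
proof (cases "a \<le> b")
  case True
  then show ?thesis using assms by (intro good_kernel_half[of \<sigma> a b]) auto
next
  case False
  then have "good_kernel B A \<sigma>" using assms by (intro good_kernel_half[of \<sigma> b a]) auto
  then show ?thesis by (rule good_kernel_reflect)
qed

section \<open>The Lax--Milgram theorem\<close>

text \<open>The direct method of the calculus of variations: the functional \<open>J\<close> is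
  bounded below, minimizing sequences are Cauchy, and the vanishing of the first variation at the
  minimizer is the claimed identity.\<close>

lemma riesz_representation:
  fixes f :: "'a::{real_inner,complete_space} \<Rightarrow> real"
  assumes "bounded_linear f"
  shows "\<exists>u. \<forall>x. f x = inner u x"
proof -
  interpret bounded_linear f by fact
  obtain K where K: "0 < K" "\<And>x. norm (f x) \<le> norm x * K" using pos_bounded by blast
  define J where "J x = (norm x)\<^sup>2 - 2 * f x" for x
  have lower: "- K\<^sup>2 \<le> J x" for x
  proof -
    have "f x \<le> norm x * K" using K(2)[of x] by simp
    moreover have "0 \<le> (norm x - K)\<^sup>2" by simp
    ultimately show ?thesis by (simp add: J_def power2_diff)
  qed
  define m where "m = Inf (range J)"
  have bb: "bdd_below (range J)" using lower by (auto intro!: bdd_belowI)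
  have m: "m \<le> J x" for x unfolding m_def using bb by (intro cInf_lower) auto
  have "\<exists>x. J x < m + 1 / real (Suc n)" for n
  proof -
    have "\<exists>y\<in>range J. y < m + 1 / real (Suc n)"
      unfolding m_def by (rule cInf_lessD) auto
    then show ?thesis by blast
  qed
  then obtain X where X: "\<And>n. J (X n) < m + 1 / real (Suc n)" by metis
  \<comment> \<open>The parallelogram law, with the value of \<open>J\<close> at the midpoint
    estimated from below by the infimum.\<close>
  have par: "(norm (x - y))\<^sup>2 \<le> 2 * (J x - m) + 2 * (J y - m)" for x y
  proof -
    have "(norm (x - y))\<^sup>2 = 2 * J x + 2 * J y - 4 * J ((1 / 2) *\<^sub>R (x + y))"
      unfolding J_def power2_norm_eq_inner
      by (simp add: add scale inner_simps inner_commute algebra_simps)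
    then show ?thesis using m[of "(1 / 2) *\<^sub>R (x + y)"] by simp
  qed
  have "Cauchy X"
  proof (rule metric_CauchyI)
    fix e :: real assume e: "0 < e"
    obtain N :: nat where N: "4 / e\<^sup>2 < real N" using reals_Archimedean2 by blast
    have "dist (X i) (X j) < e" if "N \<le> i" "N \<le> j" for i j
    proof -
      have small: "J (X l) - m < e\<^sup>2 / 4" if "N \<le> l" for l
      proof -
        have p: "0 < 4 / e\<^sup>2" using e by simp
        have "4 / e\<^sup>2 < real (Suc l)" using N that by simp
        then have "1 / real (Suc l) < e\<^sup>2 / 4" using e by (simp add: field_simps)
        then show ?thesis using X[of l] by simp
      qed
      have "(norm (X i - X j))\<^sup>2 < e\<^sup>2"
        using par[of "X i" "X j"] small[OF that(1)] small[OF that(2)] by simp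
      then show ?thesis using e by (simp add: dist_norm power2_less_imp_less)
    qed
    then show "\<exists>N. \<forall>i\<ge>N. \<forall>j\<ge>N. dist (X i) (X j) < e" by blast
  qed
  then obtain u where u: "X \<longlonglongrightarrow> u" using Cauchy_convergent convergent_def by blast
  have "(\<lambda>n. J (X n)) \<longlonglongrightarrow> J u"
    unfolding J_def by (intro tendsto_intros u tendsto)
  moreover have "(\<lambda>n. m + 1 / real (Suc n)) \<longlonglongrightarrow> m + 0"
    by (intro tendsto_intros LIMSEQ_inverse_real_of_nat[unfolded inverse_eq_divide])
  ultimately have Ju: "J u \<le> m"
    using X by (intro LIMSEQ_le) (auto intro: less_imp_le)
  have "f h = inner u h" for h
  proof -
    define d where "d = inner u h - f h"
    have q: "0 \<le> 2 * t * d + t\<^sup>2 * (norm h)\<^sup>2" for t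
    proof -
      have "J (u + t *\<^sub>R h) = J u + (2 * t * d + t\<^sup>2 * (norm h)\<^sup>2)"
        unfolding J_def d_def power2_norm_eq_inner
        by (simp add: add scale inner_simps inner_commute algebra_simps power2_eq_square)
      then show ?thesis using m[of "u + t *\<^sub>R h"] Ju by simp
    qed
    have "d = 0"
    proof (rule ccontr)
      assume "d \<noteq> 0"
      \<comment> \<open>At the point \<open>- d / n\<close> the quadratic polynomial in
        \<open>q\<close> would be negative. The added 1 keeps \<open>n\<close> positive also for
        \<open>h = 0\<close>.\<close>
      define n where "n = (norm h)\<^sup>2 + 1"
      have n: "0 < n" "(norm h)\<^sup>2 < n" by (auto simp: n_def add_nonneg_pos)
      have "2 * (- d / n) * d + (- d / n)\<^sup>2 * (norm h)\<^sup>2 < 2 * (- d / n) * d + (- d / n)\<^sup>2 * n"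
        using n \<open>d \<noteq> 0\<close> by (intro add_strict_left_mono mult_strict_left_mono) auto
      also have "\<dots> = - (d\<^sup>2 / n)" using n by (simp add: power2_eq_square field_simps)
      also have "\<dots> \<le> 0" using n by simp
      finally show False using q[of "- d / n"] by simp
    qed
    then show ?thesis by (simp add: d_def)
  qed
  then show ?thesis by blast
qed

text \<open>The solution is a fixed point of \<open>S\<close>. For coercivity constant 1 and bound
  \<open>k\<close>, the squared contraction factor is at most
  \<open>1 - 2 * r + (r * k)\<^sup>2\<close>, which equals \<open>1 - r\<close> for
  \<open>r = 1 / k\<^sup>2\<close>.\<close>

lemma lax_milgram:
  fixes a :: "'a::{real_inner,complete_space} \<Rightarrow> 'a \<Rightarrow> real"
  assumes a: "bounded_bilinear a" and coercive: "\<And>u. (norm u)\<^sup>2 \<le> a u u" and f: "bounded_linear f"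
  shows "\<exists>u. \<forall>v. a u v = f v"
proof -
  interpret a: bounded_bilinear a by fact
  obtain K where K: "0 < K" "\<And>x y. norm (a x y) \<le> norm x * norm y * K" using a.pos_bounded by blast
  \<comment> \<open>Enlarging the bound to at least 1 ensures \<open>r \<le> 1\<close>, so that
    \<open>sqrt (1 - r)\<close> is a contraction factor.\<close>
  define k where "k = max 1 K"
  have k: "1 \<le> k" "\<And>x y. norm (a x y) \<le> norm x * norm y * k"
  proof -
    show "norm (a x y) \<le> norm x * norm y * k" for x y
    proof -
      have "norm x * norm y * K \<le> norm x * norm y * k" by (intro mult_left_mono) (auto simp: k_def)
      then show ?thesis using K(2)[of x y] by linarith
    qed
  qed (simp add: k_def)
  obtain F where F: "\<And>v. f v = inner F v" using riesz_representation[OF f] by blast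
  have "\<forall>u. \<exists>w. \<forall>v. a u v = inner w v"
    using riesz_representation[OF a.bounded_linear_right] by blast
  then obtain T where T: "\<And>u v. a u v = inner (T u) v" by metis
  have Tdiff: "T u - T v = T (u - v)" for u v
  proof -
    have "inner (T u - T v - T (u - v)) x = 0" for x
      by (simp add: inner_diff_left T[symmetric] a.diff_left)
    from this[of "T u - T v - T (u - v)"] show ?thesis by simp
  qed
  have Tnorm: "norm (T w) \<le> k * norm w" for w
  proof (cases "T w = 0")
    case False
    have "norm (T w) * norm (T w) = a w (T w)" by (simp add: T dot_square_norm power2_eq_square)
    also have "\<dots> \<le> norm w * norm (T w) * k" using k(2)[of w "T w"] by simp
    finally have "norm (T w) * norm (T w) \<le> (k * norm w) * norm (T w)" by (simp add: mult_ac)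
    then show ?thesis using False by simp
  qed (use k in simp)
  define r where "r = 1 / k\<^sup>2"
  define S where "S u = u - r *\<^sub>R (T u - F)" for u
  have "\<exists>!u. S u = u"
  proof (rule banach_fix_type)
    show "0 \<le> sqrt (1 - r)" "sqrt (1 - r) < 1"
      using k(1) by (auto simp: r_def divide_le_eq_1 one_le_power)
    show "\<forall>x y. dist (S x) (S y) \<le> sqrt (1 - r) * dist x y"
    proof (intro allI)
      fix x y :: 'a
      define w where "w = x - y"
      have e: "S x - S y = w - r *\<^sub>R T w"
        by (simp add: S_def w_def Tdiff[symmetric] scaleR_diff_right)
      have "(norm (S x - S y))\<^sup>2 = (norm w)\<^sup>2 - 2 * r * a w w + r\<^sup>2 * (norm (T w))\<^sup>2"
        unfolding e power2_norm_eq_inner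
        by (simp add: T inner_simps inner_commute algebra_simps power2_eq_square)
      also have "\<dots> \<le> (norm w)\<^sup>2 - 2 * r * (norm w)\<^sup>2 + r\<^sup>2 * (k * norm w)\<^sup>2"
        using coercive[of w] Tnorm[of w] k(1)
        by (intro add_mono diff_mono mult_left_mono power_mono) (auto simp: r_def)
      also have "r\<^sup>2 * (k * norm w)\<^sup>2 = r * (norm w)\<^sup>2"
        using k(1) by (simp add: r_def power2_eq_square)
      finally have "(norm (S x - S y))\<^sup>2 \<le> (1 - r) * (norm w)\<^sup>2" by (simp add: algebra_simps)
      then have "sqrt ((norm (S x - S y))\<^sup>2) \<le> sqrt ((1 - r) * (norm w)\<^sup>2)" by (rule real_sqrt_le_mono)
      then show "dist (S x) (S y) \<le> sqrt (1 - r) * dist x y"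
        by (simp add: dist_norm real_sqrt_mult w_def)
    qed
  qed
  then obtain u where "S u = u" by blast
  then have "T u = F" using k(1) by (simp add: S_def r_def)
  then show ?thesis using F T by auto
qed

section \<open>The Hilbert space of square integrable functions\<close>

lemma Lam_borel [measurable, simp]: "Lam \<in> sets borel"
  by (simp add: Lam_def)

lemma L2b_measurable: "L2b g \<Longrightarrow> g \<in> borel_measurable borel"
  by (simp add: L2b_def)

lemma L2b_mult_integrable:
  assumes f: "L2b f" and g: "L2b g"
  shows "integrable lborel (\<lambda>s. indicator Lam s * (f s * g s))"
proof -
  note [measurable] = f[THEN L2b_measurable] g[THEN L2b_measurable]
  have "integrable lborel (\<lambda>s. indicator Lam s * (f s)\<^sup>2 + indicator Lam s * (g s)\<^sup>2)"
    using f g by (intro Bochner_Integration.integrable_add) (auto simp: L2b_def)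
  then show ?thesis
  proof (rule Bochner_Integration.integrable_bound)
    have "\<bar>f s * g s\<bar> \<le> (f s)\<^sup>2 + (g s)\<^sup>2" for s
    proof -
      have "2 * (\<bar>f s\<bar> * \<bar>g s\<bar>) \<le> (f s)\<^sup>2 + (g s)\<^sup>2"
        using zero_le_power2[of "\<bar>f s\<bar> - \<bar>g s\<bar>"] by (simp add: power2_diff)
      moreover have "0 \<le> (f s)\<^sup>2 + (g s)\<^sup>2" by simp
      ultimately show ?thesis unfolding abs_mult by linarith
    qed
    then show "AE s in lborel. norm (indicator Lam s * (f s * g s)) \<le> norm (indicator Lam s * (f s)\<^sup>2 + indicator Lam s * (g s)\<^sup>2)"
      by (intro AE_I2) (auto simp: indicator_def)
  qed simp
qed

lemma L2b_lincomb:
  assumes f: "L2b f" and g: "L2b g"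
  shows "L2b (\<lambda>s. p * f s + q * g s)"
proof -
  note [measurable] = f[THEN L2b_measurable] g[THEN L2b_measurable]
  have "integrable lborel (\<lambda>s. p\<^sup>2 * (indicator Lam s * (f s)\<^sup>2) + (q\<^sup>2 * (indicator Lam s * (g s)\<^sup>2)
     + 2 * p * q * (indicator Lam s * (f s * g s))))"
    using f g L2b_mult_integrable[OF f g]
    by (intro Bochner_Integration.integrable_add integrable_mult_right) (auto simp: L2b_def)
  also have "(\<lambda>s. p\<^sup>2 * (indicator Lam s * (f s)\<^sup>2) + (q\<^sup>2 * (indicator Lam s * (g s)\<^sup>2)
     + 2 * p * q * (indicator Lam s * (f s * g s)))) = (\<lambda>s. indicator Lam s * (p * f s + q * g s)\<^sup>2)"
    by (simp add: fun_eq_iff power2_eq_square algebra_simps)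
  finally show ?thesis by (simp add: L2b_def)
qed

lemma L2b_const: "L2b (\<lambda>_. c)"
  by (simp add: L2b_def Lam_def)

lemma L2b_add: "L2b f \<Longrightarrow> L2b g \<Longrightarrow> L2b (\<lambda>s. f s + g s)"
  using L2b_lincomb[of f g 1 1] by simp

lemma L2b_diff: "L2b f \<Longrightarrow> L2b g \<Longrightarrow> L2b (\<lambda>s. f s - g s)"
  using L2b_lincomb[of f g 1 "-1"] by simp

lemma L2b_scale: "L2b f \<Longrightarrow> L2b (\<lambda>s. c * f s)"
  using L2b_lincomb[of f f c 0] by simp

\<comment> \<open>The relation is partial because only functions satisfying \<open>L2b\<close>
  represent elements; it ignores values outside \<open>Lam\<close>, as the inner product
  does.\<close>
quotient_type l2 = "real \<Rightarrow> real" / partial: "\<lambda>f g. L2b f \<and> L2b g \<and> (AE x in lborel. x \<in> Lam \<longrightarrow> f x = g x)"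
proof (rule part_equivpI)
  show "\<exists>f. L2b f \<and> L2b f \<and> (AE x in lborel. x \<in> Lam \<longrightarrow> f x = f x)"
    using L2b_const[of 0] by auto
  show "symp (\<lambda>f g. L2b f \<and> L2b g \<and> (AE x in lborel. x \<in> Lam \<longrightarrow> f x = g x))"
    by (rule sympI) (auto elim!: eventually_mono)
  show "transp (\<lambda>f g. L2b f \<and> L2b g \<and> (AE x in lborel. x \<in> Lam \<longrightarrow> f x = g x))"
    by (rule transpI) (auto elim: eventually_elim2)
qed

definition l2ip :: "(real \<Rightarrow> real) \<Rightarrow> (real \<Rightarrow> real) \<Rightarrow> real" where
  "l2ip f g = (\<integral>s. indicator Lam s * (f s * g s) \<partial>lborel)"

lemma l2ip_cong:
  assumes "L2b f" "L2b f'" "L2b g" "L2b g'"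
    and "AE x in lborel. x \<in> Lam \<longrightarrow> f x = f' x" "AE x in lborel. x \<in> Lam \<longrightarrow> g x = g' x"
  shows "l2ip f g = l2ip f' g'"
  unfolding l2ip_def
proof (rule integral_cong_AE)
  note [measurable] = assms(1-4)[THEN L2b_measurable]
  show "(\<lambda>s. indicator Lam s * (f s * g s)) \<in> borel_measurable lborel"
    "(\<lambda>s. indicator Lam s * (f' s * g' s)) \<in> borel_measurable lborel" by measurable
  show "AE s in lborel. indicator Lam s * (f s * g s) = indicator Lam s * (f' s * g' s)"
    using assms(5,6) by eventually_elim (auto simp: indicator_def)
qed

lemma l2ip_scale: "l2ip (\<lambda>s. c * f s) g = c * l2ip f g"
  unfolding l2ip_def by (subst integral_mult_right_zero[symmetric]) (simp only: mult_ac)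

instantiation l2 :: real_inner
begin

lift_definition zero_l2 :: l2 is "\<lambda>_. 0" by (simp add: L2b_const)
lift_definition plus_l2 :: "l2 \<Rightarrow> l2 \<Rightarrow> l2" is "\<lambda>f g s. f s + g s"
  by (auto intro: L2b_add elim: eventually_elim2)
lift_definition minus_l2 :: "l2 \<Rightarrow> l2 \<Rightarrow> l2" is "\<lambda>f g s. f s - g s"
  by (auto intro: L2b_diff elim: eventually_elim2)
lift_definition uminus_l2 :: "l2 \<Rightarrow> l2" is "\<lambda>f s. - f s"
  using L2b_scale[of _ "-1"] by (auto elim: eventually_mono)
lift_definition scaleR_l2 :: "real \<Rightarrow> l2 \<Rightarrow> l2" is "\<lambda>c f s. c * f s"
  by (auto intro: L2b_scale elim: eventually_mono)
lift_definition inner_l2 :: "l2 \<Rightarrow> l2 \<Rightarrow> real" is l2ip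
  by (auto intro: l2ip_cong)

definition "norm (x :: l2) = sqrt (inner x x)"
definition "sgn (x :: l2) = scaleR (inverse (norm x)) x"
definition "dist (x :: l2) y = norm (x - y)"
definition [code del]: "(uniformity :: (l2 \<times> l2) filter) = (INF e\<in>{0 <..}. principal {(x, y). dist x y < e})"
definition [code del]: "open (U :: l2 set) = (\<forall>x\<in>U. eventually (\<lambda>(x', y). x' = x \<longrightarrow> y \<in> U) uniformity)"

instance
proof
  fix x y z :: l2 and a b :: real
  show "x + y + z = x + (y + z)" by transfer (auto intro!: L2b_add simp: add.assoc)
  show "x + y = y + x" by transfer (auto intro!: L2b_add simp: add.commute)
  show "0 + x = x" by transfer simp
  show "- x + x = 0"
    by transfer (use L2b_add L2b_scale[of _ "-1"] in \<open>auto simp: L2b_const\<close>)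
  show "x - y = x + - y"
    by transfer (use L2b_diff in auto)
  show "a *\<^sub>R (x + y) = a *\<^sub>R x + a *\<^sub>R y"
    by transfer (auto intro!: L2b_add L2b_scale simp: distrib_left)
  show "(a + b) *\<^sub>R x = a *\<^sub>R x + b *\<^sub>R x"
    by transfer (auto intro!: L2b_add L2b_scale simp: distrib_right)
  show "a *\<^sub>R b *\<^sub>R x = (a * b) *\<^sub>R x"
    by transfer (auto intro!: L2b_scale simp: mult.assoc)
  show "1 *\<^sub>R x = x" by transfer simp
  show "dist x y = norm (x - y)" by (simp add: dist_l2_def)
  show "sgn x = inverse (norm x) *\<^sub>R x" by (simp add: sgn_l2_def)
  show "(uniformity :: (l2 \<times> l2) filter) = (INF e\<in>{0 <..}. principal {(x, y). dist x y < e})"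
    by (simp add: uniformity_l2_def)
  show "open U = (\<forall>x\<in>U. \<forall>\<^sub>F (x', y) in uniformity. x' = x \<longrightarrow> y \<in> U)" for U :: "l2 set"
    by (simp add: open_l2_def)
  show "inner x y = inner y x" by transfer (simp add: l2ip_def mult.commute)
  show "inner (x + y) z = inner x z + inner y z"
  proof transfer
    fix f g h assume "L2b f \<and> L2b f \<and> (AE x in lborel. x \<in> Lam \<longrightarrow> f x = f x)"
      "L2b g \<and> L2b g \<and> (AE x in lborel. x \<in> Lam \<longrightarrow> g x = g x)" "L2b h \<and> L2b h \<and> (AE x in lborel. x \<in> Lam \<longrightarrow> h x = h x)"
    then show "l2ip (\<lambda>s. f s + g s) h = l2ip f h + l2ip g h"
      using L2b_mult_integrable[of f h] L2b_mult_integrable[of g h] by (simp add: l2ip_def algebra_simps)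
  qed
  show "inner (a *\<^sub>R x) y = a * inner x y"
    by transfer (simp add: l2ip_scale)
  show "0 \<le> inner x x" by transfer (simp add: l2ip_def)
  show "inner x x = 0 \<longleftrightarrow> x = 0"
  proof transfer
    fix f assume "L2b f \<and> L2b f \<and> (AE x in lborel. x \<in> Lam \<longrightarrow> f x = f x)"
    then have f: "L2b f" by simp
    have "l2ip f f = 0 \<longleftrightarrow> (AE s in lborel. indicator Lam s * (f s * f s) = 0)"
      unfolding l2ip_def by (rule integral_nonneg_eq_0_iff_AE) (auto intro: L2b_mult_integrable f)
    also have "\<dots> \<longleftrightarrow> (AE s in lborel. s \<in> Lam \<longrightarrow> f s = 0)"
      by (intro iffI; elim eventually_mono) (auto simp: indicator_def)
    finally show "(l2ip f f = 0) = (L2b f \<and> L2b (\<lambda>_. 0) \<and> (AE x in lborel. x \<in> Lam \<longrightarrow> f x = 0))"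
      using f by (simp add: L2b_const)
  qed
  show "norm x = sqrt (inner x x)" by (simp add: norm_l2_def)
qed

end

definition l2rep :: "l2 \<Rightarrow> real \<Rightarrow> real" where "l2rep u = rep_l2 u"
definition l2abs :: "(real \<Rightarrow> real) \<Rightarrow> l2" where "l2abs f = abs_l2 f"

lemma L2b_l2rep: "L2b (l2rep u)"
  using Quotient_rep_reflp[OF Quotient_l2, of u] by (simp add: l2rep_def)

lemma l2abs_rep: "l2abs (l2rep u) = u"
  using Quotient_abs_rep[OF Quotient_l2, of u] by (simp add: l2rep_def l2abs_def)

lemma l2rep_abs: "L2b f \<Longrightarrow> AE x in lborel. x \<in> Lam \<longrightarrow> l2rep (l2abs f) x = f x"
  using Quotient_rep_abs[OF Quotient_l2, of f] by (simp add: l2rep_def l2abs_def)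

lemma l2_inner: "inner u v = l2ip (l2rep u) (l2rep v)"
  by (simp add: inner_l2_def l2rep_def)

lemma l2_lincomb: "p *\<^sub>R u + q *\<^sub>R v = l2abs (\<lambda>s. p * l2rep u s + q * l2rep v s)"
proof -
  have 1: "c *\<^sub>R l2abs f = l2abs (\<lambda>s. c * f s)" if "L2b f" for c f
    unfolding l2abs_def using that by (subst scaleR_l2.abs_eq) auto
  have 2: "l2abs f + l2abs g = l2abs (\<lambda>s. f s + g s)" if "L2b f" "L2b g" for f g
    unfolding l2abs_def using that by (subst plus_l2.abs_eq) auto
  have "p *\<^sub>R u + q *\<^sub>R v = p *\<^sub>R l2abs (l2rep u) + q *\<^sub>R l2abs (l2rep v)"
    by (simp add: l2abs_rep)
  then show ?thesis by (simp add: 1 2 L2b_l2rep L2b_scale)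
qed

lemma l2rep_lincomb: "AE x in lborel. x \<in> Lam \<longrightarrow> l2rep (p *\<^sub>R u + q *\<^sub>R v) x = p * l2rep u x + q * l2rep v x"
  unfolding l2_lincomb by (intro l2rep_abs L2b_lincomb L2b_l2rep)

lemma l2_norm: "(norm u)\<^sup>2 = l2ip (l2rep u) (l2rep u)"
  by (simp add: power2_norm_eq_inner l2_inner)

lemma l2_dist: "(dist u v)\<^sup>2 = l2ip (\<lambda>s. l2rep u s - l2rep v s) (\<lambda>s. l2rep u s - l2rep v s)"
proof -
  have "u - v = 1 *\<^sub>R u + (-1) *\<^sub>R v" by simp
  then have "AE x in lborel. x \<in> Lam \<longrightarrow> l2rep (u - v) x = l2rep u x - l2rep v x"
    using l2rep_lincomb[of 1 u "-1" v] by simp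
  then show ?thesis
    unfolding dist_norm l2_norm by (intro l2ip_cong L2b_l2rep L2b_diff)
qed

text \<open>The parameter is kept free because two values are needed: the size of the increments in
  the proof of completeness, and the norm of \<open>f\<close> in \<open>L1_le_l2n\<close>.\<close>

lemma l2_L1_le:
  assumes f: "L2b f" and l: "0 < l"
  shows "(\<integral>\<^sup>+s. ennreal (indicator Lam s * \<bar>f s\<bar>) \<partial>lborel) \<le> ennreal (l2ip f f / (2 * l) + l)"
proof -
  note [measurable] = f[THEN L2b_measurable]
  have i: "integrable lborel (\<lambda>s. 1 / (2 * l) * (indicator Lam s * (f s * f s)) + l / 2 * indicator Lam s)"
    by (intro Bochner_Integration.integrable_add integrable_mult_right L2b_mult_integrable f) (simp add: Lam_def)
  have "(\<integral>\<^sup>+s. ennreal (indicator Lam s * \<bar>f s\<bar>) \<partial>lborel)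
     \<le> (\<integral>\<^sup>+s. ennreal (1 / (2 * l) * (indicator Lam s * (f s * f s)) + l / 2 * indicator Lam s) \<partial>lborel)"
  proof (intro nn_integral_mono ennreal_leI)
    fix s
    show "indicator Lam s * \<bar>f s\<bar> \<le> 1 / (2 * l) * (indicator Lam s * (f s * f s)) + l / 2 * indicator Lam s"
      using am_gm_scaled[OF l, of "\<bar>f s\<bar>" 1] by (auto simp: indicator_def power2_eq_square)
  qed
  also have "\<dots> = ennreal (\<integral>s. 1 / (2 * l) * (indicator Lam s * (f s * f s)) + l / 2 * indicator Lam s \<partial>lborel)"
    using l i by (intro nn_integral_eq_integral) auto
  also have "(\<integral>s. 1 / (2 * l) * (indicator Lam s * (f s * f s)) + l / 2 * indicator Lam s \<partial>lborel)
     = 1 / (2 * l) * l2ip f f + l / 2 * (\<integral>s. indicator Lam s \<partial>lborel)"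
  proof -
    have i2: "integrable lborel (indicator Lam :: real \<Rightarrow> real)" by (simp add: Lam_def)
    have "(\<integral>s. 1 / (2 * l) * (indicator Lam s * (f s * f s)) + l / 2 * indicator Lam s \<partial>lborel)
       = (\<integral>s. 1 / (2 * l) * (indicator Lam s * (f s * f s)) \<partial>lborel) + (\<integral>s. l / 2 * indicator Lam s \<partial>lborel)"
      by (intro Bochner_Integration.integral_add integrable_mult_right L2b_mult_integrable f i2)
    then show ?thesis unfolding l2ip_def by (simp only: integral_mult_right_zero)
  qed
  also have "\<dots> = l2ip f f / (2 * l) + l" by (simp add: Lam_def)
  finally show ?thesis .
qed

text \<open>The Riesz-Fischer argument. A rapidly converging subsequence has summable increments in
  L^1 and so converges almost everywhere on \<open>Lam\<close>; Fatou's lemma shows that the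
  pointwise limit is also the limit in norm. A Cauchy sequence converges along with its
  subsequence.\<close>

instance l2 :: complete_space
proof
  fix X :: "nat \<Rightarrow> l2" assume X: "Cauchy X"
  have "\<forall>k. \<exists>N. \<forall>m\<ge>N. \<forall>n\<ge>N. dist (X m) (X n) < (1 / 2) ^ k"
    using X unfolding Cauchy_def by simp
  then obtain N where N: "\<And>k m n. N k \<le> m \<Longrightarrow> N k \<le> n \<Longrightarrow> dist (X m) (X n) < (1 / 2) ^ k" by metis
  \<comment> \<open>Adding up all earlier thresholds, each increased by 1, makes \<open>r\<close>
    strictly increasing and keeps \<open>r m\<close> above \<open>N n\<close> for all
    \<open>m \<ge> n\<close>.\<close>
  define r where "r n = (\<Sum>i\<le>n. Suc (N i))" for n
  have rmono: "strict_mono r" by (rule strict_monoI_Suc) (simp add: r_def)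
  have rN: "N n \<le> r m" if "n \<le> m" for n m
  proof -
    have "Suc (N n) \<le> r m" unfolding r_def using that by (intro member_le_sum) auto
    then show ?thesis by simp
  qed
  define F where "F n = l2rep (X (r n))" for n
  have F: "L2b (F n)" for n unfolding F_def by (rule L2b_l2rep)
  note [measurable] = F[THEN L2b_measurable]
  have FF: "l2ip (\<lambda>s. F m s - F n s) (\<lambda>s. F m s - F n s) \<le> ((1 / 2) ^ n)\<^sup>2" if "n \<le> m" for m n
  proof -
    have "dist (X (r m)) (X (r n)) \<le> (1 / 2) ^ n"
      using N[OF rN[OF that] rN[OF order_refl]] by (rule less_imp_le)
    then have "(dist (X (r m)) (X (r n)))\<^sup>2 \<le> ((1 / 2) ^ n)\<^sup>2" by (intro power_mono) auto
    then show ?thesis by (simp add: l2_dist F_def)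
  qed
  define d where "d n s = indicator Lam s * \<bar>F (Suc n) s - F n s\<bar>" for n s
  have [measurable]: "d n \<in> borel_measurable borel" for n unfolding d_def by measurable
  have d1: "(\<integral>\<^sup>+s. ennreal (d n s) \<partial>lborel) \<le> ennreal (2 * (1 / 2) ^ n)" for n
  proof -
    have "(\<integral>\<^sup>+s. ennreal (d n s) \<partial>lborel)
        \<le> ennreal (l2ip (\<lambda>s. F (Suc n) s - F n s) (\<lambda>s. F (Suc n) s - F n s) / (2 * (1 / 2) ^ n) + (1 / 2) ^ n)"
      unfolding d_def by (intro l2_L1_le L2b_diff F) simp
    also have "\<dots> \<le> ennreal (((1 / 2) ^ n)\<^sup>2 / (2 * (1 / 2) ^ n) + (1 / 2) ^ n)"
      by (intro ennreal_leI add_mono divide_right_mono FF) auto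
    also have "\<dots> \<le> ennreal (2 * (1 / 2) ^ n)"
      by (intro ennreal_leI) (simp add: power2_eq_square)
    finally show ?thesis .
  qed
  have "(\<integral>\<^sup>+s. (\<Sum>n. ennreal (d n s)) \<partial>lborel) = (\<Sum>n. \<integral>\<^sup>+s. ennreal (d n s) \<partial>lborel)"
    by (rule nn_integral_suminf) simp
  also have "\<dots> \<le> (\<Sum>n. ennreal (2 * (1 / 2) ^ n))" by (intro suminf_le d1) auto
  also have "\<dots> < \<infinity>"
  proof -
    have "summable (\<lambda>n. 2 * (1 / 2 :: real) ^ n)" by (intro summable_mult summable_geometric) simp
    then have "(\<Sum>n. ennreal (2 * (1 / 2) ^ n)) = ennreal (\<Sum>n. 2 * (1 / 2) ^ n)"
      by (intro suminf_ennreal2) auto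
    then show ?thesis by simp
  qed
  finally have "AE s in lborel. (\<Sum>n. ennreal (d n s)) \<noteq> \<infinity>"
    by (intro nn_integral_PInf_AE) auto
  then have conv: "AE s in lborel. s \<in> Lam \<longrightarrow> convergent (\<lambda>n. F n s)"
  proof eventually_elim
    case (elim s)
    show ?case
    proof
      assume s: "s \<in> Lam"
      have "summable (\<lambda>n. d n s)"
        using elim by (intro summable_suminf_not_top) (auto simp: d_def)
      then have "summable (\<lambda>n. \<bar>F (Suc n) s - F n s\<bar>)"
        using s by (simp add: d_def)
      then have "summable (\<lambda>n. F (Suc n) s - F n s)"
        by (rule summable_rabs_cancel)
      then have "convergent (\<lambda>n. F n s - F 0 s)"
        using sum_lessThan_telescope[of "\<lambda>n. F n s"] by (simp add: summable_iff_convergent)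
      from convergent_add[OF this convergent_const[of "F 0 s"]]
      show "convergent (\<lambda>n. F n s)" by simp
    qed
  qed
  define H where "H s = lim (\<lambda>n. F n s)" for s
  have [measurable]: "H \<in> borel_measurable borel" unfolding H_def by measurable
  have HF: "(\<integral>\<^sup>+s. ennreal (indicator Lam s * (H s - F n s)\<^sup>2) \<partial>lborel) \<le> ennreal (((1 / 2) ^ n)\<^sup>2)" for n
  proof -
    have "(\<integral>\<^sup>+s. ennreal (indicator Lam s * (H s - F n s)\<^sup>2) \<partial>lborel)
       = (\<integral>\<^sup>+s. liminf (\<lambda>m. ennreal (indicator Lam s * (F m s - F n s)\<^sup>2)) \<partial>lborel)"
    proof (rule nn_integral_cong_AE)
      show "AE s in lborel. ennreal (indicator Lam s * (H s - F n s)\<^sup>2) = liminf (\<lambda>m. ennreal (indicator Lam s * (F m s - F n s)\<^sup>2))"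
        using conv
      proof eventually_elim
        case (elim s)
        have "(\<lambda>m. ennreal (indicator Lam s * (F m s - F n s)\<^sup>2)) \<longlonglongrightarrow> ennreal (indicator Lam s * (H s - F n s)\<^sup>2)"
        proof (cases "s \<in> Lam")
          case True
          then have "(\<lambda>m. F m s) \<longlonglongrightarrow> H s" using elim unfolding H_def by (simp add: convergent_LIMSEQ_iff)
          then show ?thesis by (intro tendsto_intros)
        qed simp
        then show ?case by (intro lim_imp_Liminf[symmetric]) auto
      qed
    qed
    also have "\<dots> \<le> liminf (\<lambda>m. \<integral>\<^sup>+s. ennreal (indicator Lam s * (F m s - F n s)\<^sup>2) \<partial>lborel)"
      by (rule nn_integral_liminf) simp
    also have "\<dots> \<le> ennreal (((1 / 2) ^ n)\<^sup>2)"
    proof (rule order_trans[OF Liminf_mono Liminf_le[OF sequentially_bot, of "\<lambda>_. ennreal (((1 / 2) ^ n)\<^sup>2)" "ennreal (((1 / 2) ^ n)\<^sup>2)"]])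
      show "\<forall>\<^sub>F m in sequentially. (\<integral>\<^sup>+s. ennreal (indicator Lam s * (F m s - F n s)\<^sup>2) \<partial>lborel) \<le> ennreal (((1 / 2) ^ n)\<^sup>2)"
        using eventually_ge_at_top[of n]
      proof eventually_elim
        case (elim m)
        have "(\<integral>\<^sup>+s. ennreal (indicator Lam s * (F m s - F n s)\<^sup>2) \<partial>lborel) = ennreal (l2ip (\<lambda>s. F m s - F n s) (\<lambda>s. F m s - F n s))"
          unfolding l2ip_def power2_eq_square
          by (intro nn_integral_eq_integral L2b_mult_integrable L2b_diff F) auto
        then show ?case using FF[OF elim] by (simp add: ennreal_leI)
      qed
    qed simp
    finally show ?thesis .
  qed
  have HFL: "L2b (\<lambda>s. H s - F n s)" for n
    unfolding L2b_def
  proof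
    show "integrable lborel (\<lambda>s. indicator Lam s * (H s - F n s)\<^sup>2)"
      using HF[of n] by (intro integrableI_nonneg) (auto intro: order_le_less_trans)
  qed simp
  have HL: "L2b H" using L2b_add[OF HFL[of 0] F[of 0]] by simp
  have dH: "dist (X (r n)) (l2abs H) \<le> (1 / 2) ^ n" for n
  proof -
    have "(dist (l2abs H) (X (r n)))\<^sup>2 = l2ip (\<lambda>s. H s - F n s) (\<lambda>s. H s - F n s)"
    proof -
      have e: "AE x in lborel. x \<in> Lam \<longrightarrow> l2rep (l2abs H) x - F n x = H x - F n x"
        using l2rep_abs[OF HL] by eventually_elim simp
      show ?thesis
        unfolding l2_dist F_def[symmetric] by (intro l2ip_cong L2b_diff L2b_l2rep HL F e)
    qed
    also have "\<dots> \<le> ((1 / 2) ^ n)\<^sup>2"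
    proof -
      have "ennreal (l2ip (\<lambda>s. H s - F n s) (\<lambda>s. H s - F n s)) = (\<integral>\<^sup>+s. ennreal (indicator Lam s * (H s - F n s)\<^sup>2) \<partial>lborel)"
        unfolding l2ip_def power2_eq_square
        by (intro nn_integral_eq_integral[symmetric] L2b_mult_integrable HFL) auto
      also have "\<dots> \<le> ennreal (((1 / 2) ^ n)\<^sup>2)" by (rule HF)
      finally show ?thesis by (simp add: ennreal_le_iff)
    qed
    finally have "dist (l2abs H) (X (r n)) \<le> (1 / 2) ^ n" by (rule power2_le_imp_le) simp
    then show ?thesis by (subst dist_commute)
  qed
  have "(X \<circ> r) \<longlonglongrightarrow> l2abs H"
  proof (rule metric_tendsto_imp_tendsto)
    show "(\<lambda>n. (1 / 2 :: real) ^ n) \<longlonglongrightarrow> 0" by (rule LIMSEQ_realpow_zero) auto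
    show "\<forall>\<^sub>F n in sequentially. dist ((X \<circ> r) n) (l2abs H) \<le> dist ((1 / 2 :: real) ^ n) 0"
      using dH by simp
  qed
  then have "X \<longlonglongrightarrow> l2abs H" using Cauchy_converges_subseq[OF X rmono] by (simp add: o_def)
  then show "convergent X" by (auto simp: convergent_def)
qed

section \<open>Weak derivatives\<close>

lemma AE_LM: "(AE x in LM. P x) \<longleftrightarrow> (AE x in lborel. x \<in> Lam \<longrightarrow> P x)"
  by (subst AE_restrict_space_iff) (auto simp: AE_completion_iff)

text \<open>The notions of the problem use Lebesgue measurable functions on a set, the estimates use
  Borel functions on the line. Since Lebesgue measure is the completion of the Borel one, a Borel
  function that agrees with \<open>f\<close> almost everywhere on \<open>S\<close> decides
  measurability, integrability and the integral.\<close>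

lemma lebesgue_on_transfer:
  fixes f f' :: "real \<Rightarrow> real"
  assumes S: "S \<in> sets borel" and f' [measurable]: "f' \<in> borel_measurable borel" and eq: "AE x in lborel. x \<in> S \<longrightarrow> f x = f' x"
  shows "f \<in> borel_measurable (lebesgue_on S)"
    and "integral\<^sup>L (lebesgue_on S) f = (\<integral>x. indicator S x * f' x \<partial>lborel)"
    and "integrable (lebesgue_on S) f \<longleftrightarrow> integrable lborel (\<lambda>x. indicator S x * f' x)"
proof -
  have L: "S \<in> sets lebesgue" using S by simp
  let ?h' = "\<lambda>x. indicator S x * f' x"
  have m': "?h' \<in> borel_measurable lebesgue" using S by (intro measurable_completion) simp
  have ae: "AE x in lebesgue. ?h' x = (if x \<in> S then f x else 0)"
    using eq by (intro AE_completion) (auto elim!: eventually_mono simp: indicator_def)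
  from borel_measurable_AE[OF m' ae] show f: "f \<in> borel_measurable (lebesgue_on S)"
    by (rule borel_measurable_if_D)
  have m: "(\<lambda>x. indicator S x *\<^sub>R f x) \<in> borel_measurable lebesgue"
  proof -
    have "(\<lambda>x. indicator S x *\<^sub>R f x) = (\<lambda>x. if x \<in> S then f x else 0)" by (auto simp: fun_eq_iff)
    then show ?thesis using borel_measurable_if_I[OF f L] by (simp only:)
  qed
  have ae': "AE x in lebesgue. indicator S x *\<^sub>R f x = ?h' x"
    using ae by eventually_elim (auto simp: indicator_def)
  have "integral\<^sup>L (lebesgue_on S) f = (\<integral>x. indicator S x *\<^sub>R f x \<partial>lebesgue)"
    using L by (intro integral_restrict_space) simp
  also have "\<dots> = (\<integral>x. ?h' x \<partial>lebesgue)"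
    by (rule integral_cong_AE[OF m m' ae'])
  finally show "integral\<^sup>L (lebesgue_on S) f = (\<integral>x. ?h' x \<partial>lborel)" using S by (simp add: integral_completion)
  have "integrable (lebesgue_on S) f \<longleftrightarrow> integrable lebesgue (\<lambda>x. indicator S x *\<^sub>R f x)"
    using L by (intro integrable_restrict_space) simp
  also have "\<dots> \<longleftrightarrow> integrable lebesgue ?h'"
    by (rule integrable_cong_AE[OF m m' ae'])
  finally show "integrable (lebesgue_on S) f \<longleftrightarrow> integrable lborel ?h'" using S by (simp add: integrable_completion)
qed

lemmas LM_measurable = lebesgue_on_transfer(1)[OF Lam_borel]
lemmas LM_integral = lebesgue_on_transfer(2)[OF Lam_borel]
lemmas LM_integrable = lebesgue_on_transfer(3)[OF Lam_borel]

lemma LM_rep: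
  fixes f :: "real \<Rightarrow> real"
  assumes f: "f \<in> borel_measurable LM"
  obtains f' where "f' \<in> borel_measurable borel" "\<And>x. x \<notin> Lam \<Longrightarrow> f' x = 0" "AE x in lborel. x \<in> Lam \<longrightarrow> f x = f' x"
proof -
  have "(\<lambda>x. if x \<in> Lam then f x else 0) \<in> borel_measurable lebesgue"
    by (rule borel_measurable_if_I[OF f]) simp
  from completion_ex_borel_measurable_real[OF this] obtain g
    where g: "g \<in> borel_measurable lborel" "AE x in lborel. (if x \<in> Lam then f x else 0) = g x" by blast
  have [measurable]: "g \<in> borel_measurable borel" using g by simp
  show ?thesis
  proof (rule that[of "\<lambda>x. indicator Lam x * g x"])
    show "AE x in lborel. x \<in> Lam \<longrightarrow> f x = indicator Lam x * g x"
      using g(2) by eventually_elim auto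
  qed auto
qed

lemma sqint_iff:
  assumes "f' \<in> borel_measurable borel" and eq: "AE x in lborel. x \<in> Lam \<longrightarrow> f x = f' x"
  shows "sqint f \<longleftrightarrow> L2b f'"
proof -
  note [measurable] = assms(1)
  have "AE x in lborel. x \<in> Lam \<longrightarrow> (f x)\<^sup>2 = (f' x)\<^sup>2" using eq by eventually_elim auto
  then show ?thesis
    unfolding sqint_def L2b_def using LM_measurable[OF assms] LM_integrable[of "\<lambda>x. (f' x)\<^sup>2" "\<lambda>x. (f x)\<^sup>2"] assms(1) by simp
qed

lemma sqint_rep:
  assumes "sqint f"
  obtains f' where "L2b f'" "AE x in lborel. x \<in> Lam \<longrightarrow> f x = f' x"
proof -
  have "f \<in> borel_measurable LM" using assms by (simp add: sqint_def)
  from LM_rep[OF this] obtain f' where f': "f' \<in> borel_measurable borel" "AE x in lborel. x \<in> Lam \<longrightarrow> f x = f' x" by blast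
  then show ?thesis using that sqint_iff[OF f'] assms by blast
qed

lemma L2ip_rep:
  assumes [measurable]: "f' \<in> borel_measurable borel" "g' \<in> borel_measurable borel"
    and "AE x in lborel. x \<in> Lam \<longrightarrow> f x = f' x" "AE x in lborel. x \<in> Lam \<longrightarrow> g x = g' x"
  shows "L2ip f g = l2ip f' g'"
  unfolding L2ip_def l2ip_def
proof (rule LM_integral)
  show "AE x in lborel. x \<in> Lam \<longrightarrow> f x * g x = f' x * g' x"
    using assms(3,4) by eventually_elim auto
qed simp

section \<open>Smooth functions with compact support\<close>

definition ebump :: "real \<Rightarrow> real \<Rightarrow> real \<Rightarrow> nat \<Rightarrow> nat \<Rightarrow> real \<Rightarrow> real" where
  "ebump \<epsilon> a b i j x = (if a < x \<and> x < b
     then (1 / (x - a)) ^ i * (1 / (b - x)) ^ j * exp (- \<epsilon> * (1 / (x - a) + 1 / (b - x))) else 0)"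

text \<open>The \<open>k\<close>-th power of the inequality \<open>z \<le> exp z\<close> at
  \<open>z = \<epsilon> * u / k\<close>.\<close>

lemma power_exp_le:
  fixes u \<epsilon> :: real
  assumes "0 < \<epsilon>" "0 < u"
  shows "u ^ k * exp (- \<epsilon> * u) \<le> (real k / \<epsilon>) ^ k"
proof (cases "k = 0")
  case False
  then have k: "0 < real k" by simp
  have "\<epsilon> * u / real k \<le> exp (\<epsilon> * u / real k)"
    using exp_ge_add_one_self[of "\<epsilon> * u / real k"] by linarith
  then have "(\<epsilon> * u / real k) ^ k \<le> exp (\<epsilon> * u / real k) ^ k"
    using assms k by (intro power_mono) auto
  also have "\<dots> = exp (\<epsilon> * u)" using k by (simp add: exp_of_nat_mult[symmetric])
  finally have "(real k / \<epsilon>) ^ k * (\<epsilon> * u / real k) ^ k \<le> (real k / \<epsilon>) ^ k * exp (\<epsilon> * u)"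
    using assms by (intro mult_left_mono) auto
  also have "(real k / \<epsilon>) ^ k * (\<epsilon> * u / real k) ^ k = u ^ k"
    using assms k by (simp add: power_mult_distrib[symmetric])
  finally show ?thesis by (simp add: exp_minus field_simps)
qed (use assms in auto)

text \<open>The exponential absorbs two more powers of the pole at the chosen end than are present.
  What is left vanishes quadratically there, so the function is differentiable at the end point with
  derivative 0.\<close>

lemma ebump_le:
  assumes "0 < \<epsilon>"
  shows "\<bar>ebump \<epsilon> a b i j x\<bar> \<le> ((real (i + 2) / \<epsilon>) ^ (i + 2) * (real j / \<epsilon>) ^ j) * (x - a)\<^sup>2"
    and "\<bar>ebump \<epsilon> a b i j x\<bar> \<le> ((real (j + 2) / \<epsilon>) ^ (j + 2) * (real i / \<epsilon>) ^ i) * (x - b)\<^sup>2"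
proof -
  have main: "u ^ i * v ^ j * exp (- \<epsilon> * (u + v)) \<le> ((real (i + 2) / \<epsilon>) ^ (i + 2) * (real j / \<epsilon>) ^ j) * (1 / u)\<^sup>2"
    if uv: "0 < u" "0 < v" for u v :: real and i j
  proof -
    have "u ^ i * v ^ j * exp (- \<epsilon> * (u + v)) = (u ^ (i + 2) * exp (- \<epsilon> * u)) * (v ^ j * exp (- \<epsilon> * v)) * (1 / u)\<^sup>2"
      using uv by (simp add: power_add exp_add[symmetric] field_simps power2_eq_square)
    also have "\<dots> \<le> ((real (i + 2) / \<epsilon>) ^ (i + 2) * (real j / \<epsilon>) ^ j) * (1 / u)\<^sup>2"
      using uv assms by (intro mult_right_mono mult_mono power_exp_le) auto
    finally show ?thesis .
  qed
  show "\<bar>ebump \<epsilon> a b i j x\<bar> \<le> ((real (i + 2) / \<epsilon>) ^ (i + 2) * (real j / \<epsilon>) ^ j) * (x - a)\<^sup>2"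
    using main[of "1 / (x - a)" "1 / (b - x)" i j] assms by (auto simp: ebump_def)
  show "\<bar>ebump \<epsilon> a b i j x\<bar> \<le> ((real (j + 2) / \<epsilon>) ^ (j + 2) * (real i / \<epsilon>) ^ i) * (x - b)\<^sup>2"
    using main[of "1 / (b - x)" "1 / (x - a)" j i] assms
    by (auto simp: ebump_def add.commute mult.commute power2_commute[of x b])
qed

lemma DERIV_zero_if_quadratic:
  fixes f :: "real \<Rightarrow> real"
  assumes "\<And>x. \<bar>f x\<bar> \<le> C * (x - c)\<^sup>2"
  shows "(f has_real_derivative 0) (at c)"
proof -
  have fc: "f c = 0" using assms[of c] by simp
  have "((\<lambda>h. C * \<bar>h\<bar>) \<longlongrightarrow> C * \<bar>0\<bar>) (at 0)" by (intro tendsto_intros)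
  then have l: "((\<lambda>h. C * \<bar>h\<bar>) \<longlongrightarrow> 0) (at (0::real))" by simp
  have "((\<lambda>h. (f (c + h) - f c) / h) \<longlongrightarrow> 0) (at 0)"
  proof (rule Lim_null_comparison[OF _ l])
    have "norm ((f (c + h) - f c) / h) \<le> C * \<bar>h\<bar>" for h
    proof (cases "h = 0")
      case False
      have "\<bar>f (c + h)\<bar> \<le> C * \<bar>h\<bar> * \<bar>h\<bar>" using assms[of "c + h"] by (simp add: power2_eq_square)
      then show ?thesis using False by (simp add: fc divide_le_eq)
    qed simp
    then show "\<forall>\<^sub>F h in at 0. norm ((f (c + h) - f c) / h) \<le> C * \<bar>h\<bar>" by simp
  qed
  then show ?thesis by (simp add: DERIV_def)
qed

text \<open>Each pole contributes one term from its power and one from the exponent. Outside the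
  interval the function vanishes locally; at the two end points the quadratic bound gives derivative
  0, as do all terms of the formula.\<close>

lemma ebump_DERIV:
  assumes \<epsilon>: "0 < \<epsilon>" and ab: "a < b"
  shows "(ebump \<epsilon> a b i j has_real_derivative
     (- real i * ebump \<epsilon> a b (i + 1) j x + real j * ebump \<epsilon> a b i (j + 1) x)
      + (\<epsilon> * ebump \<epsilon> a b (i + 2) j x + - \<epsilon> * ebump \<epsilon> a b i (j + 2) x)) (at x)"
proof -
  consider "x < a" | "x = a" | "a < x \<and> x < b" | "x = b" | "b < x" by linarith
  then show ?thesis
  proof cases
    case 1
    then have "\<forall>\<^sub>F y in nhds x. ebump \<epsilon> a b i j y = 0"
      using eventually_nhds_in_open[of "{..<a}" x] by (auto elim!: eventually_mono simp: ebump_def)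
    then have "(ebump \<epsilon> a b i j has_real_derivative 0) (at x)"
      by (subst DERIV_cong_ev[OF refl _ refl, where g="\<lambda>_. 0"]) auto
    then show ?thesis using 1 by (simp add: ebump_def)
  next
    case 5
    then have "\<forall>\<^sub>F y in nhds x. ebump \<epsilon> a b i j y = 0"
      using eventually_nhds_in_open[of "{b<..}" x] by (auto elim!: eventually_mono simp: ebump_def)
    then have "(ebump \<epsilon> a b i j has_real_derivative 0) (at x)"
      by (subst DERIV_cong_ev[OF refl _ refl, where g="\<lambda>_. 0"]) auto
    then show ?thesis using 5 by (simp add: ebump_def)
  next
    case 2
    have "(ebump \<epsilon> a b i j has_real_derivative 0) (at a)"
      by (rule DERIV_zero_if_quadratic[OF ebump_le(1)[OF \<epsilon>, of a b i j]])
    moreover have "ebump \<epsilon> a b i' j' a = 0" for i' j' by (simp add: ebump_def)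
    ultimately show ?thesis using 2 by simp
  next
    case 4
    have "(ebump \<epsilon> a b i j has_real_derivative 0) (at b)"
      by (rule DERIV_zero_if_quadratic[OF ebump_le(2)[OF \<epsilon>, of a b i j]])
    moreover have "ebump \<epsilon> a b i' j' b = 0" for i' j' by (simp add: ebump_def)
    ultimately show ?thesis using 4 by simp
  next
    case 3
    then have x: "x - a \<noteq> 0" "b - x \<noteq> 0" by auto
    define u v where "u = 1 / (x - a)" and "v = 1 / (b - x)"
    have D1: "((\<lambda>x. 1 / (x - a)) has_real_derivative - (u\<^sup>2)) (at x)"
      unfolding u_def using x by (auto intro!: derivative_eq_intros simp: power2_eq_square)
    have D2: "((\<lambda>x. 1 / (b - x)) has_real_derivative v\<^sup>2) (at x)"
      unfolding v_def using x by (auto intro!: derivative_eq_intros simp: power2_eq_square)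
    have P1: "((\<lambda>x. (1 / (x - a)) ^ i) has_real_derivative - real i * u ^ (i + 1)) (at x)"
    proof -
      have "real i * (- (u\<^sup>2) * u ^ (i - Suc 0)) = - real i * u ^ (i + 1)"
        by (cases i) (auto simp: power2_eq_square algebra_simps)
      then show ?thesis using DERIV_power[OF D1, of i] by (simp only: u_def)
    qed
    have P2: "((\<lambda>x. (1 / (b - x)) ^ j) has_real_derivative real j * v ^ (j + 1)) (at x)"
    proof -
      have "real j * (v\<^sup>2 * v ^ (j - Suc 0)) = real j * v ^ (j + 1)"
        by (cases j) (auto simp: power2_eq_square algebra_simps)
      then show ?thesis using DERIV_power[OF D2, of j] by (simp only: v_def)
    qed
    have E: "((\<lambda>x. exp (- \<epsilon> * (1 / (x - a) + 1 / (b - x)))) has_real_derivative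
        exp (- \<epsilon> * (u + v)) * (- \<epsilon> * (- (u\<^sup>2) + v\<^sup>2))) (at x)"
      using DERIV_fun_exp[OF DERIV_cmult[OF DERIV_add[OF D1 D2], of "- \<epsilon>"]] by (simp only: u_def v_def)
    have "((\<lambda>x. (1 / (x - a)) ^ i * (1 / (b - x)) ^ j * exp (- \<epsilon> * (1 / (x - a) + 1 / (b - x)))) has_real_derivative
       (- real i * u ^ (i + 1) * v ^ j + real j * v ^ (j + 1) * u ^ i) * exp (- \<epsilon> * (u + v))
        + exp (- \<epsilon> * (u + v)) * (- \<epsilon> * (- (u\<^sup>2) + v\<^sup>2)) * (u ^ i * v ^ j)) (at x)"
      using DERIV_mult[OF DERIV_mult[OF P1 P2] E] by (simp only: u_def v_def)
    also have "(- real i * u ^ (i + 1) * v ^ j + real j * v ^ (j + 1) * u ^ i) * exp (- \<epsilon> * (u + v))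
        + exp (- \<epsilon> * (u + v)) * (- \<epsilon> * (- (u\<^sup>2) + v\<^sup>2)) * (u ^ i * v ^ j)
      = (- real i * ebump \<epsilon> a b (i + 1) j x + real j * ebump \<epsilon> a b i (j + 1) x)
      + (\<epsilon> * ebump \<epsilon> a b (i + 2) j x + - \<epsilon> * ebump \<epsilon> a b i (j + 2) x)"
      using 3 by (simp add: ebump_def u_def[symmetric] v_def[symmetric] algebra_simps power2_eq_square)
    finally have D: "((\<lambda>x. (1 / (x - a)) ^ i * (1 / (b - x)) ^ j * exp (- \<epsilon> * (1 / (x - a) + 1 / (b - x)))) has_real_derivative
      (- real i * ebump \<epsilon> a b (i + 1) j x + real j * ebump \<epsilon> a b i (j + 1) x)
      + (\<epsilon> * ebump \<epsilon> a b (i + 2) j x + - \<epsilon> * ebump \<epsilon> a b i (j + 2) x)) (at x)" .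
    have "\<forall>\<^sub>F y in nhds x. ebump \<epsilon> a b i j y = (1 / (y - a)) ^ i * (1 / (b - y)) ^ j * exp (- \<epsilon> * (1 / (y - a) + 1 / (b - y)))"
      using 3 eventually_nhds_in_open[of "{a<..<b}" x] by (auto elim!: eventually_mono simp: ebump_def)
    then show ?thesis using D by (subst DERIV_cong_ev[OF refl _ refl]) auto
  qed
qed

text \<open>The linear span of these functions is closed under differentiation, so all its members are smooth.\<close>

inductive bump_span :: "(real \<Rightarrow> real) \<Rightarrow> bool" where
  base: "0 < \<epsilon> \<Longrightarrow> a < b \<Longrightarrow> bump_span (ebump \<epsilon> a b i j)"
| add: "bump_span f \<Longrightarrow> bump_span g \<Longrightarrow> bump_span (\<lambda>x. f x + g x)"
| scale: "bump_span f \<Longrightarrow> bump_span (\<lambda>x. c * f x)"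

lemma bump_span_DERIV: "bump_span f \<Longrightarrow> \<exists>f'. bump_span f' \<and> (\<forall>x. (f has_real_derivative f' x) (at x))"
proof (induction rule: bump_span.induct)
  case (base \<epsilon> a b i j)
  then have "bump_span (\<lambda>x. (- real i * ebump \<epsilon> a b (i + 1) j x + real j * ebump \<epsilon> a b i (j + 1) x)
      + (\<epsilon> * ebump \<epsilon> a b (i + 2) j x + - \<epsilon> * ebump \<epsilon> a b i (j + 2) x))"
    by (intro bump_span.add bump_span.scale bump_span.base) auto
  then show ?case using ebump_DERIV[OF base] by blast
next
  case (add f g)
  then obtain f' g' where "bump_span f'" "bump_span g'"
    "\<And>x. (f has_real_derivative f' x) (at x)" "\<And>x. (g has_real_derivative g' x) (at x)" by blast
  then show ?case by (intro exI[of _ "\<lambda>x. f' x + g' x"] conjI allI bump_span.add DERIV_add) auto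
next
  case (scale f c)
  then obtain f' where "bump_span f'" "\<And>x. (f has_real_derivative f' x) (at x)" by blast
  then show ?case by (intro exI[of _ "\<lambda>x. c * f' x"] conjI allI bump_span.scale DERIV_cmult) auto
qed

lemma bump_span_smooth: "bump_span f \<Longrightarrow> bump_span ((deriv ^^ n) f) \<and> ((deriv ^^ n) f) differentiable (at x)"
proof (induction n arbitrary: f)
  case 0
  then show ?case using bump_span_DERIV[of f] by (auto simp: real_differentiable_def)
next
  case (Suc n)
  from bump_span_DERIV[OF Suc.prems] obtain f' where f': "bump_span f'" "\<And>x. (f has_real_derivative f' x) (at x)" by blast
  have "deriv f = f'" using f'(2) by (auto simp: fun_eq_iff intro: DERIV_imp_deriv)
  then show ?case using Suc.IH[OF f'(1)] by (simp add: funpow_swap1)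
qed

lemma bump_span_continuous: "bump_span f \<Longrightarrow> continuous_on S f"
  using bump_span_DERIV[of f] DERIV_isCont by (blast intro: continuous_at_imp_continuous_on)

text \<open>A primitive taken from the left end is smooth and vanishes to the left of the support of
  \<open>h\<close>; the zero integral is what makes it vanish to the right as well.\<close>

lemma test_fun_primitive:
  assumes h: "bump_span h" and c: "-1 < c" and d: "d < 1" and cd: "c \<le> d"
    and h0: "\<And>x. x \<notin> {c..d} \<Longrightarrow> h x = 0" and int: "integral {c..d} h = 0"
  obtains \<phi> where "test_fun \<phi>" "deriv \<phi> = h"
proof -
  define \<phi> where "\<phi> x = integral {-1..x} h" for x
  have hi: "h integrable_on {x..y}" for x y
    using bump_span_continuous[OF h] by (rule integrable_continuous_interval)
  have left: "\<phi> x = 0" if "x < c" for x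
  proof -
    have "\<phi> x = integral {-1..x} (\<lambda>_. 0 :: real)"
      unfolding \<phi>_def using that h0 by (intro Henstock_Kurzweil_Integration.integral_cong) auto
    then show ?thesis by simp
  qed
  have right: "\<phi> x = 0" if "d < x" for x
  proof -
    have "\<phi> x = integral {-1..c} h + (integral {c..d} h + integral {d..x} h)"
      unfolding \<phi>_def using c cd that hi
      by (simp add: Henstock_Kurzweil_Integration.integral_combine)
    moreover have "integral {-1..c} h = 0"
    proof -
      have "integral {-1..c} h = integral {-1..c} (\<lambda>_. 0 :: real)"
        by (rule integral_spike[of "{c}"]) (use h0 in auto)
      then show ?thesis by simp
    qed
    moreover have "integral {d..x} h = 0"
    proof -
      have "integral {d..x} h = integral {d..x} (\<lambda>_. 0 :: real)"
        by (rule integral_spike[of "{d}"]) (use h0 in auto)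
      then show ?thesis by simp
    qed
    ultimately show ?thesis using int by simp
  qed
  have D: "(\<phi> has_real_derivative h x) (at x)" for x
  proof (cases "x < c")
    case True
    then have "\<forall>\<^sub>F y in nhds x. \<phi> y = 0"
      using eventually_nhds_in_open[of "{..<c}" x] left by (auto elim!: eventually_mono)
    then have "(\<phi> has_real_derivative 0) (at x)"
      by (subst DERIV_cong_ev[OF refl _ refl, where g="\<lambda>_. 0"]) auto
    then show ?thesis using True h0 by simp
  next
    case False
    have "(\<phi> has_real_derivative h x) (at x within {-1..x+1})"
      unfolding \<phi>_def using bump_span_continuous[OF h] False c
      by (intro integral_has_real_derivative) auto
    moreover have "at x within {-1..x+1} = at x" using False c by (intro at_within_interior) auto
    ultimately show ?thesis by simp
  qed
  have dh: "deriv \<phi> = h" using D by (auto simp: fun_eq_iff intro: DERIV_imp_deriv)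
  have "((deriv ^^ n) \<phi>) differentiable (at x)" for n x
  proof (cases n)
    case 0
    then show ?thesis using D by (auto simp: real_differentiable_def)
  next
    case (Suc m)
    then show ?thesis using bump_span_smooth[OF h, of m x] by (simp add: funpow_swap1 dh)
  qed
  moreover have "\<forall>x. x \<notin> {c..d} \<longrightarrow> \<phi> x = 0" using left right by (auto simp: not_le)
  ultimately have "test_fun \<phi>" unfolding test_fun_def using c d by blast
  then show ?thesis using that dh by blast
qed

lemma test_fun_DERIV: "test_fun \<phi> \<Longrightarrow> (\<phi> has_real_derivative deriv \<phi> x) (at x)"
proof -
  assume "test_fun \<phi>"
  then have "((deriv ^^ 0) \<phi>) differentiable (at x)" unfolding test_fun_def by blast
  then show ?thesis by (simp add: DERIV_deriv_iff_real_differentiable)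
qed

lemma test_fun_deriv_continuous: "test_fun \<phi> \<Longrightarrow> continuous_on S (deriv \<phi>)"
proof -
  assume t: "test_fun \<phi>"
  have "deriv \<phi> differentiable (at x)" for x
  proof -
    have "((deriv ^^ 1) \<phi>) differentiable (at x)" using t unfolding test_fun_def by blast
    then show ?thesis by simp
  qed
  then show ?thesis
    by (intro continuous_at_imp_continuous_on ballI differentiable_imp_continuous_within) simp
qed

lemma test_fun_continuous: "test_fun \<phi> \<Longrightarrow> continuous_on S \<phi>"
  using test_fun_DERIV DERIV_isCont by (blast intro: continuous_at_imp_continuous_on)

lemma test_fun_outside: "test_fun \<phi> \<Longrightarrow> x \<notin> Lam \<Longrightarrow> \<phi> x = 0"
  unfolding test_fun_def Lam_def by force

section \<open>Integration by parts and the lemma of du Bois-Reymond\<close>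

lemma prim_measurable [measurable]:
  assumes [measurable]: "g \<in> borel_measurable borel"
  shows "prim g \<in> borel_measurable borel"
proof -
  have "prim g = (\<lambda>x. \<integral>s. pw (s + 1) 0 * pw (x - s) 0 * g s \<partial>lborel)"
    unfolding prim_def by (auto simp: pw_def indicator_def fun_eq_iff intro!: Bochner_Integration.integral_cong)
  then show ?thesis by simp
qed

text \<open>Fubini's theorem on the triangle \<open>s < x\<close>, followed by the fundamental
  theorem for the test function, whose value at 1 is 0.\<close>

lemma prim_by_parts:
  assumes [measurable]: "g \<in> borel_measurable borel" and g: "integrable lborel (\<lambda>s. indicator Lam s * g s)"
    and \<phi>: "test_fun \<phi>"
  shows "l2ip (prim g) (deriv \<phi>) = - l2ip g \<phi>"
proof -
  have [measurable]: "deriv \<phi> \<in> borel_measurable borel" "\<phi> \<in> borel_measurable borel"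
    using test_fun_deriv_continuous[OF \<phi>, of UNIV] test_fun_continuous[OF \<phi>, of UNIV]
    by (auto intro: borel_measurable_continuous_onI)
  have "bounded (deriv \<phi> ` {-1..1})"
    by (intro compact_imp_bounded compact_continuous_image test_fun_deriv_continuous \<phi>) simp
  then obtain M where "\<forall>y\<in>deriv \<phi> ` {-1..1}. norm y \<le> M" unfolding bounded_iff by blast
  then have M: "\<bar>deriv \<phi> x\<bar> \<le> M" if "x \<in> {-1..1}" for x using that by auto
  have M0: "0 \<le> M" using order_trans[OF abs_ge_zero M[of 0]] by simp
  let ?F = "\<lambda>x s. (indicator Lam x * deriv \<phi> x) * (pw (x - s) 0 * (indicator Lam s * g s))"
  have int: "integrable (lborel \<Otimes>\<^sub>M lborel) (\<lambda>(x, s). ?F x s)"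
  proof (rule integrableI_bounded)
    have "(\<integral>\<^sup>+p. ennreal (norm (case p of (x, s) \<Rightarrow> ?F x s)) \<partial>(lborel \<Otimes>\<^sub>M lborel)) = (\<integral>\<^sup>+x. \<integral>\<^sup>+s. ennreal \<bar>?F x s\<bar> \<partial>lborel \<partial>lborel)"
      by (subst lborel.nn_integral_fst[symmetric]) simp_all
    also have "\<dots> \<le> (\<integral>\<^sup>+x. \<integral>\<^sup>+s. ennreal (M * indicator Lam x) * ennreal \<bar>indicator Lam s * g s\<bar> \<partial>lborel \<partial>lborel)"
    proof (intro nn_integral_mono)
      fix x s
      have 1: "\<bar>indicator Lam x * deriv \<phi> x\<bar> \<le> M * indicator Lam x"
        using M[of x] by (auto simp: indicator_def Lam_def)
      have 2: "\<bar>pw (x - s) 0 * (indicator Lam s * g s)\<bar> \<le> \<bar>indicator Lam s * g s\<bar>"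
        by (auto simp: pw_def)
      have "\<bar>?F x s\<bar> \<le> (M * indicator Lam x) * \<bar>indicator Lam s * g s\<bar>"
        unfolding abs_mult[of "indicator Lam x * deriv \<phi> x"] using M0 by (intro mult_mono 1 2) auto
      then show "ennreal \<bar>?F x s\<bar> \<le> ennreal (M * indicator Lam x) * ennreal \<bar>indicator Lam s * g s\<bar>"
        using M0 by (simp add: ennreal_mult'[symmetric] ennreal_leI)
    qed
    also have "\<dots> = (\<integral>\<^sup>+x. ennreal (M * indicator Lam x) \<partial>lborel) * (\<integral>\<^sup>+s. ennreal \<bar>indicator Lam s * g s\<bar> \<partial>lborel)"
      by (simp add: nn_integral_cmult nn_integral_multc)
    also have "\<dots> < \<infinity>"
    proof -
      have "integrable lborel (\<lambda>x. M * indicator Lam x :: real)" by (intro integrable_mult_right) (simp add: Lam_def)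
      then show ?thesis using g M0 unfolding integrable_iff_bounded by (simp add: ennreal_mult_less_top abs_mult)
    qed
    finally show "(\<integral>\<^sup>+p. ennreal (norm (case p of (x, s) \<Rightarrow> ?F x s)) \<partial>(lborel \<Otimes>\<^sub>M lborel)) < \<infinity>" .
  qed measurable
  have "l2ip (prim g) (deriv \<phi>) = (\<integral>x. \<integral>s. ?F x s \<partial>lborel \<partial>lborel)"
    unfolding l2ip_def
  proof (intro Bochner_Integration.integral_cong refl)
    fix x
    show "indicator Lam x * (prim g x * deriv \<phi> x) = (\<integral>s. ?F x s \<partial>lborel)"
    proof (cases "x \<in> Lam")
      case True
      then have e: "pw (x - s) 0 * (indicator Lam s * g s) = indicator {-1<..<x} s * g s" for s
        by (auto simp: pw_def indicator_def Lam_def)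
      show ?thesis unfolding e prim_def integral_mult_right_zero by simp
    qed simp
  qed
  also have "\<dots> = (\<integral>s. \<integral>x. ?F x s \<partial>lborel \<partial>lborel)"
    by (rule lborel_pair.Fubini_integral[OF int, symmetric])
  also have "\<dots> = (\<integral>s. - (indicator Lam s * (g s * \<phi> s)) \<partial>lborel)"
  proof (intro Bochner_Integration.integral_cong refl)
    fix s
    show "(\<integral>x. ?F x s \<partial>lborel) = - (indicator Lam s * (g s * \<phi> s))"
    proof (cases "s \<in> Lam")
      case True
      have "(\<integral>x. ?F x s \<partial>lborel) = (\<integral>x. g s * (deriv \<phi> x * indicator {s..1} x) \<partial>lborel)"
      proof (rule integral_cong_AE)
        have "AE x in lborel. x \<noteq> s \<and> x \<noteq> 1" by (simp add: AE_lborel_singleton)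
        then show "AE x in lborel. ?F x s = g s * (deriv \<phi> x * indicator {s..1} x)"
          by eventually_elim (use True in \<open>auto simp: pw_def indicator_def Lam_def\<close>)
      qed simp_all
      also have "\<dots> = g s * (\<integral>x. deriv \<phi> x * indicator {s..1} x \<partial>lborel)" by (rule integral_mult_right_zero)
      also have "(\<integral>x. deriv \<phi> x * indicator {s..1} x \<partial>lborel) = \<phi> 1 - \<phi> s"
        using True test_fun_deriv_continuous[OF \<phi>, of UNIV]
        by (intro integral_FTC_Icc_real test_fun_DERIV \<phi>) (auto simp: Lam_def continuous_on_eq_continuous_at)
      also have "\<phi> 1 = 0" by (rule test_fun_outside[OF \<phi>]) (simp add: Lam_def)
      finally show ?thesis using True by simp
    qed simp
  qed
  finally show ?thesis by (simp add: l2ip_def)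
qed

text \<open>As the parameter in the exponential tends to 0, the bump tends to 1 inside its interval.
  The interval is shrunk at the same rate so that the supports stay away from \<open>a\<close> and
  \<open>b\<close>, which matters when these are the end points of \<open>Lam\<close>.\<close>

lemma ebump_limit:
  assumes ab: "a < b" and q: "integrable lborel q"
  shows "(\<lambda>n. \<integral>x. q x * ebump (1 / real (Suc n)) (a + 1 / real (Suc n)) (b - 1 / real (Suc n)) 0 0 x \<partial>lborel)
     \<longlonglongrightarrow> (\<integral>x. indicator {a<..<b} x * q x \<partial>lborel)"
proof (rule integral_dominated_convergence)
  have [measurable]: "q \<in> borel_measurable borel" using q by auto
  have [measurable]: "ebump \<epsilon> c d i j \<in> borel_measurable borel" for \<epsilon> c d i j
    unfolding ebump_def[abs_def] by measurable
  show "(\<lambda>x. q x * ebump (1 / real (Suc n)) (a + 1 / real (Suc n)) (b - 1 / real (Suc n)) 0 0 x) \<in> borel_measurable lborel" for n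
    by measurable
  show "(\<lambda>x. indicator {a<..<b} x * q x) \<in> borel_measurable lborel" by measurable
  show "integrable lborel (\<lambda>x. \<bar>q x\<bar>)" using q by simp
  have le1: "\<bar>ebump \<epsilon> c d 0 0 x\<bar> \<le> 1" if "0 < \<epsilon>" for \<epsilon> c d x
    using that by (auto simp: ebump_def)
  show "AE x in lborel. norm (q x * ebump (1 / real (Suc n)) (a + 1 / real (Suc n)) (b - 1 / real (Suc n)) 0 0 x) \<le> \<bar>q x\<bar>" for n
  proof (rule AE_I2)
    fix x
    have "\<bar>q x\<bar> * \<bar>ebump (1 / real (Suc n)) (a + 1 / real (Suc n)) (b - 1 / real (Suc n)) 0 0 x\<bar> \<le> \<bar>q x\<bar> * 1"
      by (intro mult_left_mono le1) auto
    then show "norm (q x * ebump (1 / real (Suc n)) (a + 1 / real (Suc n)) (b - 1 / real (Suc n)) 0 0 x) \<le> \<bar>q x\<bar>"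
      by (simp only: real_norm_def abs_mult mult_1_right)
  qed
  show "AE x in lborel. (\<lambda>n. q x * ebump (1 / real (Suc n)) (a + 1 / real (Suc n)) (b - 1 / real (Suc n)) 0 0 x)
      \<longlonglongrightarrow> indicator {a<..<b} x * q x"
  proof (rule AE_I2)
    fix x
    have h: "(\<lambda>n. 1 / real (Suc n)) \<longlonglongrightarrow> 0"
      using LIMSEQ_inverse_real_of_nat by (simp add: inverse_eq_divide)
    show "(\<lambda>n. q x * ebump (1 / real (Suc n)) (a + 1 / real (Suc n)) (b - 1 / real (Suc n)) 0 0 x) \<longlonglongrightarrow> indicator {a<..<b} x * q x"
    proof (cases "a < x \<and> x < b")
      case True
      have "(\<lambda>n. exp (- (1 / real (Suc n)) * (1 / (x - (a + 1 / real (Suc n))) + 1 / ((b - 1 / real (Suc n)) - x))))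
        \<longlonglongrightarrow> exp (- 0 * (1 / (x - (a + 0)) + 1 / ((b - 0) - x)))"
        using True by (intro tendsto_intros h) auto
      then have l: "(\<lambda>n. exp (- (1 / real (Suc n)) * (1 / (x - (a + 1 / real (Suc n))) + 1 / ((b - 1 / real (Suc n)) - x)))) \<longlonglongrightarrow> 1"
        by simp
      have "\<forall>\<^sub>F n in sequentially. 1 / real (Suc n) < min (x - a) (b - x)"
        using True by (intro order_tendstoD(2)[OF h]) auto
      then have "\<forall>\<^sub>F n in sequentially. exp (- (1 / real (Suc n)) * (1 / (x - (a + 1 / real (Suc n))) + 1 / ((b - 1 / real (Suc n)) - x)))
         = ebump (1 / real (Suc n)) (a + 1 / real (Suc n)) (b - 1 / real (Suc n)) 0 0 x"
        by eventually_elim (auto simp: ebump_def)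
      from Lim_transform_eventually[OF l this]
      have "(\<lambda>n. ebump (1 / real (Suc n)) (a + 1 / real (Suc n)) (b - 1 / real (Suc n)) 0 0 x) \<longlonglongrightarrow> 1" .
      from tendsto_mult[OF tendsto_const[of "q x"] this] show ?thesis using True by simp
    next
      case False
      have "ebump (1 / real (Suc n)) (a + 1 / real (Suc n)) (b - 1 / real (Suc n)) 0 0 x = 0" for n
      proof -
        have "0 < 1 / real (Suc n)" by simp
        then show ?thesis using False unfolding ebump_def by (intro if_not_P) linarith
      qed
      then show ?thesis using False by simp
    qed
  qed
qed

lemma indicator_Lam_integral: "(\<integral>x. indicator Lam x \<partial>lborel) = (2::real)"
  by (simp add: Lam_def)

text \<open>A combination of two bumps with total integral 0 is the derivative of a test function.
  Orthogonality therefore says that the integrals of \<open>q\<close> against bumps are proportional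
  to the integrals of the bumps; in the limit, the integral of \<open>q\<close> over an interval is
  proportional to its length.\<close>

lemma du_bois_reymond:
  assumes [measurable]: "q \<in> borel_measurable borel" and q: "integrable lborel (\<lambda>x. indicator Lam x * q x)"
    and orth: "\<And>\<phi>. test_fun \<phi> \<Longrightarrow> l2ip q (deriv \<phi>) = 0"
  obtains c where "AE x in lborel. x \<in> Lam \<longrightarrow> q x = c"
proof -
  let ?q = "\<lambda>x. indicator Lam x * q x"
  define E where "E n a b = ebump (1 / real (Suc n)) (a + 1 / real (Suc n)) (b - 1 / real (Suc n)) 0 0" for n a b
  let ?I = "\<lambda>f. \<integral>x. f x * (1 :: real) \<partial>(lborel :: real measure)"
  have good: "bump_span (E n a b) \<and> -1 < a + 1 / real (Suc n) \<and> b - 1 / real (Suc n) < 1 \<and> a + 1 / real (Suc n) < b - 1 / real (Suc n)"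
    if "-1 \<le> a" "b \<le> 1" "2 / real (Suc n) < b - a" for n a b
  proof -
    have p: "0 < 1 / real (Suc n)" by simp
    have "2 / real (Suc n) = 2 * (1 / real (Suc n))" by simp
    with that p have "a + 1 / real (Suc n) < b - 1 / real (Suc n)" "-1 < a + 1 / real (Suc n)" "b - 1 / real (Suc n) < 1" by linarith+
    then show ?thesis using p unfolding E_def by (auto intro: bump_span.base)
  qed
  have Eout: "E n a b x = 0" if "x \<notin> {a + 1 / real (Suc n)..b - 1 / real (Suc n)}" for n a b x
    using that by (auto simp: E_def ebump_def)
  have Eint: "has_bochner_integral lborel (E n a b) (integral {-1..1} (E n a b))"
    if "-1 \<le> a" "b \<le> 1" "2 / real (Suc n) < b - a" for n a b
  proof -
    have "continuous_on {-1..1} (E n a b)" using good[OF that] bump_span_continuous by blast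
    then have "set_integrable lborel {-1..1} (E n a b)"
      by (rule borel_integrable_atLeastAtMost'[unfolded atLeastAtMost_iff])
    moreover have e: "(\<lambda>x. indicator {-1..1} x *\<^sub>R E n a b x) = E n a b"
    proof
      fix x
      show "indicator {-1..1} x *\<^sub>R E n a b x = E n a b x"
        using Eout[of x a n b] good[OF that] by (cases "x \<in> {-1..1}") auto
    qed
    ultimately show ?thesis
      using set_borel_integral_eq_integral(2)[of "{-1..1}" "E n a b"]
      unfolding has_bochner_integral_iff set_integrable_def set_lebesgue_integral_def e by simp
  qed
  have key: "(\<integral>x. ?q x * E n a b x \<partial>lborel) * (\<integral>x. E m a' b' x \<partial>lborel) = (\<integral>x. ?q x * E m a' b' x \<partial>lborel) * (\<integral>x. E n a b x \<partial>lborel)"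
    if h1: "-1 \<le> a" "b \<le> 1" "2 / real (Suc n) < b - a" and h2: "-1 \<le> a'" "b' \<le> 1" "2 / real (Suc m) < b' - a'" for n a b m a' b'
  proof -
    note g1 = good[OF h1] and g2 = good[OF h2]
    \<comment> \<open>The crossed masses of the two bumps as coefficients make the total integral of
      \<open>h\<close> vanish.\<close>
    define p where "p = (\<integral>x. E m a' b' x \<partial>lborel)"
    define r where "r = - (\<integral>x. E n a b x \<partial>lborel)"
    define h where "h x = p * E n a b x + r * E m a' b' x" for x
    define c d where "c = min (a + 1 / real (Suc n)) (a' + 1 / real (Suc m))" and "d = max (b - 1 / real (Suc n)) (b' - 1 / real (Suc m))"
    have hs: "bump_span h" unfolding h_def using g1 g2 by (intro bump_span.add bump_span.scale) auto
    have cd: "-1 < c" "d < 1" "c \<le> d" using g1 g2 by (auto simp: c_def d_def)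
    have h0: "h x = 0" if "x \<notin> {c..d}" for x
    proof -
      have "x \<notin> {a + 1 / real (Suc n)..b - 1 / real (Suc n)}" "x \<notin> {a' + 1 / real (Suc m)..b' - 1 / real (Suc m)}"
        using that unfolding c_def d_def by (auto simp: min_le_iff_disj le_max_iff_disj)
      from Eout[OF this(1)] Eout[OF this(2)] show ?thesis by (simp add: h_def)
    qed
    have hb: "has_bochner_integral lborel h (p * (\<integral>x. E n a b x \<partial>lborel) + r * (\<integral>x. E m a' b' x \<partial>lborel))"
      unfolding h_def using Eint[OF h1] Eint[OF h2]
      by (intro has_bochner_integral_add has_bochner_integral_mult_right) (auto simp: has_bochner_integral_iff)
    then have hI: "(\<integral>x. h x \<partial>lborel) = 0" by (simp add: has_bochner_integral_iff p_def r_def)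
    have "integral {c..d} h = 0"
    proof -
      have e: "(\<lambda>x. indicator {c..d} x *\<^sub>R h x) = h"
      proof
        fix x
        show "indicator {c..d} x *\<^sub>R h x = h x" using h0[of x] by (cases "x \<in> {c..d}") auto
      qed
      have si: "set_integrable lborel {c..d} h"
        unfolding set_integrable_def e using hb by (simp add: has_bochner_integral_iff)
      show ?thesis
        using set_borel_integral_eq_integral(2)[OF si] hI unfolding set_lebesgue_integral_def e by simp
    qed
    from test_fun_primitive[OF hs cd h0 this] obtain \<phi> where \<phi>: "test_fun \<phi>" "deriv \<phi> = h" by blast
    have bm: "integrable lborel (\<lambda>x. ?q x * E n a b x)" if "bump_span (E n a b)" for n a b
    proof (rule Bochner_Integration.integrable_bound[OF q])
      have [measurable]: "E n a b \<in> borel_measurable borel"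
        using bump_span_continuous[OF that, of UNIV] by (rule borel_measurable_continuous_onI)
      show "(\<lambda>x. ?q x * E n a b x) \<in> borel_measurable lborel" by measurable
      have "\<bar>E n a b x\<bar> \<le> 1" for x by (auto simp: E_def ebump_def)
      then show "AE x in lborel. norm (?q x * E n a b x) \<le> norm (?q x)"
        by (intro AE_I2) (simp add: abs_mult mult_left_le)
    qed
    have "0 = (\<integral>x. p * (?q x * E n a b x) + r * (?q x * E m a' b' x) \<partial>lborel)"
      using orth[OF \<phi>(1)] unfolding \<phi>(2) l2ip_def h_def by (simp add: algebra_simps)
    also have "\<dots> = p * (\<integral>x. ?q x * E n a b x \<partial>lborel) + r * (\<integral>x. ?q x * E m a' b' x \<partial>lborel)"
      using bm[of n a b] bm[of m a' b'] g1 g2 by simp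
    finally show ?thesis by (simp add: p_def r_def mult_ac)
  qed
  have lim1: "(\<lambda>n. \<integral>x. ?q x * E n a b x \<partial>lborel) \<longlonglongrightarrow> (\<integral>x. indicator {a<..<b} x * ?q x \<partial>lborel)" if "a < b" for a b
    unfolding E_def by (rule ebump_limit[OF that q])
  have lim2: "(\<lambda>n. \<integral>x. E n a b x \<partial>lborel) \<longlonglongrightarrow> b - a" if "-1 \<le> a" "a < b" "b \<le> 1" for a b
  proof -
    have "(\<lambda>n. \<integral>x. indicator Lam x * E n a b x \<partial>lborel) \<longlonglongrightarrow> (\<integral>x. indicator {a<..<b} x * indicator Lam x \<partial>lborel)"
      unfolding E_def by (rule ebump_limit[OF that(2)]) (simp add: Lam_def)
    moreover have "(\<integral>x. indicator {a<..<b} x * indicator Lam x \<partial>lborel) = (\<integral>x. indicator {a<..<b} x \<partial>lborel :: real)"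
      using that by (intro Bochner_Integration.integral_cong) (auto simp: indicator_def Lam_def)
    moreover have "indicator Lam x * E n a b x = E n a b x" for x n
    proof -
      have p: "0 < 1 / real (Suc n)" by simp
      show ?thesis
      proof (cases "x \<in> Lam")
        case False
        have "x \<notin> {a + 1 / real (Suc n)..b - 1 / real (Suc n)}"
          using False that p unfolding Lam_def atLeastAtMost_iff greaterThanLessThan_iff by linarith
        then show ?thesis using Eout False by simp
      qed simp
    qed
    ultimately show ?thesis using that by simp
  qed
  have ev: "\<forall>\<^sub>F n in sequentially. 2 / real (Suc n) < b - a" if "a < b" for a b
  proof -
    have "(\<lambda>n. 2 * (1 / real (Suc n))) \<longlonglongrightarrow> 2 * 0"
      using LIMSEQ_inverse_real_of_nat by (intro tendsto_intros) (simp add: inverse_eq_divide)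
    then show ?thesis using that order_tendstoD(2)[of _ 0 sequentially "b - a"] by simp
  qed
  \<comment> \<open>The mean value of \<open>q\<close>: the whole of \<open>Lam\<close> as
    comparison interval leaves no other constant.\<close>
  define c where "c = (\<integral>x. ?q x \<partial>lborel) / 2"
  have iv: "(\<integral>x. indicator {a<..<b} x * ?q x \<partial>lborel) = c * (b - a)" if ab: "-1 \<le> a" "a < b" "b \<le> 1" for a b
  proof -
    have t1: "(\<lambda>n. (\<integral>x. ?q x * E n a b x \<partial>lborel) * (\<integral>x. E n (-1) 1 x \<partial>lborel)) \<longlonglongrightarrow> (\<integral>x. indicator {a<..<b} x * ?q x \<partial>lborel) * (1 - -1)"
      using ab by (intro tendsto_mult lim1 lim2) auto
    have t2: "(\<lambda>n. (\<integral>x. ?q x * E n (-1) 1 x \<partial>lborel) * (\<integral>x. E n a b x \<partial>lborel)) \<longlonglongrightarrow> (\<integral>x. indicator {-1<..<1} x * ?q x \<partial>lborel) * (b - a)"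
      using ab by (intro tendsto_mult lim1 lim2) auto
    have t3: "\<forall>\<^sub>F n in sequentially. (\<integral>x. ?q x * E n a b x \<partial>lborel) * (\<integral>x. E n (-1) 1 x \<partial>lborel)
       = (\<integral>x. ?q x * E n (-1) 1 x \<partial>lborel) * (\<integral>x. E n a b x \<partial>lborel)"
      using ev[OF ab(2)] ev[of "-1" 1, simplified]
    proof eventually_elim
      case (elim n)
      show ?case by (rule key) (use elim ab in auto)
    qed
    have "(\<integral>x. indicator {a<..<b} x * ?q x \<partial>lborel) * (1 - -1) = (\<integral>x. indicator {-1<..<1} x * ?q x \<partial>lborel) * (b - a)"
      by (rule LIMSEQ_unique[OF Lim_transform_eventually[OF t1 t3] t2])
    moreover have "indicator {-1<..<1} x * ?q x = ?q x" for x by (simp add: Lam_def indicator_def)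
    ultimately show ?thesis by (simp add: c_def)
  qed
  define u where "u x = indicator Lam x * (q x - c)" for x
  have iL: "integrable lborel (indicator Lam :: real \<Rightarrow> real)" by (simp add: Lam_def)
  have ueq: "u = (\<lambda>x. ?q x - c * indicator Lam x)" by (simp add: u_def fun_eq_iff algebra_simps)
  have ui: "integrable lborel u"
    unfolding ueq by (intro Bochner_Integration.integrable_diff integrable_mult_right q iL)
  have tail: "(\<integral>x. indicator {d<..} x * u x \<partial>lborel) = 0" for d
  proof (cases "d < 1")
    case False
    then have "indicator {d<..} x * u x = 0" for x by (auto simp: u_def indicator_def Lam_def)
    then show ?thesis by (simp only:) simp
  next
    case True
    define e where "e = max (-1) d"
    have e: "-1 \<le> e" "e < 1" using True by (auto simp: e_def)
    have i1: "integrable lborel (\<lambda>x. indicator {e<..<1} x * ?q x)"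
      by (rule Bochner_Integration.integrable_bound[OF q]) (auto simp: indicator_def)
    have "(\<integral>x. indicator {d<..} x * u x \<partial>lborel) = (\<integral>x. indicator {e<..<1} x * ?q x - c * indicator {e<..<1} x \<partial>lborel)"
      by (intro Bochner_Integration.integral_cong) (auto simp: u_def e_def indicator_def Lam_def)
    also have "\<dots> = (\<integral>x. indicator {e<..<1} x * ?q x \<partial>lborel) - (\<integral>x. c * indicator {e<..<1} x \<partial>lborel)"
      using e by (intro Bochner_Integration.integral_diff i1 integrable_mult_right) auto
    also have "\<dots> = 0" using iv[of e 1] e by simp
    finally show ?thesis .
  qed
  have "AE x in lborel. u x = 0" by (rule AE_zero_if_tails_zero[OF ui tail])
  then have "AE x in lborel. x \<in> Lam \<longrightarrow> q x = c"
    by eventually_elim (auto simp: u_def)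
  then show ?thesis by (rule that)
qed

section \<open>Functions in H^1_0 as primitives of functions with mean zero\<close>

lemma prim_HK:
  assumes g: "integrable lborel (\<lambda>s. indicator Lam s * g s)" and x: "x \<in> {-1..1}"
  shows "prim g x = integral {-1..x} (\<lambda>s. indicator Lam s * g s)"
proof -
  have si: "set_integrable lborel {-1..x} (\<lambda>s. indicator Lam s * g s)"
    unfolding set_integrable_def using g by (intro integrable_mult_indicator) auto
  have "prim g x = (LINT s:{-1..x}|lborel. indicator Lam s * g s)"
    unfolding prim_def set_lebesgue_integral_def
  proof (rule integral_cong_AE)
    have "AE s in lborel. s \<noteq> x" by (rule AE_lborel_singleton)
    then show "AE s in lborel. indicator {-1<..<x} s * g s = indicator {-1..x} s *\<^sub>R (indicator Lam s * g s)"
      by eventually_elim (use x in \<open>auto simp: indicator_def Lam_def\<close>)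
    have "integrable lborel (\<lambda>s. indicator {-1<..<x} s *\<^sub>R (indicator Lam s * g s))"
      using g by (intro integrable_mult_indicator) auto
    also have "(\<lambda>s. indicator {-1<..<x} s *\<^sub>R (indicator Lam s * g s)) = (\<lambda>s. indicator {-1<..<x} s * g s)"
      using x by (auto simp: fun_eq_iff indicator_def Lam_def)
    finally show "(\<lambda>s. indicator {-1<..<x} s * g s) \<in> borel_measurable lborel" by (rule borel_measurable_integrable)
    show "(\<lambda>s. indicator {-1..x} s *\<^sub>R (indicator Lam s * g s)) \<in> borel_measurable lborel"
      using si unfolding set_integrable_def by (rule borel_measurable_integrable)
  qed
  also have "\<dots> = integral {-1..x} (\<lambda>s. indicator Lam s * g s)"
    by (rule set_borel_integral_eq_integral(2)[OF si])
  finally show ?thesis .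
qed

lemma prim_continuous:
  assumes g: "integrable lborel (\<lambda>s. indicator Lam s * g s)"
  shows "continuous_on {-1..1} (prim g)"
proof -
  have "set_integrable lborel {-1..1} (\<lambda>s. indicator Lam s * g s)"
    unfolding set_integrable_def using g by (intro integrable_mult_indicator) auto
  then have "(\<lambda>s. indicator Lam s * g s) integrable_on {-1..1}" by (rule set_borel_integral_eq_integral(1))
  then have "continuous_on {-1..1} (\<lambda>x. integral {-1..x} (\<lambda>s. indicator Lam s * g s))"
    by (rule indefinite_integral_continuous_1)
  then show ?thesis by (rule continuous_on_eq) (simp add: prim_HK[OF g])
qed

lemma prim_left: "prim g (-1) = 0"
  by (simp add: prim_def)

lemma prim_right: "prim g 1 = (\<integral>s. indicator Lam s * g s \<partial>lborel)"
  by (simp add: prim_def Lam_def)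

text \<open>A difference that is nonzero at an interior point is nonzero on a ball, which has
  positive measure. The end points follow by taking the closure; they are needed for the boundary
  conditions.\<close>

lemma AE_eq_continuous:
  fixes f h :: "real \<Rightarrow> real"
  assumes f: "continuous_on {-1..1} f" and h: "continuous_on {-1..1} h"
    and eq: "AE x in lborel. x \<in> Lam \<longrightarrow> f x = h x" and x: "x \<in> {-1..1}"
  shows "f x = h x"
proof -
  define D where "D y = f y - h y" for y
  have D: "continuous_on {-1..1} D" unfolding D_def by (intro continuous_intros f h)
  have Lz: "D y = 0" if y: "y \<in> Lam" for y
  proof (rule ccontr)
    assume "D y \<noteq> 0"
    have "Lam \<subseteq> {-1..1}" by (auto simp: Lam_def)
    then have "open Lam" "continuous_on Lam D" using continuous_on_subset[OF D] by (auto simp: Lam_def)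
    then have "open (Lam \<inter> D -` (- {0}))" by (intro continuous_open_preimage) auto
    moreover have "y \<in> Lam \<inter> D -` (- {0})" using y \<open>D y \<noteq> 0\<close> by simp
    ultimately obtain e where e: "0 < e" "ball y e \<subseteq> Lam \<inter> D -` (- {0})" by (meson open_contains_ball)
    have "AE x in lborel. x \<notin> {y - e<..<y + e}"
      using eq
    proof eventually_elim
      case (elim x)
      show ?case
      proof
        assume "x \<in> {y - e<..<y + e}"
        then have "x \<in> ball y e" by (auto simp: dist_real_def)
        then show False using e elim by (auto simp: D_def)
      qed
    qed
    then have "{y - e<..<y + e} \<in> null_sets lborel" by (subst AE_iff_null_sets) auto
    then show False using e by (auto simp: null_sets_def)
  qed
  have cl: "closure Lam = {-1..1}" by (simp add: Lam_def)
  have "D x = 0"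
    by (rule continuous_constant_on_closure[of Lam D 0 x]) (use cl D Lz x in auto)
  then show ?thesis by (simp add: D_def)
qed

text \<open>By \<open>prim_by_parts\<close>, \<open>prim g'\<close> has the same weak derivative as
  \<open>w\<close>, so the difference is orthogonal to all derivatives of test functions and hence
  constant.\<close>

lemma weak_deriv_repr:
  assumes wg: "weak_deriv w g" and g': "L2b g'" "AE x in lborel. x \<in> Lam \<longrightarrow> g x = g' x"
    and w': "L2b w'" "AE x in lborel. x \<in> Lam \<longrightarrow> w x = w' x"
  obtains c where "AE x in lborel. x \<in> Lam \<longrightarrow> w x = prim g' x + c"
proof -
  note [measurable] = g'(1)[THEN L2b_measurable] w'(1)[THEN L2b_measurable]
  have gi: "integrable lborel (\<lambda>s. indicator Lam s * g' s)" by (rule L2b_integrable[OF g'(1)])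
  have wi: "integrable lborel (\<lambda>s. indicator Lam s * w' s)" by (rule L2b_integrable[OF w'(1)])
  have bdd: "bounded (prim g' ` {-1..1})"
    by (intro compact_imp_bounded compact_continuous_image prim_continuous gi) simp
  then obtain M where M: "\<forall>y\<in>prim g' ` {-1..1}. norm y \<le> M" unfolding bounded_iff by blast
  have bi: "integrable lborel (\<lambda>s. indicator Lam s * (p s * f s))"
    if [measurable]: "p \<in> borel_measurable borel" "f \<in> borel_measurable borel" and f: "continuous_on {-1..1} f" and p: "integrable lborel (\<lambda>s. indicator Lam s * p s)" for p f :: "real \<Rightarrow> real"
  proof -
    have "bounded (f ` {-1..1})" by (intro compact_imp_bounded compact_continuous_image f) simp
    then obtain K where K: "\<forall>y\<in>f ` {-1..1}. norm y \<le> K" unfolding bounded_iff by blast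
    have "integrable lborel (\<lambda>s. K * (indicator Lam s * p s))" by (intro integrable_mult_right p)
    then show ?thesis
    proof (rule Bochner_Integration.integrable_bound)
      show "AE s in lborel. norm (indicator Lam s * (p s * f s)) \<le> norm (K * (indicator Lam s * p s))"
      proof (rule AE_I2)
        fix s
        show "norm (indicator Lam s * (p s * f s)) \<le> norm (K * (indicator Lam s * p s))"
        proof (cases "s \<in> Lam")
          case True
          then have "\<bar>f s\<bar> \<le> K" using K by (auto simp: Lam_def)
          then have "\<bar>f s\<bar> * \<bar>p s\<bar> \<le> \<bar>K\<bar> * \<bar>p s\<bar>" by (intro mult_right_mono) auto
          then show ?thesis using True by (simp add: abs_mult mult.commute)
        qed simp
      qed
    qed measurable
  qed
  have pi: "integrable lborel (\<lambda>s. indicator Lam s * prim g' s)"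
    using bi[of "\<lambda>_. 1" "prim g'"] prim_continuous[OF gi] by (simp add: Lam_def)
  obtain c where c: "AE x in lborel. x \<in> Lam \<longrightarrow> w' x - prim g' x = c"
  proof (rule du_bois_reymond[of "\<lambda>x. w' x - prim g' x"])
    show "(\<lambda>x. w' x - prim g' x) \<in> borel_measurable borel" by measurable
    show "integrable lborel (\<lambda>x. indicator Lam x * (w' x - prim g' x))"
      using wi pi by (simp add: right_diff_distrib)
    fix \<phi> assume \<phi>: "test_fun \<phi>"
    have [measurable]: "deriv \<phi> \<in> borel_measurable borel" "\<phi> \<in> borel_measurable borel"
      using test_fun_deriv_continuous[OF \<phi>, of UNIV] test_fun_continuous[OF \<phi>, of UNIV]
      by (auto intro: borel_measurable_continuous_onI)
    have "l2ip w' (deriv \<phi>) = L2ip w (deriv \<phi>)"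
      by (rule L2ip_rep[symmetric]) (use w' in auto)
    also have "\<dots> = - L2ip g \<phi>" using wg \<phi> by (simp add: weak_deriv_def)
    also have "L2ip g \<phi> = l2ip g' \<phi>" by (rule L2ip_rep) (use g' in auto)
    also have "- \<dots> = l2ip (prim g') (deriv \<phi>)"
      using prim_by_parts[OF _ gi \<phi>] by simp
    finally have e: "l2ip w' (deriv \<phi>) = l2ip (prim g') (deriv \<phi>)" .
    have "l2ip (\<lambda>x. w' x - prim g' x) (deriv \<phi>) = l2ip w' (deriv \<phi>) - l2ip (prim g') (deriv \<phi>)"
      unfolding l2ip_def
      using bi[of w' "deriv \<phi>"] bi[of "prim g'" "deriv \<phi>"] test_fun_deriv_continuous[OF \<phi>] wi pi
      by (simp add: algebra_simps)
    then show "l2ip (\<lambda>x. w' x - prim g' x) (deriv \<phi>) = 0" using e by simp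
  qed blast
  have "AE x in lborel. x \<in> Lam \<longrightarrow> w x = prim g' x + c"
    using c w'(2) by eventually_elim auto
  then show ?thesis by (rule that)
qed

text \<open>The boundary value at -1 removes the constant of integration, and the one at 1 makes the
  mean of \<open>g\<close> vanish.\<close>

lemma H10_repr:
  assumes w: "H10 w"
  obtains g where "L2b g" "(\<integral>s. indicator Lam s * g s \<partial>lborel) = 0"
    "AE x in lborel. x \<in> Lam \<longrightarrow> w x = prim g x" "AE x in lborel. x \<in> Lam \<longrightarrow> wderiv w x = g x"
proof -
  have wd: "weak_deriv w (wderiv w)"
  proof -
    obtain g where "weak_deriv w g" using w unfolding H10_def by blast
    then show ?thesis unfolding wderiv_def by (rule someI[of "weak_deriv w"])
  qed
  obtain g where g: "L2b g" "AE x in lborel. x \<in> Lam \<longrightarrow> wderiv w x = g x"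
    using wd sqint_rep unfolding weak_deriv_def by blast
  obtain w' where w': "L2b w'" "AE x in lborel. x \<in> Lam \<longrightarrow> w x = w' x"
    using w sqint_rep unfolding H10_def by blast
  obtain c where c: "AE x in lborel. x \<in> Lam \<longrightarrow> w x = prim g x + c"
    by (rule weak_deriv_repr[OF wd g w'])
  obtain w0 where w0: "continuous_on {-1..1} w0" "AE x in lborel. x \<in> Lam \<longrightarrow> w x = w0 x" "w0 (-1) = 0" "w0 1 = 0"
    using w unfolding H10_def vanishes_at_ends_def AE_LM by blast
  have gi: "integrable lborel (\<lambda>s. indicator Lam s * g s)" by (rule L2b_integrable[OF g(1)])
  have "AE x in lborel. x \<in> Lam \<longrightarrow> w0 x = prim g x + c"
    using w0(2) c by eventually_elim auto
  then have e: "w0 x = prim g x + c" if "x \<in> {-1..1}" for x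
    using that by (intro AE_eq_continuous[OF w0(1)] continuous_intros prim_continuous gi)
  have c0: "c = 0" using e[of "-1"] w0(3) by (simp add: prim_left)
  show ?thesis
  proof (rule that[of g])
    show "(\<integral>s. indicator Lam s * g s \<partial>lborel) = 0" using e[of 1] w0(4) c0 by (simp add: prim_right)
    show "AE x in lborel. x \<in> Lam \<longrightarrow> w x = prim g x" using c c0 by simp
  qed (use g in auto)
qed

lemma prim_L2b:
  assumes g: "L2b g"
  shows "L2b (prim g)"
proof -
  note [measurable] = g[THEN L2b_measurable]
  have "bounded (prim g ` {-1..1})"
    by (intro compact_imp_bounded compact_continuous_image prim_continuous L2b_integrable g) simp
  then obtain M where M: "\<forall>y\<in>prim g ` {-1..1}. norm y \<le> M" unfolding bounded_iff by blast
  have "integrable lborel (\<lambda>s. M\<^sup>2 * indicator Lam s)" by (intro integrable_mult_right) (simp add: Lam_def)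
  then have "integrable lborel (\<lambda>s. indicator Lam s * (prim g s)\<^sup>2)"
  proof (rule Bochner_Integration.integrable_bound)
    show "AE s in lborel. norm (indicator Lam s * (prim g s)\<^sup>2) \<le> norm (M\<^sup>2 * indicator Lam s)"
    proof (rule AE_I2)
      fix s
      show "norm (indicator Lam s * (prim g s)\<^sup>2) \<le> norm (M\<^sup>2 * indicator Lam s)"
      proof (cases "s \<in> Lam")
        case True
        then have "\<bar>prim g s\<bar> \<le> M" using M by (auto simp: Lam_def)
        then have "\<bar>prim g s\<bar>\<^sup>2 \<le> M\<^sup>2" by (intro power_mono) auto
        then show ?thesis using True by simp
      qed simp
    qed
  qed simp
  then show ?thesis by (simp add: L2b_def)
qed

text \<open>The value at -1 shows \<open>c = 0\<close>. Values of the primitive determine the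
  integrals over all half lines, and these determine the function.\<close>

lemma prim_inject:
  assumes g: "L2b g" and h: "L2b h" and eq: "AE x in lborel. x \<in> Lam \<longrightarrow> prim g x = prim h x + c"
  shows "AE x in lborel. x \<in> Lam \<longrightarrow> g x = h x"
proof -
  note gi = L2b_integrable[OF g] and hi = L2b_integrable[OF h]
  have e: "prim g x = prim h x + c" if "x \<in> {-1..1}" for x
    using that by (intro AE_eq_continuous[OF prim_continuous[OF gi] _ eq] continuous_intros prim_continuous hi)
  have c0: "c = 0" using e[of "-1"] by (simp add: prim_left)
  define u where "u x = indicator Lam x * (g x - h x)" for x
  have ueq: "u = (\<lambda>x. indicator Lam x * g x - indicator Lam x * h x)" by (simp add: u_def fun_eq_iff algebra_simps)
  have ui: "integrable lborel u" unfolding ueq by (intro Bochner_Integration.integrable_diff gi hi)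
  have split: "(\<integral>s. indicator {d<..} s * (indicator Lam s * f s) \<partial>lborel) = prim f 1 - prim f (max (-1) (min 1 d))"
    if f: "integrable lborel (\<lambda>s. indicator Lam s * f s)" for d and f :: "real \<Rightarrow> real"
  proof -
    define e where "e = max (-1) (min 1 d)"
    have e: "-1 \<le> e" "e \<le> 1" by (auto simp: e_def)
    have i: "integrable lborel (\<lambda>s. indicator A s * (indicator Lam s * f s))" if "A \<in> sets borel" for A :: "real set"
      using integrable_mult_indicator[of A lborel "\<lambda>s. indicator Lam s * f s"] f that by simp
    have pe: "prim f e = (\<integral>s. indicator {-1<..<e} s * (indicator Lam s * f s) \<partial>lborel)"
      unfolding prim_def using e by (intro Bochner_Integration.integral_cong) (auto simp: indicator_def Lam_def)
    have "prim f 1 = (\<integral>s. indicator {-1<..<e} s * (indicator Lam s * f s) + indicator {d<..} s * (indicator Lam s * f s) \<partial>lborel)"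
      unfolding prim_right
    proof (rule integral_cong_AE)
      have "AE s in lborel. s \<noteq> e" by (rule AE_lborel_singleton)
      then show "AE s in lborel. indicator Lam s * f s = indicator {-1<..<e} s * (indicator Lam s * f s) + indicator {d<..} s * (indicator Lam s * f s)"
        by eventually_elim (auto simp: indicator_def Lam_def e_def max_def min_def split: if_splits)
    qed (use f i in \<open>auto intro!: borel_measurable_integrable Bochner_Integration.integrable_add\<close>)
    also have "\<dots> = prim f e + (\<integral>s. indicator {d<..} s * (indicator Lam s * f s) \<partial>lborel)"
      unfolding pe using i by simp
    finally show ?thesis by (simp add: e_def)
  qed
  have "(\<integral>s. indicator {d<..} s * u s \<partial>lborel) = 0" for d
  proof -
    have i: "integrable lborel (\<lambda>s. indicator {d<..} s * (indicator Lam s * f s))" if "integrable lborel (\<lambda>s. indicator Lam s * f s)" for f :: "real \<Rightarrow> real"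
      using integrable_mult_indicator[of "{d<..}" lborel "\<lambda>s. indicator Lam s * f s"] that by simp
    have "(\<integral>s. indicator {d<..} s * u s \<partial>lborel) = (\<integral>s. indicator {d<..} s * (indicator Lam s * g s) - indicator {d<..} s * (indicator Lam s * h s) \<partial>lborel)"
      by (intro Bochner_Integration.integral_cong) (auto simp: u_def algebra_simps)
    also have "\<dots> = (prim g 1 - prim g (max (-1) (min 1 d))) - (prim h 1 - prim h (max (-1) (min 1 d)))"
      unfolding split[OF gi, symmetric] split[OF hi, symmetric]
      by (intro Bochner_Integration.integral_diff i gi hi)
    also have "\<dots> = 0" using e[of 1] e[of "max (-1) (min 1 d)"] c0 by simp
    finally show ?thesis .
  qed
  from AE_zero_if_tails_zero[OF ui this] show ?thesis
    by eventually_elim (auto simp: u_def)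
qed

text \<open>As \<open>wderiv\<close> is a choice among weak derivatives, its identification with
  \<open>g\<close> rests on uniqueness: the chosen derivative has a primitive that differs from
  \<open>prim g\<close> by a constant, and \<open>prim_inject\<close> applies.\<close>

lemma H10_primI:
  assumes g: "L2b g" and mean: "(\<integral>s. indicator Lam s * g s \<partial>lborel) = 0"
    and w: "AE x in lborel. x \<in> Lam \<longrightarrow> w x = prim g x"
  shows "H10 w" and "AE x in lborel. x \<in> Lam \<longrightarrow> wderiv w x = g x"
proof -
  note [measurable] = g[THEN L2b_measurable]
  note gi = L2b_integrable[OF g]
  have sw: "sqint w" using sqint_iff[OF _ w] prim_L2b[OF g] by simp
  have sg: "sqint g" using sqint_iff[of g g] g by simp
  have wd: "weak_deriv w g"
    unfolding weak_deriv_def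
  proof (intro conjI sg allI impI)
    fix \<phi> assume \<phi>: "test_fun \<phi>"
    have [measurable]: "deriv \<phi> \<in> borel_measurable borel" "\<phi> \<in> borel_measurable borel"
      using test_fun_deriv_continuous[OF \<phi>, of UNIV] test_fun_continuous[OF \<phi>, of UNIV]
      by (auto intro: borel_measurable_continuous_onI)
    have "L2ip w (deriv \<phi>) = l2ip (prim g) (deriv \<phi>)" by (rule L2ip_rep) (use w in auto)
    also have "\<dots> = - l2ip g \<phi>" by (rule prim_by_parts[OF _ gi \<phi>]) simp
    also have "l2ip g \<phi> = L2ip g \<phi>" by (rule L2ip_rep[symmetric]) auto
    finally show "L2ip w (deriv \<phi>) = - L2ip g \<phi>" .
  qed
  have "vanishes_at_ends w"
    unfolding vanishes_at_ends_def AE_LM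
    using prim_continuous[OF gi] w mean by (intro exI[of _ "prim g"]) (auto simp: prim_left prim_right)
  then show "H10 w" unfolding H10_def using sw wd by blast
  have wd2: "weak_deriv w (wderiv w)"
    unfolding wderiv_def by (rule someI[of "weak_deriv w", OF wd])
  obtain g2 where g2: "L2b g2" "AE x in lborel. x \<in> Lam \<longrightarrow> wderiv w x = g2 x"
    using wd2 sqint_rep unfolding weak_deriv_def by blast
  obtain c where c: "AE x in lborel. x \<in> Lam \<longrightarrow> w x = prim g2 x + c"
    by (rule weak_deriv_repr[OF wd2 g2 prim_L2b[OF g] w])
  have "AE x in lborel. x \<in> Lam \<longrightarrow> prim g x = prim g2 x + c"
    using c w by eventually_elim auto
  from prim_inject[OF g g2(1) this] show "AE x in lborel. x \<in> Lam \<longrightarrow> wderiv w x = g x"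
    using g2(2) by eventually_elim auto
qed

section \<open>The weak problem\<close>

definition l2n :: "(real \<Rightarrow> real) \<Rightarrow> real" where "l2n f = sqrt (l2ip f f)"

lemma l2ip_self_nonneg: "0 \<le> l2ip f f"
  by (simp add: l2ip_def)

lemma l2n_sq: "(l2n f)\<^sup>2 = l2ip f f"
  by (simp add: l2n_def l2ip_self_nonneg)

lemma l2n_nonneg: "0 \<le> l2n f"
  by (simp add: l2n_def l2ip_self_nonneg)

lemma l2_norm_rep: "norm u = l2n (l2rep u)"
  by (simp add: l2n_def norm_eq_sqrt_inner l2_inner)

lemma l2ip_add: "L2b f \<Longrightarrow> L2b g \<Longrightarrow> L2b h \<Longrightarrow> l2ip (\<lambda>s. p * f s + q * g s) h = p * l2ip f h + q * l2ip g h"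
proof -
  assume a: "L2b f" "L2b g" "L2b h"
  have "l2ip (\<lambda>s. p * f s + q * g s) h = (\<integral>s. p * (indicator Lam s * (f s * h s)) + q * (indicator Lam s * (g s * h s)) \<partial>lborel)"
    unfolding l2ip_def by (intro Bochner_Integration.integral_cong) (simp_all add: algebra_simps)
  also have "\<dots> = p * l2ip f h + q * l2ip g h"
    unfolding l2ip_def using L2b_mult_integrable[OF a(1,3)] L2b_mult_integrable[OF a(2,3)] by simp
  finally show ?thesis .
qed

lemma l2ip_commute: "l2ip f g = l2ip g f"
  by (simp add: l2ip_def mult.commute)

lemma L1_le_l2n:
  assumes f: "L2b f"
  shows "(\<integral>s. indicator Lam s * \<bar>f s\<bar> \<partial>lborel) \<le> 2 * l2n f"
proof -
  have i: "integrable lborel (\<lambda>s. indicator Lam s * \<bar>f s\<bar>)"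
    using integrable_abs[OF L2b_integrable[OF f]] by (simp add: abs_mult)
  have *: "(\<integral>s. indicator Lam s * \<bar>f s\<bar> \<partial>lborel) \<le> l2ip f f / (2 * l) + l" if l: "0 < l" for l
  proof -
    have "ennreal (\<integral>s. indicator Lam s * \<bar>f s\<bar> \<partial>lborel) = (\<integral>\<^sup>+s. ennreal (indicator Lam s * \<bar>f s\<bar>) \<partial>lborel)"
      by (rule nn_integral_eq_integral[OF i, symmetric]) simp
    also have "\<dots> \<le> ennreal (l2ip f f / (2 * l) + l)" by (rule l2_L1_le[OF f l])
    finally show ?thesis using l l2ip_self_nonneg[of f] by (subst (asm) ennreal_le_iff) auto
  qed
  show ?thesis
  proof (cases "l2n f = 0")
    case True
    then have "l2ip f f = 0" using l2n_sq[of f] by simp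
    then have "(\<integral>s. indicator Lam s * \<bar>f s\<bar> \<partial>lborel) \<le> 0 + l" if "0 < l" for l using *[OF that] by simp
    then have "(\<integral>s. indicator Lam s * \<bar>f s\<bar> \<partial>lborel) \<le> 0" by (rule field_le_epsilon)
    then show ?thesis using True by simp
  next
    case False
    then have p: "0 < l2n f" using l2n_nonneg[of f] by simp
    have "l2ip f f / (2 * l2n f) = l2n f / 2" using p by (simp add: l2n_sq[symmetric] power2_eq_square)
    then show ?thesis using *[OF p] p by simp
  qed
qed

lemma prim_abs_le:
  assumes g: "L2b g" and x: "x \<in> Lam"
  shows "\<bar>prim g x\<bar> \<le> 2 * l2n g"
proof -
  have ia: "integrable lborel (\<lambda>s. indicator Lam s * \<bar>g s\<bar>)"
    using integrable_abs[OF L2b_integrable[OF g]] by (simp add: abs_mult)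
  have "integrable lborel (\<lambda>s. indicator {-1<..<x} s *\<^sub>R (indicator Lam s * g s))"
    using L2b_integrable[OF g] by (intro integrable_mult_indicator) auto
  also have "(\<lambda>s. indicator {-1<..<x} s *\<^sub>R (indicator Lam s * g s)) = (\<lambda>s. indicator {-1<..<x} s * g s)"
    using x by (auto simp: fun_eq_iff indicator_def Lam_def)
  finally have ib: "integrable lborel (\<lambda>s. indicator {-1<..<x} s * g s)" .
  have "\<bar>prim g x\<bar> \<le> (\<integral>s. \<bar>indicator {-1<..<x} s * g s\<bar> \<partial>lborel)"
    unfolding prim_def by (rule integral_abs_bound)
  also have "\<dots> \<le> (\<integral>s. indicator Lam s * \<bar>g s\<bar> \<partial>lborel)"
    using x by (intro integral_mono integrable_abs ib ia) (auto simp: indicator_def Lam_def)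
  finally show ?thesis using L1_le_l2n[OF g] by simp
qed

lemma prim_lincomb:
  assumes f: "L2b f" and g: "L2b g" and x: "x \<in> Lam"
  shows "prim (\<lambda>s. p * f s + q * g s) x = p * prim f x + q * prim g x"
proof -
  have i: "integrable lborel (\<lambda>s. indicator {-1<..<x} s * h s)" if "L2b h" for h
  proof -
    have "integrable lborel (\<lambda>s. indicator {-1<..<x} s *\<^sub>R (indicator Lam s * h s))"
      using L2b_integrable[OF that] by (intro integrable_mult_indicator) auto
    also have "(\<lambda>s. indicator {-1<..<x} s *\<^sub>R (indicator Lam s * h s)) = (\<lambda>s. indicator {-1<..<x} s * h s)"
      using x by (auto simp: fun_eq_iff indicator_def Lam_def)
    finally show ?thesis .
  qed
  have "prim (\<lambda>s. p * f s + q * g s) x = (\<integral>s. p * (indicator {-1<..<x} s * f s) + q * (indicator {-1<..<x} s * g s) \<partial>lborel)"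
    unfolding prim_def by (intro Bochner_Integration.integral_cong) (simp_all add: algebra_simps)
  also have "\<dots> = p * prim f x + q * prim g x"
    unfolding prim_def using i[OF f] i[OF g] by simp
  finally show ?thesis .
qed

lemma prim_cong:
  assumes f: "L2b f" and g: "L2b g" and eq: "AE s in lborel. s \<in> Lam \<longrightarrow> f s = g s" and x: "x \<in> Lam"
  shows "prim f x = prim g x"
  unfolding prim_def
proof (rule integral_cong_AE)
  note [measurable] = f[THEN L2b_measurable] g[THEN L2b_measurable]
  show "(\<lambda>s. indicator {-1<..<x} s * f s) \<in> borel_measurable lborel" "(\<lambda>s. indicator {-1<..<x} s * g s) \<in> borel_measurable lborel"
    by measurable
  show "AE s in lborel. indicator {-1<..<x} s * f s = indicator {-1<..<x} s * g s"
    using eq by eventually_elim (use x in \<open>auto simp: indicator_def Lam_def\<close>)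
qed

definition mean0 :: "(real \<Rightarrow> real) \<Rightarrow> bool" where
  "mean0 g \<longleftrightarrow> (\<integral>s. indicator Lam s * g s \<partial>lborel) = 0"

lemma mean0_lincomb: "L2b f \<Longrightarrow> L2b g \<Longrightarrow> mean0 f \<Longrightarrow> mean0 g \<Longrightarrow> mean0 (\<lambda>s. p * f s + q * g s)"
proof -
  assume a: "L2b f" "L2b g" "mean0 f" "mean0 g"
  have "(\<integral>s. indicator Lam s * (p * f s + q * g s) \<partial>lborel) = (\<integral>s. p * (indicator Lam s * f s) + q * (indicator Lam s * g s) \<partial>lborel)"
    by (intro Bochner_Integration.integral_cong) (simp_all add: algebra_simps)
  also have "\<dots> = 0" using a L2b_integrable[OF a(1)] L2b_integrable[OF a(2)] by (simp add: mean0_def)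
  finally show ?thesis by (simp add: mean0_def)
qed

text \<open>The factor 8 is the square of the constant 2 in \<open>prim_abs_le\<close>, times the
  length 2 of \<open>Lam\<close>.\<close>

lemma l2ip_prim_le:
  assumes g: "L2b g"
  shows "l2ip (prim g) (prim g) \<le> 8 * l2ip g g"
proof -
  have "l2ip (prim g) (prim g) \<le> (\<integral>s. (2 * l2n g)\<^sup>2 * indicator Lam s \<partial>lborel)"
    unfolding l2ip_def
  proof (rule integral_mono)
    show "integrable lborel (\<lambda>s. indicator Lam s * (prim g s * prim g s))"
      by (intro L2b_mult_integrable prim_L2b g)
    show "integrable lborel (\<lambda>s. (2 * l2n g)\<^sup>2 * indicator Lam s)"
      by (intro integrable_mult_right) (simp add: Lam_def)
    fix s
    show "indicator Lam s * (prim g s * prim g s) \<le> (2 * l2n g)\<^sup>2 * indicator Lam s"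
    proof (cases "s \<in> Lam")
      case True
      have "\<bar>prim g s\<bar>\<^sup>2 \<le> (2 * l2n g)\<^sup>2" by (intro power_mono prim_abs_le g True) simp
      then show ?thesis using True by (simp add: power2_eq_square)
    qed simp
  qed
  also have "\<dots> = (2 * l2n g)\<^sup>2 * 2"
    by (simp only: integral_mult_right_zero indicator_Lam_integral)
  also have "\<dots> = 8 * l2ip g g"
    by (simp add: power_mult_distrib l2n_sq)
  finally show ?thesis .
qed

text \<open>The factor 3 is the square root of 8 + 1, with the 8 from
  \<open>l2ip_prim_le\<close>.\<close>

lemma H1norm_prim:
  assumes g: "L2b g" and m: "mean0 g" and w: "AE x in lborel. x \<in> Lam \<longrightarrow> w x = prim g x"
  shows "H1norm w = sqrt (l2ip (prim g) (prim g) + l2ip g g)" and "H1norm w \<le> 3 * l2n g"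
proof -
  note [measurable] = g[THEN L2b_measurable]
  have d: "AE x in lborel. x \<in> Lam \<longrightarrow> wderiv w x = g x"
    using H10_primI(2)[OF g _ w] m by (simp add: mean0_def)
  have "L2ip w w = l2ip (prim g) (prim g)" by (rule L2ip_rep) (use w in auto)
  moreover have "L2ip (wderiv w) (wderiv w) = l2ip g g" by (rule L2ip_rep) (use d in auto)
  ultimately show e: "H1norm w = sqrt (l2ip (prim g) (prim g) + l2ip g g)" by (simp add: H1norm_def)
  have "sqrt (l2ip (prim g) (prim g) + l2ip g g) \<le> sqrt ((3 * l2n g)\<^sup>2)"
    using l2ip_prim_le[OF g] by (intro real_sqrt_le_mono) (simp add: power_mult_distrib l2n_sq)
  also have "sqrt ((3 * l2n g)\<^sup>2) = 3 * l2n g" using l2n_nonneg[of g] by (intro real_sqrt_unique) auto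
  finally show "H1norm w \<le> 3 * l2n g" using e by simp
qed

section \<open>Bounded functionals on H^1_0\<close>

lemma H1norm_nonneg: "0 \<le> H1norm w"
  unfolding H1norm_def L2ip_def by (simp add: integral_nonneg_AE)

lemma Hm1_linear: "Hm1 f \<Longrightarrow> H10 w1 \<Longrightarrow> H10 w2 \<Longrightarrow> f (\<lambda>x. a * w1 x + b * w2 x) = a * f w1 + b * f w2"
  unfolding Hm1_def by blast

text \<open>Functionals act on functions and not on classes. That they respect equality almost
  everywhere follows from their bound, because the difference of the two arguments has norm
  0.\<close>

lemma Hm1_cong:
  assumes f: "Hm1 f" and w: "H10 w1" "H10 w2" and eq: "AE x in lborel. x \<in> Lam \<longrightarrow> w1 x = w2 x"
  shows "f w1 = f w2"
proof -
  obtain K where K: "\<And>w. H10 w \<Longrightarrow> \<bar>f w\<bar> \<le> K * H1norm w" using f unfolding Hm1_def by blast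
  define D where "D x = 1 * w1 x + (-1) * w2 x" for x
  have z: "prim (\<lambda>_. 0) x = 0" for x by (simp add: prim_def)
  have D0: "AE x in lborel. x \<in> Lam \<longrightarrow> D x = prim (\<lambda>_. 0) x"
    using eq by eventually_elim (simp add: D_def z)
  have h: "H10 D" using H10_primI(1)[OF L2b_const _ D0] by simp
  have "H1norm D = sqrt (l2ip (prim (\<lambda>_. 0)) (prim (\<lambda>_. 0)) + l2ip (\<lambda>_. 0) (\<lambda>_. 0))"
    by (rule H1norm_prim(1)[OF L2b_const _ D0]) (simp add: mean0_def)
  also have "\<dots> = 0" by (simp add: l2ip_def z)
  finally have "f D = 0" using K[OF h] by simp
  then show ?thesis using Hm1_linear[OF f w, of 1 "-1"] unfolding D_def by simp
qed

lemma Hm1norm_nonneg: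
  assumes f: "Hm1 f"
  shows "0 \<le> Hm1norm f"
proof -
  obtain K where K: "\<And>w. H10 w \<Longrightarrow> \<bar>f w\<bar> \<le> K * H1norm w" using f unfolding Hm1_def by blast
  have bdd: "bdd_above {\<bar>f w\<bar> | w. H10 w \<and> H1norm w \<le> 1}"
  proof (rule bdd_aboveI)
    fix y assume "y \<in> {\<bar>f w\<bar> | w. H10 w \<and> H1norm w \<le> 1}"
    then obtain w where w: "y = \<bar>f w\<bar>" "H10 w" "H1norm w \<le> 1" by blast
    have "y \<le> K * H1norm w" using K w by simp
    also have "\<dots> \<le> \<bar>K\<bar> * 1" using w H1norm_nonneg[of w] by (intro mult_mono) auto
    finally show "y \<le> \<bar>K\<bar>" by simp
  qed
  have z: "AE x in lborel. x \<in> Lam \<longrightarrow> prim (\<lambda>_. 0) x = prim (\<lambda>_. 0) x" by simp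
  have "H10 (prim (\<lambda>_. 0))" by (rule H10_primI(1)[OF L2b_const _ z]) simp
  moreover have "H1norm (prim (\<lambda>_. 0)) \<le> 3 * l2n (\<lambda>_. 0)"
    by (rule H1norm_prim(2)[OF L2b_const _ z]) (simp add: mean0_def)
  moreover have "l2n (\<lambda>_. 0) = 0" by (simp add: l2n_def l2ip_def)
  ultimately have "\<bar>f (prim (\<lambda>_. 0))\<bar> \<le> Hm1norm f"
    unfolding Hm1norm_def by (intro cSup_upper bdd) auto
  then show ?thesis by (rule order_trans[OF abs_ge_zero])
qed

text \<open>The supremum runs over the unit ball, so the argument is normalized. When its norm is 0
  this is impossible, but then the bound with \<open>K\<close> already forces the value 0.\<close>

lemma Hm1_bound:
  assumes f: "Hm1 f" and w: "H10 w"
  shows "\<bar>f w\<bar> \<le> Hm1norm f * H1norm w"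
proof -
  obtain K where K: "\<And>w. H10 w \<Longrightarrow> \<bar>f w\<bar> \<le> K * H1norm w" using f unfolding Hm1_def by blast
  let ?S = "{\<bar>f w\<bar> | w. H10 w \<and> H1norm w \<le> 1}"
  have bdd: "bdd_above ?S"
  proof (rule bdd_aboveI)
    fix y assume "y \<in> ?S"
    then obtain w where w: "y = \<bar>f w\<bar>" "H10 w" "H1norm w \<le> 1" by blast
    have "y \<le> K * H1norm w" using K w by simp
    also have "\<dots> \<le> \<bar>K\<bar> * 1" using w H1norm_nonneg[of w] by (intro mult_mono) auto
    finally show "y \<le> \<bar>K\<bar>" by simp
  qed
  show ?thesis
  proof (cases "H1norm w = 0")
    case True
    then show ?thesis using K[OF w] by simp
  next
    case False
    then have p: "0 < H1norm w" using H1norm_nonneg[of w] by simp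
    define t where "t = 1 / H1norm w"
    obtain g where g: "L2b g" "(\<integral>s. indicator Lam s * g s \<partial>lborel) = 0" "AE x in lborel. x \<in> Lam \<longrightarrow> w x = prim g x"
      by (rule H10_repr[OF w])
    \<comment> \<open>The summand with coefficient 0 gives the scaled function the form of a linear
      combination, for which linearity of \<open>f\<close> and \<open>prim_lincomb\<close> are
      stated.\<close>
    define v where "v x = t * w x + 0 * w x" for x
    define h where "h s = t * g s + 0 * g s" for s
    have g0: "mean0 g" using g(2) by (simp add: mean0_def)
    have h: "L2b h" "mean0 h" unfolding h_def
      by (rule L2b_lincomb[OF g(1) g(1)], rule mean0_lincomb[OF g(1) g(1) g0 g0])
    have vh: "AE x in lborel. x \<in> Lam \<longrightarrow> v x = prim h x"
      using g(3) by eventually_elim (auto simp: v_def h_def[abs_def] prim_lincomb[OF g(1) g(1), of _ t 0, simplified])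
    have "H1norm v = sqrt (l2ip (prim h) (prim h) + l2ip h h)" by (rule H1norm_prim(1)[OF h vh])
    also have "l2ip h h = t\<^sup>2 * l2ip g g"
      using l2ip_scale[of t g h] l2ip_scale[of t g g] by (simp add: h_def[abs_def] l2ip_commute[of g "\<lambda>s. t * g s"] power2_eq_square)
    also have "l2ip (prim h) (prim h) = t\<^sup>2 * l2ip (prim g) (prim g)"
    proof -
      have "l2ip (prim h) (prim h) = (\<integral>s. t\<^sup>2 * (indicator Lam s * (prim g s * prim g s)) \<partial>lborel)"
        unfolding l2ip_def
      proof (intro Bochner_Integration.integral_cong refl)
        fix s
        show "indicator Lam s * (prim h s * prim h s) = t\<^sup>2 * (indicator Lam s * (prim g s * prim g s))"
          using prim_lincomb[OF g(1) g(1), of s t 0] by (cases "s \<in> Lam") (auto simp: h_def[abs_def] power2_eq_square)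
      qed
      then show ?thesis unfolding l2ip_def by (simp only: integral_mult_right_zero)
    qed
    also have "t\<^sup>2 * l2ip (prim g) (prim g) + t\<^sup>2 * l2ip g g = t\<^sup>2 * (l2ip (prim g) (prim g) + l2ip g g)"
      by (simp add: distrib_left)
    also have "sqrt \<dots> = t * H1norm w"
      using p H1norm_prim(1)[OF g(1) _ g(3)] g(2) by (simp add: real_sqrt_mult t_def mean0_def)
    finally have "H1norm v = 1" using p by (simp add: t_def)
    moreover have "H10 v" using H10_primI(1)[OF h(1) _ vh] h(2) by (simp add: mean0_def)
    ultimately have "\<bar>f v\<bar> \<le> Hm1norm f"
      unfolding Hm1norm_def by (intro cSup_upper bdd) auto
    moreover have "f v = t * f w" using Hm1_linear[OF f w w, of t 0] unfolding v_def by simp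
    ultimately show ?thesis using p by (simp add: t_def abs_mult field_simps)
  qed
qed

lemma sin_pi_alpha_neg:
  assumes "1 < \<alpha>" "\<alpha> < 2"
  shows "sin (pi * \<alpha>) < 0"
proof -
  have "sin (pi * \<alpha>) = - sin (pi * (\<alpha> - 1))" by (simp add: right_diff_distrib)
  moreover have "0 < sin (pi * (\<alpha> - 1))" using assms by (intro sin_gt_zero) auto
  ultimately show ?thesis by simp
qed

section \<open>The Riemann-Liouville operator of the problem as a two-sided kernel\<close>

locale rl_problem =
  fixes \<alpha> p c \<mu> \<nu> :: real
  assumes \<alpha>: "1 < \<alpha>" "\<alpha> < 2" and p: "0 \<le> p" "p \<le> 1" and c: "0 \<le> c"
    and \<mu>: "\<alpha> - 2 \<le> \<mu>" "\<mu> \<le> 0" and \<nu>: "\<alpha> - 2 \<le> \<nu>" "\<nu> \<le> 0" and \<mu>\<nu>: "\<mu> + \<nu> = \<alpha> - 2"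
    and rel: "p * sin (pi * \<mu>) = (1 - p) * sin (pi * \<nu>)"
begin

definition \<sigma> where "\<sigma> = 2 - \<alpha>"
definition A where "A = Calp \<alpha> \<mu> \<nu> * p / Gamma \<sigma>"
definition B where "B = Calp \<alpha> \<mu> \<nu> * (1 - p) / Gamma \<sigma>"

lemma \<sigma>: "0 < \<sigma>" "\<sigma> < 1" using \<alpha> by (auto simp: \<sigma>_def)

text \<open>Both \<mu> and \<nu> lie in (-1, 0] and their sum is negative, so both sines in the
  numerator are at most 0 and one of them is negative; the denominator is negative as well.\<close>

lemma Calp_pos: "0 < Calp \<alpha> \<mu> \<nu>"
proof -
  have s: "sin (pi * x) \<le> 0 \<and> (x < 0 \<longrightarrow> sin (pi * x) < 0)" if "\<alpha> - 2 \<le> x" "x \<le> 0" for x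
  proof (cases "x = 0")
    case False
    then have "0 < pi * (- x)" using that by (intro mult_pos_pos) auto
    moreover have "pi * (- x) < pi * 1" using that \<alpha> by (intro mult_strict_left_mono) auto
    ultimately have "0 < sin (pi * (- x))" by (intro sin_gt_zero) auto
    then show ?thesis by simp
  qed simp
  have "\<mu> < 0 \<or> \<nu> < 0" using \<mu>\<nu> \<alpha> by linarith
  then have "sin (pi * \<mu>) + sin (pi * \<nu>) < 0" using s[OF \<mu>] s[OF \<nu>] by linarith
  then show ?thesis unfolding Calp_def using sin_pi_alpha_neg[OF \<alpha>] by (simp add: zero_less_divide_iff)
qed

lemma AB: "0 \<le> A" "0 \<le> B" "0 < A + B"
proof -
  have G: "0 < Gamma \<sigma>" using \<sigma> by (intro Gamma_real_pos)
  show "0 \<le> A" "0 \<le> B" using G Calp_pos p by (auto simp: A_def B_def)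
  have "A + B = Calp \<alpha> \<mu> \<nu> / Gamma \<sigma>" by (simp add: A_def B_def add_divide_distrib[symmetric] algebra_simps)
  then show "0 < A + B" using G Calp_pos by simp
qed

lemma good: "good_kernel A B \<sigma>"
proof (rule good_kernel[of \<sigma> "- \<nu>" "- \<mu>"])
  have "A * sin (pi * \<mu>) = Calp \<alpha> \<mu> \<nu> / Gamma \<sigma> * (p * sin (pi * \<mu>))" by (simp add: A_def)
  also have "\<dots> = B * sin (pi * \<nu>)" unfolding rel by (simp add: B_def)
  finally show "A * sin (pi * - \<mu>) = B * sin (pi * - \<nu>)" by simp
qed (use \<sigma> \<mu> \<nu> \<mu>\<nu> AB in \<open>auto simp: \<sigma>_def\<close>)

abbreviation K where "K \<equiv> rk_op A B \<sigma>"

text \<open>The coefficients are arbitrary here so that the left and the right integral can also be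
  treated separately, with coefficients 1 and 0.\<close>

lemma K_AE_integrable:
  assumes v: "L1z v" and AB': "0 \<le> A'" "0 \<le> B'"
  shows "AE x in lborel. x \<in> Lam \<longrightarrow> integrable lborel (\<lambda>y. rk A' B' \<sigma> (x - y) * v y)"
proof -
  have vi: "integrable lborel v" using v by (simp add: L1z_def)
  then have [measurable]: "v \<in> borel_measurable borel" by auto
  have "AE x in lborel. x \<in> {-1<..<1} \<longrightarrow> (\<integral>\<^sup>+y. ennreal (rk A' B' \<sigma> (x - y)) * ennreal \<bar>v y\<bar> \<partial>lborel) < \<infinity>"
  proof (rule nn_integral_rk_AE_finite[OF AB' \<sigma>(1)])
    show "(\<integral>\<^sup>+y. ennreal \<bar>v y\<bar> \<partial>lborel) < \<infinity>" using vi by (simp add: integrable_iff_bounded)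
    show "ennreal \<bar>v y\<bar> = 0" if "y \<notin> {-1<..<1}" for y using v that by (simp add: L1z_def Lam_def)
  qed simp
  then show ?thesis
  proof eventually_elim
    case (elim x)
    show ?case
    proof
      assume "x \<in> Lam"
      then have "(\<integral>\<^sup>+y. ennreal (norm (rk A' B' \<sigma> (x - y) * v y)) \<partial>lborel) < \<infinity>"
        using elim AB' by (simp add: Lam_def abs_mult rk_nonneg ennreal_mult')
      then show "integrable lborel (\<lambda>y. rk A' B' \<sigma> (x - y) * v y)" by (intro integrableI_bounded) auto
    qed
  qed
qed

lemma K_lincomb:
  assumes "L1z u" "L1z v"
  shows "AE x in lborel. x \<in> Lam \<longrightarrow> K (\<lambda>y. s * u y + t * v y) x = s * K u x + t * K v x"
  using K_AE_integrable[OF assms(1) AB(1,2)] K_AE_integrable[OF assms(2) AB(1,2)]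
proof eventually_elim
  case (elim x)
  show ?case
  proof
    assume "x \<in> Lam"
    then have i: "integrable lborel (\<lambda>y. rk A B \<sigma> (x - y) * u y)" "integrable lborel (\<lambda>y. rk A B \<sigma> (x - y) * v y)"
      using elim by auto
    have "K (\<lambda>y. s * u y + t * v y) x = (\<integral>y. s * (rk A B \<sigma> (x - y) * u y) + t * (rk A B \<sigma> (x - y) * v y) \<partial>lborel)"
      unfolding rk_op_def by (intro Bochner_Integration.integral_cong) (simp_all add: algebra_simps)
    also have "\<dots> = s * K u x + t * K v x" unfolding rk_op_def using i by simp
    finally show "K (\<lambda>y. s * u y + t * v y) x = s * K u x + t * K v x" .
  qed
qed

lemma L1z_lincomb: "L1z u \<Longrightarrow> L1z v \<Longrightarrow> L1z (\<lambda>y. s * u y + t * v y)"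
  by (simp add: L1z_def)

lemma K_inject:
  assumes u: "L1z u" and v: "L1z v" and eq: "AE x in lborel. x \<in> Lam \<longrightarrow> K u x = K v x"
  shows "AE x in lborel. u x = v x"
proof -
  have "AE x in lborel. x \<in> Lam \<longrightarrow> K (\<lambda>y. 1 * u y + (-1) * v y) x = 0"
    using K_lincomb[OF u v, of 1 "-1"] eq by eventually_elim auto
  then have "AE x in lborel. 1 * u x + (-1) * v x = 0"
    using good L1z_lincomb[OF u v, of 1 "-1"] unfolding good_kernel_def by blast
  then show ?thesis by eventually_elim simp
qed

lemma Ip_eq:
  assumes v': "L1z v'" and eq: "AE x in lborel. x \<in> Lam \<longrightarrow> v x = v' x"
  shows "AE x in lborel. x \<in> Lam \<longrightarrow> Ip \<alpha> p \<mu> \<nu> (2 - \<alpha>) v x = K v' x"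
  using K_AE_integrable[OF v' zero_le_one order_refl] K_AE_integrable[OF v' order_refl zero_le_one]
proof eventually_elim
  case (elim x)
  have [measurable]: "v' \<in> borel_measurable borel" using v' by (auto simp: L1z_def)
  have v0: "v' y = 0" if "y \<notin> Lam" for y using v' that by (simp add: L1z_def)
  \<comment> \<open>The integrals in the definition include the end points of the interval, where
    nothing relates \<open>v\<close> to \<open>v'\<close>.\<close>
  have ends: "AE y in lborel. y \<noteq> -1 \<and> y \<noteq> 1" by (simp add: AE_lborel_singleton)
  show ?case
  proof
    assume x: "x \<in> Lam"
    have l: "RL_left \<sigma> v x = 1 / Gamma \<sigma> * (\<integral>y. pw (x - y) (\<sigma> - 1) * v' y \<partial>lborel)"
    proof -
      have "integral\<^sup>L (lebesgue_on {-1..x}) (\<lambda>y. (x - y) powr (\<sigma> - 1) * v y)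
         = (\<integral>y. indicator {-1..x} y * (pw (x - y) (\<sigma> - 1) * v' y) \<partial>lborel)"
      proof (rule lebesgue_on_transfer(2))
        show "AE y in lborel. y \<in> {-1..x} \<longrightarrow> (x - y) powr (\<sigma> - 1) * v y = pw (x - y) (\<sigma> - 1) * v' y"
          using eq ends by eventually_elim (use x in \<open>auto simp: pw_def Lam_def\<close>)
      qed simp_all
      also have "\<dots> = (\<integral>y. pw (x - y) (\<sigma> - 1) * v' y \<partial>lborel)"
      proof (intro Bochner_Integration.integral_cong refl)
        fix y
        show "indicator {-1..x} y * (pw (x - y) (\<sigma> - 1) * v' y) = pw (x - y) (\<sigma> - 1) * v' y"
          using v0[of y] by (cases "y \<in> Lam") (auto simp: pw_def indicator_def Lam_def)
      qed
      finally show ?thesis by (simp add: RL_left_def)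
    qed
    have r: "RL_right \<sigma> v x = 1 / Gamma \<sigma> * (\<integral>y. pw (y - x) (\<sigma> - 1) * v' y \<partial>lborel)"
    proof -
      have "integral\<^sup>L (lebesgue_on {x..1}) (\<lambda>y. (y - x) powr (\<sigma> - 1) * v y)
         = (\<integral>y. indicator {x..1} y * (pw (y - x) (\<sigma> - 1) * v' y) \<partial>lborel)"
      proof (rule lebesgue_on_transfer(2))
        show "AE y in lborel. y \<in> {x..1} \<longrightarrow> (y - x) powr (\<sigma> - 1) * v y = pw (y - x) (\<sigma> - 1) * v' y"
          using eq ends by eventually_elim (use x in \<open>auto simp: pw_def Lam_def\<close>)
      qed simp_all
      also have "\<dots> = (\<integral>y. pw (y - x) (\<sigma> - 1) * v' y \<partial>lborel)"
      proof (intro Bochner_Integration.integral_cong refl)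
        fix y
        show "indicator {x..1} y * (pw (y - x) (\<sigma> - 1) * v' y) = pw (y - x) (\<sigma> - 1) * v' y"
          using v0[of y] by (cases "y \<in> Lam") (auto simp: pw_def indicator_def Lam_def)
      qed
      finally show ?thesis by (simp add: RL_right_def)
    qed
    have i: "integrable lborel (\<lambda>y. pw (x - y) (\<sigma> - 1) * v' y)" "integrable lborel (\<lambda>y. pw (y - x) (\<sigma> - 1) * v' y)"
      using elim x by (auto simp: rk_def)
    have "K v' x = (\<integral>y. A * (pw (x - y) (\<sigma> - 1) * v' y) + B * (pw (y - x) (\<sigma> - 1) * v' y) \<partial>lborel)"
      unfolding rk_op_def rk_def by (intro Bochner_Integration.integral_cong) (simp_all add: algebra_simps)
    also have "\<dots> = A * (\<integral>y. pw (x - y) (\<sigma> - 1) * v' y \<partial>lborel) + B * (\<integral>y. pw (y - x) (\<sigma> - 1) * v' y \<partial>lborel)"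
      using i by simp
    finally show "Ip \<alpha> p \<mu> \<nu> (2 - \<alpha>) v x = K v' x"
      unfolding Ip_def \<sigma>_def[symmetric] l r by (simp add: A_def B_def algebra_simps)
  qed
qed

definition M where "M = (SOME M. 0 \<le> M \<and> (\<forall>g. L2b g \<longrightarrow> (\<integral>s. indicator Lam s * g s \<partial>lborel) = 0 \<longrightarrow>
       (\<exists>v. L1z v \<and> (AE x in lborel. x \<in> Lam \<longrightarrow> K v x = prim g x) \<and>
          (\<integral>x. \<bar>v x\<bar> \<partial>lborel) \<le> M * sqrt (\<integral>s. indicator Lam s * (g s)\<^sup>2 \<partial>lborel) \<and>
          0 \<le> (\<integral>x. v x * prim g x \<partial>lborel))))"

text \<open>The inverse of the operator applied to \<open>prim g\<close>. The choice is unique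
  almost everywhere by injectivity, and this is the source of its linearity in
  \<open>g\<close>.\<close>

definition V where "V g = (SOME v. L1z v \<and> (AE x in lborel. x \<in> Lam \<longrightarrow> K v x = prim g x) \<and>
          (\<integral>x. \<bar>v x\<bar> \<partial>lborel) \<le> M * l2n g \<and> 0 \<le> (\<integral>x. v x * prim g x \<partial>lborel))"

lemma M_nonneg: "0 \<le> M"
  and V: "L2b g \<Longrightarrow> mean0 g \<Longrightarrow> L1z (V g) \<and> (AE x in lborel. x \<in> Lam \<longrightarrow> K (V g) x = prim g x) \<and>
          (\<integral>x. \<bar>V g x\<bar> \<partial>lborel) \<le> M * l2n g \<and> 0 \<le> (\<integral>x. V g x * prim g x \<partial>lborel)"
proof -
  have e: "sqrt (\<integral>s. indicator Lam s * (g s)\<^sup>2 \<partial>lborel) = l2n g" for g by (simp add: l2n_def l2ip_def power2_eq_square)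
  have ex: "\<exists>M. 0 \<le> M \<and> (\<forall>g. L2b g \<longrightarrow> (\<integral>s. indicator Lam s * g s \<partial>lborel) = 0 \<longrightarrow>
       (\<exists>v. L1z v \<and> (AE x in lborel. x \<in> Lam \<longrightarrow> K v x = prim g x) \<and>
          (\<integral>x. \<bar>v x\<bar> \<partial>lborel) \<le> M * sqrt (\<integral>s. indicator Lam s * (g s)\<^sup>2 \<partial>lborel) \<and>
          0 \<le> (\<integral>x. v x * prim g x \<partial>lborel)))"
    using good unfolding good_kernel_def by blast
  note M = someI_ex[OF ex, folded M_def]
  show "0 \<le> M" using M by blast
  assume "L2b g" "mean0 g"
  then have "\<exists>v. L1z v \<and> (AE x in lborel. x \<in> Lam \<longrightarrow> K v x = prim g x) \<and>
          (\<integral>x. \<bar>v x\<bar> \<partial>lborel) \<le> M * l2n g \<and> 0 \<le> (\<integral>x. v x * prim g x \<partial>lborel)"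
    using M unfolding e mean0_def by blast
  from someI_ex[OF this, folded V_def] show "L1z (V g) \<and> (AE x in lborel. x \<in> Lam \<longrightarrow> K (V g) x = prim g x) \<and>
          (\<integral>x. \<bar>V g x\<bar> \<partial>lborel) \<le> M * l2n g \<and> 0 \<le> (\<integral>x. V g x * prim g x \<partial>lborel)" .
qed

text \<open>In terms of the images \<open>prim g\<close> and \<open>prim h\<close>, this is the
  pairing of the preimage of the first with the second: the term of the weak equation that is
  multiplied by \<open>c\<close>.\<close>

definition bf where "bf g h = (\<integral>x. V g x * prim h x \<partial>lborel)"

lemma bf_integrable:
  assumes g: "L2b g" "mean0 g" and h: "L2b h"
  shows "integrable lborel (\<lambda>x. V g x * prim h x)" "\<bar>bf g h\<bar> \<le> 2 * M * l2n g * l2n h"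
proof -
  note [measurable] = h[THEN L2b_measurable]
  have v: "L1z (V g)" "(\<integral>x. \<bar>V g x\<bar> \<partial>lborel) \<le> M * l2n g" using V[OF g] by auto
  have vi: "integrable lborel (V g)" using v by (simp add: L1z_def)
  have i1: "integrable lborel (\<lambda>x. 2 * l2n h * \<bar>V g x\<bar>)" by (intro integrable_mult_right integrable_abs vi)
  have pt: "\<bar>V g x * prim h x\<bar> \<le> 2 * l2n h * \<bar>V g x\<bar>" for x
  proof (cases "x \<in> Lam")
    case True
    then show ?thesis using mult_right_mono[OF prim_abs_le[OF h True], of "\<bar>V g x\<bar>"] by (simp add: abs_mult mult.commute)
  next
    case False
    then show ?thesis using v(1) by (simp add: L1z_def)
  qed
  show i2: "integrable lborel (\<lambda>x. V g x * prim h x)"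
  proof (rule Bochner_Integration.integrable_bound[OF i1])
    show "AE x in lborel. norm (V g x * prim h x) \<le> norm (2 * l2n h * \<bar>V g x\<bar>)"
      using pt l2n_nonneg[of h] by (intro AE_I2) (simp add: abs_mult)
    show "(\<lambda>x. V g x * prim h x) \<in> borel_measurable lborel"
      using borel_measurable_integrable[OF vi] by measurable
  qed
  have "\<bar>bf g h\<bar> \<le> (\<integral>x. \<bar>V g x * prim h x\<bar> \<partial>lborel)" unfolding bf_def by (rule integral_abs_bound)
  also have "\<dots> \<le> (\<integral>x. 2 * l2n h * \<bar>V g x\<bar> \<partial>lborel)"
    by (intro integral_mono integrable_abs i1 i2 pt)
  also have "\<dots> = 2 * l2n h * (\<integral>x. \<bar>V g x\<bar> \<partial>lborel)" by (rule integral_mult_right_zero)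
  also have "\<dots> \<le> 2 * l2n h * (M * l2n g)" using v(2) l2n_nonneg[of h] by (intro mult_left_mono) auto
  finally show "\<bar>bf g h\<bar> \<le> 2 * M * l2n g * l2n h" by (simp add: mult_ac)
qed

lemma V_unique:
  assumes g: "L2b g" "mean0 g" and v: "L1z v" "AE x in lborel. x \<in> Lam \<longrightarrow> K v x = prim g x"
  shows "AE x in lborel. v x = V g x"
proof (rule K_inject[OF v(1)])
  show "L1z (V g)" using V[OF g] by blast
  have "AE x in lborel. x \<in> Lam \<longrightarrow> K (V g) x = prim g x" using V[OF g] by blast
  then show "AE x in lborel. x \<in> Lam \<longrightarrow> K v x = K (V g) x" using v(2) by eventually_elim auto
qed

lemma V_lincomb:
  assumes f: "L2b f" "mean0 f" and g: "L2b g" "mean0 g" and k: "L2b k" "mean0 k"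
    and eq: "AE x in lborel. x \<in> Lam \<longrightarrow> k x = s * f x + t * g x"
  shows "AE x in lborel. s * V f x + t * V g x = V k x"
proof (rule V_unique[OF k])
  have vf: "L1z (V f)" "AE x in lborel. x \<in> Lam \<longrightarrow> K (V f) x = prim f x"
    and vg: "L1z (V g)" "AE x in lborel. x \<in> Lam \<longrightarrow> K (V g) x = prim g x" using V[OF f] V[OF g] by auto
  show "L1z (\<lambda>x. s * V f x + t * V g x)" by (rule L1z_lincomb[OF vf(1) vg(1)])
  have pk: "prim k x = s * prim f x + t * prim g x" if "x \<in> Lam" for x
    using prim_cong[OF k(1) L2b_lincomb[OF f(1) g(1)] eq that] prim_lincomb[OF f(1) g(1) that, of s t] by simp
  show "AE x in lborel. x \<in> Lam \<longrightarrow> K (\<lambda>x. s * V f x + t * V g x) x = prim k x"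
    using K_lincomb[OF vf(1) vg(1), of s t] vf(2) vg(2) by eventually_elim (auto simp: pk)
qed

lemma bf_lincomb_left:
  assumes f: "L2b f" "mean0 f" and g: "L2b g" "mean0 g" and k: "L2b k" "mean0 k" and h: "L2b h"
    and eq: "AE x in lborel. x \<in> Lam \<longrightarrow> k x = s * f x + t * g x"
  shows "bf k h = s * bf f h + t * bf g h"
proof -
  have "bf k h = (\<integral>x. s * (V f x * prim h x) + t * (V g x * prim h x) \<partial>lborel)"
    unfolding bf_def
  proof (rule integral_cong_AE)
    show "AE x in lborel. V k x * prim h x = s * (V f x * prim h x) + t * (V g x * prim h x)"
      using V_lincomb[OF f g k eq]
    proof eventually_elim
      case (elim x)
      show ?case unfolding elim[symmetric] by (simp add: algebra_simps)
    qed
    show "(\<lambda>x. V k x * prim h x) \<in> borel_measurable lborel"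
      by (rule borel_measurable_integrable[OF bf_integrable(1)[OF k h]])
    show "(\<lambda>x. s * (V f x * prim h x) + t * (V g x * prim h x)) \<in> borel_measurable lborel"
      by (intro borel_measurable_integrable Bochner_Integration.integrable_add integrable_mult_right bf_integrable f g h)
  qed
  also have "\<dots> = s * bf f h + t * bf g h"
    unfolding bf_def using bf_integrable(1)[OF f h] bf_integrable(1)[OF g h] by simp
  finally show ?thesis .
qed

lemma bf_lincomb_right:
  assumes f: "L2b f" and g: "L2b g" and k: "L2b k" and h: "L2b h" "mean0 h"
    and eq: "AE x in lborel. x \<in> Lam \<longrightarrow> k x = s * f x + t * g x"
  shows "bf h k = s * bf h f + t * bf h g"
proof -
  have pk: "prim k x = s * prim f x + t * prim g x" if "x \<in> Lam" for x
    using prim_cong[OF k L2b_lincomb[OF f g] eq that] prim_lincomb[OF f g that, of s t] by simp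
  have v0: "V h x = 0" if "x \<notin> Lam" for x using V[OF h] that by (auto simp: L1z_def)
  have "bf h k = (\<integral>x. s * (V h x * prim f x) + t * (V h x * prim g x) \<partial>lborel)"
    unfolding bf_def
  proof (intro Bochner_Integration.integral_cong refl)
    fix x
    show "V h x * prim k x = s * (V h x * prim f x) + t * (V h x * prim g x)"
      by (cases "x \<in> Lam") (auto simp: pk v0 algebra_simps)
  qed
  also have "\<dots> = s * bf h f + t * bf h g"
    unfolding bf_def using bf_integrable(1)[OF h f] bf_integrable(1)[OF h g] by simp
  finally show ?thesis .
qed

text \<open>Subtracting the mean value projects onto the derivatives of functions vanishing at both end points.\<close>

definition Q :: "l2 \<Rightarrow> real \<Rightarrow> real" where
  "Q u = (\<lambda>s. 1 * l2rep u s + (- (\<integral>s. indicator Lam s * l2rep u s \<partial>lborel) / 2) * 1)"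

lemma Q_L2b: "L2b (Q u)"
  unfolding Q_def by (intro L2b_lincomb L2b_l2rep L2b_const)

lemma integrable_indicator_Lam: "integrable lborel (indicator Lam :: real \<Rightarrow> real)" by (simp add: Lam_def)

lemma Q_mean0: "mean0 (Q u)"
proof -
  define m where "m = (\<integral>s. indicator Lam s * l2rep u s \<partial>lborel)"
  have "(\<integral>s. indicator Lam s * Q u s \<partial>lborel) = (\<integral>s. indicator Lam s * l2rep u s + (- m / 2) * indicator Lam s \<partial>lborel)"
    unfolding Q_def m_def by (intro Bochner_Integration.integral_cong) (simp_all add: algebra_simps)
  also have "\<dots> = m + (- m / 2) * 2"
    unfolding m_def indicator_Lam_integral[symmetric] using L2b_integrable[OF L2b_l2rep[of u]] integrable_indicator_Lam
    by (subst Bochner_Integration.integral_add) auto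
  finally show ?thesis by (simp add: mean0_def)
qed

text \<open>\<open>Q\<close> is the orthogonal projection onto the complement of the constants; with
  the integral \<open>m\<close> of \<open>u\<close>, the square of the norm drops by
  \<open>m\<^sup>2 / 2\<close>.\<close>

lemma Q_norm: "l2n (Q u) \<le> norm u"
proof -
  define m where "m = (\<integral>s. indicator Lam s * l2rep u s \<partial>lborel)"
  have one: "l2ip (\<lambda>_. 1) f = (\<integral>s. indicator Lam s * f s \<partial>lborel)" for f by (simp add: l2ip_def)
  have q1: "l2ip (\<lambda>_. 1) (Q u) = 0" using Q_mean0[of u] by (simp add: one mean0_def)
  have "l2ip (Q u) (Q u) = 1 * l2ip (l2rep u) (Q u) + (- m / 2) * l2ip (\<lambda>_. 1) (Q u)"
    using l2ip_add[OF L2b_l2rep L2b_const Q_L2b, of 1 u "- m / 2" 1 u] by (simp add: Q_def m_def)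
  also have "\<dots> = l2ip (Q u) (l2rep u)" by (simp add: q1 l2ip_commute)
  also have "\<dots> = 1 * l2ip (l2rep u) (l2rep u) + (- m / 2) * l2ip (\<lambda>_. 1) (l2rep u)"
    using l2ip_add[OF L2b_l2rep L2b_const L2b_l2rep, of 1 u "- m / 2" 1 u] by (simp add: Q_def m_def)
  also have "\<dots> = l2ip (l2rep u) (l2rep u) - m\<^sup>2 / 2" by (simp add: one m_def power2_eq_square)
  also have "\<dots> \<le> l2ip (l2rep u) (l2rep u)" by simp
  finally show ?thesis unfolding l2_norm_rep l2n_def by (rule real_sqrt_le_mono)
qed

lemma Q_lincomb: "AE x in lborel. x \<in> Lam \<longrightarrow> Q (s *\<^sub>R u + t *\<^sub>R v) x = s * Q u x + t * Q v x"
proof -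
  have m: "(\<integral>x. indicator Lam x * l2rep (s *\<^sub>R u + t *\<^sub>R v) x \<partial>lborel)
     = s * (\<integral>x. indicator Lam x * l2rep u x \<partial>lborel) + t * (\<integral>x. indicator Lam x * l2rep v x \<partial>lborel)"
  proof -
    have "(\<integral>x. indicator Lam x * l2rep (s *\<^sub>R u + t *\<^sub>R v) x \<partial>lborel)
       = (\<integral>x. s * (indicator Lam x * l2rep u x) + t * (indicator Lam x * l2rep v x) \<partial>lborel)"
    proof (rule integral_cong_AE)
      show "AE x in lborel. indicator Lam x * l2rep (s *\<^sub>R u + t *\<^sub>R v) x = s * (indicator Lam x * l2rep u x) + t * (indicator Lam x * l2rep v x)"
        using l2rep_lincomb[of s u t v] by eventually_elim (auto simp: indicator_def)
      show "(\<lambda>x. indicator Lam x * l2rep (s *\<^sub>R u + t *\<^sub>R v) x) \<in> borel_measurable lborel"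
        by (rule borel_measurable_integrable[OF L2b_integrable[OF L2b_l2rep]])
      show "(\<lambda>x. s * (indicator Lam x * l2rep u x) + t * (indicator Lam x * l2rep v x)) \<in> borel_measurable lborel"
        by (intro borel_measurable_integrable Bochner_Integration.integrable_add integrable_mult_right L2b_integrable L2b_l2rep)
    qed
    then show ?thesis using L2b_integrable[OF L2b_l2rep[of u]] L2b_integrable[OF L2b_l2rep[of v]] by simp
  qed
  show ?thesis
    using l2rep_lincomb[of s u t v] by eventually_elim (auto simp: Q_def m field_simps)
qed

text \<open>The inner product is taken of \<open>u\<close> and \<open>h\<close> themselves and not
  of their projections. This keeps the form coercive on all of \<open>l2\<close>, where the
  Lax-Milgram theorem is applied; the solution turns out to have mean 0 in
  \<open>form_solution\<close>.\<close>

definition form :: "l2 \<Rightarrow> l2 \<Rightarrow> real" where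
  "form u h = inner u h + c * bf (Q u) (Q h)"

lemma form_bilinear: "bounded_bilinear form"
proof
  have L: "form (s *\<^sub>R u + t *\<^sub>R v) h = s * form u h + t * form v h" for s t u v h
    using bf_lincomb_left[OF Q_L2b Q_mean0 Q_L2b Q_mean0 Q_L2b Q_mean0 Q_L2b Q_lincomb, of s u t v h]
    by (simp add: form_def inner_simps algebra_simps)
  have R: "form h (s *\<^sub>R u + t *\<^sub>R v) = s * form h u + t * form h v" for s t u v h
    using bf_lincomb_right[OF Q_L2b Q_L2b Q_L2b Q_L2b Q_mean0 Q_lincomb, of h s u t v]
    by (simp add: form_def inner_simps algebra_simps)
  fix a a' b b' :: l2 and r :: real
  show "form (a + a') b = form a b + form a' b" using L[of 1 a 1 a' b] by simp
  show "form a (b + b') = form a b + form a b'" using R[of a 1 b 1 b'] by simp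
  show "form (r *\<^sub>R a) b = r *\<^sub>R form a b" using L[of r a 0 a b] by simp
  show "form a (r *\<^sub>R b) = r *\<^sub>R form a b" using R[of a r b 0 b] by simp
  show "\<exists>K. \<forall>a b. norm (form a b) \<le> norm a * norm b * K"
  proof (intro exI allI)
    fix a b
    have "\<bar>bf (Q a) (Q b)\<bar> \<le> 2 * M * l2n (Q a) * l2n (Q b)" by (rule bf_integrable(2)[OF Q_L2b Q_mean0 Q_L2b])
    also have "\<dots> \<le> 2 * M * norm a * norm b"
      using Q_norm[of a] Q_norm[of b] M_nonneg l2n_nonneg by (intro mult_mono) auto
    finally have "c * \<bar>bf (Q a) (Q b)\<bar> \<le> c * (2 * M * norm a * norm b)" using c by (intro mult_left_mono)
    moreover have "\<bar>inner a b\<bar> \<le> norm a * norm b" by (rule Cauchy_Schwarz_ineq2)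
    moreover have "\<bar>form a b\<bar> \<le> \<bar>inner a b\<bar> + c * \<bar>bf (Q a) (Q b)\<bar>"
      unfolding form_def using abs_triangle_ineq[of "inner a b" "c * bf (Q a) (Q b)"] c by (simp add: abs_mult)
    ultimately show "norm (form a b) \<le> norm a * norm b * (1 + 2 * c * M)" by (simp add: algebra_simps)
  qed
qed

lemma form_coercive: "(norm u)\<^sup>2 \<le> form u u"
proof -
  have "0 \<le> bf (Q u) (Q u)" using V[OF Q_L2b Q_mean0] unfolding bf_def by blast
  then show ?thesis using c by (simp add: form_def power2_norm_eq_inner)
qed

lemma prim_H10: "L2b g \<Longrightarrow> mean0 g \<Longrightarrow> H10 (prim g)"
  using H10_primI(1)[of g "prim g"] by (simp add: mean0_def)

definition rhs :: "((real \<Rightarrow> real) \<Rightarrow> real) \<Rightarrow> l2 \<Rightarrow> real" where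
  "rhs f h = f (prim (Q h))"

lemma rhs_le:
  assumes f: "Hm1 f"
  shows "\<bar>rhs f h\<bar> \<le> 3 * \<bar>Hm1norm f\<bar> * norm h"
proof -
  have "\<bar>rhs f h\<bar> \<le> Hm1norm f * H1norm (prim (Q h))"
    unfolding rhs_def by (rule Hm1_bound[OF f prim_H10[OF Q_L2b Q_mean0]])
  also have "\<dots> \<le> \<bar>Hm1norm f\<bar> * (3 * norm h)"
  proof (rule mult_mono)
    have "H1norm (prim (Q h)) \<le> 3 * l2n (Q h)" by (rule H1norm_prim(2)[OF Q_L2b Q_mean0]) simp
    then show "H1norm (prim (Q h)) \<le> 3 * norm h" using Q_norm[of h] by simp
  qed (auto simp: H1norm_nonneg)
  finally show ?thesis by simp
qed

lemma rhs_linear: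
  assumes f: "Hm1 f"
  shows "bounded_linear (rhs f)"
proof -
  have L: "rhs f (s *\<^sub>R u + t *\<^sub>R v) = s * rhs f u + t * rhs f v" for s t u v
  proof -
    define k where "k x = s * Q u x + t * Q v x" for x
    have k: "L2b k" "mean0 k" unfolding k_def using Q_L2b Q_mean0 by (auto intro!: L2b_lincomb mean0_lincomb)
    have pk: "s * prim (Q u) x + t * prim (Q v) x = prim k x" if "x \<in> Lam" for x
      unfolding k_def[abs_def] by (rule prim_lincomb[OF Q_L2b Q_L2b that, symmetric])
    have H: "H10 (\<lambda>x. s * prim (Q u) x + t * prim (Q v) x)"
      by (rule H10_primI(1)[OF k(1)]) (use k(2) pk in \<open>auto simp: mean0_def\<close>)
    have "rhs f (s *\<^sub>R u + t *\<^sub>R v) = f (\<lambda>x. s * prim (Q u) x + t * prim (Q v) x)"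
      unfolding rhs_def
    proof (rule Hm1_cong[OF f prim_H10[OF Q_L2b Q_mean0] H])
      have "prim (Q (s *\<^sub>R u + t *\<^sub>R v)) x = prim k x" if "x \<in> Lam" for x
        using Q_lincomb[of s u t v] by (intro prim_cong Q_L2b k that) (simp add: k_def)
      then show "AE x in lborel. x \<in> Lam \<longrightarrow> prim (Q (s *\<^sub>R u + t *\<^sub>R v)) x = s * prim (Q u) x + t * prim (Q v) x"
        using pk by auto
    qed
    then show ?thesis
      using Hm1_linear[OF f prim_H10[OF Q_L2b Q_mean0] prim_H10[OF Q_L2b Q_mean0]] by (simp add: rhs_def)
  qed
  show ?thesis
  proof (rule bounded_linear_intro)
    fix x y :: l2 and r :: real
    show "rhs f (x + y) = rhs f x + rhs f y" using L[of 1 x 1 y] by simp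
    show "rhs f (r *\<^sub>R x) = r *\<^sub>R rhs f x" using L[of r x 0 x] by simp
    show "norm (rhs f x) \<le> norm x * (3 * \<bar>Hm1norm f\<bar>)" using rhs_le[OF f, of x] by (simp add: mult_ac)
  qed
qed

section \<open>Equivalence with the weak problem\<close>

abbreviation Iv where "Iv \<equiv> Ip \<alpha> p \<mu> \<nu> (2 - \<alpha>)"

text \<open>The image of \<open>v\<close> lies in H^1_0 and is therefore \<open>prim h\<close> for
  some \<open>h\<close> with mean 0; injectivity then forces \<open>v\<close> to be
  \<open>V h\<close> almost everywhere. Trial and test functions are thus parametrized by the
  derivatives of their images.\<close>

lemma HRL0_repr:
  assumes v: "HRL0 \<alpha> p \<mu> \<nu> v"
  obtains h where "L2b h" "mean0 h" "AE x in lborel. x \<in> Lam \<longrightarrow> v x = V h x"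
    "AE x in lborel. x \<in> Lam \<longrightarrow> Iv v x = prim h x" "AE x in lborel. x \<in> Lam \<longrightarrow> Dp \<alpha> p \<mu> \<nu> v x = h x"
    "H10 (Iv v)"
proof -
  have int: "integrable LM v" and H: "H10 (Iv v)"
    using v by (auto simp: HRL0_def HRL_def H10_def)
  obtain v' where v': "v' \<in> borel_measurable borel" "\<And>x. x \<notin> Lam \<Longrightarrow> v' x = 0" "AE x in lborel. x \<in> Lam \<longrightarrow> v x = v' x"
    by (rule LM_rep[OF borel_measurable_integrable[OF int]], rule that)
  have i: "integrable lborel (\<lambda>x. indicator Lam x * v' x)" using LM_integrable[OF v'(1,3)] int by simp
  have "(\<lambda>x. indicator Lam x * v' x) = v'"
  proof
    show "indicator Lam x * v' x = v' x" for x using v'(2)[of x] by (cases "x \<in> Lam") auto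
  qed
  then have L: "L1z v'" using v'(2) i unfolding L1z_def by auto
  obtain h where h: "L2b h" "(\<integral>s. indicator Lam s * h s \<partial>lborel) = 0"
    "AE x in lborel. x \<in> Lam \<longrightarrow> Iv v x = prim h x" "AE x in lborel. x \<in> Lam \<longrightarrow> wderiv (Iv v) x = h x"
    by (rule H10_repr[OF H])
  have m: "mean0 h" using h(2) by (simp add: mean0_def)
  have "AE x in lborel. x \<in> Lam \<longrightarrow> K v' x = prim h x"
    using Ip_eq[OF L v'(3)] h(3) by eventually_elim auto
  from V_unique[OF h(1) m L this] have "AE x in lborel. x \<in> Lam \<longrightarrow> v x = V h x"
    using v'(3) by eventually_elim auto
  then show ?thesis using that[OF h(1) m _ h(3) _ H] h(4) unfolding Dp_def by blast
qed

lemma V_HRL0: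
  assumes g: "L2b g" "mean0 g"
  shows "HRL0 \<alpha> p \<mu> \<nu> (V g)" "AE x in lborel. x \<in> Lam \<longrightarrow> Iv (V g) x = prim g x"
    "AE x in lborel. x \<in> Lam \<longrightarrow> Dp \<alpha> p \<mu> \<nu> (V g) x = g x" "H10 (Iv (V g))"
proof -
  have L: "L1z (V g)" and Kg: "AE x in lborel. x \<in> Lam \<longrightarrow> K (V g) x = prim g x" using V[OF g] by auto
  have [measurable]: "V g \<in> borel_measurable borel" using L by (auto simp: L1z_def)
  have "AE x in lborel. x \<in> Lam \<longrightarrow> Iv (V g) x = K (V g) x" by (rule Ip_eq[OF L]) simp
  then show I: "AE x in lborel. x \<in> Lam \<longrightarrow> Iv (V g) x = prim g x"
    using Kg by eventually_elim auto
  show H: "H10 (Iv (V g))" using H10_primI(1)[OF g(1) _ I] g(2) by (simp add: mean0_def)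
  show "AE x in lborel. x \<in> Lam \<longrightarrow> Dp \<alpha> p \<mu> \<nu> (V g) x = g x"
    using H10_primI(2)[OF g(1) _ I] g(2) by (simp add: mean0_def Dp_def)
  have "(\<lambda>x. indicator Lam x * V g x) = V g" using L by (auto simp: fun_eq_iff indicator_def L1z_def)
  then have "integrable LM (V g)" using LM_integrable[of "V g" "V g"] L by (simp add: L1z_def)
  then show "HRL0 \<alpha> p \<mu> \<nu> (V g)" using H by (simp add: HRL0_def HRL_def H10_def)
qed

lemma L2ip_bf:
  assumes g: "L2b g" "mean0 g" and u: "AE x in lborel. x \<in> Lam \<longrightarrow> u x = V g x"
    and h: "L2b h" and w: "AE x in lborel. x \<in> Lam \<longrightarrow> w x = prim h x"
  shows "L2ip u w = bf g h"
proof -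
  note [measurable] = h[THEN L2b_measurable]
  have L: "L1z (V g)" using V[OF g] by auto
  have [measurable]: "V g \<in> borel_measurable borel" using L by (auto simp: L1z_def)
  have "L2ip u w = l2ip (V g) (prim h)" by (rule L2ip_rep) (use u w in auto)
  also have "\<dots> = bf g h"
    unfolding l2ip_def bf_def using L by (intro Bochner_Integration.integral_cong) (auto simp: L1z_def indicator_def)
  finally show ?thesis .
qed

text \<open>Both the unknown and the test functions are replaced by the derivatives of their images.
  The image of a test function equals \<open>prim h\<close> only almost everywhere, so
  \<open>Hm1_cong\<close> is what carries the right-hand side over.\<close>

lemma weak_eq_iff:
  assumes g: "L2b g" "mean0 g" and u: "HRL0 \<alpha> p \<mu> \<nu> u" "AE x in lborel. x \<in> Lam \<longrightarrow> u x = V g x"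
    "AE x in lborel. x \<in> Lam \<longrightarrow> Dp \<alpha> p \<mu> \<nu> u x = g x" and f: "Hm1 f"
  shows "weak_eq \<alpha> p \<mu> \<nu> c f u \<longleftrightarrow> (\<forall>h. L2b h \<longrightarrow> mean0 h \<longrightarrow> c * bf g h + l2ip g h = f (prim h))"
proof -
  note [measurable] = g(1)[THEN L2b_measurable]
  have *: "c * L2ip u (Iv v) + L2ip (Dp \<alpha> p \<mu> \<nu> u) (Dp \<alpha> p \<mu> \<nu> v) = f (Iv v) \<longleftrightarrow> c * bf g h + l2ip g h = f (prim h)"
    if h: "L2b h" "mean0 h" "AE x in lborel. x \<in> Lam \<longrightarrow> Iv v x = prim h x"
      "AE x in lborel. x \<in> Lam \<longrightarrow> Dp \<alpha> p \<mu> \<nu> v x = h x" "H10 (Iv v)" for v h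
  proof -
    note [measurable] = h(1)[THEN L2b_measurable]
    have 1: "L2ip u (Iv v) = bf g h" by (rule L2ip_bf[OF g u(2) h(1,3)])
    have 2: "L2ip (Dp \<alpha> p \<mu> \<nu> u) (Dp \<alpha> p \<mu> \<nu> v) = l2ip g h" by (rule L2ip_rep) (use u h in auto)
    have 3: "f (Iv v) = f (prim h)" by (rule Hm1_cong[OF f h(5) prim_H10[OF h(1,2)] h(3)])
    show ?thesis unfolding 1 2 3 ..
  qed
  show ?thesis
  proof
    assume w: "weak_eq \<alpha> p \<mu> \<nu> c f u"
    show "\<forall>h. L2b h \<longrightarrow> mean0 h \<longrightarrow> c * bf g h + l2ip g h = f (prim h)"
    proof (intro allI impI)
      fix h assume h: "L2b h" "mean0 h"
      note V' = V_HRL0[OF h]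
      show "c * bf g h + l2ip g h = f (prim h)"
        using w V'(1) *[OF h V'(2,3,4)] unfolding weak_eq_def by blast
    qed
  next
    assume r: "\<forall>h. L2b h \<longrightarrow> mean0 h \<longrightarrow> c * bf g h + l2ip g h = f (prim h)"
    show "weak_eq \<alpha> p \<mu> \<nu> c f u"
      unfolding weak_eq_def
    proof (intro allI impI)
      fix v assume "HRL0 \<alpha> p \<mu> \<nu> v"
      then obtain h where h: "L2b h" "mean0 h" "AE x in lborel. x \<in> Lam \<longrightarrow> Iv v x = prim h x"
        "AE x in lborel. x \<in> Lam \<longrightarrow> Dp \<alpha> p \<mu> \<nu> v x = h x" "H10 (Iv v)"
        by (rule HRL0_repr) blast
      show "c * L2ip u (Iv v) + L2ip (Dp \<alpha> p \<mu> \<nu> u) (Dp \<alpha> p \<mu> \<nu> v) = f (Iv v)"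
        using *[OF h] r h by blast
    qed
  qed
qed

lemma form_solution:
  assumes f: "Hm1 f"
  obtains g where "L2b g" "mean0 g" "\<And>h. L2b h \<Longrightarrow> mean0 h \<Longrightarrow> c * bf g h + l2ip g h = f (prim h)" "l2n g \<le> 3 * Hm1norm f"
proof -
  obtain u where u: "\<And>h. form u h = rhs f h"
    using lax_milgram[OF form_bilinear form_coercive rhs_linear[OF f]] by blast
  define g where "g = l2rep u"
  have g: "L2b g" unfolding g_def by (rule L2b_l2rep)
  have Qprim: "prim (Q (l2abs h)) x = prim h x" if h: "L2b h" "mean0 h" and x: "x \<in> Lam" for h x
  proof (rule prim_cong[OF Q_L2b h(1) _ x])
    have "(\<integral>s. indicator Lam s * l2rep (l2abs h) s \<partial>lborel) = (\<integral>s. indicator Lam s * h s \<partial>lborel)"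
    proof (rule integral_cong_AE)
      show "AE s in lborel. indicator Lam s * l2rep (l2abs h) s = indicator Lam s * h s"
        using l2rep_abs[OF h(1)] by eventually_elim (auto simp: indicator_def)
    qed (rule borel_measurable_integrable[OF L2b_integrable[OF L2b_l2rep]] borel_measurable_integrable[OF L2b_integrable[OF h(1)]])+
    then have "(\<integral>s. indicator Lam s * l2rep (l2abs h) s \<partial>lborel) = 0" using h(2) by (simp add: mean0_def)
    then show "AE s in lborel. s \<in> Lam \<longrightarrow> Q (l2abs h) s = h s"
      using l2rep_abs[OF h(1)] by (simp add: Q_def)
  qed
  have inn: "inner u (l2abs h) = l2ip g h" if "L2b h" for h
    unfolding l2_inner g_def using l2rep_abs[OF that] by (intro l2ip_cong L2b_l2rep that) auto
  have zero: "L2b (\<lambda>_. 0)" "mean0 (\<lambda>_. 0)" by (simp_all add: L2b_const mean0_def)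
  have Q1: "AE s in lborel. s \<in> Lam \<longrightarrow> Q (l2abs (\<lambda>_. 1)) s = 0"
  proof -
    have "(\<integral>s. indicator Lam s * l2rep (l2abs (\<lambda>_. 1)) s \<partial>lborel) = (\<integral>s. indicator Lam s \<partial>lborel)"
    proof (rule integral_cong_AE)
      show "AE s in lborel. indicator Lam s * l2rep (l2abs (\<lambda>_. 1)) s = indicator Lam s"
        using l2rep_abs[OF L2b_const[of 1]] by eventually_elim (auto simp: indicator_def)
        next
      show "(\<lambda>s. indicator Lam s * l2rep (l2abs (\<lambda>_. 1)) s) \<in> borel_measurable lborel"
        by (rule borel_measurable_integrable[OF L2b_integrable[OF L2b_l2rep]])
    qed (simp add: Lam_def)
    then show ?thesis
      using l2rep_abs[OF L2b_const[of 1]] unfolding indicator_Lam_integral by (simp add: Q_def)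
  qed
  have p1: "prim (Q (l2abs (\<lambda>_. 1))) x = 0" if "x \<in> Lam" for x
    using prim_cong[OF Q_L2b zero(1) Q1 that] by (simp add: prim_def)
  \<comment> \<open>The constant 1 is annihilated by \<open>Q\<close>. Tested with it, the equation
    loses the term with \<open>c\<close> and its right-hand side, and what remains is the mean of
    \<open>g\<close>.\<close>
  have m: "mean0 g"
  proof -
    have b0: "bf (Q u) (Q (l2abs (\<lambda>_. 1))) = 0"
      using bf_lincomb_right[OF zero(1) zero(1) Q_L2b Q_L2b Q_mean0, of "l2abs (\<lambda>_. 1)" 0 0 u] Q1 by simp
    have "rhs f (l2abs (\<lambda>_. 1)) = f (prim (\<lambda>_. 0))"
      unfolding rhs_def
      by (rule Hm1_cong[OF f prim_H10[OF Q_L2b Q_mean0] prim_H10[OF zero]]) (use p1 in \<open>auto simp: prim_def\<close>)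
    also have "f (prim (\<lambda>_. 0)) = 0"
    proof -
      have "(\<lambda>x. 0 * prim (\<lambda>_. 0) x + 0 * prim (\<lambda>_. 0) x) = prim (\<lambda>_. 0 :: real)" by (simp add: fun_eq_iff prim_def)
      then show ?thesis using Hm1_linear[OF f prim_H10[OF zero] prim_H10[OF zero], of 0 0] by simp
    qed
    finally have "inner u (l2abs (\<lambda>_. 1)) = 0" using u[of "l2abs (\<lambda>_. 1)"] by (simp add: form_def b0)
    then show ?thesis using inn[OF L2b_const[of 1]] by (simp add: l2ip_def mean0_def)
  qed
  have Qg: "Q u = g" using m by (simp add: Q_def g_def[symmetric] mean0_def)
  show ?thesis
  proof (rule that[OF g m])
    fix h assume h: "L2b h" "mean0 h"
    have b: "bf (Q u) (Q (l2abs h)) = bf g h"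
      unfolding Qg bf_def
    proof (intro Bochner_Integration.integral_cong refl)
      fix x
      show "V g x * prim (Q (l2abs h)) x = V g x * prim h x"
        using Qprim[OF h, of x] V[OF g m] by (cases "x \<in> Lam") (auto simp: L1z_def)
    qed
    have "rhs f (l2abs h) = f (prim h)"
      unfolding rhs_def
      by (rule Hm1_cong[OF f prim_H10[OF Q_L2b Q_mean0] prim_H10[OF h]]) (use Qprim[OF h] in auto)
    then show "c * bf g h + l2ip g h = f (prim h)"
      using u[of "l2abs h"] inn[OF h(1)] by (simp add: form_def b)
  next
    \<comment> \<open>The equation is tested with its own solution; coercivity with constant 1
      bounds the squared norm, and one factor of the norm cancels unless it is 0.\<close>
    have "(l2n g)\<^sup>2 = (norm u)\<^sup>2" by (simp add: l2_norm_rep g_def)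
    also have "\<dots> \<le> rhs f u" using form_coercive[of u] u by simp
    also have "\<dots> \<le> Hm1norm f * H1norm (prim g)"
      using Hm1_bound[OF f prim_H10[OF g m]] by (simp add: rhs_def Qg)
    also have "\<dots> \<le> Hm1norm f * (3 * l2n g)"
      by (intro mult_left_mono H1norm_prim(2)[OF g m] Hm1norm_nonneg f) simp
    finally have "l2n g * l2n g \<le> (3 * Hm1norm f) * l2n g" by (simp add: power2_eq_square mult_ac)
    then show "l2n g \<le> 3 * Hm1norm f"
      using l2n_nonneg[of g] Hm1norm_nonneg[OF f] by (cases "l2n g = 0") auto
  qed
qed

lemma weak_problem_solvable:
  assumes f: "Hm1 f"
  shows "\<exists>u. HRL0 \<alpha> p \<mu> \<nu> u \<and> weak_eq \<alpha> p \<mu> \<nu> c f u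
        \<and> (\<forall>u'. HRL0 \<alpha> p \<mu> \<nu> u' \<and> weak_eq \<alpha> p \<mu> \<nu> c f u' \<longrightarrow> (AE x in LM. u' x = u x))
        \<and> HRLnorm \<alpha> p \<mu> \<nu> u \<le> 9 * Hm1norm f"
proof -
  obtain g where g: "L2b g" "mean0 g" "\<And>h. L2b h \<Longrightarrow> mean0 h \<Longrightarrow> c * bf g h + l2ip g h = f (prim h)" "l2n g \<le> 3 * Hm1norm f"
    by (rule form_solution[OF f]) blast
  note Vg = V_HRL0[OF g(1,2)]
  show ?thesis
  proof (intro exI[of _ "V g"] conjI allI impI)
    show "HRL0 \<alpha> p \<mu> \<nu> (V g)" by (rule Vg(1))
    show "weak_eq \<alpha> p \<mu> \<nu> c f (V g)"
      by (subst weak_eq_iff[OF g(1,2) Vg(1) _ Vg(3) f]) (use g(3) in auto)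
    \<comment> \<open>The constant 9 is 3 from \<open>form_solution\<close> times 3 from comparing
      the H^1 norm with the norm of the derivative.\<close>
    have "HRLnorm \<alpha> p \<mu> \<nu> (V g) = H1norm (Iv (V g))" by (simp add: HRLnorm_def H1norm_def Dp_def)
    also have "\<dots> \<le> 3 * l2n g" by (rule H1norm_prim(2)[OF g(1,2) Vg(2)])
    also have "\<dots> \<le> 9 * Hm1norm f" using g(4) by simp
    finally show "HRLnorm \<alpha> p \<mu> \<nu> (V g) \<le> 9 * Hm1norm f" .
    fix u' assume u': "HRL0 \<alpha> p \<mu> \<nu> u' \<and> weak_eq \<alpha> p \<mu> \<nu> c f u'"
    then obtain g' where g': "L2b g'" "mean0 g'" "AE x in lborel. x \<in> Lam \<longrightarrow> u' x = V g' x"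
      "AE x in lborel. x \<in> Lam \<longrightarrow> Dp \<alpha> p \<mu> \<nu> u' x = g' x"
      using HRL0_repr by blast
    have w': "c * bf g' h + l2ip g' h = f (prim h)" if "L2b h" "mean0 h" for h
      using weak_eq_iff[OF g'(1,2) _ g'(3,4) f] u' that by blast
    \<comment> \<open>The equations for the two derivatives are subtracted and tested with the
      difference. Both terms are nonnegative, so the norm of the difference vanishes.\<close>
    define d where "d s = 1 * g s + (-1) * g' s" for s
    have d: "L2b d" "mean0 d" unfolding d_def
      by (rule L2b_lincomb[OF g(1) g'(1)], rule mean0_lincomb[OF g(1) g'(1) g(2) g'(2)])
    have bd: "bf d d = 1 * bf g d + (-1) * bf g' d"
      by (rule bf_lincomb_left[OF g(1,2) g'(1,2) d d(1)]) (simp add: d_def)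
    have ld: "l2ip d d = 1 * l2ip g d + (-1) * l2ip g' d"
      using l2ip_add[OF g(1) g'(1) d(1), of 1 "-1"] by (simp add: d_def[abs_def])
    have "c * bf d d + l2ip d d = 0"
      using g(3)[OF d] w'[OF d] unfolding bd ld by (simp add: algebra_simps)
    moreover have "0 \<le> bf d d" using V[OF d] by (simp add: bf_def)
    ultimately have "l2ip d d = 0" using mult_nonneg_nonneg[OF c, of "bf d d"] l2ip_self_nonneg[of d] by linarith
    then have "AE s in lborel. indicator Lam s * (d s * d s) = 0"
      unfolding l2ip_def by (subst (asm) integral_nonneg_eq_0_iff_AE[OF L2b_mult_integrable[OF d(1) d(1)]]) auto
    then have eq: "AE s in lborel. s \<in> Lam \<longrightarrow> g' s = 1 * g s + 0 * g s"
      by eventually_elim (auto simp: indicator_def d_def)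
    have "AE x in lborel. 1 * V g x + 0 * V g x = V g' x"
      by (rule V_lincomb[OF g(1,2) g(1,2) g'(1,2) eq])
    then show "AE x in LM. u' x = V g x"
      unfolding AE_LM using g'(3) by eventually_elim auto
  qed
qed

end

theorem theorem3p1:
  fixes \<alpha> p c \<mu> \<nu> :: real
  assumes "1 < \<alpha>" "\<alpha> < 2" "0 \<le> p" "p \<le> 1" "0 \<le> c"
    and "\<alpha> - 2 \<le> \<mu>" "\<mu> \<le> 0" "\<alpha> - 2 \<le> \<nu>" "\<nu> \<le> 0" "\<mu> + \<nu> = \<alpha> - 2"
    and "p * sin (pi * \<mu>) = (1 - p) * sin (pi * \<nu>)"
  shows "\<exists>C. \<forall>f. Hm1 f \<longrightarrow>
     (\<exists>u. HRL0 \<alpha> p \<mu> \<nu> u \<and> weak_eq \<alpha> p \<mu> \<nu> c f u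
        \<and> (\<forall>u'. HRL0 \<alpha> p \<mu> \<nu> u' \<and> weak_eq \<alpha> p \<mu> \<nu> c f u' \<longrightarrow> (AE x in LM. u' x = u x))
        \<and> HRLnorm \<alpha> p \<mu> \<nu> u \<le> C * Hm1norm f)"
proof -
  have loc: "rl_problem \<alpha> p c \<mu> \<nu>" by (rule rl_problem.intro; rule assms)
  show ?thesis
    \<comment> \<open>The constant is independent not only of the functional but also of all
      parameters.\<close>
    by (rule exI[of _ 9], rule allI, rule impI, rule rl_problem.weak_problem_solvable[OF loc])
qed

end
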